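(* Let $V=\begin{pmatrix} p & q \\ q & -p \end{pmatrix}$ with real-valued $p,q\in C^1([0,\infty))$, and let $T>0$. Let $B^T_D$ be the set of entire functions $$B^T_D=\left\{F:\ F(\lambda)=\int_0^T\left(ie^{i\lambda(T-s)}f_1(s)-ie^{-i\lambda(T-s)}f_2(s)\right)ds,\ \begin{pmatrix} f_1 \\ f_2 \end{pmatrix}\in L_2((0,T);\mathbb{C}^2)\right\},$$ equipped with the scalar product $[F,G]_{B^T_D}=\left(C^T\begin{pmatrix} f_1 \\ f_2 \end{pmatrix},\begin{pmatrix} g_1 \\ g_2 \end{pmatrix}\right)_{L_2((0,T);\mathbb{C}^2)}$, where $(f_1,f_2)^{\top},(g_1,g_2)^{\top}$ represent $F,G$ and $C^T$ is the connecting operator of the Dirac system with potential $V$. Then $B^T_D$ is a Hilbert space and is a De Branges space, i.e. there is a Hermite-Biehler function $E$ such that $B_D^T=B(E)$ as sets with equal norms. Moreover, for every $z\in\mathbb{C}$ the equation $$\left(C^T\begin{pmatrix} j^z_1 \\ j^z_2 \end{pmatrix}\right)(s)=\overline{\begin{pmatrix} ie^{iz(T-s)} \\ -ie^{-iz(T-s)} \end{pmatrix}},\qquad 0<s<T,$$ has a unique solution in $L_2((0,T);\mathbb{C}^2)$, and the reproducing kernel of $B^T_D$, i.e. the function $J_z\in B^T_D$ with $[J_z,F]_{B^T_D}=F(z)$ for all $F\in B^T_D$, is $$J_z(\lambda)=\int_0^T\left(ie^{i\lambda(T-s)}j^z_1(s)-ie^{-i\lambda(T-s)}j^z_2(s)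\right)ds.$$
   Context: Scalar products are conjugate-linear in the first argument: $(a,b)=\int_0^T\overline{a(x)}\cdot b(x)\,dx$. Dirac system and operators: let $J=\begin{pmatrix} 0 & 1 \\ -1 & 0 \end{pmatrix}$. For $f\in L_2((0,T);\mathbb{C})$ let $u^f(x,t)\in\mathbb{C}^2$ be the generalized solution (the $L_2$-limit of solutions for smooth controls vanishing near $t=0$) of $iu_t+Ju_x+Vu=0$ for $x>0$, $0<t<T$, with $u|_{t=0}=0$, $u_1|_{x=0}=f$. It has the form $u^f(x,t)=f(t-x)\begin{pmatrix} 1 \\ i \end{pmatrix}+\int_x^tw(x,s)f(t-s)\,ds$ for $x\le t$ and vanishes for $x>t$, with a vector kernel $w$ determined by $V$. For $g\in L_2((0,T);\mathbb{C})$ let $v^g$ be the solution of $iv_t-Jv_x-Vv=0$, $v|_{t=0}=0$, $v_1|_{x=0}=g$; equivalently $v^g=\overline{u^{\overline g}}$. The (extended) control operator $W^T:L_2((0,T);\mathbb{C}^2)\to L_2((0,T);\mathbb{C}^2)$ is $W^T\begin{pmatrix} f_1 \\ f_2 \end{pmatrix}=u^{f_1}(\cdot,T)+v^{f_2}(\cdot,T)$, and the connecting operator is $C^T=(W^T)^*W^T$. An entire function $E$ is a Hermite-Biehler function if $|E(z)|>|E(\overline z)|$ for $\operatorname{Im}z>0$. Put $F^\#(z)=\overline{F(\overline z)}$, and let $H_2$ be the Hardy space of functions $f$ holomorphic in the upper half-plane with $\sup_{y>0}\int_{-\infty}^\infty|f(x+iy)|^2dx<\infty$. The De Branges space $B(E)$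 is the set of entire functions $F$ with $\int_{\mathbb{R}}|F(\lambda)/E(\lambda)|^2d\lambda<\infty$ and $F/E,\ F^\#/E\in H_2$, with scalar product $[F,G]_{B(E)}=\frac1\pi\int_{\mathbb{R}}\overline{F(\lambda)}G(\lambda)\frac{d\lambda}{|E(\lambda)|^2}$. *)

theory Defs
  imports "HOL-Analysis.Analysis"
begin

subsection \<open>Square-integrable functions\<close>

text \<open>Elements of an $L_2$ space are represented by functions; equality is equality almost
  everywhere with respect to \<^term>\<open>M\<close>.\<close>

abbreviation lborel_on :: "real set \<Rightarrow> real measure" where
  "lborel_on S \<equiv> restrict_space lborel S"

definition L2 :: "real measure \<Rightarrow> (real \<Rightarrow> 'a::real_normed_vector) set" where
  "L2 M = {f \<in> borel_measurable M. integrable M (\<lambda>x. (norm (f x))\<^sup>2)}"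

definition L2_inner :: "real measure \<Rightarrow> (real \<Rightarrow> complex^2) \<Rightarrow> (real \<Rightarrow> complex^2) \<Rightarrow> complex" where
  "L2_inner M a b = (LINT x|M. (\<Sum>k\<in>UNIV. cnj (a x $ k) * b x $ k))"

definition L2_tendsto ::
    "real measure \<Rightarrow> (nat \<Rightarrow> real \<Rightarrow> 'a::real_normed_vector) \<Rightarrow> (real \<Rightarrow> 'a) \<Rightarrow> bool" where
  "L2_tendsto M f g \<longleftrightarrow>
     (\<forall>n. f n \<in> L2 M) \<and> g \<in> L2 M \<and>
     (\<lambda>n. sqrt (LINT x|M. (norm (f n x - g x))\<^sup>2)) \<longlonglongrightarrow> 0"

text \<open>The adjoint \<open>A\<^sup>*\<close> of a bounded operator on \<open>L\<^sub>2(M; C\<^sup>2)\<close>; the value \<open>A\<^sup>* y\<close> is determined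
  almost everywhere.\<close>

definition L2_adjoint ::
    "real measure \<Rightarrow> ((real \<Rightarrow> complex^2) \<Rightarrow> (real \<Rightarrow> complex^2)) \<Rightarrow> (real \<Rightarrow> complex^2) \<Rightarrow> (real \<Rightarrow> complex^2)" where
  "L2_adjoint M A y =
     (SOME h. h \<in> L2 M \<and> (\<forall>g\<in>L2 M. L2_inner M h g = L2_inner M y (A g)))"

subsection \<open>The Dirac system\<close>

definition C1_half_line :: "(real \<Rightarrow> real) \<Rightarrow> bool" where
  "C1_half_line p \<longleftrightarrow>
     (\<exists>p'. (\<forall>x\<ge>0. (p has_real_derivative p' x) (at x within {0..})) \<and> continuous_on {0..} p')"

definition dirac_J :: "complex^2^2" where
  "dirac_J = vector [vector [0, 1], vector [-1, 0]]"

definition dirac_V :: "(real \<Rightarrow> real) \<Rightarrow> (real \<Rightarrow> real) \<Rightarrow> real \<Rightarrow> complex^2^2" where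
  "dirac_V p q x =
     vector [vector [complex_of_real (p x), complex_of_real (q x)],
             vector [complex_of_real (q x), - complex_of_real (p x)]]"

text \<open>Controls in \<open>C\<^sup>\<infinity>([0,T])\<close> vanishing near \<open>t = 0\<close>; \<open>D k\<close> is the \<open>k\<close>-th derivative, one-sided
  at the endpoints.\<close>

definition smooth_control :: "real \<Rightarrow> (real \<Rightarrow> complex) \<Rightarrow> bool" where
  "smooth_control T f \<longleftrightarrow>
     (\<exists>D :: nat \<Rightarrow> real \<Rightarrow> complex.
        (\<forall>t\<in>{0..T}. D 0 t = f t) \<and>
        (\<forall>k. \<forall>t\<in>{0..T}. (D k has_vector_derivative D (Suc k) t) (at t within {0..T}))) \<and>
     (\<exists>e>0. \<forall>t\<in>{0..T}. t \<le> e \<longrightarrow> f t = 0)"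

text \<open>Classical (\<open>C\<^sup>1\<close> up to the boundary) solutions \<open>u x t\<close> of
  \<open>i u\<^sub>t + \<sigma> (J u\<^sub>x + V u) = 0\<close> with zero initial data and \<open>u\<^sub>1 = f\<close> at \<open>x = 0\<close>.
  The sign \<open>\<sigma> = 1\<close> gives the system for \<open>u\<^sup>f\<close>, the sign \<open>\<sigma> = -1\<close> the one for \<open>v\<^sup>g\<close>.\<close>

definition classical_solution ::
    "complex \<Rightarrow> (real \<Rightarrow> real) \<Rightarrow> (real \<Rightarrow> real) \<Rightarrow> real \<Rightarrow> (real \<Rightarrow> complex) \<Rightarrow> (real \<Rightarrow> real \<Rightarrow> complex^2) \<Rightarrow> bool" where
  "classical_solution \<sigma> p q T f u \<longleftrightarrow>
     (\<exists>ux ut.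
        continuous_on ({0..} \<times> {0..T}) (\<lambda>(x, t). ux x t) \<and>
        continuous_on ({0..} \<times> {0..T}) (\<lambda>(x, t). ut x t) \<and>
        (\<forall>x\<ge>0. \<forall>t\<in>{0..T}.
           ((\<lambda>y. u y t) has_vector_derivative ux x t) (at x within {0..}) \<and>
           ((\<lambda>r. u x r) has_vector_derivative ut x t) (at t within {0..T})) \<and>
        (\<forall>x>0. \<forall>t\<in>{0<..<T}.
           \<i> *s ut x t + \<sigma> *s (dirac_J *v ux x t + dirac_V p q x *v u x t) = 0)) \<and>
     (\<forall>x\<ge>0. u x 0 = 0) \<and>
     (\<forall>t\<in>{0..T}. u 0 t $ 1 = f t)"

text \<open>The \<open>L\<^sub>2\<close> limit of classical solutions is taken at each time, so that the trace
  \<open>u(\<cdot>, T)\<close> is a well-defined element of \<open>L\<^sub>2(0, \<infinity>)\<close>.\<close>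

definition generalized_solution ::
    "complex \<Rightarrow> (real \<Rightarrow> real) \<Rightarrow> (real \<Rightarrow> real) \<Rightarrow> real \<Rightarrow> (real \<Rightarrow> complex) \<Rightarrow> (real \<Rightarrow> real \<Rightarrow> complex^2) \<Rightarrow> bool" where
  "generalized_solution \<sigma> p q T f u \<longleftrightarrow>
     (\<exists>fn un.
        (\<forall>n. smooth_control T (fn n) \<and> classical_solution \<sigma> p q T (fn n) (un n)) \<and>
        L2_tendsto (lborel_on {0<..<T}) fn f \<and>
        (\<forall>t\<in>{0..T}. L2_tendsto (lborel_on {0<..}) (\<lambda>n x. un n x t) (\<lambda>x. u x t)))"

definition dirac_solution ::
    "complex \<Rightarrow> (real \<Rightarrow> real) \<Rightarrow> (real \<Rightarrow> real) \<Rightarrow> real \<Rightarrow> (real \<Rightarrow> complex) \<Rightarrow> (real \<Rightarrow> real \<Rightarrow> complex^2)" where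
  "dirac_solution \<sigma> p q T f = (SOME u. generalized_solution \<sigma> p q T f u)"

definition control_operator ::
    "(real \<Rightarrow> real) \<Rightarrow> (real \<Rightarrow> real) \<Rightarrow> real \<Rightarrow> (real \<Rightarrow> complex^2) \<Rightarrow> (real \<Rightarrow> complex^2)" where
  "control_operator p q T f =
     (\<lambda>x. dirac_solution 1 p q T (\<lambda>s. f s $ 1) x T + dirac_solution (-1) p q T (\<lambda>s. f s $ 2) x T)"

definition connecting_operator ::
    "(real \<Rightarrow> real) \<Rightarrow> (real \<Rightarrow> real) \<Rightarrow> real \<Rightarrow> (real \<Rightarrow> complex^2) \<Rightarrow> (real \<Rightarrow> complex^2)" where
  "connecting_operator p q T f =
     L2_adjoint (lborel_on {0<..<T}) (control_operator p q T) (control_operator p q T f)"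

subsection \<open>Hilbert spaces of complex-valued functions\<close>

definition ip_norm :: "('b \<Rightarrow> 'b \<Rightarrow> complex) \<Rightarrow> 'b \<Rightarrow> real" where
  "ip_norm ip F = sqrt (Re (ip F F))"

definition hilbert_function_space ::
    "('a \<Rightarrow> complex) set \<Rightarrow> (('a \<Rightarrow> complex) \<Rightarrow> ('a \<Rightarrow> complex) \<Rightarrow> complex) \<Rightarrow> bool" where
  "hilbert_function_space S ip \<longleftrightarrow>
     (\<lambda>_. 0) \<in> S \<and>
     (\<forall>F\<in>S. \<forall>G\<in>S. (\<lambda>w. F w + G w) \<in> S) \<and>
     (\<forall>c. \<forall>F\<in>S. (\<lambda>w. c * F w) \<in> S) \<and>
     (\<forall>F\<in>S. \<forall>G\<in>S. \<forall>H\<in>S. ip F (\<lambda>w. G w + H w) = ip F G + ip F H) \<and>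
     (\<forall>c. \<forall>F\<in>S. \<forall>G\<in>S. ip F (\<lambda>w. c * G w) = c * ip F G) \<and>
     (\<forall>F\<in>S. \<forall>G\<in>S. ip G F = cnj (ip F G)) \<and>
     (\<forall>F\<in>S. F \<noteq> (\<lambda>_. 0) \<longrightarrow> 0 < Re (ip F F)) \<and>
     (\<forall>X :: nat \<Rightarrow> 'a \<Rightarrow> complex. (\<forall>n. X n \<in> S) \<and>
        (\<forall>e>0. \<exists>N. \<forall>m\<ge>N. \<forall>n\<ge>N. ip_norm ip (\<lambda>w. X m w - X n w) < e) \<longrightarrow>
        (\<exists>F\<in>S. (\<lambda>n. ip_norm ip (\<lambda>w. X n w - F w)) \<longlonglongrightarrow> 0))"

definition is_reproducing_kernel ::
    "('a \<Rightarrow> complex) set \<Rightarrow> (('a \<Rightarrow> complex) \<Rightarrow> ('a \<Rightarrow> complex) \<Rightarrow> complex) \<Rightarrow> 'a \<Rightarrow> ('a \<Rightarrow> complex) \<Rightarrow> bool" where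
  "is_reproducing_kernel S ip z K \<longleftrightarrow> K \<in> S \<and> (\<forall>F\<in>S. ip K F = F z)"

subsection \<open>De Branges spaces\<close>

definition hermite_biehler :: "(complex \<Rightarrow> complex) \<Rightarrow> bool" where
  "hermite_biehler E \<longleftrightarrow>
     E holomorphic_on UNIV \<and> (\<forall>z. Im z > 0 \<longrightarrow> norm (E z) > norm (E (cnj z)))"

definition sharp :: "(complex \<Rightarrow> complex) \<Rightarrow> (complex \<Rightarrow> complex)" where
  "sharp F = (\<lambda>z. cnj (F (cnj z)))"

definition hardy_H2 :: "(complex \<Rightarrow> complex) set" where
  "hardy_H2 = {f. f holomorphic_on {z. Im z > 0} \<and>
     (SUP y\<in>{0<..}. \<integral>\<^sup>+x. ennreal ((norm (f (Complex x y)))\<^sup>2) \<partial>lborel) < \<infinity>}"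

definition de_Branges_space :: "(complex \<Rightarrow> complex) \<Rightarrow> (complex \<Rightarrow> complex) set" where
  "de_Branges_space E = {F. F holomorphic_on UNIV \<and>
     (\<integral>\<^sup>+x. ennreal ((norm (F (complex_of_real x) / E (complex_of_real x)))\<^sup>2) \<partial>lborel) < \<infinity> \<and>
     (\<lambda>z. F z / E z) \<in> hardy_H2 \<and> (\<lambda>z. sharp F z / E z) \<in> hardy_H2}"

definition de_Branges_inner ::
    "(complex \<Rightarrow> complex) \<Rightarrow> (complex \<Rightarrow> complex) \<Rightarrow> (complex \<Rightarrow> complex) \<Rightarrow> complex" where
  "de_Branges_inner E F G = complex_of_real (1 / pi) *
     (LINT x|lborel. cnj (F (complex_of_real x)) * G (complex_of_real x) /
        complex_of_real ((norm (E (complex_of_real x)))\<^sup>2))"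

subsection \<open>The space attached to the Dirac system\<close>

definition dirac_row :: "real \<Rightarrow> complex \<Rightarrow> real \<Rightarrow> complex^2" where
  "dirac_row T l s =
     vector [\<i> * exp (\<i> * l * complex_of_real (T - s)),
             - \<i> * exp (- \<i> * l * complex_of_real (T - s))]"

definition dirac_transform :: "real \<Rightarrow> (real \<Rightarrow> complex^2) \<Rightarrow> complex \<Rightarrow> complex" where
  "dirac_transform T f = (\<lambda>l. LINT s|lborel_on {0<..<T}.
     dirac_row T l s $ 1 * f s $ 1 + dirac_row T l s $ 2 * f s $ 2)"

definition dirac_space :: "real \<Rightarrow> (complex \<Rightarrow> complex) set" where
  "dirac_space T =
     {F. F holomorphic_on UNIV \<and> (\<exists>f\<in>L2 (lborel_on {0<..<T}). F = dirac_transform T f)}"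

text \<open>The definite description refers to the value \<open>(C\<^sup>T f, g)\<close> common to all
  representatives \<open>f\<close>, \<open>g\<close> of \<open>F\<close>, \<open>G\<close>.\<close>

definition dirac_inner ::
    "(real \<Rightarrow> real) \<Rightarrow> (real \<Rightarrow> real) \<Rightarrow> real \<Rightarrow> (complex \<Rightarrow> complex) \<Rightarrow> (complex \<Rightarrow> complex) \<Rightarrow> complex" where
  "dirac_inner p q T F G =
     (THE c. \<exists>f\<in>L2 (lborel_on {0<..<T}). \<exists>g\<in>L2 (lborel_on {0<..<T}).
        dirac_transform T f = F \<and> dirac_transform T g = G \<and>
        c = L2_inner (lborel_on {0<..<T}) (connecting_operator p q T f) g)"

definition solves_kernel_equation ::
    "(real \<Rightarrow> real) \<Rightarrow> (real \<Rightarrow> real) \<Rightarrow> real \<Rightarrow> complex \<Rightarrow> (real \<Rightarrow> complex^2) \<Rightarrow> bool" where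
  "solves_kernel_equation p q T z j \<longleftrightarrow>
     j \<in> L2 (lborel_on {0<..<T}) \<and>
     (AE s in lborel_on {0<..<T}. \<forall>k. connecting_operator p q T j s $ k = cnj (dirac_row T z s $ k))"

end

(* Let \<theta>(x,l) solve J \<theta>' + V \<theta> = l \<theta>, \<theta>(0,l) = (0,1). Integrating the Dirac system against \<theta> gives
   F(l) = \<integral> (W f)(x) \<cdot> \<theta>(x,l) dx over (0,T) for the element F of the space represented by f. The control
   operator W is composed of a reflection x \<mapsto> T - x, a constant invertible matrix and a
   Volterra perturbation of the identity, so it maps onto L2; hence F \<mapsto> W f is unitary onto L2, and
   the reproducing kernel at z is represented by the control which W sends to \<theta>(\<cdot>,cnj z), that is, by the
   solution of the kernel equation. The Lagrange identity evaluates the kernel in terms of \<theta>(T,\<cdot>), and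
   the result is the kernel of B(E) with E = \<theta>_1(T,\<cdot>) - i \<theta>_2(T,\<cdot>). Two Hilbert spaces of entire functions
   with the same reproducing kernel coincide; as the kernels with Im z > 0 already span, completeness of
   B(E) is not needed. *)

theory Submission
  imports Defs "HOL-Complex_Analysis.Complex_Analysis"
begin

text \<open>Solutions, adjoint and scalar product are given by choice or definite description, so
  nothing can be computed before existence and almost everywhere uniqueness are known. For the
  solutions these come from an explicit kernel formula (\<open>wave\<close>) and an energy estimate,
  for the adjoint from Riesz representation, for the scalar product from injectivity of the
  transform, which is a moment problem. Since \<open>p\<close> and \<open>q\<close> are real,
  conjugation exchanges the systems for u and v, and the analysis is done for sign 1. Passing to u1
  - i u2 and u1 + i u2 diagonalizes the principal part; kernels, spectral solution and control
  operator become Volterra problems solved by one Picard scheme. The Volterra part maps integrable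
  functions to continuous ones, so inverting the control operator needs Picard iteration for
  continuous functions only. On the side of B(E) the obstacle is a Cauchy formula for functions with
  mere square-integral bounds on horizontal lines; real zeros of E must be excluded so that F / E is
  continuous up to the axis.\<close>

no_notation fps_nth (infixl "$" 75)

section \<open>Square-integrable functions\<close>

lemma L2_I: "f \<in> borel_measurable M \<Longrightarrow> integrable M (\<lambda>x. (norm (f x))\<^sup>2) \<Longrightarrow> f \<in> L2 M"
  by (simp add: L2_def)

lemma L2_measurable: "f \<in> L2 M \<Longrightarrow> f \<in> borel_measurable M"
  by (simp add: L2_def)

lemma L2_integrable: "f \<in> L2 M \<Longrightarrow> integrable M (\<lambda>x. (norm (f x))\<^sup>2)"
  by (simp add: L2_def)

lemma nn_integral_norm_sq:
  assumes "f \<in> L2 M"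
  shows "(\<integral>\<^sup>+x. ennreal ((norm (f x))\<^sup>2) \<partial>M) = ennreal (LINT x|M. (norm (f x))\<^sup>2)"
  using L2_integrable[OF assms] by (intro nn_integral_eq_integral) auto

text \<open>Fatou's lemma yields bounds for the nonnegative integral only; this turns them into
  membership and a bound for the Bochner integral.\<close>

lemma L2_nn_integral_I:
  fixes f :: "real \<Rightarrow> 'a::{banach,second_countable_topology}"
  assumes "f \<in> borel_measurable M" "(\<integral>\<^sup>+x. ennreal ((norm (f x))\<^sup>2) \<partial>M) \<le> ennreal C" "0 \<le> C"
  shows "f \<in> L2 M" "(LINT x|M. (norm (f x))\<^sup>2) \<le> C"
proof -
  have "integrable M (\<lambda>x. (norm (f x))\<^sup>2)"
    using assms(1) le_less_trans[OF assms(2)] by (intro integrableI_bounded) auto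
  then show "f \<in> L2 M" by (intro L2_I assms)
  from nn_integral_norm_sq[OF this] assms(2,3) show "(LINT x|M. (norm (f x))\<^sup>2) \<le> C"
    by simp
qed

text \<open>The inequality for nonnegative integrals gives integrability and both bounds at once.
  Only a pointwise bound of \<open>h\<close> is asked for, which covers products, conjugates and
  scalar products of vectors; with \<open>g = 1\<close> on a finite measure it embeds
  \<open>L2\<close> into the integrable functions.\<close>

lemma cauchy_schwarz_L2:
  fixes f :: "real \<Rightarrow> 'a::{banach,second_countable_topology}"
    and g :: "real \<Rightarrow> 'b::{banach,second_countable_topology}"
    and h :: "real \<Rightarrow> 'c::{banach,second_countable_topology}"
  assumes f: "f \<in> L2 M" and g: "g \<in> L2 M" and h[measurable]: "h \<in> borel_measurable M"
    and le: "\<And>x. x \<in> space M \<Longrightarrow> norm (h x) \<le> norm (f x) * norm (g x)"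
  shows "integrable M h"
    and "(LINT x|M. norm (h x))\<^sup>2 \<le> (LINT x|M. (norm (f x))\<^sup>2) * (LINT x|M. (norm (g x))\<^sup>2)"
    and "(norm (LINT x|M. h x))\<^sup>2 \<le> (LINT x|M. (norm (f x))\<^sup>2) * (LINT x|M. (norm (g x))\<^sup>2)"
proof -
  note [measurable] = L2_measurable[OF f] L2_measurable[OF g]
  have "(\<integral>\<^sup>+x. ennreal (norm (h x)) \<partial>M) \<le> (\<integral>\<^sup>+x. ennreal (norm (f x)) * ennreal (norm (g x)) \<partial>M)"
    using le by (intro nn_integral_mono) (simp add: ennreal_mult[symmetric] ennreal_leI)
  then have "(\<integral>\<^sup>+x. ennreal (norm (h x)) \<partial>M)\<^sup>2 \<le> (\<integral>\<^sup>+x. ennreal (norm (f x)) * ennreal (norm (g x)) \<partial>M)\<^sup>2"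
    by (rule power_mono) simp
  also have "\<dots> \<le> (\<integral>\<^sup>+x. ennreal (norm (f x)) ^ 2 \<partial>M) * (\<integral>\<^sup>+x. ennreal (norm (g x)) ^ 2 \<partial>M)"
    by (rule Cauchy_Schwarz_nn_integral) auto
  also have "\<dots> = ennreal (LINT x|M. (norm (f x))\<^sup>2) * ennreal (LINT x|M. (norm (g x))\<^sup>2)"
    using nn_integral_norm_sq[OF f] nn_integral_norm_sq[OF g] by (simp add: ennreal_power)
  also have "\<dots> = ennreal ((LINT x|M. (norm (f x))\<^sup>2) * (LINT x|M. (norm (g x))\<^sup>2))"
    by (simp add: ennreal_mult)
  finally have b: "(\<integral>\<^sup>+x. ennreal (norm (h x)) \<partial>M)\<^sup>2 \<le> ennreal ((LINT x|M. (norm (f x))\<^sup>2) * (LINT x|M. (norm (g x))\<^sup>2))" .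
  have "(\<integral>\<^sup>+x. ennreal (norm (h x)) \<partial>M) < \<infinity>"
  proof (rule ccontr)
    assume "\<not> (\<integral>\<^sup>+x. ennreal (norm (h x)) \<partial>M) < \<infinity>"
    then have "(\<integral>\<^sup>+x. ennreal (norm (h x)) \<partial>M) = top" by (simp add: less_top[symmetric])
    then show False using b by (simp add: power2_eq_square ennreal_top_mult top_unique)
  qed
  then show i: "integrable M h" by (intro integrableI_bounded) auto
  have "(\<integral>\<^sup>+x. ennreal (norm (h x)) \<partial>M) = ennreal (LINT x|M. norm (h x))"
    using i by (intro nn_integral_eq_integral) auto
  with b show c: "(LINT x|M. norm (h x))\<^sup>2 \<le> (LINT x|M. (norm (f x))\<^sup>2) * (LINT x|M. (norm (g x))\<^sup>2)"
    by (simp add: ennreal_power)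
  have "(norm (LINT x|M. h x))\<^sup>2 \<le> (LINT x|M. norm (h x))\<^sup>2"
    by (intro power_mono integral_norm_bound) auto
  with c show "(norm (LINT x|M. h x))\<^sup>2 \<le> (LINT x|M. (norm (f x))\<^sup>2) * (LINT x|M. (norm (g x))\<^sup>2)"
    by linarith
qed

text \<open>Takes the place of Minkowski's inequality: the limits and bounds derived from it are
  insensitive to the factor 2.\<close>

lemma norm_add_sq_le: "(norm (a + b :: 'a::real_normed_vector))\<^sup>2 \<le> 2 * (norm a)\<^sup>2 + 2 * (norm b)\<^sup>2"
proof -
  have "(norm (a + b))\<^sup>2 \<le> (norm a + norm b)\<^sup>2"
    by (intro power_mono norm_triangle_ineq) auto
  also have "\<dots> \<le> 2 * (norm a)\<^sup>2 + 2 * (norm b)\<^sup>2"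
    using zero_le_power2[of "norm a - norm b"] by (simp add: power2_eq_square algebra_simps)
  finally show ?thesis .
qed

lemma L2_add:
  fixes f :: "real \<Rightarrow> 'a::{banach,second_countable_topology}"
  assumes f: "f \<in> L2 M" and g: "g \<in> L2 M"
  shows "(\<lambda>x. f x + g x) \<in> L2 M"
    and "(LINT x|M. (norm (f x + g x))\<^sup>2) \<le> 2 * (LINT x|M. (norm (f x))\<^sup>2) + 2 * (LINT x|M. (norm (g x))\<^sup>2)"
proof -
  note [measurable] = L2_measurable[OF f] L2_measurable[OF g]
  note i = L2_integrable[OF f] L2_integrable[OF g]
  have j: "integrable M (\<lambda>x. (norm (f x + g x))\<^sup>2)"
    by (rule Bochner_Integration.integrable_bound[where f = "\<lambda>x. 2 * (norm (f x))\<^sup>2 + 2 * (norm (g x))\<^sup>2"])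
       (auto intro!: i norm_add_sq_le)
  then show "(\<lambda>x. f x + g x) \<in> L2 M" by (intro L2_I) auto
  have "(LINT x|M. (norm (f x + g x))\<^sup>2) \<le> (LINT x|M. 2 * (norm (f x))\<^sup>2 + 2 * (norm (g x))\<^sup>2)"
    by (rule integral_mono[OF j]) (auto intro!: i norm_add_sq_le)
  also have "\<dots> = 2 * (LINT x|M. (norm (f x))\<^sup>2) + 2 * (LINT x|M. (norm (g x))\<^sup>2)"
    using i by simp
  finally show "(LINT x|M. (norm (f x + g x))\<^sup>2) \<le> 2 * (LINT x|M. (norm (f x))\<^sup>2) + 2 * (LINT x|M. (norm (g x))\<^sup>2)" .
qed

lemma L2_dominated:
  fixes f :: "real \<Rightarrow> 'a::{banach,second_countable_topology}"
    and g :: "real \<Rightarrow> 'b::{banach,second_countable_topology}"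
  assumes f: "f \<in> L2 M" and g[measurable]: "g \<in> borel_measurable M"
    and le: "\<And>x. x \<in> space M \<Longrightarrow> norm (g x) \<le> K * norm (f x)"
  shows "g \<in> L2 M" and "(LINT x|M. (norm (g x))\<^sup>2) \<le> K\<^sup>2 * (LINT x|M. (norm (f x))\<^sup>2)"
proof -
  note [measurable] = L2_measurable[OF f]
  have *: "(norm (g x))\<^sup>2 \<le> K\<^sup>2 * (norm (f x))\<^sup>2" if "x \<in> space M" for x
    using power_mono[OF le[OF that], of 2] by (simp add: power_mult_distrib)
  have j: "integrable M (\<lambda>x. (norm (g x))\<^sup>2)"
    by (rule Bochner_Integration.integrable_bound[where f = "\<lambda>x. K\<^sup>2 * (norm (f x))\<^sup>2"])
       (auto intro!: L2_integrable[OF f] *)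
  then show "g \<in> L2 M" by (intro L2_I) auto
  have "(LINT x|M. (norm (g x))\<^sup>2) \<le> (LINT x|M. K\<^sup>2 * (norm (f x))\<^sup>2)"
    by (rule integral_mono[OF j]) (auto intro!: L2_integrable[OF f] *)
  then show "(LINT x|M. (norm (g x))\<^sup>2) \<le> K\<^sup>2 * (LINT x|M. (norm (f x))\<^sup>2)" by simp
qed

lemma L2_bounded_linear:
  fixes f :: "real \<Rightarrow> 'a::{banach,second_countable_topology}"
    and A :: "'a \<Rightarrow> 'b::{banach,second_countable_topology}"
  assumes f: "f \<in> L2 M" and A: "bounded_linear A"
  shows "(\<lambda>x. A (f x)) \<in> L2 M"
    and "(LINT x|M. (norm (A (f x)))\<^sup>2) \<le> (onorm A)\<^sup>2 * (LINT x|M. (norm (f x))\<^sup>2)"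
proof -
  have m: "(\<lambda>x. A (f x)) \<in> borel_measurable M"
    using L2_measurable[OF f] bounded_linear.continuous_on[OF A continuous_on_id]
    by (intro borel_measurable_continuous_on[of A]) auto
  note * = L2_dominated[OF f m, of "onorm A"]
  show "(\<lambda>x. A (f x)) \<in> L2 M" "(LINT x|M. (norm (A (f x)))\<^sup>2) \<le> (onorm A)\<^sup>2 * (LINT x|M. (norm (f x))\<^sup>2)"
    using onorm[OF A] by (auto intro!: *)
qed

lemma L2_diff:
  fixes f :: "real \<Rightarrow> 'a::{banach,second_countable_topology}"
  assumes f: "f \<in> L2 M" and g: "g \<in> L2 M"
  shows "(\<lambda>x. f x - g x) \<in> L2 M"
    and "(LINT x|M. (norm (f x - g x))\<^sup>2) \<le> 2 * (LINT x|M. (norm (f x))\<^sup>2) + 2 * (LINT x|M. (norm (g x))\<^sup>2)"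
proof -
  have "(\<lambda>x. - g x) \<in> L2 M"
    using g by (auto simp: L2_def)
  from L2_add[OF f this] show "(\<lambda>x. f x - g x) \<in> L2 M"
    "(LINT x|M. (norm (f x - g x))\<^sup>2) \<le> 2 * (LINT x|M. (norm (f x))\<^sup>2) + 2 * (LINT x|M. (norm (g x))\<^sup>2)"
    by simp_all
qed

lemma L2_zero: "(\<lambda>x. 0) \<in> L2 M"
  by (simp add: L2_def)

lemma L2_AE_eq_iff:
  fixes f :: "real \<Rightarrow> 'a::{banach,second_countable_topology}"
  assumes f: "f \<in> L2 M" and g: "g \<in> L2 M"
  shows "(LINT x|M. (norm (f x - g x))\<^sup>2) = 0 \<longleftrightarrow> (AE x in M. f x = g x)"
proof -
  have "(LINT x|M. (norm (f x - g x))\<^sup>2) = 0 \<longleftrightarrow> (AE x in M. (norm (f x - g x))\<^sup>2 = 0)"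
    by (rule integral_nonneg_eq_0_iff_AE[OF L2_integrable[OF L2_diff(1)[OF f g]]]) simp
  then show ?thesis by simp
qed

lemma L2_tendsto_iff:
  "L2_tendsto M f g \<longleftrightarrow> (\<forall>n. f n \<in> L2 M) \<and> g \<in> L2 M \<and>
     (\<lambda>n. (LINT x|M. (norm (f n x - g x))\<^sup>2)) \<longlonglongrightarrow> 0"
proof -
  have "(\<lambda>n. sqrt (LINT x|M. (norm (f n x - g x))\<^sup>2)) \<longlonglongrightarrow> 0 \<longleftrightarrow>
      (\<lambda>n. (LINT x|M. (norm (f n x - g x))\<^sup>2)) \<longlonglongrightarrow> 0" (is "?L = ?R")
  proof
    assume ?L
    from tendsto_power[OF this, of 2] show ?R by simp
  next
    assume ?R
    from tendsto_real_sqrt[OF this] show ?L by simp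
  qed
  then show ?thesis by (simp add: L2_tendsto_def)
qed

lemma L2_tendsto_unique:
  fixes g :: "real \<Rightarrow> 'a::{banach,second_countable_topology}"
  assumes "L2_tendsto M f g" "L2_tendsto M f g'"
  shows "AE x in M. g x = g' x"
proof -
  have L: "\<And>n. f n \<in> L2 M" "g \<in> L2 M" "g' \<in> L2 M"
    and l: "(\<lambda>n. (LINT x|M. (norm (f n x - g x))\<^sup>2)) \<longlonglongrightarrow> 0"
      "(\<lambda>n. (LINT x|M. (norm (f n x - g' x))\<^sup>2)) \<longlonglongrightarrow> 0"
    using assms by (auto simp: L2_tendsto_iff)
  have "(LINT x|M. (norm (g x - g' x))\<^sup>2) \<le>
      2 * (LINT x|M. (norm (f n x - g' x))\<^sup>2) + 2 * (LINT x|M. (norm (f n x - g x))\<^sup>2)" for n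
    using L2_diff(2)[OF L2_diff(1)[OF L(1)[of n] L(3)] L2_diff(1)[OF L(1)[of n] L(2)]] by simp
  moreover have "(\<lambda>n. 2 * (LINT x|M. (norm (f n x - g' x))\<^sup>2) + 2 * (LINT x|M. (norm (f n x - g x))\<^sup>2)) \<longlonglongrightarrow> 0"
    using tendsto_add[OF tendsto_mult_left[OF l(2), of 2] tendsto_mult_left[OF l(1), of 2]] by simp
  ultimately have "(LINT x|M. (norm (g x - g' x))\<^sup>2) \<le> 0"
    by (intro LIMSEQ_le_const) auto
  then have "(LINT x|M. (norm (g x - g' x))\<^sup>2) = 0"
    by (intro antisym) auto
  then show ?thesis using L2_AE_eq_iff[OF L(2,3)] by simp
qed

text \<open>The bound is required for large \<open>n\<close> only, because in the closure arguments
  the norms of the approximants merely converge and obey a bound with slack from some index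
  on.\<close>

lemma fatou_norm_sq:
  fixes g :: "real \<Rightarrow> 'a::{banach,second_countable_topology}"
  assumes [measurable]: "\<And>n. f n \<in> borel_measurable M" "g \<in> borel_measurable M"
    and lim: "AE x in M. (\<lambda>n. f n x) \<longlonglongrightarrow> g x"
    and b: "\<forall>\<^sub>F n in sequentially. (\<integral>\<^sup>+x. ennreal ((norm (f n x))\<^sup>2) \<partial>M) \<le> C"
  shows "(\<integral>\<^sup>+x. ennreal ((norm (g x))\<^sup>2) \<partial>M) \<le> C"
proof -
  have "(\<integral>\<^sup>+x. ennreal ((norm (g x))\<^sup>2) \<partial>M) = (\<integral>\<^sup>+x. liminf (\<lambda>n. ennreal ((norm (f n x))\<^sup>2)) \<partial>M)"
  proof (rule nn_integral_cong_AE, use lim in eventually_elim)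
    fix x assume "(\<lambda>n. f n x) \<longlonglongrightarrow> g x"
    then have "(\<lambda>n. ennreal ((norm (f n x))\<^sup>2)) \<longlonglongrightarrow> ennreal ((norm (g x))\<^sup>2)"
      by (intro tendsto_intros)
    then show "ennreal ((norm (g x))\<^sup>2) = liminf (\<lambda>n. ennreal ((norm (f n x))\<^sup>2))"
      by (intro lim_imp_Liminf[symmetric]) auto
  qed
  also have "\<dots> \<le> liminf (\<lambda>n. \<integral>\<^sup>+x. ennreal ((norm (f n x))\<^sup>2) \<partial>M)"
    by (rule nn_integral_liminf) auto
  also have "\<dots> \<le> C"
    using Liminf_mono[OF b] by (simp add: Liminf_const)
  finally show ?thesis .
qed

text \<open>Riesz-Fischer. On a finite measure a Cauchy sequence in \<open>L2\<close> is Cauchy in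
  mean, hence has an almost everywhere convergent subsequence; Fatou's lemma along it bounds the
  distance of the whole sequence to the limit.\<close>

lemma L2_complete:
  fixes s :: "nat \<Rightarrow> real \<Rightarrow> 'a::{banach,second_countable_topology}"
  assumes fin: "finite_measure M" and s: "\<And>n. s n \<in> L2 M"
    and cau: "\<And>e. e > 0 \<Longrightarrow> \<exists>N. \<forall>m\<ge>N. \<forall>n\<ge>N. (LINT x|M. (norm (s m x - s n x))\<^sup>2) < e"
  obtains g where "g \<in> L2 M" "(\<lambda>n. (LINT x|M. (norm (s n x - g x))\<^sup>2)) \<longlonglongrightarrow> 0"
proof -
  interpret finite_measure M by fact
  note [measurable] = L2_measurable[OF s]
  have one: "(\<lambda>x. 1::real) \<in> L2 M" by (auto simp: L2_def)
  define m where "m = measure M (space M)"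
  have m0: "m \<ge> 0" by (simp add: m_def)
  have int: "integrable M (s n)" for n
    by (rule cauchy_schwarz_L2(1)[OF s one]) auto
  have L1: "(LINT x|M. norm (s i x - s j x))\<^sup>2 \<le> (LINT x|M. (norm (s i x - s j x))\<^sup>2) * m" for i j
    using cauchy_schwarz_L2(2)[OF L2_diff(1)[OF s[of i] s[of j]] one, of "\<lambda>x. s i x - s j x"]
    by (simp add: m_def)
  obtain r where r: "strict_mono r" and ae: "AE x in M. Cauchy (\<lambda>i. s (r i) x)"
  proof (rule cauchy_L1_AE_cauchy_subseq[of M s])
    show "integrable M (s n)" for n by (rule int)
  next
    fix e :: real assume e: "e > 0"
    \<comment> \<open>\<open>m + 1\<close> instead of \<open>m\<close> keeps the quotient meaningful
      when the whole space is a null set.\<close>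
    then have "e\<^sup>2 / (m + 1) > 0" using m0 by simp
    from cau[OF this] obtain N where N: "\<And>i j. i \<ge> N \<Longrightarrow> j \<ge> N \<Longrightarrow>
        (LINT x|M. (norm (s i x - s j x))\<^sup>2) < e\<^sup>2 / (m + 1)" by blast
    have "(LINT x|M. norm (s i x - s j x)) < e" if "i \<ge> N" "j \<ge> N" for i j
    proof -
      have "(LINT x|M. norm (s i x - s j x))\<^sup>2 \<le> (LINT x|M. (norm (s i x - s j x))\<^sup>2) * m" by (rule L1)
      also have "\<dots> \<le> (LINT x|M. (norm (s i x - s j x))\<^sup>2) * (m + 1)"
        by (intro mult_left_mono) auto
      also have "\<dots> < (e\<^sup>2 / (m + 1)) * (m + 1)"
        using m0 by (intro mult_strict_right_mono N that) auto
      also have "\<dots> = e\<^sup>2" using m0 by simp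
      finally show ?thesis using e by (simp add: power_less_imp_less_base)
    qed
    then show "\<exists>N. \<forall>i\<ge>N. \<forall>j\<ge>N. LINT x|M. norm (s i x - s j x) < e" by blast
  qed auto
  define g where "g x = lim (\<lambda>i. s (r i) x)" for x
  have gm[measurable]: "g \<in> borel_measurable M" unfolding g_def by measurable
  have lim: "AE x in M. (\<lambda>i. s (r i) x) \<longlonglongrightarrow> g x"
    using ae by eventually_elim (simp add: g_def Cauchy_convergent_iff convergent_LIMSEQ_iff)
  have key: "\<exists>N. \<forall>n\<ge>N. (\<lambda>x. s n x - g x) \<in> L2 M \<and> (LINT x|M. (norm (s n x - g x))\<^sup>2) \<le> e" if e: "e > 0" for e
  proof -
    from cau[OF e] obtain N where N: "\<And>i j. i \<ge> N \<Longrightarrow> j \<ge> N \<Longrightarrow>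
        (LINT x|M. (norm (s i x - s j x))\<^sup>2) < e" by blast
    have "(\<integral>\<^sup>+x. ennreal ((norm (s n x - g x))\<^sup>2) \<partial>M) \<le> ennreal e" if n: "n \<ge> N" for n
    proof (rule fatou_norm_sq[where f = "\<lambda>i x. s n x - s (r i) x"])
      show "AE x in M. (\<lambda>i. s n x - s (r i) x) \<longlonglongrightarrow> s n x - g x"
        using lim by eventually_elim (intro tendsto_intros)
      have "(\<integral>\<^sup>+x. ennreal ((norm (s n x - s (r i) x))\<^sup>2) \<partial>M) \<le> ennreal e" if "i \<ge> N" for i
      proof -
        have "r i \<ge> N" using that seq_suble[OF r, of i] by linarith
        then show ?thesis
          using N[OF n, of "r i"] nn_integral_norm_sq[OF L2_diff(1)[OF s[of n] s[of "r i"]]]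
          by (simp add: ennreal_leI)
      qed
      then show "\<forall>\<^sub>F i in sequentially. (\<integral>\<^sup>+x. ennreal ((norm (s n x - s (r i) x))\<^sup>2) \<partial>M) \<le> ennreal e"
        by (auto simp: eventually_sequentially)
    qed auto
    then have "\<forall>n\<ge>N. (\<lambda>x. s n x - g x) \<in> L2 M \<and> (LINT x|M. (norm (s n x - g x))\<^sup>2) \<le> e"
      using e by (auto intro!: L2_nn_integral_I)
    then show ?thesis by blast
  qed
  from key[of 1] obtain N where "(\<lambda>x. s N x - g x) \<in> L2 M" by auto
  from L2_diff(1)[OF s this, of N] have "g \<in> L2 M" by simp
  moreover have "(\<lambda>n. (LINT x|M. (norm (s n x - g x))\<^sup>2)) \<longlonglongrightarrow> 0"
  proof (rule LIMSEQ_I)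
    fix e :: real assume "e > 0"
    with key[of "e/2"] show "\<exists>no. \<forall>n\<ge>no. norm ((LINT x|M. (norm (s n x - g x))\<^sup>2) - 0) < e"
      by fastforce
  qed
  ultimately show ?thesis by (rule that)
qed

section \<open>Functionals on Hilbert spaces of functions\<close>

locale function_hilbert_space =
  fixes S :: "('a \<Rightarrow> complex) set" and ip :: "('a \<Rightarrow> complex) \<Rightarrow> ('a \<Rightarrow> complex) \<Rightarrow> complex"
  assumes hilbert: "hilbert_function_space S ip"
begin

lemma zero_mem: "(\<lambda>_. 0) \<in> S"
  and add_mem: "F \<in> S \<Longrightarrow> G \<in> S \<Longrightarrow> (\<lambda>w. F w + G w) \<in> S"
  and scale_mem: "F \<in> S \<Longrightarrow> (\<lambda>w. c * F w) \<in> S"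
  and ip_add_right: "F \<in> S \<Longrightarrow> G \<in> S \<Longrightarrow> H \<in> S \<Longrightarrow> ip F (\<lambda>w. G w + H w) = ip F G + ip F H"
  and ip_scale_right: "F \<in> S \<Longrightarrow> G \<in> S \<Longrightarrow> ip F (\<lambda>w. c * G w) = c * ip F G"
  and ip_cnj: "F \<in> S \<Longrightarrow> G \<in> S \<Longrightarrow> ip G F = cnj (ip F G)"
  and ip_pos: "F \<in> S \<Longrightarrow> F \<noteq> (\<lambda>_. 0) \<Longrightarrow> 0 < Re (ip F F)"
  and complete: "(\<And>n. X n \<in> S) \<Longrightarrow> (\<And>e. e > 0 \<Longrightarrow> \<exists>N. \<forall>m\<ge>N. \<forall>n\<ge>N. ip_norm ip (\<lambda>w. X m w - X n w) < e)
     \<Longrightarrow> \<exists>F\<in>S. (\<lambda>n. ip_norm ip (\<lambda>w. X n w - F w)) \<longlonglongrightarrow> 0"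
  using hilbert unfolding hilbert_function_space_def by blast+

lemma diff_mem: assumes "F \<in> S" "G \<in> S" shows "(\<lambda>w. F w - G w) \<in> S"
  using add_mem[OF assms(1) scale_mem[OF assms(2), of "-1"]] by simp

lemma ip_diff_right: assumes "F \<in> S" "G \<in> S" "H \<in> S"
  shows "ip F (\<lambda>w. G w - H w) = ip F G - ip F H"
  using ip_add_right[OF assms(1,2) scale_mem[OF assms(3), of "-1"]] ip_scale_right[OF assms(1,3), of "-1"] by simp

lemma ip_add_left: assumes "F \<in> S" "G \<in> S" "H \<in> S"
  shows "ip (\<lambda>w. G w + H w) F = ip G F + ip H F"
  using assms by (simp add: ip_cnj[of F] add_mem ip_add_right)

lemma ip_diff_left: assumes "F \<in> S" "G \<in> S" "H \<in> S"
  shows "ip (\<lambda>w. G w - H w) F = ip G F - ip H F"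
  using assms by (simp add: ip_cnj[of F] diff_mem ip_diff_right)

lemma ip_scale_left: assumes "F \<in> S" "G \<in> S"
  shows "ip (\<lambda>w. c * G w) F = cnj c * ip G F"
  using assms by (simp add: ip_cnj[of F] scale_mem ip_scale_right)

lemma Im_ip_self: "F \<in> S \<Longrightarrow> Im (ip F F) = 0"
  using arg_cong[OF ip_cnj[of F F], of Im] by simp

lemma ip_self_nonneg: "F \<in> S \<Longrightarrow> 0 \<le> Re (ip F F)"
  using ip_pos[of F] ip_scale_right[OF zero_mem zero_mem, of 0] by (cases "F = (\<lambda>_. 0)") (auto simp: less_imp_le)

lemma ip_norm_nonneg: "0 \<le> ip_norm ip F" if "F \<in> S"
  using ip_self_nonneg[OF that] by (simp add: ip_norm_def)

lemma ip_norm_sq: "F \<in> S \<Longrightarrow> (ip_norm ip F)\<^sup>2 = Re (ip F F)"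
  using ip_self_nonneg by (simp add: ip_norm_def)

lemma cauchy_schwarz: assumes F: "F \<in> S" and G: "G \<in> S"
  shows "cmod (ip F G) \<le> ip_norm ip F * ip_norm ip G"
proof (cases "G = (\<lambda>_. 0)")
  case True
  then show ?thesis using ip_scale_right[OF F G, of 0] ip_norm_nonneg[OF F] ip_norm_nonneg[OF G] by simp
next
  case False
  define n where "n = Re (ip G G)"
  have n: "n > 0" using ip_pos[OF G False] by (simp add: n_def)
  have gg: "ip G G = complex_of_real n" using Im_ip_self[OF G] by (simp add: n_def complex_eq_iff)
  \<comment> \<open>With this coefficient \<open>c * G\<close> is the orthogonal projection of
    \<open>F\<close> onto the line through \<open>G\<close>.\<close>
  define c where "c = ip G F / n"
  have cG: "(\<lambda>w. c * G w) \<in> S" by (rule scale_mem[OF G])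
  have D: "(\<lambda>w. F w - c * G w) \<in> S" by (rule diff_mem[OF F cG])
  have "ip (\<lambda>w. F w - c * G w) (\<lambda>w. F w - c * G w)
      = ip F F - c * ip F G - (cnj c * ip G F - cnj c * (c * ip G G))"
    by (simp add: ip_diff_right[OF D F cG] ip_diff_left[OF F F cG] ip_diff_left[OF cG F cG] ip_scale_left[OF F G]
       ip_scale_right[OF F G] ip_scale_left[OF cG G] ip_scale_right[OF G G])
  also have "\<dots> = ip F F - complex_of_real ((cmod (ip F G))\<^sup>2 / n)"
  proof -
    have "c * ip F G = complex_of_real ((cmod (ip F G))\<^sup>2 / n)"
      unfolding c_def ip_cnj[OF F G] using complex_norm_square[of "ip F G"] n
      by (simp add: mult.commute)
    moreover have "cnj c * ip G F - cnj c * (c * ip G G) = 0"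
      using n unfolding gg c_def by simp
    ultimately show ?thesis by (simp only: diff_zero)
  qed
  finally have "Re (ip F F) - (cmod (ip F G))\<^sup>2 / n \<ge> 0"
    using ip_self_nonneg[OF D] by simp
  then have "(cmod (ip F G))\<^sup>2 \<le> (ip_norm ip F * ip_norm ip G)\<^sup>2"
    using n by (simp add: power_mult_distrib ip_norm_sq[OF F] ip_norm_sq[OF G] n_def[symmetric] field_simps)
  then show ?thesis
    using ip_norm_nonneg[OF F] ip_norm_nonneg[OF G] by (simp add: power2_le_iff_abs_le)
qed

lemma Re_ip_add_scaled:
  assumes "F \<in> S" "G \<in> S"
  shows "Re (ip (\<lambda>w. F w + complex_of_real t * G w) (\<lambda>w. F w + complex_of_real t * G w))
    = Re (ip F F) + 2 * t * Re (ip F G) + t\<^sup>2 * Re (ip G G)"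
proof -
  have tG: "(\<lambda>w. complex_of_real t * G w) \<in> S" by (rule scale_mem[OF assms(2)])
  have "Re (ip G F) = Re (ip F G)" using ip_cnj[OF assms] by simp
  then show ?thesis
    by (simp add: ip_add_right[OF add_mem[OF assms(1) tG] assms(1) tG] ip_add_left[OF assms(1) assms(1) tG]
      ip_add_left[OF tG assms(1) tG] ip_scale_left[OF assms] ip_scale_right[OF assms] ip_scale_left[OF tG assms(2)]
      ip_scale_right[OF assms(2,2)] power2_eq_square ring_distribs)
qed

text \<open>The functional is represented by the minimizer of \<open>\<parallel>F\<parallel>\<^sup>2 - 2 Re (\<phi> F)\<close>, which exists in the
  closure of the subspace.\<close>

lemma riesz_on_subspace:
  assumes M: "M \<subseteq> S" "(\<lambda>_. 0) \<in> M" "\<And>F G. F \<in> M \<Longrightarrow> G \<in> M \<Longrightarrow> (\<lambda>w. F w + G w) \<in> M"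
      "\<And>c F. F \<in> M \<Longrightarrow> (\<lambda>w. c * F w) \<in> M"
    and \<phi>_add: "\<And>F G. F \<in> M \<Longrightarrow> G \<in> M \<Longrightarrow> \<phi> (\<lambda>w. F w + G w) = \<phi> F + \<phi> G"
    and \<phi>_scale: "\<And>c F. F \<in> M \<Longrightarrow> \<phi> (\<lambda>w. c * F w) = c * \<phi> F"
    and bound: "\<And>F. F \<in> M \<Longrightarrow> cmod (\<phi> F) \<le> C * ip_norm ip F"
  obtains F0 X where "F0 \<in> S" "\<And>n. X n \<in> M" "(\<lambda>n. ip_norm ip (\<lambda>w. X n w - F0 w)) \<longlonglongrightarrow> 0"
    "\<And>F. F \<in> M \<Longrightarrow> ip F0 F = \<phi> F"
proof -
  define Q where "Q F = Re (ip F F) - 2 * Re (\<phi> F)" for F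
  have inS: "F \<in> S" if "F \<in> M" for F using M(1) that by blast
  have Qb: "- C\<^sup>2 \<le> Q F" if "F \<in> M" for F
  proof -
    have "Re (\<phi> F) \<le> C * ip_norm ip F"
      using bound[OF that] complex_Re_le_cmod[of "\<phi> F"] by linarith
    then have "Q F \<ge> (ip_norm ip F)\<^sup>2 - 2 * C * ip_norm ip F"
      by (simp add: Q_def ip_norm_sq[OF inS[OF that]])
    moreover have "(ip_norm ip F)\<^sup>2 - 2 * C * ip_norm ip F = (ip_norm ip F - C)\<^sup>2 - C\<^sup>2"
      by (simp add: power2_eq_square algebra_simps)
    ultimately show ?thesis using zero_le_power2[of "ip_norm ip F - C"] by linarith
  qed
  define d where "d = Inf (Q ` M)"
  have bdd: "bdd_below (Q ` M)" using Qb by (auto intro!: bdd_belowI[of _ "- C\<^sup>2"])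
  have dle: "d \<le> Q F" if "F \<in> M" for F unfolding d_def using bdd that by (intro cInf_lower) auto
  have "\<exists>F\<in>M. Q F < d + 1 / Suc n" for n
    using cInf_lessD[of "Q ` M" "d + 1 / Suc n"] M(2) unfolding d_def by auto
  then obtain X where X: "\<And>n. X n \<in> M" "\<And>n. Q (X n) < d + 1 / Suc n" by metis
  have Qadd: "Q (\<lambda>w. F w + complex_of_real t * G w) = Q F + 2 * t * Re (ip F G - \<phi> G) + t\<^sup>2 * Re (ip G G)"
    if "F \<in> M" "G \<in> M" for F G t
    using that by (simp add: Q_def Re_ip_add_scaled inS \<phi>_add \<phi>_scale M) (simp add: algebra_simps)
  \<comment> \<open>Convexity: since \<open>d\<close> bounds \<open>Q\<close> from below at the
    midpoint of \<open>F\<close> and \<open>G\<close> as well, two almost minimal elements are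
    close. This makes the minimizing sequence Cauchy.\<close>
  have par: "Re (ip (\<lambda>w. F w - G w) (\<lambda>w. F w - G w)) \<le> 2 * (Q F - d) + 2 * (Q G - d)"
    if F: "F \<in> M" and G: "G \<in> M" for F G
  proof -
    define H where "H = (\<lambda>w. F w - G w)"
    have H: "H \<in> M" using M(3)[OF F M(4)[OF G, of "-1"]] by (simp add: H_def)
    have eF: "F = (\<lambda>w. G w + complex_of_real 1 * H w)" by (simp add: H_def)
    have "Q F = Q G + 2 * Re (ip G H - \<phi> H) + Re (ip H H)"
      using Qadd[OF G H, of 1] eF by simp
    moreover have "d \<le> Q G + Re (ip G H - \<phi> H) + (1/2)\<^sup>2 * Re (ip H H)"
      using dle[OF M(3)[OF G M(4)[OF H, of "complex_of_real (1/2)"]]] Qadd[OF G H, of "1/2"] by simp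
    ultimately show ?thesis unfolding H_def[symmetric] by (simp add: power2_eq_square)
  qed
  have "\<exists>F0\<in>S. (\<lambda>n. ip_norm ip (\<lambda>w. X n w - F0 w)) \<longlonglongrightarrow> 0"
  proof (rule complete)
    show "X n \<in> S" for n using X inS by blast
    fix e :: real assume e: "e > 0"
    obtain N where N: "1 / Suc N < e\<^sup>2 / 4"
      using e reals_Archimedean[of "e\<^sup>2/4"] by (auto simp: inverse_eq_divide)
    have "ip_norm ip (\<lambda>w. X m w - X n w) < e" if "m \<ge> N" "n \<ge> N" for m n
    proof -
      have a: "1 / real (Suc m) \<le> 1 / Suc N" "1 / real (Suc n) \<le> 1 / Suc N"
        using that by (auto intro!: divide_left_mono)
      have "(ip_norm ip (\<lambda>w. X m w - X n w))\<^sup>2 < 2 * (1 / Suc N) + 2 * (1 / Suc N)"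
      proof -
        have b: "Q (X m) - d < 1 / Suc N" "Q (X n) - d < 1 / Suc N"
          using X(2)[of m] X(2)[of n] a by linarith+
        show ?thesis
          unfolding ip_norm_sq[OF diff_mem[OF inS[OF X(1)] inS[OF X(1)]]]
          using par[OF X(1) X(1), of m n] b by argo
      qed
      also have "\<dots> < e\<^sup>2" using N by simp
      finally show ?thesis using e by (simp add: power_less_imp_less_base)
    qed
    then show "\<exists>N. \<forall>m\<ge>N. \<forall>n\<ge>N. ip_norm ip (\<lambda>w. X m w - X n w) < e" by blast
  qed
  then obtain F0 where F0: "F0 \<in> S" and lim: "(\<lambda>n. ip_norm ip (\<lambda>w. X n w - F0 w)) \<longlonglongrightarrow> 0" by blast
  have ipl: "(\<lambda>n. ip (X n) F) \<longlonglongrightarrow> ip F0 F" if "F \<in> S" for F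
  proof (rule LIM_zero_cancel, rule Lim_null_comparison)
    show "\<forall>\<^sub>F n in sequentially. norm (ip (X n) F - ip F0 F) \<le> ip_norm ip (\<lambda>w. X n w - F0 w) * ip_norm ip F"
      using cauchy_schwarz[OF diff_mem[OF inS[OF X(1)] F0] that]
      by (simp add: ip_diff_left[OF that inS[OF X(1)] F0])
    show "(\<lambda>n. ip_norm ip (\<lambda>w. X n w - F0 w) * ip_norm ip F) \<longlonglongrightarrow> 0"
      using tendsto_mult_right[OF lim, of "ip_norm ip F"] by simp
  qed
  \<comment> \<open>First variation: \<open>Q\<close> at \<open>X n + t F\<close> cannot drop below
    \<open>d\<close>. In the limit \<open>2 t A + t\<^sup>2 B\<close> is nonnegative for all real
    \<open>t\<close>, which forces \<open>A = 0\<close>.\<close>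
  have re: "Re (ip F0 F) = Re (\<phi> F)" if F: "F \<in> M" for F
  proof -
    define A where "A = Re (ip F0 F - \<phi> F)"
    define B where "B = Re (ip F F)"
    have B: "B \<ge> 0" unfolding B_def by (rule ip_self_nonneg[OF inS[OF F]])
    have *: "0 \<le> 2 * t * A + t\<^sup>2 * B" for t
    proof -
      have "0 \<le> 1 / Suc n + 2 * t * Re (ip (X n) F - \<phi> F) + t\<^sup>2 * B" for n
        using dle[OF M(3)[OF X(1)[of n] M(4)[OF F, of "complex_of_real t"]]] Qadd[OF X(1) F, of n t] X(2)[of n]
        by (simp add: B_def)
      moreover have "(\<lambda>n. 1 / Suc n + 2 * t * Re (ip (X n) F - \<phi> F) + t\<^sup>2 * B) \<longlonglongrightarrow> 0 + 2 * t * A + t\<^sup>2 * B"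
        unfolding A_def by (intro tendsto_intros ipl inS F LIMSEQ_Suc[OF lim_1_over_n])
      ultimately show ?thesis by (intro LIMSEQ_le_const[where a = 0]) auto
    qed
    have "A = 0"
    proof (rule ccontr)
      assume "A \<noteq> 0"
      \<comment> \<open>At \<open>t = - u\<close> the quadratic is negative unless
        \<open>A = 0\<close>; \<open>B + 1\<close> avoids a division by zero when \<open>F\<close>
        is zero.\<close>
      define u where "u = A / (B + 1)"
      have u: "A = u * (B + 1)" "u \<noteq> 0" using B \<open>A \<noteq> 0\<close> by (simp_all add: u_def)
      have "0 \<le> 2 * (- u) * A + (- u)\<^sup>2 * B" by (rule *)
      also have "\<dots> = - (u\<^sup>2 * (B + 2))"
        unfolding u(1) by (simp add: algebra_simps power2_eq_square)
      also have "\<dots> < 0" using B u(2) by simp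
      finally show False by simp
    qed
    then show ?thesis by (simp add: A_def)
  qed
  have "ip F0 F = \<phi> F" if F: "F \<in> M" for F
  proof (rule complex_eqI)
    show "Re (ip F0 F) = Re (\<phi> F)" by (rule re[OF F])
    show "Im (ip F0 F) = Im (\<phi> F)"
      using re[OF M(4)[OF F, of \<i>]] by (simp add: ip_scale_right[OF F0 inS[OF F]] \<phi>_scale[OF F])
  qed
  with F0 X(1) lim show ?thesis by (rule that)
qed

end

section \<open>Hardy space functions on the upper half-plane\<close>

text \<open>Serves as the squared norm of the Cauchy kernel on a horizontal line and as the
  normalization of the Poisson kernel. The primitive is an arctangent.\<close>

lemma integral_inverse_quadratic:
  fixes a b :: real assumes b: "b > 0"
  shows "integrable lborel (\<lambda>x. 1 / ((x - a)\<^sup>2 + b\<^sup>2))" "(LINT x|lborel. 1 / ((x - a)\<^sup>2 + b\<^sup>2)) = pi / b"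
proof -
  have pos: "(x - a)\<^sup>2 + b\<^sup>2 > 0" for x using b by (simp add: add_nonneg_pos)
  define F where "F x = arctan ((x - a) / b) / b" for x
  have D: "DERIV F x :> 1 / ((x - a)\<^sup>2 + b\<^sup>2)" for x
  proof -
    have e: "1 + ((x - a) / b)\<^sup>2 = ((x - a)\<^sup>2 + b\<^sup>2) / b\<^sup>2"
      using b by (simp add: power_divide field_simps)
    have "DERIV F x :> (1 / b) / (1 + ((x - a) / b)\<^sup>2) / b"
      unfolding F_def using b by (auto intro!: derivative_eq_intros simp: inverse_eq_divide)
    then show ?thesis unfolding e using b by (simp add: power2_eq_square)
  qed
  have top: "LIM x at_top. (x - a) / b :> at_top" "LIM x at_bot. (x - a) / b :> at_bot"
  proof -
    show "LIM x at_top. (x - a) / b :> at_top"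
      unfolding filterlim_at_top
    proof
      fix Z
      have "x \<ge> Z * b + a \<Longrightarrow> Z \<le> (x - a) / b" for x using b by (simp add: pos_le_divide_eq)
      then show "\<forall>\<^sub>F x in at_top. Z \<le> (x - a) / b" unfolding eventually_at_top_linorder by blast
    qed
    show "LIM x at_bot. (x - a) / b :> at_bot"
      unfolding filterlim_at_bot
    proof
      fix Z
      have "x \<le> Z * b + a \<Longrightarrow> (x - a) / b \<le> Z" for x using b by (simp add: pos_divide_le_eq)
      then show "\<forall>\<^sub>F x in at_bot. (x - a) / b \<le> Z" unfolding eventually_at_bot_linorder by blast
    qed
  qed
  have l1: "((F \<circ> real_of_ereal) \<longlongrightarrow> - (pi / 2) / b) (at_right (- \<infinity>))"
    unfolding ereal_tendsto_simps1 F_def using b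
    by (intro tendsto_divide filterlim_compose[OF tendsto_arctan_at_bot top(2)] tendsto_const) auto
  have l2: "((F \<circ> real_of_ereal) \<longlongrightarrow> (pi / 2) / b) (at_left \<infinity>)"
    unfolding ereal_tendsto_simps1 F_def using b
    by (intro tendsto_divide filterlim_compose[OF tendsto_arctan_at_top top(1)] tendsto_const) auto
  have c: "isCont (\<lambda>x. 1 / ((x - a)\<^sup>2 + b\<^sup>2)) x" for x
    using pos[of x] by (intro continuous_intros) auto
  note * = interval_integral_FTC_nonneg[where a = "-\<infinity>" and b = \<infinity>, OF _ D c _ l1 l2]
  have e: "einterval (- \<infinity>) \<infinity> = (UNIV :: real set)" by (auto simp: einterval_def)
  have si: "set_integrable lborel (einterval (- \<infinity>) \<infinity>) (\<lambda>x. 1 / ((x - a)\<^sup>2 + b\<^sup>2))"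
    using pos by (intro *) (auto simp: less_imp_le)
  then show "integrable lborel (\<lambda>x. 1 / ((x - a)\<^sup>2 + b\<^sup>2))"
    by (simp add: e set_integrable_def)
  have "(LBINT x=-\<infinity>..\<infinity>. 1 / ((x - a)\<^sup>2 + b\<^sup>2)) = (pi / 2) / b - (- (pi / 2) / b)"
    using pos by (intro *) (auto simp: less_imp_le)
  then show "(LINT x|lborel. 1 / ((x - a)\<^sup>2 + b\<^sup>2)) = pi / b"
    using b by (simp add: interval_lebesgue_integral_def e set_lebesgue_integral_def field_simps)
qed

text \<open>If \<open>v\<close> exceeded 1 on a whole half-line, its integral would exceed the
  length of every interval in it. Applied to vertical means of a Hardy function it selects abscissae
  for the sides of rectangles.\<close>

lemma small_value_right:
  fixes v :: "real \<Rightarrow> ennreal"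
  assumes v: "(\<integral>\<^sup>+x. v x \<partial>lborel) < \<infinity>"
  shows "\<exists>R\<ge>c. v R \<le> 1" "\<exists>R\<le>c. v R \<le> 1"
proof -
  have key: "\<exists>x\<in>A. v x \<le> 1" if A: "A \<in> sets lborel" "\<And>n::nat. \<exists>a. {a..a + real n} \<subseteq> A" for A
  proof (rule ccontr)
    assume "\<not> (\<exists>x\<in>A. v x \<le> 1)"
    then have "(\<integral>\<^sup>+x. indicator A x \<partial>lborel) \<le> (\<integral>\<^sup>+x. v x \<partial>lborel)"
      by (intro nn_integral_mono) (auto simp: indicator_def not_le less_imp_le)
    then have "emeasure lborel A \<le> (\<integral>\<^sup>+x. v x \<partial>lborel)" using A(1) by simp
    moreover have "of_nat n \<le> emeasure lborel A" for n
    proof -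
      obtain a where "{a..a + real n} \<subseteq> A" using A(2) by blast
      then have "emeasure lborel {a..a + real n} \<le> emeasure lborel A"
        using A(1) by (intro emeasure_mono) auto
      then show ?thesis by (simp add: ennreal_of_nat_eq_real_of_nat)
    qed
    ultimately have "of_nat n \<le> (\<integral>\<^sup>+x. v x \<partial>lborel)" for n by (meson order_trans)
    moreover obtain n where "(\<integral>\<^sup>+x. v x \<partial>lborel) < of_nat n"
      using v ennreal_Ex_less_of_nat by (auto simp: less_top)
    ultimately show False using not_le by blast
  qed
  have "\<exists>x\<in>{c..}. v x \<le> 1" by (rule key) (auto intro!: exI[of _ c])
  then show "\<exists>R\<ge>c. v R \<le> 1" by auto
  have "\<exists>x\<in>{..c}. v x \<le> 1"
    by (rule key) (auto intro!: exI[of _ "c - real n" for n])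
  then show "\<exists>R\<le>c. v R \<le> 1" by auto
qed

text \<open>Continuity up to the real axis is included because the quotients \<open>F / E\<close>
  have it when \<open>E\<close> does not vanish there. Boundary values are then plain values, and
  nontangential limits do not enter.\<close>

locale hardy_halfplane =
  fixes f :: "complex \<Rightarrow> complex" and M :: real
  assumes cont: "continuous_on {z. 0 \<le> Im z} f"
    and hol: "f holomorphic_on {z. 0 < Im z}"
    and M_nonneg: "0 \<le> M"
    and bound: "\<And>y. y > 0 \<Longrightarrow> (\<integral>\<^sup>+x. ennreal ((cmod (f (Complex x y)))\<^sup>2) \<partial>lborel) \<le> ennreal M"
begin

lemma continuous_on_line: assumes "y \<ge> 0" shows "continuous_on A (\<lambda>x. f (Complex x y))"
  by (rule continuous_on_compose2[OF cont]) (use assms in \<open>auto simp: Complex_eq intro!: continuous_intros\<close>)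

lemma measurable_line: "y \<ge> 0 \<Longrightarrow> (\<lambda>x. f (Complex x y)) \<in> borel_measurable borel"
  by (intro borel_measurable_continuous_onI continuous_on_line)

text \<open>The new height is 0, reached by Fatou's lemma along lines slightly above.\<close>

lemma bound_line:
  assumes "y \<ge> 0"
  shows "(\<integral>\<^sup>+x. ennreal ((cmod (f (Complex x y)))\<^sup>2) \<partial>lborel) \<le> ennreal M"
proof (rule fatou_norm_sq[where f = "\<lambda>n x. f (Complex x (y + 1 / Suc n))"])
  show "(\<lambda>x. f (Complex x (y + 1 / real (Suc n)))) \<in> borel_measurable lborel" for n
    using measurable_line[of "y + 1 / Suc n"] assms by simp
  show "(\<lambda>x. f (Complex x y)) \<in> borel_measurable lborel" using measurable_line assms by simp
  show "AE x in lborel. (\<lambda>n. f (Complex x (y + 1 / real (Suc n)))) \<longlonglongrightarrow> f (Complex x y)"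
  proof (rule AE_I2)
    fix x
    have "(\<lambda>n. Complex x (y + 1 / real (Suc n))) \<longlonglongrightarrow> Complex x (y + 0)"
      by (intro tendsto_Complex tendsto_intros LIMSEQ_Suc[OF lim_1_over_n])
    then show "(\<lambda>n. f (Complex x (y + 1 / real (Suc n)))) \<longlonglongrightarrow> f (Complex x y)"
      using assms by (intro continuous_on_tendsto_compose[OF cont]) auto
  qed
  show "\<forall>\<^sub>F n in sequentially. (\<integral>\<^sup>+x. ennreal ((cmod (f (Complex x (y + 1 / real (Suc n)))))\<^sup>2) \<partial>lborel) \<le> ennreal M"
    using assms by (intro always_eventually allI bound) (simp add: add_nonneg_pos)
qed

lemma line_L2:
  assumes "y \<ge> 0"
  shows "(\<lambda>x. f (Complex x y)) \<in> L2 lborel" "(LINT x|lborel. (cmod (f (Complex x y)))\<^sup>2) \<le> M"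
  using L2_nn_integral_I[OF _ bound_line M_nonneg] measurable_line assms by auto

lemma cauchy_kernel_L2:
  assumes "y \<noteq> Im z"
  shows "(\<lambda>x. 1 / (Complex x y - z)) \<in> L2 lborel"
    "(LINT x|lborel. (cmod (1 / (Complex x y - z)))\<^sup>2) = pi / \<bar>y - Im z\<bar>"
proof -
  have e: "(cmod (1 / (Complex x y - z)))\<^sup>2 = 1 / ((x - Re z)\<^sup>2 + \<bar>y - Im z\<bar>\<^sup>2)" for x
    by (simp add: norm_divide power_divide) (simp add: cmod_def)
  have "(\<lambda>x. 1 / (Complex x y - z)) \<in> borel_measurable borel"
    using assms by (intro borel_measurable_continuous_onI) (auto simp: Complex_eq intro!: continuous_intros simp: complex_eq_iff)
  moreover have "integrable lborel (\<lambda>x. (cmod (1 / (Complex x y - z)))\<^sup>2)"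
    unfolding e using assms by (intro integral_inverse_quadratic(1)) simp
  ultimately show "(\<lambda>x. 1 / (Complex x y - z)) \<in> L2 lborel" by (intro L2_I) auto
  show "(LINT x|lborel. (cmod (1 / (Complex x y - z)))\<^sup>2) = pi / \<bar>y - Im z\<bar>"
    unfolding e using integral_inverse_quadratic(2)[of "\<bar>y - Im z\<bar>" "Re z"] assms by simp
qed

text \<open>Cauchy-Schwarz against the Cauchy kernel. The factor
  \<open>pi / \<bar>y - Im z\<bar>\<close> is what makes the contribution of a high horizontal line
  vanish.\<close>

lemma cauchy_integrand:
  assumes y: "y \<ge> 0" and z: "y \<noteq> Im z"
  shows "integrable lborel (\<lambda>x. f (Complex x y) / (Complex x y - z))"
    "(cmod (LINT x|lborel. f (Complex x y) / (Complex x y - z)))\<^sup>2 \<le> M * (pi / \<bar>y - Im z\<bar>)"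
proof -
  note k = cauchy_kernel_L2[OF z]
  have m: "(\<lambda>x. f (Complex x y) / (Complex x y - z)) \<in> borel_measurable lborel"
    using borel_measurable_times[OF L2_measurable[OF line_L2(1)[OF y]] L2_measurable[OF k(1)]] by simp
  note * = cauchy_schwarz_L2[OF line_L2(1)[OF y] k(1) m]
  show "integrable lborel (\<lambda>x. f (Complex x y) / (Complex x y - z))"
    by (rule *(1)) (simp add: norm_divide)
  have "(cmod (LINT x|lborel. f (Complex x y) / (Complex x y - z)))\<^sup>2
      \<le> (LINT x|lborel. (cmod (f (Complex x y)))\<^sup>2) * (LINT x|lborel. (cmod (1 / (Complex x y - z)))\<^sup>2)"
    by (rule *(3)) (simp add: norm_divide)
  also have "\<dots> \<le> M * (pi / \<bar>y - Im z\<bar>)"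
    unfolding k(2) using line_L2(2)[OF y] by (intro mult_right_mono) auto
  finally show "(cmod (LINT x|lborel. f (Complex x y) / (Complex x y - z)))\<^sup>2 \<le> M * (pi / \<bar>y - Im z\<bar>)" .
qed

lemma cauchy_rectangle:
  assumes z: "Im z \<noteq> 0" "Im z < Y" and R: "R1 < Re z" "Re z < R2" and Y: "Y > 0"
  defines "h \<equiv> \<lambda>w. f w / (w - z)"
  shows "integral {R1..R2} (\<lambda>x. h (Complex x 0)) + \<i> * integral {0..Y} (\<lambda>y. h (Complex R2 y))
     - integral {R1..R2} (\<lambda>x. h (Complex x Y)) - \<i> * integral {0..Y} (\<lambda>y. h (Complex R1 y))
     = (if Im z > 0 then 2 * pi * \<i> * f z else 0)"
proof -
  define a b where "a = Complex R1 0" and "b = Complex R2 Y"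
  have le: "Re a \<le> Re b" "Im a \<le> Im b" using R Y by (auto simp: a_def b_def)
  have box: "w \<in> box a b \<Longrightarrow> 0 < Im w" for w by (auto simp: in_box_complex_iff a_def)
  have pi_cb: "path_image (rectpath a b) \<subseteq> cbox a b" by (rule path_image_rectpath_subset_cbox[OF le])
  have cf: "continuous_on (cbox a b) f"
    by (rule continuous_on_subset[OF cont]) (auto simp: in_cbox_complex_iff a_def)
  have df: "f field_differentiable at w" if "w \<in> box a b" for w
    by (rule holomorphic_on_imp_differentiable_at[OF hol open_halfspace_Im_gt]) (use box[OF that] in simp)
  have zn: "z \<notin> path_image (rectpath a b)"
    unfolding path_image_rectpath[OF le] using z R Y by (auto simp: a_def b_def)
  have hc: "(h has_contour_integral (if Im z > 0 then 2 * pi * \<i> * f z else 0)) (rectpath a b)"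
  proof (cases "Im z > 0")
    case True
    have zb: "z \<in> box a b" using True z R by (auto simp: in_box_complex_iff a_def b_def)
    have "(h has_contour_integral (2 * pi * \<i> * winding_number (rectpath a b) z * f z)) (rectpath a b)"
      unfolding h_def
      by (rule Cauchy_integral_formula_weak[where S = "cbox a b" and k = "{}"])
         (use cf df zb pi_cb zn in \<open>auto simp: interior_cbox\<close>)
    then show ?thesis using True by (simp add: winding_number_rectpath[OF zb])
  next
    case False
    then have zc: "w - z \<noteq> 0" if "w \<in> cbox a b" for w
      using that z by (auto simp: in_cbox_complex_iff a_def)
    have "(h has_contour_integral 0) (rectpath a b)"
    proof (rule Cauchy_theorem_convex[where S = "cbox a b" and K = "{}"])
      show "continuous_on (cbox a b) h" unfolding h_def using zc by (intro continuous_intros cf) auto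
      show "h field_differentiable at w" if "w \<in> interior (cbox a b) - {}" for w
      proof -
        have w: "w \<in> box a b" using that by (simp add: interior_cbox)
        then show ?thesis unfolding h_def using zc[of w] box_subset_cbox[of a b]
          by (intro derivative_intros df) auto
      qed
    qed (use pi_cb in auto)
    then show ?thesis using False by simp
  qed
  define a2 a4 where "a2 = Complex R2 0" and "a4 = Complex R1 Y"
  have rp: "rectpath a b = linepath a a2 +++ linepath a2 b +++ linepath b a4 +++ linepath a4 a"
    by (simp add: rectpath_def Let_def a_def b_def a2_def a4_def)
  have ch: "continuous_on (path_image (rectpath a b)) h"
    unfolding h_def using zn by (intro continuous_intros continuous_on_subset[OF cf pi_cb]) auto
  have pim: "path_image (rectpath a b) = closed_segment a a2 \<union> closed_segment a2 b \<union> closed_segment b a4 \<union> closed_segment a4 a"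
    unfolding rp by (simp add: path_image_join Un_assoc)
  have ci: "h contour_integrable_on linepath a a2" "h contour_integrable_on linepath a2 b"
      "h contour_integrable_on linepath b a4" "h contour_integrable_on linepath a4 a"
    by (auto intro!: contour_integrable_continuous_linepath continuous_on_subset[OF ch] simp: pim)
  have sum: "(if Im z > 0 then 2 * pi * \<i> * f z else 0) =
     contour_integral (linepath a a2) h + contour_integral (linepath a2 b) h
     - contour_integral (linepath a4 b) h - contour_integral (linepath a a4) h"
    using contour_integral_unique[OF hc, symmetric] ci unfolding rp
    by (simp del: of_real_mult add: contour_integrable_join contour_integral_reversepath[of "linepath a4 b", simplified] 
        contour_integral_reversepath[of "linepath a a4", simplified])
  have ci': "h contour_integrable_on linepath a4 b" "h contour_integrable_on linepath a a4"
    using ci(3,4) contour_integrable_reversepath_eq[of "linepath b a4" h] contour_integrable_reversepath_eq[of "linepath a4 a" h]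
    by (simp_all)
  have vert: "contour_integral (linepath (Complex c 0) (Complex c Y)) h = \<i> * integral {0..Y} (\<lambda>y. h (Complex c y))"
    if "h contour_integrable_on linepath (Complex c 0) (Complex c Y)" for c
    using has_contour_integral_linepath_same_Re_iff[of "Complex c 0" c "Complex c Y" 0 Y h] 
      has_contour_integral_integral[OF that] Y by (auto dest!: integral_unique)
  have hor: "contour_integral (linepath (Complex R1 y) (Complex R2 y)) h = integral {R1..R2} (\<lambda>x. h (Complex x y))"
    if "h contour_integrable_on linepath (Complex R1 y) (Complex R2 y)" for y
  proof -
    have e: "linepath (Complex R1 y) (Complex R2 y) x = linepath (complex_of_real R1) (complex_of_real R2) x + \<i> * y" for x
      by (simp add: linepath_def complex_eq_iff algebra_simps)
    have "((\<lambda>w. h (w + \<i> * y)) has_contour_integral contour_integral (linepath (Complex R1 y) (Complex R2 y)) h)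
        (linepath (complex_of_real R1) (complex_of_real R2))"
      using has_contour_integral_integral[OF that] unfolding has_contour_integral_linepath e
      by (simp add: complex_eq_iff Complex_eq scaleR_conv_of_real algebra_simps)
    then have "((\<lambda>x. h (complex_of_real x + \<i> * y)) has_integral contour_integral (linepath (Complex R1 y) (Complex R2 y)) h) {R1..R2}"
      using R by (subst (asm) has_contour_integral_linepath_Reals_iff) auto
    then show ?thesis by (simp add: Complex_eq integral_unique)
  qed
  show ?thesis
    unfolding sum using vert[of R2] vert[of R1] hor[of 0] hor[of Y] ci ci'
    by (simp add: a_def a2_def a4_def b_def)
qed


text \<open>Fubini's theorem with the uniform bound on horizontal lines: the vertical means over
  \<open>{0..Y}\<close> form an integrable function of \<open>x\<close>, so
  \<open>small_value_right\<close> applies to them. Writing \<open>max 0 y\<close> makes the factor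
  with \<open>f\<close> continuous on the whole plane without changing it on the strip.\<close>

lemma vertical_average:
  assumes Y: "Y \<ge> 0"
  shows "(\<integral>\<^sup>+x. (\<integral>\<^sup>+y. indicator {0..Y} y * ennreal ((cmod (f (Complex x (max 0 y))))\<^sup>2) \<partial>lborel) \<partial>lborel) < \<infinity>"
proof -
  have c: "continuous_on UNIV (\<lambda>p. f (Complex (snd p) (max 0 (fst p))))"
    by (rule continuous_on_compose2[OF cont]) (auto simp: Complex_eq intro!: continuous_intros)
  have m: "(\<lambda>p::real \<times> real. f (Complex (snd p) (max 0 (fst p)))) \<in> borel_measurable (lborel \<Otimes>\<^sub>M lborel)"
    using borel_measurable_continuous_onI[OF c] by (simp add: lborel_prod)
  have "(\<integral>\<^sup>+x. (\<integral>\<^sup>+y. indicator {0..Y} y * ennreal ((cmod (f (Complex x (max 0 y))))\<^sup>2) \<partial>lborel) \<partial>lborel)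
     = (\<integral>\<^sup>+y. (\<integral>\<^sup>+x. indicator {0..Y} y * ennreal ((cmod (f (Complex x (max 0 y))))\<^sup>2) \<partial>lborel) \<partial>lborel)"
    using m by (intro lborel_pair.Fubini') (simp add: case_prod_beta')
  also have "\<dots> \<le> (\<integral>\<^sup>+y. indicator {0..Y} y * ennreal M \<partial>lborel)"
  proof (rule nn_integral_mono)
    fix y :: real
    have "(\<lambda>x. f (Complex x (max 0 y))) \<in> borel_measurable borel" by (rule measurable_line) simp
    then have "(\<integral>\<^sup>+x. indicator {0..Y} y * ennreal ((cmod (f (Complex x (max 0 y))))\<^sup>2) \<partial>lborel)
      = indicator {0..Y} y * (\<integral>\<^sup>+x. ennreal ((cmod (f (Complex x (max 0 y))))\<^sup>2) \<partial>lborel)"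
      by (intro nn_integral_cmult) simp
    also have "\<dots> \<le> indicator {0..Y} y * ennreal M"
      by (intro mult_left_mono bound_line) auto
    finally show "(\<integral>\<^sup>+x. indicator {0..Y} y * ennreal ((cmod (f (Complex x (max 0 y))))\<^sup>2) \<partial>lborel) \<le> indicator {0..Y} y * ennreal M" .
  qed
  also have "\<dots> = ennreal Y * ennreal M" using Y by (simp add: nn_integral_multc)
  also have "\<dots> < \<infinity>" by (simp add: ennreal_mult_less_top)
  finally show ?thesis .
qed

lemma vertical_bound:
  assumes Y: "Y > 0" and R: "d > 0" "d \<le> \<bar>R - Re z\<bar>"
    and v: "(\<integral>\<^sup>+y. indicator {0..Y} y * ennreal ((cmod (f (Complex R (max 0 y))))\<^sup>2) \<partial>lborel) \<le> 1"
  shows "cmod (integral {0..Y} (\<lambda>y. f (Complex R y) / (Complex R y - z))) \<le> (Y + 1) / d"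
proof -
  have ne: "Complex R y - z \<noteq> 0" for y using R by (auto simp: complex_eq_iff)
  have cR: "continuous_on {0..Y} (\<lambda>y. f (Complex R y))"
    by (rule continuous_on_compose2[OF cont]) (auto simp: Complex_eq intro!: continuous_intros)
  have i2: "(\<lambda>y. (cmod (f (Complex R y)))\<^sup>2) integrable_on {0..Y}"
    by (intro integrable_continuous_interval continuous_intros cR)
  have si: "set_integrable lborel {0..Y} (\<lambda>y. (cmod (f (Complex R y)))\<^sup>2)"
    by (intro borel_integrable_atLeastAtMost' continuous_intros cR)
  have "integral {0..Y} (\<lambda>y. (cmod (f (Complex R y)))\<^sup>2) = (LINT y|lborel. indicator {0..Y} y *\<^sub>R (cmod (f (Complex R y)))\<^sup>2)"
    using set_borel_integral_eq_integral(2)[OF si] by (simp add: set_lebesgue_integral_def)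
  moreover have "ennreal \<dots> = (\<integral>\<^sup>+y. ennreal (indicator {0..Y} y *\<^sub>R (cmod (f (Complex R y)))\<^sup>2) \<partial>lborel)"
    using si by (intro nn_integral_eq_integral[symmetric]) (auto simp: set_integrable_def)
  moreover have "\<dots> = (\<integral>\<^sup>+y. indicator {0..Y} y * ennreal ((cmod (f (Complex R (max 0 y))))\<^sup>2) \<partial>lborel)"
    by (intro nn_integral_cong) (auto simp: indicator_def)
  ultimately have "ennreal (integral {0..Y} (\<lambda>y. (cmod (f (Complex R y)))\<^sup>2)) \<le> 1" using v by simp
  then have i3: "integral {0..Y} (\<lambda>y. (cmod (f (Complex R y)))\<^sup>2) \<le> 1"
    by (simp add: ennreal_le_1)
  have "cmod (integral {0..Y} (\<lambda>y. f (Complex R y) / (Complex R y - z)))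
    \<le> integral {0..Y} (\<lambda>y. (1 + (cmod (f (Complex R y)))\<^sup>2) / d)"
  proof (rule integral_norm_bound_integral)
    show "(\<lambda>y. f (Complex R y) / (Complex R y - z)) integrable_on {0..Y}"
      using ne by (intro integrable_continuous_interval continuous_intros cR) (auto simp: Complex_eq intro!: continuous_intros)
    show "(\<lambda>y. (1 + (cmod (f (Complex R y)))\<^sup>2) / d) integrable_on {0..Y}"
      using R by (intro integrable_continuous_interval continuous_intros cR) auto
    fix y
    have "d \<le> cmod (Complex R y - z)"
      using abs_Re_le_cmod[of "Complex R y - z"] R by simp
    \<comment> \<open>The inequality s <= 1 + s^2 reduces the first power to the square, whose
      integral is controlled.\<close>
    moreover have "cmod (f (Complex R y)) \<le> 1 + (cmod (f (Complex R y)))\<^sup>2"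
      using zero_le_power2[of "cmod (f (Complex R y)) - 1"] zero_le_power2[of "cmod (f (Complex R y))"]
      unfolding power2_diff power_one mult_1_right by linarith
    ultimately show "cmod (f (Complex R y) / (Complex R y - z)) \<le> (1 + (cmod (f (Complex R y)))\<^sup>2) / d"
      using R by (simp add: norm_divide frac_le)
  qed
  also have "\<dots> = (Y + integral {0..Y} (\<lambda>y. (cmod (f (Complex R y)))\<^sup>2)) / d"
    using Y Henstock_Kurzweil_Integration.integral_add[OF integrable_const_ivl i2, of 1] by simp
  also have "\<dots> \<le> (Y + 1) / d" using i3 R by (intro divide_right_mono) auto
  finally show ?thesis .
qed

text \<open>Square-integral bounds give no pointwise decay, so the vertical sides are placed at
  abscissae \<open>R n\<close> and \<open>L n\<close> where the vertical mean is at most 1; their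
  distance of at least \<open>Suc n\<close> from \<open>Re z\<close> then makes their contribution
  O(1/n).\<close>

lemma cauchy_strip:
  assumes z: "Im z \<noteq> 0" and Y: "Y > 0" "Im z < Y"
  shows "(LINT x|lborel. f (Complex x 0) / (Complex x 0 - z)) - (LINT x|lborel. f (Complex x Y) / (Complex x Y - z))
     = (if Im z > 0 then 2 * pi * \<i> * f z else 0)" (is "?L0 - ?LY = ?c")
proof -
  let ?v = "\<lambda>R. (\<integral>\<^sup>+y. indicator {0..Y} y * ennreal ((cmod (f (Complex R (max 0 y))))\<^sup>2) \<partial>lborel)"
  have va: "(\<integral>\<^sup>+R. ?v R \<partial>lborel) < \<infinity>" using Y by (intro vertical_average) simp
  have "\<forall>n. \<exists>R. R \<ge> Re z + real (Suc n) \<and> ?v R \<le> 1" "\<forall>n. \<exists>R. R \<le> Re z - real (Suc n) \<and> ?v R \<le> 1"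
    using small_value_right[OF va] by auto
  from this[THEN choice] obtain R L where RL: "\<forall>n. R n \<ge> Re z + real (Suc n) \<and> ?v (R n) \<le> 1"
    "\<forall>n. L n \<le> Re z - real (Suc n) \<and> ?v (L n) \<le> 1" by (elim exE)
  have R: "R n \<ge> Re z + real (Suc n)" "?v (R n) \<le> 1" for n using RL(1) by simp_all
  have L: "L n \<le> Re z - real (Suc n)" "?v (L n) \<le> 1" for n using RL(2) by simp_all
  let ?h = "\<lambda>y x. f (Complex x y) / (Complex x y - z)"
  have lim: "(\<lambda>n. integral {L n..R n} (?h y)) \<longlonglongrightarrow> (LINT x|lborel. ?h y x)" if y: "y \<ge> 0" "y \<noteq> Im z" for y
  proof -
    note i = cauchy_integrand(1)[OF y]
    have "integral {L n..R n} (?h y) = (LINT x|lborel. indicator {L n..R n} x *\<^sub>R ?h y x)" for n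
      using set_borel_integral_eq_integral(2)[of "{L n..R n}" "?h y"] integrable_mult_indicator[OF _ i, of "{L n..R n}"]
      by (simp add: set_integrable_def set_lebesgue_integral_def)
    moreover have "(\<lambda>n. (LINT x|lborel. indicator {L n..R n} x *\<^sub>R ?h y x)) \<longlonglongrightarrow> (LINT x|lborel. ?h y x)"
    proof (rule integral_dominated_convergence[where w = "\<lambda>x. norm (?h y x)"])
      show "AE x in lborel. (\<lambda>n. indicator {L n..R n} x *\<^sub>R ?h y x) \<longlonglongrightarrow> ?h y x"
      proof (rule AE_I2)
        fix x
        obtain N where N: "\<bar>x - Re z\<bar> \<le> real N" using real_arch_simple by blast
        have "indicator {L n..R n} x *\<^sub>R ?h y x = ?h y x" if "n \<ge> N" for n
        proof -
          have "x \<in> {L n..R n}" using R(1)[of n] L(1)[of n] N that by (simp add: abs_le_iff)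
          then show ?thesis by simp
        qed
        then have "\<forall>\<^sub>F n in sequentially. indicator {L n..R n} x *\<^sub>R ?h y x = ?h y x"
          unfolding eventually_sequentially by blast
        then show "(\<lambda>n. indicator {L n..R n} x *\<^sub>R ?h y x) \<longlonglongrightarrow> ?h y x" by (rule tendsto_eventually)
      qed
      show "?h y \<in> borel_measurable lborel" by (rule borel_measurable_integrable[OF i])
      show "(\<lambda>x. indicator {L n..R n} x *\<^sub>R ?h y x) \<in> borel_measurable lborel" for n
        by (rule borel_measurable_integrable[OF integrable_mult_indicator[OF _ i]]) simp
      show "integrable lborel (\<lambda>x. norm (?h y x))" by (rule integrable_norm[OF i])
      show "AE x in lborel. norm (indicator {L n..R n} x *\<^sub>R ?h y x) \<le> norm (?h y x)" for n
        by (rule AE_I2) (simp add: indicator_def)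
    qed
    ultimately show ?thesis by simp
  qed
  have vert: "(\<lambda>n. integral {0..Y} (\<lambda>y. ?h y (Q n))) \<longlonglongrightarrow> 0"
    if Q: "\<And>n. real (Suc n) \<le> \<bar>Q n - Re z\<bar>" "\<And>n. ?v (Q n) \<le> 1" for Q
  proof (rule Lim_null_comparison)
    show "\<forall>\<^sub>F n in sequentially. norm (integral {0..Y} (\<lambda>y. ?h y (Q n))) \<le> (Y + 1) * (1 / Suc n)"
      using vertical_bound[OF Y(1) _ Q(1) Q(2)] by (intro always_eventually) simp
    show "(\<lambda>n. (Y + 1) * (1 / real (Suc n))) \<longlonglongrightarrow> 0"
      using tendsto_mult_left[OF LIMSEQ_Suc[OF lim_1_over_n]] by simp
  qed
  have "integral {L n..R n} (?h 0) + \<i> * integral {0..Y} (\<lambda>y. ?h y (R n))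
     - integral {L n..R n} (?h Y) - \<i> * integral {0..Y} (\<lambda>y. ?h y (L n)) = ?c" for n
  proof -
    have "L n < Re z" "Re z < R n" using R(1)[of n] L(1)[of n] by linarith+
    from cauchy_rectangle[OF z Y(2) this Y(1)] show ?thesis by simp
  qed
  moreover have "(\<lambda>n. integral {L n..R n} (?h 0) + \<i> * integral {0..Y} (\<lambda>y. ?h y (R n))
     - integral {L n..R n} (?h Y) - \<i> * integral {0..Y} (\<lambda>y. ?h y (L n))) \<longlonglongrightarrow> ?L0 + \<i> * 0 - ?LY - \<i> * 0"
  proof -
    have "real (Suc n) \<le> \<bar>R n - Re z\<bar>" "real (Suc n) \<le> \<bar>L n - Re z\<bar>" for n
      using R(1)[of n] L(1)[of n] by linarith+
    note v = vert[OF this(1) R(2)] vert[OF this(2) L(2)]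
    have l: "(\<lambda>n. integral {L n..R n} (?h 0)) \<longlonglongrightarrow> ?L0" "(\<lambda>n. integral {L n..R n} (?h Y)) \<longlonglongrightarrow> ?LY"
      using z Y by (intro lim; simp)+
    show ?thesis
      by (intro tendsto_diff tendsto_add tendsto_mult tendsto_const l v)
  qed
  ultimately have "(\<lambda>n::nat. ?c) \<longlonglongrightarrow> ?L0 - ?LY" by simp
  then show ?thesis by (simp add: LIMSEQ_const_iff)
qed

text \<open>The upper side of the strip is pushed to infinity; by \<open>cauchy_integrand\<close>
  its contribution is of order Y^(-1/2).\<close>

lemma cauchy_boundary:
  assumes z: "Im z \<noteq> 0"
  shows "(LINT x|lborel. f (complex_of_real x) / (complex_of_real x - z)) = (if Im z > 0 then 2 * pi * \<i> * f z else 0)"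
    (is "?L0 = ?c")
proof -
  define D where "D = (cmod (?L0 - ?c))\<^sup>2"
  have D: "D \<le> M * pi / real (Suc n)" for n
  proof -
    define Y where "Y = \<bar>Im z\<bar> + real (Suc n)"
    have Y: "Y > 0" "Im z < Y" "Y \<noteq> Im z" "real (Suc n) \<le> \<bar>Y - Im z\<bar>" by (auto simp: Y_def)
    have "?L0 - ?c = (LINT x|lborel. f (Complex x Y) / (Complex x Y - z))"
      using cauchy_strip[OF z Y(1,2)] by (simp add: Complex_eq algebra_simps)
    then have "D \<le> M * (pi / \<bar>Y - Im z\<bar>)"
      unfolding D_def using cauchy_integrand(2)[of Y z] Y by simp
    also have "\<dots> \<le> M * (pi / real (Suc n))"
      using M_nonneg Y by (intro mult_left_mono divide_left_mono) auto
    finally show ?thesis by simp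
  qed
  have "(\<lambda>n. M * pi * (1 / real (Suc n))) \<longlonglongrightarrow> M * pi * 0"
    by (intro tendsto_mult_left LIMSEQ_Suc[OF lim_1_over_n])
  then have "D \<le> 0" using D by (intro LIMSEQ_le_const[where X = "\<lambda>n. M * pi / real (Suc n)"]) auto
  then show ?thesis by (simp add: D_def)
qed

text \<open>Subtracting the vanishing Cauchy integral at \<open>cnj z\<close> from the one at \<open>z\<close> gives the Poisson
  formula, whose kernel is a probability density.\<close>

lemma line_norm_le_boundary:
  assumes y: "y > 0"
  shows "(\<integral>\<^sup>+x. ennreal ((cmod (f (Complex x y)))\<^sup>2) \<partial>lborel)
     \<le> (\<integral>\<^sup>+x. ennreal ((cmod (f (complex_of_real x)))\<^sup>2) \<partial>lborel)"
proof -
  define P where "P s t = y / pi * (1 / ((t - s)\<^sup>2 + y\<^sup>2))" for s t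
  have P0: "P s t \<ge> 0" for s t using y by (simp add: P_def)
  have Pi1: "integrable lborel (P s)" for s
    unfolding P_def by (intro Bochner_Integration.integrable_mult_right integral_inverse_quadratic y)
  have Pi2: "(LINT t|lborel. P s t) = 1" for s
    unfolding P_def integral_mult_right_zero using integral_inverse_quadratic(2)[OF y, of s] y by simp
  have fm[measurable]: "(\<lambda>t. f (complex_of_real t)) \<in> borel_measurable borel"
    using measurable_line[of 0] by (simp add: complex_of_real_def)
  have Pm1[measurable]: "P s \<in> borel_measurable borel" for s using Pi1[of s] by auto
  have rep: "f (Complex s y) = (LINT t|lborel. P s t * f (complex_of_real t))" for s
  proof -
    define z where "z = Complex s y"
    have z: "Im z > 0" "Im (cnj z) < 0" using y by (auto simp: z_def)
    have i: "integrable lborel (\<lambda>x. f (complex_of_real x) / (complex_of_real x - w))" if "Im w \<noteq> 0" for w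
      using cauchy_integrand(1)[of 0 w] that by (simp add: complex_of_real_def)
    have "2 * pi * \<i> * f z = (LINT x|lborel. f (complex_of_real x) / (complex_of_real x - z))
        - (LINT x|lborel. f (complex_of_real x) / (complex_of_real x - cnj z))"
      using cauchy_boundary[of z] cauchy_boundary[of "cnj z"] z by simp
    also have "\<dots> = (LINT x|lborel. f (complex_of_real x) / (complex_of_real x - z) - f (complex_of_real x) / (complex_of_real x - cnj z))"
      using z i[of z] i[of "cnj z"] by (intro Bochner_Integration.integral_diff[symmetric]) auto
    also have "\<dots> = (LINT t|lborel. (2 * pi * \<i>) * (P s t * f (complex_of_real t)))"
    proof (rule Bochner_Integration.integral_cong)
      fix t :: real
      have ne: "complex_of_real t - z \<noteq> 0" "complex_of_real t - cnj z \<noteq> 0"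
        using z by (auto simp: complex_eq_iff)
      have "1 / (complex_of_real t - z) - 1 / (complex_of_real t - cnj z) = (z - cnj z) / ((complex_of_real t - z) * (complex_of_real t - cnj z))"
        using ne by (subst diff_frac_eq) auto
      also have "z - cnj z = 2 * \<i> * y" by (simp add: complex_eq_iff z_def)
      also have "(complex_of_real t - z) * (complex_of_real t - cnj z) = complex_of_real ((t - s)\<^sup>2 + y\<^sup>2)"
        by (simp add: complex_eq_iff z_def power2_eq_square algebra_simps)
      finally have "1 / (complex_of_real t - z) - 1 / (complex_of_real t - cnj z) = 2 * pi * \<i> * P s t"
        by (simp add: P_def)
      then have "f (complex_of_real t) * (1 / (complex_of_real t - z) - 1 / (complex_of_real t - cnj z)) = f (complex_of_real t) * (2 * pi * \<i> * P s t)"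
        by simp
      then show "f (complex_of_real t) / (complex_of_real t - z) - f (complex_of_real t) / (complex_of_real t - cnj z)
         = (2 * pi * \<i>) * (P s t * f (complex_of_real t))" by (simp add: algebra_simps)
    qed simp
    also have "\<dots> = 2 * pi * \<i> * (LINT t|lborel. P s t * f (complex_of_real t))"
      by (rule integral_mult_right_zero)
    finally show ?thesis by (simp add: z_def)
  qed
  \<comment> \<open>Jensen's inequality for the probability density \<open>P s\<close>, obtained
    from Cauchy-Schwarz by splitting \<open>P\<close> into two factors
    \<open>sqrt P\<close>.\<close>
  have le: "ennreal ((cmod (f (Complex s y)))\<^sup>2) \<le> (\<integral>\<^sup>+t. ennreal (P s t * (cmod (f (complex_of_real t)))\<^sup>2) \<partial>lborel)" for s
  proof -
    let ?u = "\<lambda>t. ennreal (sqrt (P s t))" and ?w = "\<lambda>t. ennreal (sqrt (P s t) * cmod (f (complex_of_real t)))"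
    have sq: "sqrt (P s t) * (sqrt (P s t) * c) = P s t * c" for t c
      using P0[of s t] by (simp add: mult.assoc[symmetric])
    have "ennreal (cmod (f (Complex s y))) \<le> (\<integral>\<^sup>+t. ennreal (norm (P s t * f (complex_of_real t))) \<partial>lborel)"
      unfolding rep
      \<comment> \<open>The Bochner integral of a nonintegrable function is 0, so the bound holds in
        that case as well.\<close>
      by (cases "integrable lborel (\<lambda>t. P s t * f (complex_of_real t))")
        (auto intro!: integral_norm_bound_ennreal simp: not_integrable_integral_eq)
    also have "\<dots> = (\<integral>\<^sup>+t. ?u t * ?w t \<partial>lborel)"
      using P0 by (intro nn_integral_cong) (simp add: ennreal_mult[symmetric] norm_mult sq)
    finally have "ennreal (cmod (f (Complex s y))) ^ 2 \<le> (\<integral>\<^sup>+t. ?u t * ?w t \<partial>lborel)\<^sup>2" by (rule power_mono) simp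
    also have "\<dots> \<le> (\<integral>\<^sup>+t. ?u t ^ 2 \<partial>lborel) * (\<integral>\<^sup>+t. ?w t ^ 2 \<partial>lborel)"
      by (rule Cauchy_Schwarz_nn_integral) auto
    also have "(\<integral>\<^sup>+t. ?u t ^ 2 \<partial>lborel) = (\<integral>\<^sup>+t. ennreal (P s t) \<partial>lborel)"
      using P0 by (intro nn_integral_cong) (simp add: ennreal_power)
    also have "\<dots> = 1" using nn_integral_eq_integral[OF Pi1[of s]] P0 Pi2 by simp
    also have "(\<integral>\<^sup>+t. ?w t ^ 2 \<partial>lborel) = (\<integral>\<^sup>+t. ennreal (P s t * (cmod (f (complex_of_real t)))\<^sup>2) \<partial>lborel)"
      using P0 by (intro nn_integral_cong) (simp add: ennreal_power power_mult_distrib)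
    finally show ?thesis by (simp add: ennreal_power)
  qed
  have "(\<integral>\<^sup>+s. ennreal ((cmod (f (Complex s y)))\<^sup>2) \<partial>lborel)
      \<le> (\<integral>\<^sup>+s. (\<integral>\<^sup>+t. ennreal (P s t * (cmod (f (complex_of_real t)))\<^sup>2) \<partial>lborel) \<partial>lborel)"
    by (intro nn_integral_mono le)
  also have "\<dots> = (\<integral>\<^sup>+t. (\<integral>\<^sup>+s. ennreal (P s t * (cmod (f (complex_of_real t)))\<^sup>2) \<partial>lborel) \<partial>lborel)"
  proof (rule lborel_pair.Fubini'[symmetric])
    have "(\<lambda>p. ennreal (P (fst p) (snd p) * (cmod (f (complex_of_real (snd p))))\<^sup>2)) \<in> borel_measurable (borel \<Otimes>\<^sub>M borel)"
      unfolding P_def by measurable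
    then show "(\<lambda>(s, t). ennreal (P s t * (cmod (f (complex_of_real t)))\<^sup>2)) \<in> borel_measurable (lborel \<Otimes>\<^sub>M lborel)"
      by (simp add: case_prod_beta' cong: measurable_cong_sets sets_pair_measure_cong)
  qed
  also have "\<dots> = (\<integral>\<^sup>+t. ennreal ((cmod (f (complex_of_real t)))\<^sup>2) \<partial>lborel)"
  proof (intro nn_integral_cong)
    fix t
    \<comment> \<open>By symmetry of the Poisson kernel its integral over \<open>s\<close> is 1 as
      well.\<close>
    have sym: "P s t = P t s" for s by (simp add: P_def power2_commute)
    have "(\<integral>\<^sup>+s. ennreal (P s t * (cmod (f (complex_of_real t)))\<^sup>2) \<partial>lborel)
      = (\<integral>\<^sup>+s. ennreal (P t s) * ennreal ((cmod (f (complex_of_real t)))\<^sup>2) \<partial>lborel)"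
      using P0 by (intro nn_integral_cong) (simp add: ennreal_mult sym)
    also have "\<dots> = (\<integral>\<^sup>+s. ennreal (P t s) \<partial>lborel) * ennreal ((cmod (f (complex_of_real t)))\<^sup>2)"
      by (rule nn_integral_multc) simp
    also have "(\<integral>\<^sup>+s. ennreal (P t s) \<partial>lborel) = 1" using nn_integral_eq_integral[OF Pi1[of t]] P0 Pi2 by simp
    finally show "(\<integral>\<^sup>+s. ennreal (P s t * (cmod (f (complex_of_real t)))\<^sup>2) \<partial>lborel) = ennreal ((cmod (f (complex_of_real t)))\<^sup>2)" by simp
  qed
  finally show ?thesis .
qed


end

section \<open>De Branges spaces\<close>

lemma continuous_on_sharp:
  assumes "continuous_on UNIV F" shows "continuous_on A (sharp F)"
proof -
  have "continuous_on A (\<lambda>z. F (cnj z))"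
    by (rule continuous_on_compose2[OF assms continuous_on_cnj[OF continuous_on_id]]) simp
  then show ?thesis unfolding sharp_def by (rule continuous_on_cnj)
qed

lemma holomorphic_sharp: "F holomorphic_on UNIV \<Longrightarrow> sharp F holomorphic_on A"
proof -
  assume "F holomorphic_on UNIV"
  then have "(cnj \<circ> F \<circ> cnj) holomorphic_on UNIV"
    by (intro holomorphic_on_compose_cnj_cnj) (auto intro: holomorphic_on_subset)
  then show ?thesis
    unfolding sharp_def comp_def by (rule holomorphic_on_subset) simp
qed

lemma sharp_of_real: "sharp F (complex_of_real x) = cnj (F (complex_of_real x))"
  by (simp add: sharp_def)

lemma sharp_add: "sharp (\<lambda>z. F z + G z) = (\<lambda>z. sharp F z + sharp G z)"
  and sharp_scale: "sharp (\<lambda>z. c * F z) = (\<lambda>z. cnj c * sharp F z)"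
  by (simp_all add: sharp_def fun_eq_iff)

lemma hardy_halfplane_add:
  assumes "hardy_halfplane f M" "hardy_halfplane g N"
  shows "hardy_halfplane (\<lambda>z. f z + g z) (2 * M + 2 * N)"
proof -
  interpret f: hardy_halfplane f M by fact
  interpret g: hardy_halfplane g N by fact
  show ?thesis
  proof
    show "continuous_on {z. 0 \<le> Im z} (\<lambda>z. f z + g z)" by (intro continuous_intros f.cont g.cont)
    show "(\<lambda>z. f z + g z) holomorphic_on {z. 0 < Im z}" by (intro holomorphic_intros f.hol g.hol)
    show "0 \<le> 2 * M + 2 * N" using f.M_nonneg g.M_nonneg by simp
    fix y :: real assume "y > 0"
    then have y: "y \<ge> 0" by simp
    note a = L2_add[OF f.line_L2(1)[OF y] g.line_L2(1)[OF y]]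
    show "(\<integral>\<^sup>+x. ennreal ((cmod (f (Complex x y) + g (Complex x y)))\<^sup>2) \<partial>lborel) \<le> ennreal (2 * M + 2 * N)"
      unfolding nn_integral_norm_sq[OF a(1)] using a(2) f.line_L2(2)[OF y] g.line_L2(2)[OF y]
      by (intro ennreal_leI) linarith
  qed
qed

lemma hardy_halfplane_scale:
  assumes "hardy_halfplane f M"
  shows "hardy_halfplane (\<lambda>z. c * f z) ((cmod c)\<^sup>2 * M)"
proof -
  interpret f: hardy_halfplane f M by fact
  show ?thesis
  proof
    show "continuous_on {z. 0 \<le> Im z} (\<lambda>z. c * f z)" by (intro continuous_intros f.cont)
    show "(\<lambda>z. c * f z) holomorphic_on {z. 0 < Im z}" by (intro holomorphic_intros f.hol)
    show "0 \<le> (cmod c)\<^sup>2 * M" using f.M_nonneg by simp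
    fix y :: real assume "y > 0"
    then have y: "y \<ge> 0" by simp
    have m: "(\<lambda>x. c * f (Complex x y)) \<in> borel_measurable lborel"
      using L2_measurable[OF f.line_L2(1)[OF y]] by simp
    note a = L2_dominated[OF f.line_L2(1)[OF y] m, of "cmod c"]
    have a': "(\<lambda>x. c * f (Complex x y)) \<in> L2 lborel"
        "(LINT x|lborel. (cmod (c * f (Complex x y)))\<^sup>2) \<le> (cmod c)\<^sup>2 * (LINT x|lborel. (cmod (f (Complex x y)))\<^sup>2)"
      by (rule a; simp add: norm_mult)+
    have "(LINT x|lborel. (cmod (c * f (Complex x y)))\<^sup>2) \<le> (cmod c)\<^sup>2 * M"
      using a'(2) mult_left_mono[OF f.line_L2(2)[OF y], of "(cmod c)\<^sup>2"] by simp
    then show "(\<integral>\<^sup>+x. ennreal ((cmod (c * f (Complex x y)))\<^sup>2) \<partial>lborel) \<le> ennreal ((cmod c)\<^sup>2 * M)"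
      unfolding nn_integral_norm_sq[OF a'(1)] by (rule ennreal_leI)
  qed
qed

text \<open>For \<open>w\<close> in the upper half-plane \<open>cnj w\<close> lies below the axis,
  so decay like the inverse of \<open>cmod (z - cnj w)\<close> is square integrable on every
  horizontal line, uniformly with the constant \<open>pi / Im w\<close> that belongs to the axis
  itself.\<close>

lemma hardy_halfplane_of_decay:
  assumes cont: "continuous_on {z. 0 \<le> Im z} f" and hol: "f holomorphic_on {z. 0 < Im z}"
    and w: "Im w > 0" and le: "\<And>z. Im z > 0 \<Longrightarrow> cmod (f z) * cmod (z - cnj w) \<le> C"
  shows "hardy_halfplane f (C\<^sup>2 * (pi / Im w))"
proof
  show "0 \<le> C\<^sup>2 * (pi / Im w)" using w by simp
  fix y :: real assume y: "y > 0"
  let ?k = "\<lambda>x. 1 / ((x - Re w)\<^sup>2 + (y + Im w)\<^sup>2)"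
  have kpos: "(x - Re w)\<^sup>2 + (y + Im w)\<^sup>2 > 0" for x using w y by (intro add_nonneg_pos) auto
  have yw: "0 < y + Im w" using y w by simp
  have ki: "integrable lborel (\<lambda>x. C\<^sup>2 * ?k x)" "(LINT x|lborel. C\<^sup>2 * ?k x) = C\<^sup>2 * (pi / (y + Im w))"
    by (intro Bochner_Integration.integrable_mult_right integral_inverse_quadratic yw)
      (simp only: integral_mult_right_zero integral_inverse_quadratic(2)[OF yw])
  have "(\<integral>\<^sup>+x. ennreal ((cmod (f (Complex x y)))\<^sup>2) \<partial>lborel) \<le> (\<integral>\<^sup>+x. ennreal (C\<^sup>2 * ?k x) \<partial>lborel)"
  proof (intro nn_integral_mono ennreal_leI)
    fix x
    have "(cmod (f (Complex x y)) * cmod (Complex x y - cnj w))\<^sup>2 \<le> C\<^sup>2"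
      using le[of "Complex x y"] y by (intro power_mono) auto
    moreover have "(cmod (Complex x y - cnj w))\<^sup>2 = (x - Re w)\<^sup>2 + (y + Im w)\<^sup>2"
      by (simp add: cmod_def)
    ultimately show "(cmod (f (Complex x y)))\<^sup>2 \<le> C\<^sup>2 * ?k x"
      using kpos[of x] by (simp add: power_mult_distrib pos_le_divide_eq)
  qed
  also have "\<dots> = ennreal (C\<^sup>2 * (pi / (y + Im w)))"
    unfolding ki(2)[symmetric] using kpos by (intro nn_integral_eq_integral[OF ki(1)]) (auto simp: less_imp_le)
  also have "\<dots> \<le> ennreal (C\<^sup>2 * (pi / Im w))"
    using y w by (intro ennreal_leI mult_left_mono divide_left_mono) auto
  finally show "(\<integral>\<^sup>+x. ennreal ((cmod (f (Complex x y)))\<^sup>2) \<partial>lborel) \<le> ennreal (C\<^sup>2 * (pi / Im w))" .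
qed (use cont hol in auto)

lemma hardy_H2_iff:
  assumes "continuous_on {z. 0 \<le> Im z} f" "f holomorphic_on {z. 0 < Im z}"
  shows "f \<in> hardy_H2 \<longleftrightarrow> (\<exists>M. hardy_halfplane f M)"
proof
  let ?I = "\<lambda>y. \<integral>\<^sup>+x. ennreal ((norm (f (Complex x y)))\<^sup>2) \<partial>lborel"
  assume "f \<in> hardy_H2"
  then have s: "(SUP y\<in>{0<..}. ?I y) < \<infinity>" by (simp add: hardy_H2_def)
  have "hardy_halfplane f (enn2real (SUP y\<in>{0<..}. ?I y))"
  proof
    fix y :: real assume "y > 0"
    then have "?I y \<le> (SUP y\<in>{0<..}. ?I y)" by (intro SUP_upper) auto
    also have "\<dots> = ennreal (enn2real (SUP y\<in>{0<..}. ?I y))" using s by simp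
    finally show "?I y \<le> ennreal (enn2real (SUP y\<in>{0<..}. ?I y))" .
  qed (use assms in auto)
  then show "\<exists>M. hardy_halfplane f M" by blast
next
  assume "\<exists>M. hardy_halfplane f M"
  then obtain M where "hardy_halfplane f M" by blast
  then interpret hardy_halfplane f M .
  have "(SUP y\<in>{0<..}. \<integral>\<^sup>+x. ennreal ((norm (f (Complex x y)))\<^sup>2) \<partial>lborel) \<le> ennreal M"
    by (intro SUP_least bound) auto
  then show "f \<in> hardy_H2"
    using assms(2) le_less_trans[of _ "ennreal M" \<infinity>] by (simp add: hardy_H2_def)
qed

text \<open>The point of \<open>nonzero\<close> is the real axis: without zeros there,
  \<open>F / E\<close> is continuous up to the boundary and fits
  \<open>hardy_halfplane\<close>.\<close>

locale hermite_biehler_function =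
  fixes E :: "complex \<Rightarrow> complex"
  assumes hb: "hermite_biehler E" and nonzero: "\<And>z. Im z \<ge> 0 \<Longrightarrow> E z \<noteq> 0"
begin

lemma E_hol: "E holomorphic_on A"
  using hb by (auto simp: hermite_biehler_def intro: holomorphic_on_subset)

lemma E_cont: "continuous_on A E"
  using E_hol holomorphic_on_imp_continuous_on by blast

lemma quotient_regular:
  assumes "F holomorphic_on UNIV"
  shows "continuous_on {z. 0 \<le> Im z} (\<lambda>z. F z / E z)" "(\<lambda>z. F z / E z) holomorphic_on {z. 0 < Im z}"
  using assms nonzero
  by (auto intro!: continuous_intros holomorphic_intros E_cont E_hol
      intro: holomorphic_on_imp_continuous_on holomorphic_on_subset continuous_on_subset)

lemma sharp_quotient_le: "Im z \<ge> 0 \<Longrightarrow> cmod (sharp E z) \<le> cmod (E z)"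
proof (cases "Im z = 0")
  case True
  then have "cnj z = z" by (simp add: complex_eq_iff)
  then show ?thesis by (simp add: sharp_def)
next
  case False
  moreover assume "Im z \<ge> 0"
  ultimately show ?thesis using hb by (auto simp: hermite_biehler_def sharp_def less_imp_le)
qed

text \<open>Square integrability on the real axis is inherited from the Hardy bound of
  \<open>F / E\<close> by Fatou's lemma, so membership amounts to two half-plane bounds.\<close>

lemma de_Branges_iff:
  "F \<in> de_Branges_space E \<longleftrightarrow> F holomorphic_on UNIV \<and>
     (\<exists>M. hardy_halfplane (\<lambda>z. F z / E z) M) \<and> (\<exists>M. hardy_halfplane (\<lambda>z. sharp F z / E z) M)"
proof (cases "F holomorphic_on UNIV")
  case True
  note a = hardy_H2_iff[OF quotient_regular[OF True]] hardy_H2_iff[OF quotient_regular[OF holomorphic_sharp[OF True]]]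
  have "(\<integral>\<^sup>+x. ennreal ((norm (F (complex_of_real x) / E (complex_of_real x)))\<^sup>2) \<partial>lborel) < \<infinity>"
    if "hardy_halfplane (\<lambda>z. F z / E z) M" for M
    using hardy_halfplane.bound_line[OF that, of 0] le_less_trans[of _ "ennreal M" \<infinity>]
    by (simp add: complex_of_real_def)
  then show ?thesis unfolding de_Branges_space_def using True a by auto
qed (simp add: de_Branges_space_def)

definition bdry :: "(complex \<Rightarrow> complex) \<Rightarrow> real \<Rightarrow> complex" where
  "bdry F x = F (complex_of_real x) / E (complex_of_real x)"

lemma bdry_add: "bdry (\<lambda>z. F z + G z) x = bdry F x + bdry G x"
  and bdry_scale: "bdry (\<lambda>z. c * F z) x = c * bdry F x"
  by (simp_all add: bdry_def add_divide_distrib)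

lemma de_Branges_L2:
  assumes "F \<in> de_Branges_space E"
  shows "bdry F \<in> L2 lborel"
proof -
  obtain M where "hardy_halfplane (\<lambda>z. F z / E z) M" using assms by (auto simp: de_Branges_iff)
  from hardy_halfplane.line_L2(1)[OF this, of 0] show ?thesis by (simp add: complex_of_real_def bdry_def[abs_def])
qed

lemma de_Branges_inner_eq:
  "de_Branges_inner E F G = complex_of_real (1 / pi) * (LINT x|lborel. cnj (bdry F x) * bdry G x)"
  unfolding de_Branges_inner_def bdry_def
  by (intro arg_cong2[of _ _ _ _ "(*)"] Bochner_Integration.integral_cong refl)
     (simp only: complex_norm_square complex_cnj_divide times_divide_times_eq mult.commute)

lemma de_Branges_add:
  assumes "F \<in> de_Branges_space E" "G \<in> de_Branges_space E"
  shows "(\<lambda>z. F z + G z) \<in> de_Branges_space E"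
proof -
  obtain M1 M2 N1 N2 where "hardy_halfplane (\<lambda>z. F z / E z) M1" "hardy_halfplane (\<lambda>z. G z / E z) M2"
    "hardy_halfplane (\<lambda>z. sharp F z / E z) N1" "hardy_halfplane (\<lambda>z. sharp G z / E z) N2"
    using assms unfolding de_Branges_iff by auto
  then show ?thesis
    using hardy_halfplane_add[of "\<lambda>z. F z / E z" M1 "\<lambda>z. G z / E z" M2]
      hardy_halfplane_add[of "\<lambda>z. sharp F z / E z" N1 "\<lambda>z. sharp G z / E z" N2] assms
    unfolding de_Branges_iff sharp_add add_divide_distrib by (auto intro: holomorphic_on_add)
qed

lemma de_Branges_scale:
  assumes "F \<in> de_Branges_space E"
  shows "(\<lambda>z. c * F z) \<in> de_Branges_space E"
proof -
  obtain M N where "hardy_halfplane (\<lambda>z. F z / E z) M" "hardy_halfplane (\<lambda>z. sharp F z / E z) N"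
    using assms unfolding de_Branges_iff by auto
  then show ?thesis
    using hardy_halfplane_scale[of "\<lambda>z. F z / E z" M c] hardy_halfplane_scale[of "\<lambda>z. sharp F z / E z" N "cnj c"] assms
    unfolding de_Branges_iff sharp_scale times_divide_eq_right[symmetric]
    by (auto intro: holomorphic_on_mult)
qed

lemma de_Branges_inner_self:
  "Re (de_Branges_inner E F F) = (1 / pi) * (LINT x|lborel. (cmod (bdry F x))\<^sup>2)"
proof -
  have "cnj (bdry F x) * bdry F x = complex_of_real ((cmod (bdry F x))\<^sup>2)" for x
    by (simp only: complex_norm_square mult.commute)
  then show ?thesis by (simp only: de_Branges_inner_eq integral_complex_of_real Re_complex_of_real of_real_mult[symmetric])
qed

lemma de_Branges_integrable:
  assumes "F \<in> de_Branges_space E" "G \<in> de_Branges_space E"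
  shows "integrable lborel (\<lambda>x. cnj (bdry F x) * bdry G x)"
    and "cmod (de_Branges_inner E F G) \<le> ip_norm (de_Branges_inner E) F * ip_norm (de_Branges_inner E) G"
proof -
  note L = de_Branges_L2[OF assms(1)] de_Branges_L2[OF assms(2)]
  have m: "(\<lambda>x. cnj (bdry F x) * bdry G x) \<in> borel_measurable lborel"
    using L[THEN L2_measurable] borel_measurable_continuous_onI[of cnj] continuous_on_cnj[OF continuous_on_id]
    by (intro borel_measurable_times measurable_compose[of _ lborel borel cnj]) auto
  note cs = cauchy_schwarz_L2[OF L m]
  show "integrable lborel (\<lambda>x. cnj (bdry F x) * bdry G x)"
    by (rule cs) (simp add: norm_mult)
  have p: "(LINT x|lborel. (cmod (bdry F x))\<^sup>2) \<ge> 0" for F by (intro integral_nonneg_AE) auto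
  have "(cmod (de_Branges_inner E F G))\<^sup>2 = (1/pi)\<^sup>2 * (cmod (LINT x|lborel. cnj (bdry F x) * bdry G x))\<^sup>2"
    unfolding de_Branges_inner_eq norm_mult power_mult_distrib by (simp add: norm_divide)
  also have "\<dots> \<le> (1/pi)\<^sup>2 * ((LINT x|lborel. (cmod (bdry F x))\<^sup>2) * (LINT x|lborel. (cmod (bdry G x))\<^sup>2))"
    by (intro mult_left_mono cs) (auto simp: norm_mult)
  also have "\<dots> = Re (de_Branges_inner E F F) * Re (de_Branges_inner E G G)"
    unfolding de_Branges_inner_self by (simp add: power2_eq_square)
  also have "\<dots> = (ip_norm (de_Branges_inner E) F * ip_norm (de_Branges_inner E) G)\<^sup>2"
    unfolding ip_norm_def power_mult_distrib using p[of F] p[of G] by (simp add: de_Branges_inner_self)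
  finally show "cmod (de_Branges_inner E F G) \<le> ip_norm (de_Branges_inner E) F * ip_norm (de_Branges_inner E) G"
    by (rule power2_le_imp_le) (use p in \<open>auto simp: ip_norm_def de_Branges_inner_self\<close>)
qed

lemma de_Branges_inner_add_right:
  assumes "F \<in> de_Branges_space E" "G \<in> de_Branges_space E" "H \<in> de_Branges_space E"
  shows "de_Branges_inner E F (\<lambda>z. G z + H z) = de_Branges_inner E F G + de_Branges_inner E F H"
  using de_Branges_integrable(1)[OF assms(1,2)] de_Branges_integrable(1)[OF assms(1,3)]
  unfolding de_Branges_inner_eq bdry_add distrib_left by (simp add: distrib_left)

lemma de_Branges_inner_scale_right:
  "de_Branges_inner E F (\<lambda>z. c * G z) = c * de_Branges_inner E F G"
  unfolding de_Branges_inner_eq bdry_scale by (simp add: mult.left_commute[of _ c])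

lemma de_Branges_inner_cnj:
  "de_Branges_inner E G F = cnj (de_Branges_inner E F G)"
  unfolding de_Branges_inner_eq complex_cnj_mult Bochner_Integration.integral_cnj[symmetric] by (simp add: mult.commute)

text \<open>In the upper half-plane \<open>sharp E\<close> is dominated by \<open>E\<close>, so the
  right side of \<open>eq\<close> is at most a constant times \<open>cmod (E z)\<close>, and
  dividing by \<open>z - cnj w\<close> gives decay. The reflected kernel has the divisor
  \<open>z - w\<close>, which vanishes inside the half-plane; near \<open>w\<close> compactness
  replaces the estimate.\<close>

lemma kernel_decay:
  assumes K: "K holomorphic_on UNIV" and w: "Im w > 0"
    and eq: "\<And>z. (z - cnj w) * K z = \<i> / 2 * (E z * cnj (E w) - sharp E z * E (cnj w))"
  shows "K \<in> de_Branges_space E"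
proof -
  define c where "c = (cmod (E w) + cmod (E (cnj w))) / 2"
  have c0: "c \<ge> 0" by (simp add: c_def)
  have b1: "cmod (E z * cnj (E w) - sharp E z * E (cnj w)) \<le> 2 * c * cmod (E z)" if "Im z \<ge> 0" for z
  proof -
    have "cmod (E z * cnj (E w) - sharp E z * E (cnj w)) \<le> cmod (E z) * cmod (E w) + cmod (sharp E z) * cmod (E (cnj w))"
      by (rule order_trans[OF norm_triangle_ineq4]) (simp add: norm_mult)
    also have "\<dots> \<le> cmod (E z) * cmod (E w) + cmod (E z) * cmod (E (cnj w))"
      by (intro add_left_mono mult_right_mono sharp_quotient_le that) auto
    also have "\<dots> = 2 * c * cmod (E z)" by (simp add: c_def algebra_simps)
    finally show ?thesis .
  qed
  have h1: "hardy_halfplane (\<lambda>z. K z / E z) (c\<^sup>2 * (pi / Im w))"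
  proof (rule hardy_halfplane_of_decay[OF quotient_regular[OF K] w])
    fix z assume z: "Im z > 0"
    have "cmod (K z) * cmod (z - cnj w) \<le> c * cmod (E z)"
    proof -
      have "2 * (cmod (K z) * cmod (z - cnj w)) = cmod (E z * cnj (E w) - sharp E z * E (cnj w))"
        using arg_cong[OF eq[of z], of cmod] by (simp add: norm_mult mult.commute)
      then show ?thesis using b1[OF less_imp_le[OF z]] by linarith
    qed
    then show "cmod (K z / E z) * cmod (z - cnj w) \<le> c"
      using nonzero[of z] z by (simp add: norm_divide pos_divide_le_eq)
  qed
  have Kc: "continuous_on UNIV K" using K by (rule holomorphic_on_imp_continuous_on)
  have eq': "cmod (sharp K z) * cmod (z - w) \<le> c * cmod (E z)" if "Im z \<ge> 0" for z
  proof -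
    have "(z - w) * sharp K z = cnj ((cnj z - cnj w) * K (cnj z))" by (simp add: sharp_def)
    also have "\<dots> = - \<i> / 2 * (sharp E z * E w - E z * cnj (E (cnj w)))"
      unfolding eq by (simp add: sharp_def)
    finally have "cmod ((z - w) * sharp K z) = cmod (- \<i> / 2 * (sharp E z * E w - E z * cnj (E (cnj w))))"
      by (rule arg_cong)
    then have "cmod (sharp K z) * cmod (z - w) = cmod (sharp E z * E w - E z * cnj (E (cnj w))) / 2"
      unfolding norm_mult by (simp add: norm_divide mult.commute)
    also have "\<dots> \<le> (cmod (sharp E z) * cmod (E w) + cmod (E z) * cmod (E (cnj w))) / 2"
      by (intro divide_right_mono order_trans[OF norm_triangle_ineq4]) (auto simp: norm_mult)
    also have "\<dots> \<le> (cmod (E z) * cmod (E w) + cmod (E z) * cmod (E (cnj w))) / 2"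
      by (intro divide_right_mono add_right_mono mult_right_mono sharp_quotient_le that) auto
    also have "\<dots> = c * cmod (E z)" by (simp add: c_def algebra_simps)
    finally show ?thesis .
  qed
  \<comment> \<open>Near \<open>w\<close> the estimate \<open>eq'\<close> is void; there the
    quotient is bounded by some \<open>D\<close> because it is continuous.\<close>
  have "compact (cball w 1 \<inter> {z. 0 \<le> Im z})"
    by (intro compact_Int_closed compact_cball closed_halfspace_Im_ge)
  then have "compact ((\<lambda>z. sharp K z / E z) ` (cball w 1 \<inter> {z. 0 \<le> Im z}))"
    by (rule compact_continuous_image[rotated])
      (auto intro: continuous_on_subset[OF quotient_regular(1)[OF holomorphic_sharp[OF K]]])
  from compact_imp_bounded[OF this] obtain D where "\<forall>x\<in>(\<lambda>z. sharp K z / E z) ` (cball w 1 \<inter> {z. 0 \<le> Im z}). cmod x \<le> D"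
    unfolding bounded_iff by blast
  then have D: "\<And>z. z \<in> cball w 1 \<Longrightarrow> Im z \<ge> 0 \<Longrightarrow> cmod (sharp K z / E z) \<le> D" by blast
  have D0: "D \<ge> 0" using order_trans[OF norm_ge_zero D[of w]] w by simp
  \<comment> \<open>\<open>cmod (z - cnj w)\<close> is at most
    \<open>cmod (z - w) + 2 * Im w\<close>, hence at most \<open>1 + 2 * Im w\<close> on the unit
    disc about \<open>w\<close> and at most \<open>(1 + 2 * Im w) * cmod (z - w)\<close> off it.
    This explains the constant.\<close>
  have h2: "hardy_halfplane (\<lambda>z. sharp K z / E z) ((max c D * (1 + 2 * Im w))\<^sup>2 * (pi / Im w))"
  proof (rule hardy_halfplane_of_decay[OF quotient_regular[OF holomorphic_sharp[OF K]] w])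
    fix z assume z: "Im z > 0"
    have ez: "cmod (E z) > 0" using nonzero[of z] z by simp
    have "cmod (z - cnj w) \<le> cmod (z - w) + cmod (w - cnj w)" using norm_triangle_ineq[of "z - w" "w - cnj w"] by simp
    moreover have "w - cnj w = complex_of_real (2 * Im w) * \<i>" by (simp add: complex_eq_iff)
    ultimately have tri: "cmod (z - cnj w) \<le> cmod (z - w) + 2 * Im w" using w by (simp add: norm_mult)
    show "cmod (sharp K z / E z) * cmod (z - cnj w) \<le> max c D * (1 + 2 * Im w)"
    proof (cases "z \<in> cball w 1")
      case True
      then have "cmod (z - w) \<le> 1" by (simp add: dist_norm norm_minus_commute)
      then show ?thesis using D[OF True] z tri D0 w
        by (intro mult_mono) (auto simp: max_def)
    next
      case False
      then have 1: "cmod (z - w) > 1" by (simp add: dist_norm norm_minus_commute)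
      have "cmod (sharp K z / E z) * cmod (z - cnj w) \<le> cmod (sharp K z / E z) * (cmod (z - w) * (1 + 2 * Im w))"
      proof (intro mult_left_mono)
        have "2 * Im w * 1 \<le> 2 * Im w * cmod (z - w)" using 1 w by (intro mult_left_mono) auto
        then show "cmod (z - cnj w) \<le> cmod (z - w) * (1 + 2 * Im w)" using tri by (simp add: algebra_simps)
      qed simp
      also have "\<dots> = (cmod (sharp K z) * cmod (z - w)) / cmod (E z) * (1 + 2 * Im w)" by (simp add: norm_divide)
      also have "\<dots> \<le> c * (1 + 2 * Im w)"
        using eq'[of z] z ez w by (intro mult_right_mono) (auto simp: pos_divide_le_eq)
      also have "\<dots> \<le> max c D * (1 + 2 * Im w)" using w by (intro mult_right_mono) auto
      finally show ?thesis .
    qed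
  qed
  show ?thesis unfolding de_Branges_iff using K h1 h2 by blast
qed

text \<open>On the real axis the integrand of the scalar product splits into Cauchy integrands: one
  of \<open>G / E\<close> at \<open>w\<close>, which yields the residue, and the conjugate of one of
  \<open>sharp G / E\<close> at \<open>cnj w\<close>, which integrates to 0. The constants combine
  to pi, cancelled by the factor \<open>1 / pi\<close> of the scalar product.\<close>

lemma kernel_reproduces:
  assumes w: "Im w > 0"
    and eq: "\<And>z. (z - cnj w) * K z = \<i> / 2 * (E z * cnj (E w) - sharp E z * E (cnj w))"
    and G: "G \<in> de_Branges_space E"
  shows "de_Branges_inner E K G = G w"
proof -
  obtain M N where "hardy_halfplane (\<lambda>z. G z / E z) M" and "hardy_halfplane (\<lambda>z. sharp G z / E z) N"
    using G by (auto simp: de_Branges_iff)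
  then interpret g: hardy_halfplane "\<lambda>z. G z / E z" M + h: hardy_halfplane "\<lambda>z. sharp G z / E z" N .
  let ?g = "\<lambda>t. G (complex_of_real t) / E (complex_of_real t) / (complex_of_real t - w)"
  let ?h = "\<lambda>t. sharp G (complex_of_real t) / E (complex_of_real t) / (complex_of_real t - cnj w)"
  have i: "integrable lborel ?g" "integrable lborel ?h"
    using g.cauchy_integrand(1)[of 0 w] h.cauchy_integrand(1)[of 0 "cnj w"] w by (simp_all add: complex_of_real_def)
  have v: "(LINT t|lborel. ?g t) = 2 * pi * \<i> * (G w / E w)" "(LINT t|lborel. ?h t) = 0"
    using g.cauchy_boundary[of w] h.cauchy_boundary[of "cnj w"] w by simp_all
  have "(LINT t|lborel. cnj (bdry K t) * bdry G t)
     = (LINT t|lborel. (- \<i> / 2) * (E w * ?g t - cnj (E (cnj w)) * cnj (?h t)))"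
  proof (intro Bochner_Integration.integral_cong refl)
    fix t :: real
    let ?t = "complex_of_real t"
    have t: "?t - w \<noteq> 0" using w by (auto simp: complex_eq_iff)
    have et: "E ?t \<noteq> 0" "cnj (E ?t) \<noteq> 0" using nonzero[of ?t] by auto
    have "(?t - w) * cnj (K ?t) = cnj ((?t - cnj w) * K ?t)" by simp
    also have "\<dots> = - \<i> / 2 * (cnj (E ?t) * E w - E ?t * cnj (E (cnj w)))"
      unfolding eq by (simp add: sharp_of_real)
    finally have fin: "(?t - w) * cnj (K ?t) = - \<i> / 2 * (cnj (E ?t) * E w - E ?t * cnj (E (cnj w)))" .
    have h: "cnj (?h t) = G ?t / cnj (E ?t) / (?t - w)" by (simp add: sharp_of_real)
    have alg: "a / e' * (g / e) = k * (A * (g / e / d) - B * (g / e' / d))"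
      if "d \<noteq> 0" "e \<noteq> 0" "e' \<noteq> 0" "d * a = k * (e' * A - e * B)" for a e e' g A B d k :: complex
    proof -
      have "k * (A * (g / e / d) - B * (g / e' / d)) = k * (e' * A - e * B) * g / (e * e' * d)"
        using that(1-3) by (simp add: divide_simps) (simp add: algebra_simps)
      also have "\<dots> = a / e' * (g / e)" unfolding that(4)[symmetric] using that(1-3) by simp
      finally show ?thesis by simp
    qed
    show "cnj (bdry K t) * bdry G t = (- \<i> / 2) * (E w * ?g t - cnj (E (cnj w)) * cnj (?h t))"
      unfolding bdry_def h unfolding complex_cnj_divide by (rule alg[OF t et fin])
  qed
  also have "\<dots> = (- \<i> / 2) * (E w * (LINT t|lborel. ?g t) - cnj (E (cnj w)) * cnj (LINT t|lborel. ?h t))"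
  proof -
    have "(LINT t|lborel. k * (a * g t - b * cnj (h t))) = k * (a * (LINT t|lborel. g t) - b * cnj (LINT t|lborel. h t))"
      if "integrable lborel g" "integrable lborel h" for g h :: "real \<Rightarrow> complex" and a b k
      using that by simp
    from this[OF i] show ?thesis .
  qed
  also have "\<dots> = pi * G w" unfolding v using nonzero[of w] w by (simp add: complex_eq_iff)
  finally show ?thesis unfolding de_Branges_inner_eq by simp
qed

end

text \<open>The set \<open>M\<close> of common elements on which the two scalar products agree contains the kernels.
  A function in either space defines a bounded functional on \<open>M\<close>; the vector representing it in the
  closure of \<open>M\<close> takes the same values on the upper half-plane.\<close>

theorem de_Branges_space_of_kernel:
  fixes S :: "(complex \<Rightarrow> complex) set"
  assumes H: "function_hilbert_space S ip" and E: "hermite_biehler_function E"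
    and entire: "\<And>F. F \<in> S \<Longrightarrow> F holomorphic_on UNIV"
    and K: "\<And>w. K w \<in> S" "\<And>w F. F \<in> S \<Longrightarrow> ip (K w) F = F w"
    and eq: "\<And>w z. Im w > 0 \<Longrightarrow> (z - cnj w) * K w z = \<i> / 2 * (E z * cnj (E w) - sharp E z * E (cnj w))"
  shows "S = de_Branges_space E" "\<And>F. F \<in> S \<Longrightarrow> ip_norm ip F = ip_norm (de_Branges_inner E) F"
proof -
  interpret function_hilbert_space S ip by fact
  interpret hermite_biehler_function E by fact
  let ?B = "de_Branges_space E" and ?ib = "de_Branges_inner E"
  define M where "M = {F \<in> S \<inter> ?B. \<forall>G\<in>S \<inter> ?B. ip F G = ?ib F G}"
  have MS: "M \<subseteq> S" and MB: "M \<subseteq> ?B" by (auto simp: M_def)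
  have zB: "(\<lambda>_. 0) \<in> ?B"
    unfolding de_Branges_iff sharp_def by (auto intro!: exI[of _ 0] hardy_halfplane.intro)
  have KB: "K w \<in> ?B" if "Im w > 0" for w by (rule kernel_decay[OF entire[OF K(1)] that eq[OF that]])
  have KM: "K w \<in> M" if "Im w > 0" for w
    using K(1) KB[OF that] K(2) kernel_reproduces[OF that eq[OF that]] by (auto simp: M_def)
  have ib_add_left: "?ib (\<lambda>z. F z + G z) H = ?ib F H + ?ib G H" if "F \<in> ?B" "G \<in> ?B" "H \<in> ?B" for F G H
    using de_Branges_inner_add_right[OF that(3,1,2)] by (metis complex_cnj_add de_Branges_inner_cnj)
  have ib_scale_left: "?ib (\<lambda>z. c * F z) H = cnj c * ?ib F H" for c F H
    using de_Branges_inner_scale_right[of H c F] by (metis complex_cnj_mult de_Branges_inner_cnj)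
  have ib_diff_left: "?ib (\<lambda>z. F z - G z) H = ?ib F H - ?ib G H" if "F \<in> ?B" "G \<in> ?B" "H \<in> ?B" for F G H
    using ib_add_left[OF that(1) de_Branges_scale[OF that(2), of "-1"] that(3)] ib_scale_left[of "-1" G H] by simp
  have Mz: "(\<lambda>_. 0) \<in> M"
    using zero_mem zB ip_scale_left[OF _ zero_mem, of _ 0] ib_scale_left[of 0 "\<lambda>_. 0"] by (auto simp: M_def)
  have Ma: "(\<lambda>w. F w + G w) \<in> M" if "F \<in> M" "G \<in> M" for F G
    using that by (auto simp: M_def add_mem de_Branges_add ip_add_left ib_add_left)
  have Ms: "(\<lambda>w. c * F w) \<in> M" if "F \<in> M" for c F
    using that by (auto simp: M_def scale_mem de_Branges_scale ip_scale_left ib_scale_left)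
  have Mn: "ip_norm ?ib F = ip_norm ip F" if "F \<in> M" for F
    using that by (auto simp: M_def ip_norm_def)
  note riesz = riesz_on_subspace[OF MS Mz Ma Ms]

  have eval: "cmod (F z) \<le> ip_norm ip (K z) * ip_norm ip F" if "F \<in> S" for F z
    using cauchy_schwarz[OF K(1) that, of z] K(2)[OF that] by simp

  have unique: "F = G" if "F holomorphic_on UNIV" "G holomorphic_on UNIV" "\<And>w. Im w > 0 \<Longrightarrow> F w = G w" for F G
  proof
    fix z
    show "F z = G z"
      by (rule analytic_continuation_open[of "{w. Im w > 0}" UNIV F G])
        (use that open_halfspace_Im_gt in \<open>auto intro!: exI[of _ \<i>]\<close>)
  qed

  \<comment> \<open>Convergence in \<open>S\<close> gives pointwise convergence through the kernels
    \<open>K z\<close>, and Fatou's lemma carries the bounds of \<open>X n / E\<close> and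
    \<open>sharp (X n) / E\<close> over to the limit.\<close>
  have limB: "F \<in> ?B \<and> ip_norm ?ib F \<le> ip_norm ip F"
    if F: "F \<in> S" and X: "\<And>n. X n \<in> M" and lim: "(\<lambda>n. ip_norm ip (\<lambda>w. X n w - F w)) \<longlonglongrightarrow> 0" for F X
  proof -
    have pt: "(\<lambda>n. X n z) \<longlonglongrightarrow> F z" for z
    proof (rule LIM_zero_cancel, rule Lim_null_comparison)
      show "\<forall>\<^sub>F n in sequentially. norm (X n z - F z) \<le> ip_norm ip (K z) * ip_norm ip (\<lambda>w. X n w - F w)"
        using eval[OF diff_mem[OF subsetD[OF MS X] F]] by simp
      show "(\<lambda>n. ip_norm ip (K z) * ip_norm ip (\<lambda>w. X n w - F w)) \<longlonglongrightarrow> 0"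
        using tendsto_mult_left[OF lim] by simp
    qed
    have XS: "X n \<in> S" and XB: "X n \<in> ?B" for n using X MS MB by auto
    have nl: "(\<lambda>n. (ip_norm ip (X n))\<^sup>2) \<longlonglongrightarrow> (ip_norm ip F)\<^sup>2"
    proof -
      have ipX: "(\<lambda>n. ip (X n) G) \<longlonglongrightarrow> ip F G" if "G \<in> S" for G
      proof (rule LIM_zero_cancel, rule Lim_null_comparison)
        show "\<forall>\<^sub>F n in sequentially. norm (ip (X n) G - ip F G) \<le> ip_norm ip (\<lambda>w. X n w - F w) * ip_norm ip G"
          using cauchy_schwarz[OF diff_mem[OF XS F] that] by (simp add: ip_diff_left[OF that XS F])
        show "(\<lambda>n. ip_norm ip (\<lambda>w. X n w - F w) * ip_norm ip G) \<longlonglongrightarrow> 0"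
          using tendsto_mult_right[OF lim] by simp
      qed
      have "(ip_norm ip (X n))\<^sup>2 = (ip_norm ip (\<lambda>w. X n w - F w))\<^sup>2 + 2 * Re (ip (X n) F) - Re (ip F F)" for n
        using Re_ip_add_scaled[OF XS[of n] F, of "-1"]
        by (simp add: ip_norm_sq diff_mem XS F)
      moreover have "(\<lambda>n. (ip_norm ip (\<lambda>w. X n w - F w))\<^sup>2 + 2 * Re (ip (X n) F) - Re (ip F F)) \<longlonglongrightarrow> 0\<^sup>2 + 2 * Re (ip F F) - Re (ip F F)"
        by (intro tendsto_intros lim ipX F)
      ultimately show ?thesis by (simp add: ip_norm_sq F)
    qed
    have Fh: "F holomorphic_on UNIV" by (rule entire[OF F])
    have XL: "(\<integral>\<^sup>+x. ennreal ((cmod (bdry (X n) x))\<^sup>2) \<partial>lborel) = ennreal (pi * (ip_norm ip (X n))\<^sup>2)" for n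
    proof -
      have "(ip_norm ip (X n))\<^sup>2 = (1 / pi) * (LINT x|lborel. (cmod (bdry (X n) x))\<^sup>2)"
        unfolding Mn[OF X, symmetric] unfolding ip_norm_def de_Branges_inner_self by (simp add: integral_nonneg_AE)
      then show ?thesis unfolding nn_integral_norm_sq[OF de_Branges_L2[OF XB]] by simp
    qed
    \<comment> \<open>The norms of \<open>X n\<close> only converge to the norm of \<open>F\<close>;
      the slack \<open>e\<close> is removed at the end by \<open>field_le_epsilon\<close>.\<close>
    have bd: "(\<integral>\<^sup>+x. ennreal ((cmod (bdry F x))\<^sup>2) \<partial>lborel) \<le> ennreal (pi * (ip_norm ip F)\<^sup>2 + e)"
       (is ?t1) and bh: "\<And>y. y > 0 \<Longrightarrow> (\<integral>\<^sup>+x. ennreal ((cmod (F (Complex x y) / E (Complex x y)))\<^sup>2) \<partial>lborel) \<le> ennreal (pi * (ip_norm ip F)\<^sup>2 + e)"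
       and bs: "\<And>y. y > 0 \<Longrightarrow> (\<integral>\<^sup>+x. ennreal ((cmod (sharp F (Complex x y) / E (Complex x y)))\<^sup>2) \<partial>lborel) \<le> ennreal (pi * (ip_norm ip F)\<^sup>2 + e)"
       if e: "e > 0" for e
    proof -
      have "(\<lambda>n. pi * (ip_norm ip (X n))\<^sup>2) \<longlonglongrightarrow> pi * (ip_norm ip F)\<^sup>2" by (intro tendsto_intros nl)
      then have ev: "\<forall>\<^sub>F n in sequentially. pi * (ip_norm ip (X n))\<^sup>2 < pi * (ip_norm ip F)\<^sup>2 + e"
        by (rule order_tendstoD(2)) (use e in simp)
      have cm: "(\<lambda>x. G (Complex x y) / E (Complex x y)) \<in> borel_measurable lborel" if "y \<ge> 0" "continuous_on UNIV G" for G y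
      proof -
        have "(\<lambda>x. G (Complex x y) / E (Complex x y)) \<in> borel_measurable borel"
          using that nonzero by (intro borel_measurable_continuous_onI continuous_on_divide continuous_on_compose2[OF that(2)] continuous_on_compose2[OF E_cont[of UNIV]])
            (auto simp: Complex_eq intro!: continuous_intros)
        then show ?thesis by simp
      qed
      have hc: "continuous_on UNIV G" if "G holomorphic_on UNIV" for G using that by (rule holomorphic_on_imp_continuous_on)
      show ?t1
      proof (rule fatou_norm_sq[where f = "\<lambda>n x. bdry (X n) x"])
        show "(\<lambda>x. bdry (X n) x) \<in> borel_measurable lborel" for n
          using cm[of 0 "X n"] hc[OF entire[OF XS]] by (simp add: complex_of_real_def bdry_def)
        show "(\<lambda>x. bdry F x) \<in> borel_measurable lborel"
          using cm[of 0 F] hc[OF Fh] by (simp add: complex_of_real_def bdry_def)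
        show "AE x in lborel. (\<lambda>n. bdry (X n) x) \<longlonglongrightarrow> bdry F x"
          unfolding bdry_def using nonzero by (intro AE_I2 tendsto_divide pt tendsto_const) auto
        show "\<forall>\<^sub>F n in sequentially. (\<integral>\<^sup>+x. ennreal ((cmod (bdry (X n) x))\<^sup>2) \<partial>lborel) \<le> ennreal (pi * (ip_norm ip F)\<^sup>2 + e)"
          using ev by eventually_elim (simp only: XL ennreal_leI less_imp_le)
      qed
      fix y :: real assume y: "y > 0"
      show "(\<integral>\<^sup>+x. ennreal ((cmod (F (Complex x y) / E (Complex x y)))\<^sup>2) \<partial>lborel) \<le> ennreal (pi * (ip_norm ip F)\<^sup>2 + e)"
      proof (rule fatou_norm_sq[where f = "\<lambda>n x. X n (Complex x y) / E (Complex x y)"])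
        show "AE x in lborel. (\<lambda>n. X n (Complex x y) / E (Complex x y)) \<longlonglongrightarrow> F (Complex x y) / E (Complex x y)"
          using nonzero y by (intro AE_I2 tendsto_divide pt tendsto_const) auto
        show "\<forall>\<^sub>F n in sequentially. (\<integral>\<^sup>+x. ennreal ((cmod (X n (Complex x y) / E (Complex x y)))\<^sup>2) \<partial>lborel) \<le> ennreal (pi * (ip_norm ip F)\<^sup>2 + e)"
          using ev
        proof eventually_elim
          case (elim n)
          obtain N where "hardy_halfplane (\<lambda>z. X n z / E z) N" using XB[of n] by (auto simp: de_Branges_iff)
          \<comment> \<open>For elements of \<open>M\<close> the boundary norm is known through the
            norm of \<open>S\<close>; the Poisson bound transfers it to every horizontal line with
            the same constant.\<close>
          from hardy_halfplane.line_norm_le_boundary[OF this y] show ?case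
            unfolding bdry_def[symmetric] XL using elim by (meson ennreal_leI less_imp_le order_trans)
        qed
      qed (use y cm hc entire XS Fh in auto)
      show "(\<integral>\<^sup>+x. ennreal ((cmod (sharp F (Complex x y) / E (Complex x y)))\<^sup>2) \<partial>lborel) \<le> ennreal (pi * (ip_norm ip F)\<^sup>2 + e)"
      proof (rule fatou_norm_sq[where f = "\<lambda>n x. sharp (X n) (Complex x y) / E (Complex x y)"])
        show "AE x in lborel. (\<lambda>n. sharp (X n) (Complex x y) / E (Complex x y)) \<longlonglongrightarrow> sharp F (Complex x y) / E (Complex x y)"
          unfolding sharp_def using nonzero y by (intro AE_I2 tendsto_divide tendsto_cnj pt tendsto_const) auto
        show "\<forall>\<^sub>F n in sequentially. (\<integral>\<^sup>+x. ennreal ((cmod (sharp (X n) (Complex x y) / E (Complex x y)))\<^sup>2) \<partial>lborel) \<le> ennreal (pi * (ip_norm ip F)\<^sup>2 + e)"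
          using ev
        proof eventually_elim
          case (elim n)
          obtain N where "hardy_halfplane (\<lambda>z. sharp (X n) z / E z) N" using XB[of n] by (auto simp: de_Branges_iff)
          from hardy_halfplane.line_norm_le_boundary[OF this y] show ?case
            unfolding sharp_of_real norm_divide complex_mod_cnj unfolding norm_divide[symmetric] bdry_def[symmetric] XL
            using elim by (meson ennreal_leI less_imp_le order_trans)
        qed
      qed (use y cm hc[THEN continuous_on_sharp] entire XS Fh in auto)
    qed
    have nn: "0 \<le> pi * (ip_norm ip F)\<^sup>2 + 1" by (simp add: add_nonneg_nonneg)
    have FB: "F \<in> ?B"
      unfolding de_Branges_iff
      using Fh quotient_regular[OF Fh] quotient_regular[OF holomorphic_sharp[OF Fh]] nn bh[of 1] bs[of 1]
      by (auto intro!: exI[of _ "pi * (ip_norm ip F)\<^sup>2 + 1"] hardy_halfplane.intro)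
    have "pi * (ip_norm ?ib F)\<^sup>2 \<le> pi * (ip_norm ip F)\<^sup>2"
    proof (rule field_le_epsilon)
      fix e :: real assume e: "e > 0"
      have p: "0 \<le> pi * (ip_norm ip F)\<^sup>2 + e" using e by (simp add: add_nonneg_nonneg)
      have "(LINT x|lborel. (cmod (bdry F x))\<^sup>2) \<le> pi * (ip_norm ip F)\<^sup>2 + e"
        using bd[OF e] p unfolding nn_integral_norm_sq[OF de_Branges_L2[OF FB]] by simp
      then show "pi * (ip_norm ?ib F)\<^sup>2 \<le> pi * (ip_norm ip F)\<^sup>2 + e"
        using de_Branges_inner_self[of F] by (simp add: ip_norm_def integral_nonneg_AE)
    qed
    then have "(ip_norm ?ib F)\<^sup>2 \<le> (ip_norm ip F)\<^sup>2" by simp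
    then have "ip_norm ?ib F \<le> ip_norm ip F" by (rule power2_le_imp_le) (rule ip_norm_nonneg[OF F])
    then show ?thesis using FB by simp
  qed

  \<comment> \<open>Applying \<open>limB\<close> to \<open>X n - F\<close>, the limit of
    \<open>X n - X m\<close> over \<open>m\<close>, bounds its norm in B(E) by its norm in
    \<open>S\<close>. Both scalar products therefore pass to the limit together, and
    \<open>M\<close> is closed in \<open>S\<close>.\<close>
  have SM: "F \<in> M" if F: "F \<in> S" and X: "\<And>n. X n \<in> M" and lim: "(\<lambda>n. ip_norm ip (\<lambda>w. X n w - F w)) \<longlonglongrightarrow> 0" for F X
  proof -
    have FB: "F \<in> ?B" using limB[OF F X lim] by blast
    have "ip F G = ?ib F G" if G: "G \<in> S \<inter> ?B" for G
    proof -
      have "cmod (ip F G - ?ib F G) \<le> ip_norm ip (\<lambda>w. X n w - F w) * (ip_norm ip G + ip_norm ?ib G)" for n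
      proof -
        have Xn: "X n \<in> S" "X n \<in> ?B" "ip (X n) G = ?ib (X n) G" using X[of n] G by (auto simp: M_def)
        have D: "(\<lambda>w. X n w - F w) \<in> S" by (rule diff_mem[OF Xn(1) F])
        have mD: "(\<lambda>w. X n w - X m w) \<in> M" for m using Ma[OF X[of n] Ms[OF X[of m], of "-1"]] by simp
        have DB: "(\<lambda>w. X n w - F w) \<in> ?B \<and> ip_norm ?ib (\<lambda>w. X n w - F w) \<le> ip_norm ip (\<lambda>w. X n w - F w)"
        proof (rule limB[OF D mD])
          have "(\<lambda>w. X n w - X m w - (X n w - F w)) = (\<lambda>w. (-1) * (X m w - F w))" for m by auto
          moreover have "ip_norm ip (\<lambda>w. (-1) * (X m w - F w)) = ip_norm ip (\<lambda>w. X m w - F w)" for m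
          proof -
            have D: "(\<lambda>w. X m w - F w) \<in> S" using diff_mem[OF subsetD[OF MS X[of m]] F] .
            show ?thesis unfolding ip_norm_def
              by (subst ip_scale_left[OF scale_mem[OF D] D], subst ip_scale_right[OF D D]) simp
          qed
          ultimately show "(\<lambda>m. ip_norm ip (\<lambda>w. X n w - X m w - (X n w - F w))) \<longlonglongrightarrow> 0" using lim by simp
        qed
        have e: "ip F G - ?ib F G = ?ib (\<lambda>w. X n w - F w) G - ip (\<lambda>w. X n w - F w) G"
        proof -
          have G': "G \<in> S" "G \<in> ?B" using G by auto
          show ?thesis unfolding ib_diff_left[OF Xn(2) FB G'(2)] ip_diff_left[OF G'(1) Xn(1) F] Xn(3) by simp
        qed
        have "cmod (ip F G - ?ib F G) \<le> cmod (?ib (\<lambda>w. X n w - F w) G) + cmod (ip (\<lambda>w. X n w - F w) G)"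
          unfolding e by (rule norm_triangle_ineq4)
        also have "\<dots> \<le> ip_norm ?ib (\<lambda>w. X n w - F w) * ip_norm ?ib G + ip_norm ip (\<lambda>w. X n w - F w) * ip_norm ip G"
          using G by (intro add_mono de_Branges_integrable(2)[OF conjunct1[OF DB]] cauchy_schwarz[OF D]) simp_all
        also have "\<dots> \<le> ip_norm ip (\<lambda>w. X n w - F w) * ip_norm ?ib G + ip_norm ip (\<lambda>w. X n w - F w) * ip_norm ip G"
          by (intro add_right_mono mult_right_mono conjunct2[OF DB]) (simp add: ip_norm_def de_Branges_inner_self integral_nonneg_AE)
        finally show ?thesis by (simp only: distrib_left add.commute)
      qed
      moreover have "(\<lambda>n. ip_norm ip (\<lambda>w. X n w - F w) * (ip_norm ip G + ip_norm ?ib G)) \<longlonglongrightarrow> 0"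
        using tendsto_mult_right[OF lim] by simp
      ultimately have "cmod (ip F G - ?ib F G) \<le> 0"
        by (intro LIMSEQ_le_const[where X = "\<lambda>n. ip_norm ip (\<lambda>w. X n w - F w) * (ip_norm ip G + ip_norm ?ib G)"]) auto
      then show ?thesis by simp
    qed
    then show ?thesis using F FB by (simp add: M_def)
  qed

  have 1: "G \<in> M" if G: "G \<in> ?B" for G
  proof -
    obtain F0 X where F0: "F0 \<in> S" "\<And>n. X n \<in> M" "(\<lambda>n. ip_norm ip (\<lambda>w. X n w - F0 w)) \<longlonglongrightarrow> 0"
      and rep: "\<And>F. F \<in> M \<Longrightarrow> ip F0 F = ?ib G F"
    proof (rule riesz[where \<phi> = "?ib G" and C = "ip_norm ?ib G"])
      show "cmod (?ib G F) \<le> ip_norm ?ib G * ip_norm ip F" if "F \<in> M" for F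
        using de_Branges_integrable(2)[OF G, of F] that Mn[OF that] MB by auto
      show "?ib G (\<lambda>w. F w + H w) = ?ib G F + ?ib G H" if "F \<in> M" "H \<in> M" for F H
        by (rule de_Branges_inner_add_right[OF G subsetD[OF MB that(1)] subsetD[OF MB that(2)]])
      show "?ib G (\<lambda>w. c * F w) = c * ?ib G F" for c F
        by (rule de_Branges_inner_scale_right)
    qed (assumption+, rule that)
    have "F0 w = G w" if w: "Im w > 0" for w
      using rep[OF KM[OF w]] ip_cnj[OF K(1) F0(1), of w] K(2)[OF F0(1), of w]
        de_Branges_inner_cnj[of G "K w"] kernel_reproduces[OF w eq[OF w] G] by simp
    then have "F0 = G" using unique[OF entire[OF F0(1)]] G by (auto simp: de_Branges_iff)
    then show ?thesis using SM[OF F0] by simp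
  qed
  have 2: "G \<in> M" if G: "G \<in> S" for G
  proof -
    obtain F0 X where F0: "F0 \<in> S" "\<And>n. X n \<in> M" "(\<lambda>n. ip_norm ip (\<lambda>w. X n w - F0 w)) \<longlonglongrightarrow> 0"
      and rep: "\<And>F. F \<in> M \<Longrightarrow> ip F0 F = ip G F"
    proof (rule riesz[where \<phi> = "ip G" and C = "ip_norm ip G"])
      show "cmod (ip G F) \<le> ip_norm ip G * ip_norm ip F" if "F \<in> M" for F
        using cauchy_schwarz[OF G, of F] that MS by auto
      show "ip G (\<lambda>w. F w + H w) = ip G F + ip G H" if "F \<in> M" "H \<in> M" for F H
        by (rule ip_add_right[OF G subsetD[OF MS that(1)] subsetD[OF MS that(2)]])
      show "ip G (\<lambda>w. c * F w) = c * ip G F" if "F \<in> M" for c F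
        by (rule ip_scale_right[OF G subsetD[OF MS that]])
    qed (assumption+, rule that)
    have "F0 w = G w" if w: "Im w > 0" for w
      using rep[OF KM[OF w]] ip_cnj[OF K(1) F0(1), of w] K(2)[OF F0(1), of w]
        ip_cnj[OF K(1) G, of w] K(2)[OF G, of w] by simp
    then have "F0 = G" using unique[OF entire[OF F0(1)] entire[OF G]] by auto
    then show ?thesis using SM[OF F0] by simp
  qed
  show "S = ?B" using 1 2 MS MB by blast
  show "ip_norm ip F = ip_norm ?ib F" if "F \<in> S" for F using Mn[OF 2[OF that]] by simp
qed

section \<open>Successive approximation\<close>

text \<open>Integrals with variable endpoints are written as \<open>(d - c) *\<^sub>R\<close> an
  integral over the unit interval. Orientation is then automatic, and continuity in all variables
  follows from this one statement.\<close>

lemma continuous_on_unit_integral: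
  fixes G :: "'a::topological_space \<Rightarrow> real \<Rightarrow> 'b::banach"
  assumes "continuous_on UNIV (\<lambda>(z, \<tau>). G z \<tau>)"
  shows "continuous_on UNIV (\<lambda>z. integral {0..1} (G z))"
  using integral_continuous_on_param[of UNIV 0 "1::real" G] continuous_on_subset[OF assms] by simp

text \<open>The division by \<open>n + 1\<close> accumulates over the iterations to the factorials
  in \<open>picard_series\<close>.\<close>

lemma unit_integral_bound:
  fixes h :: "real \<Rightarrow> 'b::banach"
  assumes "continuous_on {0..1} h" "\<And>\<tau>. 0 \<le> \<tau> \<Longrightarrow> \<tau> \<le> 1 \<Longrightarrow> norm (h \<tau>) \<le> K * \<tau> ^ n"
  shows "norm (integral {0..1} h) \<le> K / real (n + 1)"
proof -
  have "((\<lambda>\<tau>. K * (\<tau> ^ Suc n / Suc n)) has_vector_derivative K * \<tau> ^ n) (at \<tau> within {0..1})" for \<tau>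
    using DERIV_cmult[OF DERIV_cdivide[OF DERIV_pow[of "Suc n" \<tau> "{0..1}"]], of K "real (Suc n)"]
    by (simp add: has_real_derivative_iff_has_vector_derivative del: power_Suc)
  then have "((\<lambda>\<tau>. K * \<tau> ^ n) has_integral (K * (1 ^ Suc n / Suc n) - K * (0 ^ Suc n / Suc n))) {0..1}"
    by (intro fundamental_theorem_of_calculus) auto
  then have i: "((\<lambda>\<tau>. K * \<tau> ^ n) has_integral K / real (n + 1)) {0..1}" by simp
  have "norm (integral {0..1} h) \<le> integral {0..1} (\<lambda>\<tau>. K * \<tau> ^ n)"
    using assms i by (intro integral_norm_bound_integral) (auto intro: integrable_continuous_interval)
  then show ?thesis unfolding integral_unique[OF i] .
qed

lemma unit_integral_eq_increment:
  fixes g G :: "real \<Rightarrow> 'b::banach"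
  assumes "\<And>x. x \<in> closed_segment c d \<Longrightarrow> (G has_vector_derivative g x) (at x within S)" "closed_segment c d \<subseteq> S"
  shows "(d - c) *\<^sub>R integral {0..1} (\<lambda>\<tau>. g (c + \<tau> * (d - c))) = G d - G c"
proof -
  have m: "c + \<tau> * (d - c) \<in> closed_segment c d" if "\<tau> \<in> {0..1}" for \<tau>
    unfolding closed_segment_def using that by (intro CollectI exI[of _ \<tau>]) (simp add: algebra_simps)
  have "((\<lambda>\<tau>. G (c + \<tau> * (d - c))) has_vector_derivative (d - c) *\<^sub>R g (c + \<tau> * (d - c))) (at \<tau> within {0..1})"
    if t: "\<tau> \<in> {0..1}" for \<tau>
  proof -
    have "((\<lambda>\<tau>. c + \<tau> * (d - c)) has_vector_derivative (d - c)) (at \<tau> within {0..1})"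
      unfolding has_real_derivative_iff_has_vector_derivative[symmetric] by (auto intro!: derivative_eq_intros)
    from vector_diff_chain_within[OF this, of G "g (c + \<tau> * (d - c))"] show ?thesis
      unfolding o_def using m assms(2)
      by (blast intro: has_vector_derivative_within_subset[OF assms(1)[OF m[OF t]]])
  qed
  then have "((\<lambda>\<tau>. (d - c) *\<^sub>R g (c + \<tau> * (d - c))) has_integral (G (c + 1 * (d - c)) - G (c + 0 * (d - c)))) {0..1}"
    by (intro fundamental_theorem_of_calculus) auto
  from integral_unique[OF this] show ?thesis unfolding integral_cmul by simp
qed

lemma unit_integral_vector_derivative:
  fixes g :: "real \<Rightarrow> 'b::banach"
  assumes g: "continuous_on UNIV g"
  shows "((\<lambda>d. (d - c) *\<^sub>R integral {0..1} (\<lambda>\<tau>. g (c + \<tau> * (d - c)))) has_vector_derivative g d) (at d)"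
proof -
  \<comment> \<open>The margin 1 puts \<open>d\<close> in the interior, where a derivative within
    the interval is a derivative.\<close>
  define a b where "a = min c d - 1" and "b = max c d + 1"
  obtain G where G: "\<And>x. x \<in> {a..b} \<Longrightarrow> (G has_vector_derivative g x) (at x within {a..b})"
    by (rule antiderivative_continuous[OF continuous_on_subset[OF g subset_UNIV, of "{a..b}"]]) (rule that)
  have d: "d \<in> {a<..<b}" and c: "c \<in> {a..b}" by (auto simp: a_def b_def)
  have eq: "(d' - c) *\<^sub>R integral {0..1} (\<lambda>\<tau>. g (c + \<tau> * (d' - c))) = G d' - G c" if "d' \<in> {a<..<b}" for d'
  proof -
    have "closed_segment c d' \<subseteq> {a..b}" using c that by (auto simp: closed_segment_eq_real_ivl split: if_splits)
    then show ?thesis using G by (intro unit_integral_eq_increment[where S = "{a..b}"]) auto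
  qed
  have "(G has_vector_derivative g d) (at d within {a<..<b})"
    using d by (intro has_vector_derivative_within_subset[OF G]) auto
  then have "(G has_vector_derivative g d) (at d)" using d by (simp add: at_within_open[of d "{a<..<b}"])
  from has_vector_derivative_diff[OF this has_vector_derivative_const[of "G c"]]
  have "((\<lambda>d'. G d' - G c) has_vector_derivative g d) (at d)" by simp
  then show ?thesis
    by (rule has_vector_derivative_transform_within_open[where S = "{a<..<b}"]) (use d eq in auto)
qed

text \<open>Abstract Volterra equation \<open>g = g0 + \<Phi> g\<close>: the iterates of \<open>\<Phi>\<close> are dominated by an
  exponential series on each member of an exhaustion \<open>K\<close>.\<close>

lemma picard_series:
  fixes \<Phi> :: "('a::t2_space \<Rightarrow> 'b::banach) \<Rightarrow> 'a \<Rightarrow> 'b" and K :: "nat \<Rightarrow> 'a set"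
  assumes exh: "\<And>z. \<exists>R. z \<in> interior (K R)"
    and cont: "\<And>G. continuous_on UNIV G \<Longrightarrow> continuous_on UNIV (\<Phi> G)"
    and add: "\<And>G H. continuous_on UNIV G \<Longrightarrow> continuous_on UNIV H \<Longrightarrow> \<Phi> (\<lambda>z. G z + H z) = (\<lambda>z. \<Phi> G z + \<Phi> H z)"
    and est: "\<And>R. \<exists>c\<ge>0. \<forall>G D n. 0 \<le> D \<longrightarrow> continuous_on UNIV G \<longrightarrow> (\<forall>z\<in>K R. norm (G z) \<le> D * \<rho> z ^ n / fact n)
        \<longrightarrow> (\<forall>z\<in>K R. norm (\<Phi> G z) \<le> D * c * \<rho> z ^ Suc n / fact (Suc n))"
    and rho: "\<And>z. \<rho> z \<ge> 0" "\<And>R. \<exists>P. \<forall>z\<in>K R. \<rho> z \<le> P"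
    and g0: "continuous_on UNIV g0" "\<And>R. \<exists>D. \<forall>z\<in>K R. norm (g0 z) \<le> D"
  obtains g where "continuous_on UNIV g" "\<And>z. g z = g0 z + \<Phi> g z"
    "\<And>R. uniform_limit (K R) (\<lambda>n z. \<Sum>k<n. (\<Phi> ^^ k) g0 z) g sequentially"
proof -
  define G where "G k = (\<Phi> ^^ k) g0" for k
  have Gc: "continuous_on UNIV (G k)" for k unfolding G_def by (induction k) (simp_all add: g0(1) cont)
  have G0: "G 0 = g0" and GS: "G (Suc k) = \<Phi> (G k)" for k by (simp_all add: G_def)
  define g where "g z = (\<Sum>k. G k z)" for z
  have ul: "uniform_limit (K R) (\<lambda>n z. \<Sum>k<n. G k z) g sequentially" for R
  proof -
    obtain c where c: "c \<ge> 0" "\<And>G D n. 0 \<le> D \<Longrightarrow> continuous_on UNIV G \<Longrightarrow> (\<forall>z\<in>K R. norm (G z) \<le> D * \<rho> z ^ n / fact n)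
        \<Longrightarrow> (\<forall>z\<in>K R. norm (\<Phi> G z) \<le> D * c * \<rho> z ^ Suc n / fact (Suc n))"
      using est[of R] by blast
    obtain D' where D': "\<forall>z\<in>K R. norm (g0 z) \<le> D'" using g0(2) by blast
    define D where "D = max D' 0"
    obtain P where P: "\<forall>z\<in>K R. \<rho> z \<le> P" using rho(2) by blast
    have b: "\<forall>z\<in>K R. norm (G k z) \<le> D * c ^ k * \<rho> z ^ k / fact k" for k
    proof (induction k)
      case 0 then show ?case using D' by (auto simp: G0 D_def le_max_iff_disj)
    next
      case (Suc k)
      have "0 \<le> D * c ^ k" using c by (simp add: D_def)
      from c(2)[OF this Gc Suc.IH] show ?case by (simp add: GS mult.assoc mult.commute mult.left_commute)
    qed
    show ?thesis unfolding g_def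
    proof (rule Weierstrass_m_test)
      show "norm (G k z) \<le> D * ((c * P) ^ k / fact k)" if "z \<in> K R" for k z
      proof -
        have "norm (G k z) \<le> D * c ^ k * \<rho> z ^ k / fact k" using b that by blast
        also have "\<dots> \<le> D * c ^ k * P ^ k / fact k"
          using P that rho c by (intro divide_right_mono mult_left_mono power_mono) (auto simp: D_def)
        finally show ?thesis by (simp add: power_mult_distrib)
      qed
      show "summable (\<lambda>k. D * ((c * P) ^ k / fact k))"
        using summable_exp[of "c * P"] by (intro summable_mult) (simp add: field_simps)
    qed
  qed
  have "isCont g z" for z
  proof -
    obtain R where R: "z \<in> interior (K R)" using exh by blast
    have "continuous_on (K R) g"
      by (rule uniform_limit_theorem[OF _ ul])
        (auto intro!: always_eventually continuous_intros continuous_on_subset[OF Gc])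
    then show "isCont g z" using R by (rule continuous_on_interior)
  qed
  then have gc: "continuous_on UNIV g" by (intro continuous_at_imp_continuous_on) simp
  have Sc: "continuous_on UNIV (\<lambda>z. \<Sum>k<n. G k z)" for n by (intro continuous_intros Gc)
  have \<Phi>0: "\<Phi> (\<lambda>z. 0) = (\<lambda>z. 0)" using add[of "\<lambda>z. 0" "\<lambda>z. 0"] by (simp add: fun_eq_iff)
  have \<Phi>S: "\<Phi> (\<lambda>z. \<Sum>k<n. G k z) = (\<lambda>z. \<Sum>k<n. G (Suc k) z)" for n
  proof (induction n)
    case (Suc n)
    have "\<Phi> (\<lambda>z. (\<Sum>k<n. G k z) + G n z) = (\<lambda>z. (\<Sum>k<n. G (Suc k) z) + G (Suc n) z)"
      unfolding add[OF Sc Gc] Suc GS ..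
    then show ?case by simp
  qed (simp add: \<Phi>0)
  have "g z = g0 z + \<Phi> g z" for z
  proof -
    obtain R where "z \<in> interior (K R)" using exh by blast
    then have R: "z \<in> K R" using interior_subset by blast
    obtain c where c: "c \<ge> 0" "\<And>G D n. 0 \<le> D \<Longrightarrow> continuous_on UNIV G \<Longrightarrow> (\<forall>z\<in>K R. norm (G z) \<le> D * \<rho> z ^ n / fact n)
        \<Longrightarrow> (\<forall>z\<in>K R. norm (\<Phi> G z) \<le> D * c * \<rho> z ^ Suc n / fact (Suc n))"
      using est[of R] by blast
    \<comment> \<open>Continuity of \<open>\<Phi>\<close> under uniform convergence is the estimate
      \<open>est\<close> for \<open>n = 0\<close>, applied to the remainder of the series.\<close>
    have "(\<lambda>n. \<Phi> (\<lambda>z. \<Sum>k<n. G k z) z) \<longlonglongrightarrow> \<Phi> g z"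
    proof (rule tendstoI)
      fix e :: real assume e: "e > 0"
      define \<delta> where "\<delta> = e / (c * \<rho> z + 1)"
      have cp: "c * \<rho> z \<ge> 0" using c rho by simp
      have d: "\<delta> > 0" using e cp by (simp add: \<delta>_def add_nonneg_pos)
      have "\<forall>\<^sub>F n in sequentially. \<forall>w\<in>K R. dist (\<Sum>k<n. G k w) (g w) < \<delta>"
        using uniform_limitD[OF ul d] .
      then show "\<forall>\<^sub>F n in sequentially. dist (\<Phi> (\<lambda>z. \<Sum>k<n. G k z) z) (\<Phi> g z) < e"
      proof eventually_elim
        case (elim n)
        let ?H = "\<lambda>w. g w - (\<Sum>k<n. G k w)"
        have Hc: "continuous_on UNIV ?H" by (intro continuous_intros gc Gc)
        have "\<forall>w\<in>K R. norm (?H w) \<le> \<delta> * \<rho> w ^ 0 / fact 0"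
          using elim by (auto simp: dist_norm norm_minus_commute less_imp_le)
        from c(2)[OF less_imp_le[OF d] Hc this] R have "norm (\<Phi> ?H z) \<le> \<delta> * (c * \<rho> z)" by (simp add: mult.assoc)
        also have "\<dots> < \<delta> * (c * \<rho> z + 1)" using d by simp
        also have "\<dots> = e" using cp by (simp add: \<delta>_def)
        finally have "norm (\<Phi> ?H z) < e" .
        moreover have "\<Phi> g z = \<Phi> ?H z + \<Phi> (\<lambda>w. \<Sum>k<n. G k w) z"
          using add[OF Hc Sc, of n] by (simp add: fun_eq_iff)
        ultimately show ?case by (simp add: dist_norm norm_minus_commute)
      qed
    qed
    moreover have "(\<lambda>n. \<Phi> (\<lambda>z. \<Sum>k<n. G k z) z) = (\<lambda>n. (\<Sum>k<Suc n. G k z) - g0 z)"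
      unfolding \<Phi>S by (simp add: sum.lessThan_Suc_shift G0 del: sum.lessThan_Suc)
    moreover have "(\<lambda>n. (\<Sum>k<Suc n. G k z) - g0 z) \<longlonglongrightarrow> g z - g0 z"
      using tendsto_uniform_limitI[OF ul R] by (intro tendsto_intros LIMSEQ_Suc)
    ultimately have "\<Phi> g z = g z - g0 z" using LIMSEQ_unique by metis
    then show ?thesis by simp
  qed
  then show ?thesis by (rule that[OF gc _ ul[unfolded G_def]])
qed

lemma continuous_on_comp_UNIV:
  "continuous_on UNIV g \<Longrightarrow> continuous_on A f \<Longrightarrow> continuous_on A (\<lambda>x. g (f x))"
  by (rule continuous_on_compose2[of UNIV g A f]) auto

lemma compact_bound:
  fixes f :: "'a::topological_space \<Rightarrow> 'b::real_normed_vector"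
  assumes "continuous_on UNIV f" "compact C"
  obtains B where "B \<ge> 0" "\<And>x. x \<in> C \<Longrightarrow> norm (f x) \<le> B"
proof -
  have "bounded (f ` C)"
    by (intro compact_imp_bounded compact_continuous_image continuous_on_subset[OF assms(1)] assms(2)) simp
  then obtain B where "\<forall>x\<in>f ` C. norm x \<le> B" unfolding bounded_iff by blast
  then show ?thesis by (intro that[of "max B 0"]) (auto simp: le_max_iff_disj)
qed

lemma unit_integral_add:
  fixes f g :: "real \<Rightarrow> 'b::banach"
  assumes "continuous_on UNIV f" "continuous_on UNIV g"
  shows "integral {0..1} (\<lambda>\<tau>. f \<tau> + g \<tau>) = integral {0..1} f + integral {0..1} g"
  using assms[THEN continuous_on_subset, of "{0..1}"]
  by (intro integral_add integrable_continuous_interval) auto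

section \<open>The Goursat kernel\<close>

text \<open>With \<open>\<alpha> = u\<^sub>1 - i u\<^sub>2\<close>, \<open>\<beta> = u\<^sub>1 + i u\<^sub>2\<close> and \<open>r = q + i p\<close> the system reads
  \<open>\<alpha>\<^sub>t + \<alpha>\<^sub>x = r \<beta>\<close>, \<open>\<beta>\<^sub>t - \<beta>\<^sub>x = - cnj r \<alpha>\<close>. The functions \<open>a\<close>, \<open>b\<close> are the regular parts of the response
  to a delta control, in the characteristic coordinates \<open>\<xi> = (t - x) / 2\<close>, \<open>\<eta> = (t + x) / 2\<close>.\<close>

lemma goursat_kernel:
  fixes r :: "real \<Rightarrow> complex"
  assumes r: "continuous_on UNIV r"
  obtains a b :: "real \<Rightarrow> real \<Rightarrow> complex" where
    "continuous_on UNIV (\<lambda>z. a (fst z) (snd z))" "continuous_on UNIV (\<lambda>z. b (fst z) (snd z))"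
    "\<And>\<xi> \<eta>. (a \<xi> has_vector_derivative r (\<eta> - \<xi>) * b \<xi> \<eta>) (at \<eta>)"
    "\<And>\<xi> \<eta>. ((\<lambda>\<xi>. b \<xi> \<eta>) has_vector_derivative - cnj (r (\<eta> - \<xi>)) * a \<xi> \<eta>) (at \<xi>)"
    "\<And>\<xi>. a \<xi> \<xi> = - b \<xi> \<xi>" "\<And>\<eta>. b 0 \<eta> = - cnj (r \<eta>)"
proof -
  \<comment> \<open>\<open>\<Psi>\<close> integrates the equation for \<open>a\<close> in the second
    coordinate from the diagonal, where \<open>a = - b\<close>; \<open>\<Phi>\<close> integrates the
    equation for \<open>b\<close> in the first coordinate from 0. Their composition leaves one
    Volterra equation for \<open>b\<close>, and \<open>a\<close> is recovered by
    \<open>\<Psi>\<close>.\<close>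
  define \<Psi> :: "(real \<times> real \<Rightarrow> complex) \<Rightarrow> real \<times> real \<Rightarrow> complex" where
    "\<Psi> G z = - G (fst z, fst z) + (snd z - fst z) *\<^sub>R integral {0..1}
       (\<lambda>\<tau>. r ((fst z + \<tau> * (snd z - fst z)) - fst z) * G (fst z, fst z + \<tau> * (snd z - fst z)))" for G z
  define \<Phi> :: "(real \<times> real \<Rightarrow> complex) \<Rightarrow> real \<times> real \<Rightarrow> complex" where
    "\<Phi> G z = - ((fst z - 0) *\<^sub>R integral {0..1}
       (\<lambda>\<tau>. cnj (r (snd z - (0 + \<tau> * (fst z - 0)))) * \<Psi> G (0 + \<tau> * (fst z - 0), snd z)))" for G z
  define g0 :: "real \<times> real \<Rightarrow> complex" where "g0 z = - cnj (r (snd z))" for z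
  have ci1: "continuous_on UNIV (\<lambda>\<tau>. r (c + \<tau> * d - e) * G (f, c + \<tau> * d))" if "continuous_on UNIV G" for G c d e f
    by (intro continuous_intros continuous_on_comp_UNIV[OF r] continuous_on_comp_UNIV[OF that])
  have c\<Psi>: "continuous_on UNIV (\<Psi> G)" if G: "continuous_on UNIV G" for G
    unfolding \<Psi>_def
    by (intro continuous_intros continuous_on_unit_integral continuous_on_comp_UNIV[OF G])
      (auto simp: split_beta intro!: continuous_intros continuous_on_comp_UNIV[OF r] continuous_on_comp_UNIV[OF G])
  have ci2: "continuous_on UNIV (\<lambda>\<tau>. cnj (r (c - (0 + \<tau> * d))) * \<Psi> G (0 + \<tau> * d, e))" if "continuous_on UNIV G" for G c d e
    by (intro continuous_intros continuous_on_comp_UNIV[OF r] continuous_on_comp_UNIV[OF c\<Psi>[OF that]])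
  have c\<Phi>: "continuous_on UNIV (\<Phi> G)" if G: "continuous_on UNIV G" for G
    unfolding \<Phi>_def
    by (intro continuous_intros continuous_on_unit_integral)
      (auto simp: split_beta intro!: continuous_intros continuous_on_comp_UNIV[OF r] continuous_on_comp_UNIV[OF c\<Psi>[OF G]])
  have add\<Psi>: "\<Psi> (\<lambda>z. G z + H z) z = \<Psi> G z + \<Psi> H z" if "continuous_on UNIV G" "continuous_on UNIV H" for G H z
    unfolding \<Psi>_def distrib_left unit_integral_add[OF ci1[OF that(1)] ci1[OF that(2)]]
    by (simp add: scaleR_add_right)
  have add\<Phi>: "\<Phi> (\<lambda>z. G z + H z) = (\<lambda>z. \<Phi> G z + \<Phi> H z)" if "continuous_on UNIV G" "continuous_on UNIV H" for G H
    unfolding \<Phi>_def add\<Psi>[OF that] distrib_left unit_integral_add[OF ci2[OF that(1)] ci2[OF that(2)]]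
    by (simp add: scaleR_add_right)
  define K where "K R = {- real R..real R} \<times> {- real R..real R}" for R
  have K: "z \<in> K R \<longleftrightarrow> \<bar>fst z\<bar> \<le> R \<and> \<bar>snd z\<bar> \<le> R" for z R by (cases z) (auto simp: K_def)
  \<comment> \<open>Only the integration in the first coordinate raises the power of
    \<open>\<bar>fst z\<bar>\<close>. \<open>\<Psi>\<close> works at a fixed first coordinate, so it
    preserves the power and costs the factor \<open>1 + 2 * R * M\<close>, where
    \<open>2 * R\<close> bounds the difference of the coordinates on \<open>K R\<close>.\<close>
  have est: "\<exists>c\<ge>0. \<forall>G D n. 0 \<le> D \<longrightarrow> continuous_on UNIV G \<longrightarrow> (\<forall>z\<in>K R. norm (G z) \<le> D * \<bar>fst z\<bar> ^ n / fact n)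
        \<longrightarrow> (\<forall>z\<in>K R. norm (\<Phi> G z) \<le> D * c * \<bar>fst z\<bar> ^ Suc n / fact (Suc n))" for R
  proof -
    obtain M where M: "M \<ge> 0" "\<And>x. x \<in> {- (2 * real R)..2 * real R} \<Longrightarrow> norm (r x) \<le> M"
      using compact_bound[OF r compact_Icc] by blast
    define c where "c = M * (1 + 2 * real R * M)"
    have c0: "c \<ge> 0" using M by (simp add: c_def)
    have "norm (\<Phi> G z) \<le> D * c * \<bar>fst z\<bar> ^ Suc n / fact (Suc n)"
      if D: "0 \<le> D" and G: "continuous_on UNIV G" and b: "\<forall>z\<in>K R. norm (G z) \<le> D * \<bar>fst z\<bar> ^ n / fact n" and z: "z \<in> K R"
      for G D n z
    proof -
      have b\<Psi>: "norm (\<Psi> G w) \<le> (1 + 2 * real R * M) * (D * \<bar>fst w\<bar> ^ n / fact n)" if w: "w \<in> K R" for w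
      proof -
        obtain \<xi> \<eta> where we: "w = (\<xi>, \<eta>)" by (cases w)
        define L where "L = D * \<bar>\<xi>\<bar> ^ n / fact n"
        have L: "L \<ge> 0" using D by (simp add: L_def)
        have in1: "\<bar>\<xi>\<bar> \<le> R" "\<bar>\<eta>\<bar> \<le> R" using w by (auto simp: K we)
        have "norm (integral {0..1} (\<lambda>\<tau>. r ((\<xi> + \<tau> * (\<eta> - \<xi>)) - \<xi>) * G (\<xi>, \<xi> + \<tau> * (\<eta> - \<xi>)))) \<le> M * L / real (0 + 1)"
        proof (rule unit_integral_bound)
          show "continuous_on {0..1} (\<lambda>\<tau>. r ((\<xi> + \<tau> * (\<eta> - \<xi>)) - \<xi>) * G (\<xi>, \<xi> + \<tau> * (\<eta> - \<xi>)))"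
            by (rule continuous_on_subset[OF ci1[OF G]]) simp
          fix \<tau> :: real assume t: "0 \<le> \<tau>" "\<tau> \<le> 1"
          have "\<bar>\<tau> * (\<eta> - \<xi>)\<bar> \<le> 1 * \<bar>\<eta> - \<xi>\<bar>" unfolding abs_mult using t by (intro mult_right_mono) auto
          then have 1: "norm (r ((\<xi> + \<tau> * (\<eta> - \<xi>)) - \<xi>)) \<le> M" using in1 by (intro M) auto
          have "\<bar>(1 - \<tau>) * \<xi> + \<tau> * \<eta>\<bar> \<le> (1 - \<tau>) * R + \<tau> * R"
            using t in1 by (intro order_trans[OF abs_triangle_ineq] add_mono) (auto simp: abs_mult intro!: mult_left_mono)
          then have "\<bar>\<xi> + \<tau> * (\<eta> - \<xi>)\<bar> \<le> R" by (simp add: algebra_simps)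
          then have "(\<xi>, \<xi> + \<tau> * (\<eta> - \<xi>)) \<in> K R" using in1 by (simp add: K)
          from bspec[OF b this] have 2: "norm (G (\<xi>, \<xi> + \<tau> * (\<eta> - \<xi>))) \<le> L" by (simp add: L_def)
          show "norm (r ((\<xi> + \<tau> * (\<eta> - \<xi>)) - \<xi>) * G (\<xi>, \<xi> + \<tau> * (\<eta> - \<xi>))) \<le> M * L * \<tau> ^ 0"
            unfolding norm_mult using mult_mono[OF 1 2] M by simp
        qed
        then have i: "norm (integral {0..1} (\<lambda>\<tau>. r ((\<xi> + \<tau> * (\<eta> - \<xi>)) - \<xi>) * G (\<xi>, \<xi> + \<tau> * (\<eta> - \<xi>)))) \<le> M * L" by simp
        have "(\<xi>, \<xi>) \<in> K R" using in1 by (simp add: K)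
        from bspec[OF b this] have g: "norm (G (\<xi>, \<xi>)) \<le> L" by (simp add: L_def)
        have "norm (\<Psi> G w) \<le> norm (G (\<xi>, \<xi>)) + \<bar>\<eta> - \<xi>\<bar> * norm (integral {0..1} (\<lambda>\<tau>. r ((\<xi> + \<tau> * (\<eta> - \<xi>)) - \<xi>) * G (\<xi>, \<xi> + \<tau> * (\<eta> - \<xi>))))"
          unfolding \<Psi>_def we fst_conv snd_conv by (rule order_trans[OF norm_triangle_ineq]) simp
        also have "\<dots> \<le> L + (2 * real R) * (M * L)"
          using in1 M L by (intro add_mono g mult_mono i) auto
        finally show ?thesis by (simp add: we L_def algebra_simps)
      qed
      obtain \<xi> \<eta> where ze: "z = (\<xi>, \<eta>)" by (cases z)
      have in1: "\<bar>\<xi>\<bar> \<le> R" "\<bar>\<eta>\<bar> \<le> R" using z by (auto simp: K ze)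
      define L where "L = D * \<bar>\<xi>\<bar> ^ n / fact n"
      have "norm (integral {0..1} (\<lambda>\<tau>. cnj (r (\<eta> - (0 + \<tau> * (\<xi> - 0)))) * \<Psi> G (0 + \<tau> * (\<xi> - 0), \<eta>))) \<le> (c * L) / real (n + 1)"
      proof (rule unit_integral_bound)
        show "continuous_on {0..1} (\<lambda>\<tau>. cnj (r (\<eta> - (0 + \<tau> * (\<xi> - 0)))) * \<Psi> G (0 + \<tau> * (\<xi> - 0), \<eta>))"
          by (rule continuous_on_subset[OF ci2[OF G]]) simp
        fix \<tau> :: real assume t: "0 \<le> \<tau>" "\<tau> \<le> 1"
        have tx: "\<bar>\<tau> * \<xi>\<bar> \<le> 1 * \<bar>\<xi>\<bar>" unfolding abs_mult using t by (intro mult_right_mono) auto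
        then have 1: "norm (cnj (r (\<eta> - (0 + \<tau> * (\<xi> - 0))))) \<le> M" using in1 by (auto intro!: M)
        have "(0 + \<tau> * (\<xi> - 0), \<eta>) \<in> K R" using in1 tx by (simp add: K)
        from b\<Psi>[OF this] have 2: "norm (\<Psi> G (0 + \<tau> * (\<xi> - 0), \<eta>)) \<le> (1 + 2 * real R * M) * (L * \<tau> ^ n)"
          using t by (simp add: L_def abs_mult power_mult_distrib algebra_simps)
        show "norm (cnj (r (\<eta> - (0 + \<tau> * (\<xi> - 0)))) * \<Psi> G (0 + \<tau> * (\<xi> - 0), \<eta>)) \<le> c * L * \<tau> ^ n"
          unfolding norm_mult using mult_mono[OF 1 2] M by (simp add: c_def mult.assoc)
      qed
      from mult_left_mono[OF this abs_ge_zero[of \<xi>]]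
      have "norm (\<Phi> G z) \<le> \<bar>\<xi>\<bar> * (c * L / real (n + 1))"
        unfolding \<Phi>_def ze by simp
      also have "\<dots> = D * c * \<bar>fst z\<bar> ^ Suc n / fact (Suc n)" by (simp add: L_def ze field_simps)
      finally show ?thesis .
    qed
    then show ?thesis using c0 by blast
  qed
  have exh: "\<exists>R. z \<in> interior (K R)" for z
  proof -
    obtain R where R: "\<bar>fst z\<bar> + \<bar>snd z\<bar> < real R" using reals_Archimedean2 by blast
    have "z \<in> {- real R<..<real R} \<times> {- real R<..<real R}" using R by (cases z) auto
    then have "z \<in> interior (K R)"
      unfolding K_def by (intro interiorI[of "{- real R<..<real R} \<times> {- real R<..<real R}"]) (auto intro: open_Times)
    then show ?thesis ..
  qed
  have g0c: "continuous_on UNIV g0" unfolding g0_def by (intro continuous_intros continuous_on_comp_UNIV[OF r])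
  have g0b: "\<exists>D. \<forall>z\<in>K R. norm (g0 z) \<le> D" for R
    using compact_bound[OF g0c, of "K R"] by (metis K_def compact_Icc compact_Times)
  have rho: "\<exists>P. \<forall>z\<in>K R. \<bar>fst z\<bar> \<le> P" for R by (auto simp: K)
  obtain g where gc: "continuous_on UNIV g" and geq: "\<And>z. g z = g0 z + \<Phi> g z"
    and "\<And>R. uniform_limit (K R) (\<lambda>n z. \<Sum>k<n. (\<Phi> ^^ k) g0 z) g sequentially"
    by (rule picard_series[of K \<Phi> "\<lambda>z. \<bar>fst z\<bar>" g0, OF exh c\<Phi> add\<Phi> est abs_ge_zero rho g0c g0b]) (assumption+, rule that)
  define a b where "a \<xi> \<eta> = \<Psi> g (\<xi>, \<eta>)" and "b \<xi> \<eta> = g (\<xi>, \<eta>)" for \<xi> \<eta>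
  show ?thesis
  proof
    show "continuous_on UNIV (\<lambda>z. a (fst z) (snd z))" "continuous_on UNIV (\<lambda>z. b (fst z) (snd z))"
      unfolding a_def b_def using c\<Psi>[OF gc] gc by simp_all
    fix \<xi> \<eta> :: real
    have "((\<lambda>\<eta>. - g (\<xi>, \<xi>) + (\<eta> - \<xi>) *\<^sub>R integral {0..1} (\<lambda>\<tau>. r ((\<xi> + \<tau> * (\<eta> - \<xi>)) - \<xi>) * g (\<xi>, \<xi> + \<tau> * (\<eta> - \<xi>))))
        has_vector_derivative 0 + r (\<eta> - \<xi>) * g (\<xi>, \<eta>)) (at \<eta>)"
      by (intro has_vector_derivative_add has_vector_derivative_const unit_integral_vector_derivative[of "\<lambda>y. r (y - \<xi>) * g (\<xi>, y)"]
         continuous_intros continuous_on_comp_UNIV[OF r] continuous_on_comp_UNIV[OF gc])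
    then show "(a \<xi> has_vector_derivative r (\<eta> - \<xi>) * b \<xi> \<eta>) (at \<eta>)"
      by (simp add: a_def[abs_def] b_def \<Psi>_def)
    have "((\<lambda>\<xi>. - cnj (r \<eta>) + - ((\<xi> - 0) *\<^sub>R integral {0..1} (\<lambda>\<tau>. cnj (r (\<eta> - (0 + \<tau> * (\<xi> - 0)))) * \<Psi> g (0 + \<tau> * (\<xi> - 0), \<eta>))))
        has_vector_derivative 0 + - (cnj (r (\<eta> - \<xi>)) * \<Psi> g (\<xi>, \<eta>))) (at \<xi>)"
      by (intro has_vector_derivative_add has_vector_derivative_const has_vector_derivative_minus
         unit_integral_vector_derivative[of "\<lambda>y. cnj (r (\<eta> - y)) * \<Psi> g (y, \<eta>)"]
         continuous_intros continuous_on_comp_UNIV[OF r] continuous_on_comp_UNIV[OF c\<Psi>[OF gc]])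
    moreover have "b x \<eta> = - cnj (r \<eta>) + - ((x - 0) *\<^sub>R integral {0..1} (\<lambda>\<tau>. cnj (r (\<eta> - (0 + \<tau> * (x - 0)))) * \<Psi> g (0 + \<tau> * (x - 0), \<eta>)))" for x
      unfolding b_def by (subst geq) (simp only: g0_def \<Phi>_def fst_conv snd_conv)
    ultimately show "((\<lambda>\<xi>. b \<xi> \<eta>) has_vector_derivative - cnj (r (\<eta> - \<xi>)) * a \<xi> \<eta>) (at \<xi>)"
      by (simp only: a_def add_0_left mult_minus_left)
    show "a \<xi> \<xi> = - b \<xi> \<xi>" by (simp add: a_def b_def \<Psi>_def)
    show "b 0 \<eta> = - cnj (r \<eta>)" unfolding b_def by (subst geq) (simp add: g0_def \<Phi>_def)
  qed
qed

section \<open>The spectral solution\<close>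

text \<open>\<open>\<phi> = \<theta>\<^sub>1 - i \<theta>\<^sub>2\<close> for the solution of \<open>J \<theta>' + V \<theta> = l \<theta>\<close>, \<open>\<theta>(0) = (0, 1)\<close>. Since \<open>p\<close>, \<open>q\<close> are real,
  \<open>\<theta>\<^sub>1 + i \<theta>\<^sub>2\<close> at \<open>l\<close> is the conjugate of \<open>\<phi>\<close> at \<open>cnj l\<close>.\<close>

lemma spectral_solution:
  fixes r :: "real \<Rightarrow> complex"
  assumes r: "continuous_on UNIV r"
  obtains \<phi> :: "real \<Rightarrow> complex \<Rightarrow> complex" where
    "continuous_on UNIV (\<lambda>z. \<phi> (fst z) (snd z))"
    "\<And>x l. ((\<lambda>x. \<phi> x l) has_vector_derivative (- \<i> * l * \<phi> x l + r x * cnj (\<phi> x (cnj l)))) (at x)"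
    "\<And>l. \<phi> 0 l = - \<i>" "\<And>x. \<phi> x holomorphic_on UNIV"
proof -
  \<comment> \<open>The unknown enters both at \<open>l\<close> and at \<open>cnj l\<close>, so the
    integral equation is solved for functions of the pair \<open>(x, l)\<close> and not for each
    \<open>l\<close> separately.\<close>
  define I :: "(real \<times> complex \<Rightarrow> complex) \<Rightarrow> complex \<Rightarrow> real \<Rightarrow> complex" where
    "I G l y = - \<i> * l * G (y, l) + r y * cnj (G (y, cnj l))" for G l y
  define \<Phi> :: "(real \<times> complex \<Rightarrow> complex) \<Rightarrow> real \<times> complex \<Rightarrow> complex" where
    "\<Phi> G z = (fst z - 0) *\<^sub>R integral {0..1} (\<lambda>\<tau>. I G (snd z) (0 + \<tau> * (fst z - 0)))" for G z
  define g0 :: "real \<times> complex \<Rightarrow> complex" where "g0 z = - \<i>" for z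
  have cI: "continuous_on A (\<lambda>w. I G (h w) (f w))"
    if G: "continuous_on UNIV G" and "continuous_on A h" "continuous_on A f" for G h f and A :: "'x::topological_space set"
    unfolding I_def
    by (intro continuous_intros continuous_on_comp_UNIV[OF r] continuous_on_comp_UNIV[OF G] that)
  have cI1: "continuous_on UNIV (\<lambda>\<tau>::real. I G l (c + \<tau> * d))" if "continuous_on UNIV G" for G l c d
    unfolding I_def
    by (intro continuous_intros continuous_on_comp_UNIV[OF r] continuous_on_comp_UNIV[OF that])
  have cI2: "continuous_on UNIV (\<lambda>y::real. I G l y)" if "continuous_on UNIV G" for G l
    unfolding I_def
    by (intro continuous_intros continuous_on_comp_UNIV[OF r] continuous_on_comp_UNIV[OF that])
  have c\<Phi>: "continuous_on UNIV (\<Phi> G)" if G: "continuous_on UNIV G" for G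
    unfolding \<Phi>_def I_def split_beta
    by (intro continuous_intros continuous_on_unit_integral)
      (auto simp: split_beta intro!: continuous_intros continuous_on_comp_UNIV[OF r] continuous_on_comp_UNIV[OF G])
  have addI: "I (\<lambda>z. G z + H z) l y = I G l y + I H l y" for G H l y
    by (simp add: I_def algebra_simps)
  have add\<Phi>: "\<Phi> (\<lambda>z. G z + H z) = (\<lambda>z. \<Phi> G z + \<Phi> H z)" if "continuous_on UNIV G" "continuous_on UNIV H" for G H
    unfolding \<Phi>_def addI unit_integral_add[OF cI1[OF that(1)] cI1[OF that(2)]]
    by (simp add: scaleR_add_right)
  \<comment> \<open>Discs about 0 are invariant under conjugation, so a bound on \<open>K R\<close>
    controls both values of the unknown.\<close>
  define K where "K R = {- real R..real R} \<times> cball (0::complex) (real R)" for R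
  have K: "z \<in> K R \<longleftrightarrow> \<bar>fst z\<bar> \<le> R \<and> cmod (snd z) \<le> R" for z R by (cases z) (auto simp: K_def)
  have est: "\<exists>c\<ge>0. \<forall>G D n. 0 \<le> D \<longrightarrow> continuous_on UNIV G \<longrightarrow> (\<forall>z\<in>K R. norm (G z) \<le> D * \<bar>fst z\<bar> ^ n / fact n)
        \<longrightarrow> (\<forall>z\<in>K R. norm (\<Phi> G z) \<le> D * c * \<bar>fst z\<bar> ^ Suc n / fact (Suc n))" for R
  proof -
    obtain M where M: "M \<ge> 0" "\<And>x. x \<in> {- real R..real R} \<Longrightarrow> norm (r x) \<le> M"
      using compact_bound[OF r compact_Icc] by blast
    define c where "c = real R + M"
    have c0: "c \<ge> 0" using M by (simp add: c_def)
    have "norm (\<Phi> G z) \<le> D * c * \<bar>fst z\<bar> ^ Suc n / fact (Suc n)"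
      if D: "0 \<le> D" and G: "continuous_on UNIV G" and b: "\<forall>z\<in>K R. norm (G z) \<le> D * \<bar>fst z\<bar> ^ n / fact n" and z: "z \<in> K R"
      for G D n z
    proof -
      obtain x l where ze: "z = (x, l)" by (cases z)
      have in1: "\<bar>x\<bar> \<le> R" "cmod l \<le> R" using z by (auto simp: K ze)
      define L where "L = D * \<bar>x\<bar> ^ n / fact n"
      have "norm (integral {0..1} (\<lambda>\<tau>. I G l (0 + \<tau> * (x - 0)))) \<le> (c * L) / real (n + 1)"
      proof (rule unit_integral_bound)
        show "continuous_on {0..1} (\<lambda>\<tau>. I G l (0 + \<tau> * (x - 0)))"
          by (rule continuous_on_subset[OF cI1[OF G]]) simp
        fix \<tau> :: real assume t: "0 \<le> \<tau>" "\<tau> \<le> 1"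
        have tx: "\<bar>\<tau> * x\<bar> \<le> 1 * \<bar>x\<bar>" unfolding abs_mult using t by (intro mult_right_mono) auto
        have 0: "norm (r (\<tau> * x)) \<le> M" using in1 tx by (intro M) auto
        have "(\<tau> * x, l) \<in> K R" "(\<tau> * x, cnj l) \<in> K R" using in1 tx by (simp_all add: K)
        from bspec[OF b this(1)] bspec[OF b this(2)]
        have 2: "norm (G (\<tau> * x, l)) \<le> L * \<tau> ^ n" "norm (G (\<tau> * x, cnj l)) \<le> L * \<tau> ^ n"
          using t by (simp_all add: L_def abs_mult power_mult_distrib mult_ac)
        have "norm (I G l (0 + \<tau> * (x - 0))) \<le> norm l * norm (G (\<tau> * x, l)) + norm (r (\<tau> * x)) * norm (G (\<tau> * x, cnj l))"
          unfolding I_def by (rule order_trans[OF norm_triangle_ineq]) (simp add: norm_mult)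
        also have "\<dots> \<le> R * (L * \<tau> ^ n) + M * (L * \<tau> ^ n)"
          using M by (intro add_mono mult_mono in1 0 2) auto
        finally show "norm (I G l (0 + \<tau> * (x - 0))) \<le> c * L * \<tau> ^ n" by (simp add: c_def algebra_simps)
      qed
      from mult_left_mono[OF this abs_ge_zero[of x]]
      have "norm (\<Phi> G z) \<le> \<bar>x\<bar> * (c * L / real (n + 1))"
        unfolding \<Phi>_def ze by simp
      also have "\<dots> = D * c * \<bar>fst z\<bar> ^ Suc n / fact (Suc n)" by (simp add: L_def ze field_simps)
      finally show ?thesis .
    qed
    then show ?thesis using c0 by blast
  qed
  have intK: "(x, l) \<in> interior (K R)" if "\<bar>x\<bar> < real R" "cmod l < real R" for x l R
    unfolding K_def using that
    by (intro interiorI[of "{- real R<..<real R} \<times> ball 0 (real R)"]) (auto intro: open_Times)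
  have exh: "\<exists>R. z \<in> interior (K R)" for z
  proof -
    obtain R where R: "\<bar>fst z\<bar> + cmod (snd z) < real R" using reals_Archimedean2 by blast
    have "0 \<le> \<bar>fst z\<bar>" "0 \<le> cmod (snd z)" by simp_all
    then have "\<bar>fst z\<bar> < real R" "cmod (snd z) < real R" using R by linarith+
    from intK[OF this] show ?thesis by auto
  qed
  have g0c: "continuous_on UNIV g0" unfolding g0_def by (intro continuous_intros)
  have g0b: "\<exists>D. \<forall>z\<in>K R. norm (g0 z) \<le> D" for R by (auto simp: g0_def)
  have rho: "\<exists>P. \<forall>z\<in>K R. \<bar>fst z\<bar> \<le> P" for R by (auto simp: K)
  obtain g where gc: "continuous_on UNIV g" and geq: "\<And>z. g z = g0 z + \<Phi> g z"
    and gu: "\<And>R. uniform_limit (K R) (\<lambda>n z. \<Sum>k<n. (\<Phi> ^^ k) g0 z) g sequentially"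
    by (rule picard_series[of K \<Phi> "\<lambda>z. \<bar>fst z\<bar>" g0, OF exh c\<Phi> add\<Phi> est abs_ge_zero rho g0c g0b]) (assumption+, rule that)
  \<comment> \<open>Differentiability in \<open>l\<close> is inherited by the iterates because
    conjugating both the argument and the value of a holomorphic function gives a holomorphic
    function. Continuity of the derivative is carried along in order to differentiate under the
    integral.\<close>
  have diff: "\<exists>G'. continuous_on UNIV ((\<Phi> ^^ k) g0) \<and> continuous_on UNIV G' \<and>
      (\<forall>x l. ((\<lambda>l. (\<Phi> ^^ k) g0 (x, l)) has_field_derivative G' (x, l)) (at l))" for k
  proof (induction k)
    case 0
    show ?case by (rule exI[of _ "\<lambda>_. 0"]) (simp add: g0_def[abs_def])
  next
    case (Suc k)
    define G where "G = (\<Phi> ^^ k) g0"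
    obtain G' where G: "continuous_on UNIV G" and G': "continuous_on UNIV G'"
      and D: "\<And>x l. ((\<lambda>l. G (x, l)) has_field_derivative G' (x, l)) (at l)"
      using Suc unfolding G_def by blast
    define I' where "I' l y = - \<i> * G (y, l) + - \<i> * l * G' (y, l) + r y * cnj (G' (y, cnj l))" for l y
    note cs = continuous_intros continuous_on_comp_UNIV[OF r] continuous_on_comp_UNIV[OF G] continuous_on_comp_UNIV[OF G']
    have DI: "((\<lambda>l. I G l y) has_field_derivative I' l y) (at l)" for l y
    proof -
      have "((cnj \<circ> (\<lambda>l. G (y, l)) \<circ> cnj) has_field_derivative cnj (G' (y, cnj l))) (at l)"
        by (rule has_field_derivative_cnj_cnj[OF D])
      then have c: "((\<lambda>l. cnj (G (y, cnj l))) has_field_derivative cnj (G' (y, cnj l))) (at l)" by (simp add: o_def)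
      have "((\<lambda>l. (- \<i> * l) * G (y, l) + r y * cnj (G (y, cnj l))) has_field_derivative
          ((- \<i> * 1) * G (y, l) + G' (y, l) * (- \<i> * l)) + r y * cnj (G' (y, cnj l))) (at l)"
        by (intro DERIV_add DERIV_mult DERIV_cmult D c DERIV_ident)
      then show ?thesis unfolding I_def I'_def by (simp add: mult.commute)
    qed
    define G'' where "G'' z = fst z *\<^sub>R integral {0..1} (\<lambda>\<tau>. I' (snd z) (\<tau> * fst z))" for z
    have "continuous_on UNIV (\<Phi> G)" by (rule c\<Phi>[OF G])
    moreover have "continuous_on UNIV G''"
      unfolding G''_def I'_def
      by (intro continuous_intros continuous_on_unit_integral) (auto simp: split_beta intro!: cs)
    moreover have "((\<lambda>l. \<Phi> G (x, l)) has_field_derivative G'' (x, l)) (at l)" for x l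
    proof -
      have "((\<lambda>l. integral (cbox 0 1) (\<lambda>\<tau>. I G l (\<tau> * x))) has_field_derivative integral (cbox 0 1) (\<lambda>\<tau>. I' l (\<tau> * x))) (at l within UNIV)"
      proof (rule leibniz_rule_field_derivative)
        show "(\<lambda>\<tau>. I G l (\<tau> * x)) integrable_on cbox 0 1" for l
          using continuous_on_subset[OF cI1[OF G, of l 0 x] subset_UNIV] by (intro integrable_continuous) simp
        show "continuous_on (UNIV \<times> cbox 0 1) (\<lambda>(l, \<tau>). I' l (\<tau> * x))"
          unfolding I'_def split_beta by (intro cs)
        show "((\<lambda>l. I G l (\<tau> * x)) has_field_derivative I' l (\<tau> * x)) (at l within UNIV)" for l \<tau>
          using DI by simp
      qed simp_all
      then have "((\<lambda>l. complex_of_real x * integral {0..1} (\<lambda>\<tau>. I G l (\<tau> * x))) has_field_derivative complex_of_real x * integral {0..1} (\<lambda>\<tau>. I' l (\<tau> * x))) (at l)"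
        by (intro DERIV_cmult) simp
      then show ?thesis by (simp add: \<Phi>_def G''_def scaleR_conv_of_real)
    qed
    ultimately show ?case by (auto simp: G_def)
  qed
  define \<phi> where "\<phi> x l = g (x, l)" for x l
  show ?thesis
  proof
    show "continuous_on UNIV (\<lambda>z. \<phi> (fst z) (snd z))" unfolding \<phi>_def using gc by simp
    fix x :: real and l :: complex
    have D: "((\<lambda>x. - \<i> + (x - 0) *\<^sub>R integral {0..1} (\<lambda>\<tau>. I g l (0 + \<tau> * (x - 0)))) has_vector_derivative 0 + I g l x) (at x)"
      by (intro has_vector_derivative_add has_vector_derivative_const unit_integral_vector_derivative[of "I g l"] cI2[OF gc])
    have e1: "(\<lambda>x. \<phi> x l) = (\<lambda>x. - \<i> + (x - 0) *\<^sub>R integral {0..1} (\<lambda>\<tau>. I g l (0 + \<tau> * (x - 0))))"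
      unfolding \<phi>_def by (rule ext, subst geq) (simp only: g0_def \<Phi>_def fst_conv snd_conv)
    have e2: "- \<i> * l * \<phi> x l + r x * cnj (\<phi> x (cnj l)) = 0 + I g l x"
      by (simp add: I_def \<phi>_def)
    show "((\<lambda>x. \<phi> x l) has_vector_derivative (- \<i> * l * \<phi> x l + r x * cnj (\<phi> x (cnj l)))) (at x)"
      unfolding e1 e2 by (rule D)
    show "\<phi> 0 l = - \<i>" unfolding \<phi>_def by (subst geq) (simp add: g0_def \<Phi>_def)
    show "\<phi> x holomorphic_on UNIV"
    proof (rule holomorphic_uniform_sequence[OF open_UNIV])
      show "(\<lambda>l. \<Sum>k<n. (\<Phi> ^^ k) g0 (x, l)) holomorphic_on UNIV" for n
      proof (intro holomorphic_on_sum)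
        fix k
        show "(\<lambda>l. (\<Phi> ^^ k) g0 (x, l)) holomorphic_on UNIV"
          using diff[of k] by (auto simp: holomorphic_on_open)
      qed
      fix l :: complex
      obtain R where R: "\<bar>x\<bar> + cmod l + 1 < real R" using reals_Archimedean2 by blast
      have sub: "(x, w) \<in> K R" if "w \<in> cball l 1" for w
      proof -
        have "cmod w \<le> cmod l + 1" using norm_triangle_ineq2[of w l] that by (simp add: dist_norm norm_minus_commute)
        then show ?thesis unfolding K using R norm_ge_zero[of l] by (simp del: norm_ge_zero)
      qed
      have "uniform_limit (cball l 1) (\<lambda>n l. \<Sum>k<n. (\<Phi> ^^ k) g0 (x, l)) (\<lambda>l. g (x, l)) sequentially"
      proof (rule uniform_limitI)
        fix e :: real assume "e > 0"
        from uniform_limitD[OF gu[of R] this]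
        show "\<forall>\<^sub>F n in sequentially. \<forall>w\<in>cball l 1. dist (\<Sum>k<n. (\<Phi> ^^ k) g0 (x, w)) (g (x, w)) < e"
          by eventually_elim (use sub in blast)
      qed
      then show "\<exists>d>0. cball l d \<subseteq> UNIV \<and> uniform_limit (cball l d) (\<lambda>n l. \<Sum>k<n. (\<Phi> ^^ k) g0 (x, l)) (\<phi> x) sequentially"
        by (intro exI[of _ 1]) (simp add: \<phi>_def[abs_def])
    qed
  qed
qed

section \<open>Dense sets of controls\<close>

lemma finite_measure_interval: "finite_measure (lborel_on {a<..<b::real})"
  by (rule finite_measureI, cases "a \<le> b") (simp_all add: space_restrict_space emeasure_restrict_space)

lemma space_interval [simp]: "space (lborel_on S) = S"
  by (simp add: space_restrict_space)

lemma measurable_lborel_on: "f \<in> borel_measurable borel \<Longrightarrow> f \<in> borel_measurable (lborel_on S)"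
  by (simp add: measurable_restrict_space1)

lemma AE_lborel_on: "S \<in> sets borel \<Longrightarrow> (AE x in lborel. P x) \<Longrightarrow> (AE x in lborel_on S. P x)"
  by (subst AE_restrict_space_iff) (auto elim: eventually_mono)

lemma L2_bounded_interval:
  fixes f :: "real \<Rightarrow> 'a::{banach,second_countable_topology}"
  assumes m: "f \<in> borel_measurable (lborel_on {a<..<b})" and B: "\<And>x. x \<in> {a<..<b} \<Longrightarrow> norm (f x) \<le> B"
  shows "f \<in> L2 (lborel_on {a<..<b})"
proof -
  interpret finite_measure "lborel_on {a<..<b}" by (rule finite_measure_interval)
  show ?thesis
  proof (rule L2_I[OF m], rule integrable_const_bound[where B = "B\<^sup>2"])
    show "AE x in lborel_on {a<..<b}. norm ((norm (f x))\<^sup>2) \<le> B\<^sup>2"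
      using B by (intro AE_I2) (auto intro: power_mono)
  qed (use m in simp)
qed

lemma L2_continuous:
  fixes f :: "real \<Rightarrow> 'a::{banach,second_countable_topology}"
  assumes "continuous_on {a..b} f"
  shows "f \<in> L2 (lborel_on {a<..<b})"
proof -
  have "bounded (f ` {a..b})" by (intro compact_imp_bounded compact_continuous_image assms compact_Icc)
  then obtain B where B: "\<And>x. x \<in> {a..b} \<Longrightarrow> norm (f x) \<le> B" unfolding bounded_iff by blast
  have "continuous_on {a<..<b} f" by (rule continuous_on_subset[OF assms]) auto
  then have "f \<in> borel_measurable (restrict_space borel {a<..<b})" by (intro borel_measurable_continuous_on_restrict)
  moreover have "sets (restrict_space borel {a<..<b}) = sets (lborel_on {a<..<b})"
    by (intro sets_restrict_space_cong) simp
  ultimately have "f \<in> borel_measurable (lborel_on {a<..<b})"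
    using measurable_cong_sets by blast
  then show ?thesis by (rule L2_bounded_interval[where B = B]) (use B in auto)
qed

text \<open>Measurable functions are limits of continuous ones off a negligible set; clipping both
  at a fixed modulus supplies the domination that turns this into convergence in
  \<open>L2\<close>.\<close>

lemma continuous_dense_L2:
  fixes f :: "real \<Rightarrow> complex"
  assumes f: "f \<in> L2 (lborel_on {a<..<b})" and e: "e > 0"
  obtains c where "continuous_on UNIV c" "(LINT x|lborel_on {a<..<b}. (norm (f x - c x))\<^sup>2) < e"
proof -
  interpret finite_measure "lborel_on {a<..<b}" by (rule finite_measure_interval)
  \<comment> \<open>Radial retraction onto the disc of radius \<open>Suc k\<close>: continuous,
    bounded, and the identity on the disc.\<close>
  define cl :: "nat \<Rightarrow> complex \<Rightarrow> complex" where "cl k z = (1 / max 1 (cmod z / Suc k)) *\<^sub>R z" for k z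
  have clc: "continuous_on UNIV (cl k)" for k unfolding cl_def by (intro continuous_intros) (auto simp: max_def)
  have clb: "cmod (cl k z) \<le> Suc k" for k z
  proof (cases "cmod z / Suc k \<le> 1")
    case True
    then show ?thesis by (simp add: cl_def max_def divide_le_eq)
  next
    case False
    then have "cmod (cl k z) = (1 / (cmod z / Suc k)) * cmod z" by (simp add: cl_def max_def)
    also have "\<dots> \<le> Suc k" using False by simp
    finally show ?thesis .
  qed
  have clid: "cl k z = z" if "cmod z \<le> Suc k" for k z using that by (simp add: cl_def max_def divide_le_eq)
  have cld: "cmod (z - cl k z) \<le> cmod z" for k z
  proof -
    define u where "u = 1 / max 1 (cmod z / Suc k)"
    have u: "0 \<le> u" "u \<le> 1" by (auto simp: u_def)
    have "z - cl k z = (1 - u) *\<^sub>R z" by (simp add: cl_def u_def scaleR_diff_left)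
    then show ?thesis using u by (simp add: mult_left_le_one_le)
  qed
  note fm[measurable] = L2_measurable[OF f]
  have clm[measurable]: "cl k \<in> borel_measurable borel" for k by (intro borel_measurable_continuous_onI clc)
  have "(\<lambda>k. LINT x|lborel_on {a<..<b}. (cmod (f x - cl k (f x)))\<^sup>2) \<longlonglongrightarrow> (LINT x|lborel_on {a<..<b}. 0)"
  proof (rule integral_dominated_convergence[where w = "\<lambda>x. (cmod (f x))\<^sup>2"])
    show "integrable (lborel_on {a<..<b}) (\<lambda>x. (cmod (f x))\<^sup>2)" by (rule L2_integrable[OF f])
    show "AE x in lborel_on {a<..<b}. norm ((cmod (f x - cl k (f x)))\<^sup>2) \<le> (cmod (f x))\<^sup>2" for k
      using cld by (intro AE_I2) (simp add: power_mono)
    show "AE x in lborel_on {a<..<b}. (\<lambda>k. (cmod (f x - cl k (f x)))\<^sup>2) \<longlonglongrightarrow> 0"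
    proof (rule AE_I2)
      fix x
      obtain N where N: "cmod (f x) \<le> real N" using real_arch_simple by blast
      have "\<forall>\<^sub>F k in sequentially. (cmod (f x - cl k (f x)))\<^sup>2 = 0"
        unfolding eventually_sequentially using N by (intro exI[of _ N]) (auto simp: clid)
      then show "(\<lambda>k. (cmod (f x - cl k (f x)))\<^sup>2) \<longlonglongrightarrow> 0" by (rule tendsto_eventually)
    qed
  qed simp_all
  then have "\<forall>\<^sub>F k in sequentially. (LINT x|lborel_on {a<..<b}. (cmod (f x - cl k (f x)))\<^sup>2) < e / 4"
    by (rule order_tendstoD(2)) (use e in simp)
  then obtain k where k: "(LINT x|lborel_on {a<..<b}. (cmod (f x - cl k (f x)))\<^sup>2) < e / 4"
    by (auto simp: eventually_sequentially)
  define F where "F x = (if x \<in> {a<..<b} then f x else 0)" for x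
  have "F \<in> borel_measurable lborel"
  proof -
    have "(\<lambda>x. indicator {a<..<b} x *\<^sub>R f x) \<in> borel_measurable lborel"
      using fm by (subst borel_measurable_restrict_space_iff[symmetric]) auto
    moreover have "(\<lambda>x. indicator {a<..<b} x *\<^sub>R f x) = F" by (auto simp: F_def)
    ultimately show ?thesis by simp
  qed
  then have "F \<in> borel_measurable lebesgue" by (rule measurable_completion)
  then have "F measurable_on UNIV" by (subst measurable_on_iff_borel_measurable) auto
  then obtain N g where N: "negligible N" and g: "\<And>n. continuous_on UNIV (g n)"
    and lim: "\<And>x. x \<notin> N \<Longrightarrow> (\<lambda>n. g n x) \<longlonglongrightarrow> F x"
    unfolding measurable_on_def by auto
  have "AE x in lebesgue. x \<notin> N" using N by (auto intro!: AE_not_in simp: negligible_iff_null_sets)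
  then have aeN: "AE x in lborel. x \<notin> N" by (simp add: AE_completion_iff)
  have gm[measurable]: "g n \<in> borel_measurable borel" for n by (intro borel_measurable_continuous_onI g)
  have [measurable]: "(\<lambda>x. cl k (g n x)) \<in> borel_measurable (lborel_on {a<..<b})" for n
    by (intro measurable_lborel_on) simp
  have "(\<lambda>n. LINT x|lborel_on {a<..<b}. (cmod (cl k (f x) - cl k (g n x)))\<^sup>2) \<longlonglongrightarrow> (LINT x|lborel_on {a<..<b}. 0)"
  proof (rule integral_dominated_convergence[where w = "\<lambda>x. (2 * real (Suc k))\<^sup>2"])
    show "integrable (lborel_on {a<..<b}) (\<lambda>x. (2 * real (Suc k))\<^sup>2)" by simp
    show "AE x in lborel_on {a<..<b}. norm ((cmod (cl k (f x) - cl k (g n x)))\<^sup>2) \<le> (2 * real (Suc k))\<^sup>2" for n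
    proof (rule AE_I2)
      fix x
      have "cmod (cl k (f x) - cl k (g n x)) \<le> real (Suc k) + real (Suc k)"
        by (rule order_trans[OF norm_triangle_ineq4]) (intro add_mono clb)
      then have "cmod (cl k (f x) - cl k (g n x)) \<le> 2 * real (Suc k)" by simp
      from power_mono[OF this norm_ge_zero, of 2]
      show "norm ((cmod (cl k (f x) - cl k (g n x)))\<^sup>2) \<le> (2 * real (Suc k))\<^sup>2" by simp
    qed
    show "AE x in lborel_on {a<..<b}. (\<lambda>n. (cmod (cl k (f x) - cl k (g n x)))\<^sup>2) \<longlonglongrightarrow> 0"
    proof -
      have "AE x in lborel_on {a<..<b}. x \<notin> N" by (rule AE_lborel_on[OF _ aeN]) simp
      moreover have "AE x in lborel_on {a<..<b}. x \<in> {a<..<b}" by (rule AE_I2) simp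
      ultimately show ?thesis
      proof eventually_elim
        case (elim x)
        then have "(\<lambda>n. g n x) \<longlonglongrightarrow> f x" using lim[of x] by (simp add: F_def)
        then have "(\<lambda>n. cl k (g n x)) \<longlonglongrightarrow> cl k (f x)"
          by (rule continuous_on_tendsto_compose[OF clc]) auto
        then have "(\<lambda>n. (cmod (cl k (f x) - cl k (g n x)))\<^sup>2) \<longlonglongrightarrow> (cmod (cl k (f x) - cl k (f x)))\<^sup>2"
          by (intro tendsto_intros)
        then show ?case by simp
      qed
    qed
  qed simp_all
  then have "\<forall>\<^sub>F n in sequentially. (LINT x|lborel_on {a<..<b}. (cmod (cl k (f x) - cl k (g n x)))\<^sup>2) < e / 4"
    by (rule order_tendstoD(2)) (use e in simp)
  then obtain n where n: "(LINT x|lborel_on {a<..<b}. (cmod (cl k (f x) - cl k (g n x)))\<^sup>2) < e / 4"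
    by (auto simp: eventually_sequentially)
  have L1: "(\<lambda>x. cl k (f x)) \<in> L2 (lborel_on {a<..<b})" "(\<lambda>x. cl k (g n x)) \<in> L2 (lborel_on {a<..<b})"
    by (rule L2_bounded_interval[OF _ clb], simp)+
  have "(LINT x|lborel_on {a<..<b}. (cmod ((f x - cl k (f x)) + (cl k (f x) - cl k (g n x))))\<^sup>2)
      \<le> 2 * (LINT x|lborel_on {a<..<b}. (cmod (f x - cl k (f x)))\<^sup>2) + 2 * (LINT x|lborel_on {a<..<b}. (cmod (cl k (f x) - cl k (g n x)))\<^sup>2)"
    by (rule L2_add(2)[OF L2_diff(1)[OF f L1(1)] L2_diff(1)[OF L1]])
  also have "\<dots> < e" using k n by simp
  finally have "(LINT x|lborel_on {a<..<b}. (norm (f x - cl k (g n x)))\<^sup>2) < e" by simp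
  moreover have "continuous_on UNIV (\<lambda>x. cl k (g n x))" by (rule continuous_on_comp_UNIV[OF clc g])
  ultimately show ?thesis by (rule that[rotated])
qed

lemma polynomial_approx:
  fixes c :: "real \<Rightarrow> complex"
  assumes c: "continuous_on {0..b} c" and e: "e > 0"
  obtains P :: "complex poly" where "\<And>s. s \<in> {0..b} \<Longrightarrow> cmod (c s - poly P (complex_of_real s)) < e"
proof -
  have rp: "\<exists>Q :: real poly. \<forall>s\<in>{0..b}. \<bar>g s - poly Q s\<bar> < e / 2" if g: "continuous_on {0..b} g" for g :: "real \<Rightarrow> real"
  proof -
    obtain h where h: "real_polynomial_function h" "\<And>x. x \<in> {0..b} \<Longrightarrow> \<bar>g x - h x\<bar> < e / 2"
      by (rule Stone_Weierstrass_real_polynomial_function[OF compact_Icc g, of "e / 2"]) (use e in auto)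
    then obtain a n where a: "h = (\<lambda>x. \<Sum>i\<le>n. a i * x ^ i)" unfolding real_polynomial_function_iff_sum by blast
    have "poly (\<Sum>i\<le>n. monom (a i) i) x = h x" for x by (simp add: a poly_sum poly_monom)
    then show ?thesis using h(2) by (intro exI[of _ "\<Sum>i\<le>n. monom (a i) i"]) simp
  qed
  obtain Q1 Q2 :: "real poly" where Q: "\<And>s. s \<in> {0..b} \<Longrightarrow> \<bar>Re (c s) - poly Q1 s\<bar> < e / 2" "\<And>s. s \<in> {0..b} \<Longrightarrow> \<bar>Im (c s) - poly Q2 s\<bar> < e / 2"
    using rp[OF continuous_on_Re[OF c]] rp[OF continuous_on_Im[OF c]] by blast
  have mp: "poly (map_poly complex_of_real Q) (complex_of_real s) = complex_of_real (poly Q s)" for Q s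
    by (induction Q) (simp_all add: map_poly_pCons)
  show ?thesis
  proof (rule that[of "map_poly complex_of_real Q1 + smult \<i> (map_poly complex_of_real Q2)"])
    fix s assume s: "s \<in> {0..b}"
    let ?z = "c s - poly (map_poly complex_of_real Q1 + smult \<i> (map_poly complex_of_real Q2)) (complex_of_real s)"
    have R: "Re ?z = Re (c s) - poly Q1 s" and I: "Im ?z = Im (c s) - poly Q2 s" by (simp_all add: mp)
    have "cmod ?z \<le> \<bar>Re ?z\<bar> + \<bar>Im ?z\<bar>" by (rule cmod_le)
    also have "\<dots> = \<bar>Re (c s) - poly Q1 s\<bar> + \<bar>Im (c s) - poly Q2 s\<bar>" unfolding R I ..
    also have "\<dots> < e" using Q(1)[OF s] Q(2)[OF s] by linarith
    finally show "cmod ?z < e" .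
  qed
qed

text \<open>On the interval \<open>T - x\<close> is the square root of its square, so Weierstrass
  approximation in the variable \<open>(T - x)\<^sup>2\<close> suffices. Even powers are what the
  transform offers: its Taylor coefficients of even and odd order see the difference and the sum of
  the two controls.\<close>

lemma even_polynomials_dense_L2:
  fixes f :: "real \<Rightarrow> complex"
  assumes f: "f \<in> L2 (lborel_on {0<..<T})" and e: "e > 0"
  obtains P :: "complex poly" where "(LINT x|lborel_on {0<..<T}. (norm (f x - poly P (complex_of_real ((T - x)\<^sup>2))))\<^sup>2) < e"
proof -
  interpret finite_measure "lborel_on {0<..<T}" by (rule finite_measure_interval)
  obtain c where c: "continuous_on UNIV c" "(LINT x|lborel_on {0<..<T}. (norm (f x - c x))\<^sup>2) < e / 4"
    using continuous_dense_L2[OF f, of "e / 4"] e by auto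
  \<comment> \<open>\<open>m\<close> exceeds the length by 1 to be positive; with \<open>d\<close>
    chosen from it the uniform error contributes at most \<open>e / 4\<close>.\<close>
  define m where "m = measure (lborel_on {0<..<T}) {0<..<T} + 1"
  have m: "m > 0" by (simp add: m_def add_nonneg_pos)
  define d where "d = sqrt (e / (4 * m))"
  have d: "d > 0" "d\<^sup>2 = e / (4 * m)" using e m by (simp_all add: d_def)
  have "continuous_on {0..T\<^sup>2} (\<lambda>s. c (T - sqrt s))"
    by (intro continuous_on_comp_UNIV[OF c(1)] continuous_intros)
  from polynomial_approx[OF this d(1)] obtain P where P: "\<And>s. s \<in> {0..T\<^sup>2} \<Longrightarrow> cmod (c (T - sqrt s) - poly P (complex_of_real s)) < d" by blast
  let ?P = "\<lambda>x. poly P (complex_of_real ((T - x)\<^sup>2))"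
  have b: "cmod (c x - ?P x) < d" if "x \<in> {0<..<T}" for x
  proof -
    have "(T - x)\<^sup>2 \<le> T\<^sup>2" using that by (intro power_mono) auto
    then show ?thesis using P[of "(T - x)\<^sup>2"] that by simp
  qed
  have cL: "c \<in> L2 (lborel_on {0<..<T})" by (rule L2_continuous[OF continuous_on_subset[OF c(1)]]) simp
  have PL: "?P \<in> L2 (lborel_on {0<..<T})" by (rule L2_continuous) (intro continuous_intros)
  have "(LINT x|lborel_on {0<..<T}. (cmod (c x - ?P x))\<^sup>2) \<le> (LINT x|lborel_on {0<..<T}. d\<^sup>2)"
    by (rule integral_mono[OF L2_integrable[OF L2_diff(1)[OF cL PL]]]) (use b in \<open>auto intro!: power_mono simp: less_imp_le\<close>)
  also have "\<dots> = (m - 1) * d\<^sup>2" by (simp add: m_def)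
  also have "\<dots> \<le> m * d\<^sup>2" by (intro mult_right_mono) auto
  also have "\<dots> = e / 4" using m by (simp add: d)
  finally have 2: "(LINT x|lborel_on {0<..<T}. (cmod (c x - ?P x))\<^sup>2) \<le> e / 4" .
  have "(LINT x|lborel_on {0<..<T}. (cmod ((f x - c x) + (c x - ?P x)))\<^sup>2)
      \<le> 2 * (LINT x|lborel_on {0<..<T}. (cmod (f x - c x))\<^sup>2) + 2 * (LINT x|lborel_on {0<..<T}. (cmod (c x - ?P x))\<^sup>2)"
    by (rule L2_add(2)[OF L2_diff(1)[OF f cL] L2_diff(1)[OF cL PL]])
  also have "\<dots> < e" using c(2) 2 by simp
  finally show ?thesis by (intro that[of P]) simp
qed

text \<open>The squared norm of \<open>f\<close> equals the integral of
  \<open>f * (cnj f - P)\<close> for every even polynomial \<open>P\<close> in \<open>T - s\<close>,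
  and the second factor can be made small.\<close>

lemma even_moments_zero:
  fixes f :: "real \<Rightarrow> complex"
  assumes f: "f \<in> L2 (lborel_on {0<..<T})"
    and mom: "\<And>n. (LINT s|lborel_on {0<..<T}. complex_of_real ((T - s) ^ (2 * n)) * f s) = 0"
  shows "AE s in lborel_on {0<..<T}. f s = 0"
proof -
  note [measurable] = L2_measurable[OF f]
  let ?M = "lborel_on {0<..<T}"
  have wL: "(\<lambda>s. complex_of_real ((T - s) ^ n)) \<in> L2 ?M" for n by (rule L2_continuous) (intro continuous_intros)
  have int: "integrable ?M (\<lambda>s. complex_of_real ((T - s) ^ n) * f s)" for n
    using L2_measurable[OF wL[of n]] by (intro cauchy_schwarz_L2(1)[OF wL[of n] f]) (auto simp: norm_mult)
  have pz: "integrable ?M (\<lambda>s. poly P (complex_of_real ((T - s)\<^sup>2)) * f s) \<and> (LINT s|?M. poly P (complex_of_real ((T - s)\<^sup>2)) * f s) = 0" for P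
  proof -
    have "poly P (complex_of_real ((T - s)\<^sup>2)) * f s = (\<Sum>i\<le>degree P. coeff P i * (complex_of_real ((T - s) ^ (2 * i)) * f s))" for s
      by (simp add: poly_altdef sum_distrib_right power_mult mult.assoc)
    then show ?thesis using int mom by simp
  qed
  let ?A = "LINT s|?M. (cmod (f s))\<^sup>2"
  have A0: "?A \<ge> 0" by (intro integral_nonneg_AE) auto
  have fc: "(\<lambda>s. cnj (f s)) \<in> L2 ?M" by (rule L2_bounded_linear(1)[OF f bounded_linear_cnj])
  have "?A\<^sup>2 \<le> ?A * e" if e: "e > 0" for e
  proof -
    obtain P where P: "(LINT x|?M. (norm (cnj (f x) - poly P (complex_of_real ((T - x)\<^sup>2))))\<^sup>2) < e"
      using even_polynomials_dense_L2[OF fc e] by blast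
    let ?P = "\<lambda>x. poly P (complex_of_real ((T - x)\<^sup>2))"
    have PL: "?P \<in> L2 ?M" by (rule L2_continuous) (intro continuous_intros)
    have DL: "(\<lambda>s. cnj (f s) - ?P s) \<in> L2 ?M" by (rule L2_diff(1)[OF fc PL])
    have m: "(\<lambda>s. f s * (cnj (f s) - ?P s)) \<in> borel_measurable ?M"
      using L2_measurable[OF DL] by simp
    note cs = cauchy_schwarz_L2[OF f DL m]
    have if2: "integrable ?M (\<lambda>s. complex_of_real ((cmod (f s))\<^sup>2))" by (rule integrable_of_real[OF L2_integrable[OF f]])
    have "(LINT s|?M. f s * (cnj (f s) - ?P s)) = (LINT s|?M. complex_of_real ((cmod (f s))\<^sup>2) - ?P s * f s)"
      by (intro Bochner_Integration.integral_cong refl) (simp add: complex_norm_square algebra_simps del: of_real_power)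
    also have "\<dots> = complex_of_real ?A"
      using pz[of P] if2 by (subst Bochner_Integration.integral_diff) (simp_all del: of_real_power)
    finally have "cmod (LINT s|?M. f s * (cnj (f s) - ?P s)) = ?A" using A0 by simp
    then have "?A\<^sup>2 \<le> ?A * (LINT s|?M. (cmod (cnj (f s) - ?P s))\<^sup>2)"
      using cs(3) by (simp add: norm_mult)
    also have "\<dots> \<le> ?A * e" using P A0 by (intro mult_left_mono) auto
    finally show ?thesis .
  qed
  then have "?A\<^sup>2 \<le> 0 + e" if "e > 0" for e
  proof (cases "?A = 0")
    case False
    then have "?A > 0" using A0 by linarith
    then have "e / ?A > 0" using that by simp
    from \<open>\<And>e. e > 0 \<Longrightarrow> ?A\<^sup>2 \<le> ?A * e\<close>[OF this] show ?thesis using \<open>?A > 0\<close> by simp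
  qed (use that in simp)
  then have "?A\<^sup>2 \<le> 0" by (rule field_le_epsilon)
  then have "?A = 0" by simp
  then show ?thesis using L2_AE_eq_iff[OF f L2_zero] by simp
qed

text \<open>The factor \<open>s ^ d\<close> allows every polynomial times \<open>exp (- 1 / s)\<close> to be written in this form, and
  the form is stable under differentiation.\<close>

definition flat :: "nat \<Rightarrow> complex poly \<Rightarrow> real \<Rightarrow> complex" where
  "flat d B s = (if s > 0 then complex_of_real (s ^ d * exp (- (1 / s))) * poly B (complex_of_real (1 / s)) else 0)"

text \<open>In the variable y = 1/s the prefactor \<open>s ^ d * exp (- (1 / s))\<close> contributes
  its logarithmic derivative d y + y^2, and the chain rule turns the polynomial B(y) into - y^2
  B'(y).\<close>

definition flat_deriv :: "nat \<Rightarrow> complex poly \<Rightarrow> complex poly" where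
  "flat_deriv d B = smult (of_nat d) ([:0, 1:] * B) + [:0, 0, 1:] * (B - pderiv B)"

lemma poly_times_exp_tendsto_0:
  "((\<lambda>y::real. complex_of_real (y ^ k * exp (- y)) * poly B (complex_of_real y)) \<longlongrightarrow> 0) at_top"
proof (induction B arbitrary: k)
  case 0
  then show ?case by simp
next
  case (pCons c B)
  have "((\<lambda>y::real. complex_of_real (y ^ k * exp (- y))) \<longlongrightarrow> complex_of_real 0) at_top"
    using tendsto_power_div_exp_0[of k] by (intro tendsto_of_real) (simp add: exp_minus field_simps)
  then have "((\<lambda>y::real. complex_of_real (y ^ k * exp (- y)) * c + complex_of_real (y ^ Suc k * exp (- y)) * poly B (complex_of_real y)) \<longlongrightarrow> complex_of_real 0 * c + 0) at_top"
    by (intro tendsto_add tendsto_mult tendsto_const pCons.IH)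
  then show ?case by (simp add: algebra_simps)
qed

lemma flat_vector_derivative: "(flat d B has_vector_derivative flat d (flat_deriv d B) s) (at s)"
proof -
  consider "s < 0" | "s = 0" | "s > 0" by linarith
  then show ?thesis
  proof cases
    case 1
    have "((\<lambda>_. 0) has_vector_derivative (0::complex)) (at s)" by simp
    then have "(flat d B has_vector_derivative 0) (at s)"
      by (rule has_vector_derivative_transform_within_open[where S = "{..<0}"]) (use 1 in \<open>auto simp: flat_def\<close>)
    then show ?thesis using 1 by (simp add: flat_def)
  next
    case 2
    have "(flat d B has_derivative (\<lambda>h. h *\<^sub>R 0)) (at 0)"
      unfolding has_derivative_at_alt
    proof (intro conjI allI impI)
      show "bounded_linear (\<lambda>h::real. h *\<^sub>R (0::complex))" by simp
      fix e :: real assume e: "e > 0"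
      have "\<forall>\<^sub>F y in at_top. dist (complex_of_real (y ^ 1 * exp (- y)) * poly B (complex_of_real y)) 0 < e"
        by (rule tendstoD[OF poly_times_exp_tendsto_0 e])
      then obtain Y where Y: "\<And>y. y \<ge> Y \<Longrightarrow> cmod (complex_of_real (y * exp (- y)) * poly B (complex_of_real y)) < e"
        by (auto simp: eventually_at_top_linorder)
      define \<delta> where "\<delta> = min 1 (1 / max Y 1)"
      have "norm (flat d B h) \<le> e * norm h" if h: "norm h < \<delta>" for h
      proof (cases "h > 0")
        case True
        have hY: "1 / h \<ge> Y"
        proof -
          have "h < 1 / max Y 1" using h True by (simp add: \<delta>_def)
          then have "h * max Y 1 < 1" by (simp add: pos_less_divide_eq)
          then have "max Y 1 < 1 / h" unfolding pos_less_divide_eq[OF True] by (simp only: mult.commute)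
          then show ?thesis by simp
        qed
        have "\<delta> \<le> 1" by (simp add: \<delta>_def)
        then have h1: "h ^ d \<le> 1" using h True by (simp add: power_le_one)
        \<comment> \<open>One factor \<open>h\<close> is split off for the difference quotient at 0;
          besides \<open>h ^ d\<close> the rest is \<open>y * exp (- y)\<close> times the polynomial
          at \<open>y = 1 / h\<close>, which is small.\<close>
        have "flat d B h = complex_of_real (h ^ d) * (complex_of_real h * (complex_of_real (1 / h * exp (- (1 / h))) * poly B (complex_of_real (1 / h))))"
          using True by (simp add: flat_def)
        then have "norm (flat d B h) = h ^ d * (h * cmod (complex_of_real (1 / h * exp (- (1 / h))) * poly B (complex_of_real (1 / h))))"
          using True by (simp only: norm_mult norm_of_real) simp
        also have "\<dots> \<le> 1 * (h * e)"
          using True h1 less_imp_le[OF Y[OF hY]] by (intro mult_mono) auto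
        finally show ?thesis using True by (simp add: mult.commute)
      next
        case False
        then have "flat d B h = 0" by (simp add: flat_def)
        moreover have "0 \<le> e * norm h" using e by (intro mult_nonneg_nonneg) auto
        ultimately show ?thesis by simp
      qed
      moreover have "\<delta> > 0" by (simp add: \<delta>_def)
      ultimately show "\<exists>\<delta>>0. \<forall>y. norm (y - 0) < \<delta> \<longrightarrow> norm (flat d B y - flat d B 0 - (y - 0) *\<^sub>R 0) \<le> e * norm (y - 0)"
        by (intro exI[of _ \<delta>]) (simp add: flat_def)
    qed
    then show ?thesis using 2 by (simp add: has_vector_derivative_def flat_def)
  next
    case 3
    have r1: "((\<lambda>s. s ^ d * exp (- (1 / s))) has_real_derivative (s ^ d * exp (- (1 / s))) * (real d / s + 1 / s\<^sup>2)) (at s)"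
    proof -
      have "((\<lambda>s. s ^ d * exp (- (1 / s))) has_real_derivative (real d * s ^ (d - Suc 0)) * exp (- (1 / s)) + (exp (- (1 / s)) * (1 / s\<^sup>2)) * s ^ d) (at s)"
        using 3 by (auto intro!: derivative_eq_intros simp: power2_eq_square field_simps)
      moreover have "real d * s ^ (d - Suc 0) = s ^ d * (real d / s)" using 3 by (cases d) auto
      ultimately show ?thesis by (simp add: algebra_simps)
    qed
    then have d1: "((\<lambda>s. complex_of_real (s ^ d * exp (- (1 / s)))) has_vector_derivative complex_of_real ((s ^ d * exp (- (1 / s))) * (real d / s + 1 / s\<^sup>2))) (at s)"
      by (intro has_vector_derivative_of_real) (simp add: has_real_derivative_iff_has_vector_derivative)
    have "((\<lambda>s. 1 / s) has_real_derivative - (1 / s\<^sup>2)) (at s)"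
      using 3 by (auto intro!: derivative_eq_intros simp: power2_eq_square)
    then have "((\<lambda>s. complex_of_real (1 / s)) has_vector_derivative complex_of_real (- (1 / s\<^sup>2))) (at s)"
      by (intro has_vector_derivative_of_real) (simp add: has_real_derivative_iff_has_vector_derivative)
    from field_vector_diff_chain_at[OF this poly_DERIV[of B]]
    have d2: "((\<lambda>s. poly B (complex_of_real (1 / s))) has_vector_derivative complex_of_real (- (1 / s\<^sup>2)) * poly (pderiv B) (complex_of_real (1 / s))) (at s)"
      by (simp add: o_def)
    have "((\<lambda>s. complex_of_real (s ^ d * exp (- (1 / s))) * poly B (complex_of_real (1 / s))) has_vector_derivative
        (complex_of_real (s ^ d * exp (- (1 / s))) * (complex_of_real (- (1 / s\<^sup>2)) * poly (pderiv B) (complex_of_real (1 / s))) +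
         complex_of_real ((s ^ d * exp (- (1 / s))) * (real d / s + 1 / s\<^sup>2)) * poly B (complex_of_real (1 / s)))) (at s)"
      by (rule has_vector_derivative_mult[OF d1 d2])
    moreover have "(complex_of_real (s ^ d * exp (- (1 / s))) * (complex_of_real (- (1 / s\<^sup>2)) * poly (pderiv B) (complex_of_real (1 / s))) +
         complex_of_real ((s ^ d * exp (- (1 / s))) * (real d / s + 1 / s\<^sup>2)) * poly B (complex_of_real (1 / s))) = flat d (flat_deriv d B) s"
      using 3 by (simp add: flat_def flat_deriv_def power2_eq_square algebra_simps add_divide_distrib)
    ultimately have "((\<lambda>s. complex_of_real (s ^ d * exp (- (1 / s))) * poly B (complex_of_real (1 / s))) has_vector_derivative flat d (flat_deriv d B) s) (at s)"
      by (simp only:)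
    then show ?thesis
      by (rule has_vector_derivative_transform_within_open[where S = "{0<..}"]) (use 3 in \<open>auto simp: flat_def\<close>)
  qed
qed

lemma smooth_control_flat:
  assumes m: "m > 0"
  shows "smooth_control T (\<lambda>t. flat d B (m * t - 1))"
  unfolding smooth_control_def
proof (intro conjI exI[of _ "\<lambda>k t. complex_of_real (m ^ k) * flat d ((flat_deriv d ^^ k) B) (m * t - 1)"] exI[of _ "1 / m"] allI ballI impI)
  fix k t
  have "((\<lambda>t. m * t - 1) has_vector_derivative m) (at t within {0..T})"
    unfolding has_real_derivative_iff_has_vector_derivative[symmetric] by (auto intro!: derivative_eq_intros)
  from vector_diff_chain_within[OF this has_vector_derivative_at_within[OF flat_vector_derivative]]
  have "((\<lambda>t. flat d ((flat_deriv d ^^ k) B) (m * t - 1)) has_vector_derivative m *\<^sub>R flat d (flat_deriv d ((flat_deriv d ^^ k) B)) (m * t - 1)) (at t within {0..T})"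
    by (simp add: o_def)
  from has_vector_derivative_mult_right[OF this, of "complex_of_real (m ^ k)"]
  show "((\<lambda>t. complex_of_real (m ^ k) * flat d ((flat_deriv d ^^ k) B) (m * t - 1)) has_vector_derivative
      complex_of_real (m ^ Suc k) * flat d ((flat_deriv d ^^ Suc k) B) (m * t - 1)) (at t within {0..T})"
    by (simp add: scaleR_conv_of_real mult_ac)
qed (use m in \<open>auto simp: flat_def field_simps\<close>)

lemma smooth_control_continuous:
  assumes "smooth_control T f" shows "continuous_on {0..T} f"
proof -
  obtain D where D: "\<forall>t\<in>{0..T}. D 0 t = f t"
    "\<forall>k. \<forall>t\<in>{0..T}. (D k has_vector_derivative D (Suc k) t) (at t within {0..T})"
    using assms unfolding smooth_control_def by blast
  have "continuous_on {0..T} (D 0)"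
    unfolding continuous_on_eq_continuous_within using D(2) has_vector_derivative_continuous by blast
  then show ?thesis by (rule continuous_on_eq) (use D in auto)
qed

text \<open>An even polynomial \<open>p\<close> close to \<open>f\<close> is multiplied by
  \<open>exp (- (1 / (m * t - 1)))\<close> for \<open>t > 1 / m\<close>, with
  \<open>m = Suc n\<close>, and by 0 before. The cut-off is at most 1 and tends to 1 at every
  \<open>t > 0\<close>, so dominated convergence applies.\<close>

lemma smooth_controls_dense:
  fixes f :: "real \<Rightarrow> complex"
  assumes f: "f \<in> L2 (lborel_on {0<..<T})"
  obtains F where "\<And>n. smooth_control T (F n)" "L2_tendsto (lborel_on {0<..<T}) F f"
proof -
  let ?M = "lborel_on {0<..<T}"
  have "\<exists>g. smooth_control T g \<and> (LINT x|?M. (norm (g x - f x))\<^sup>2) < e" if e: "e > 0" for e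
  proof -
    obtain P where P: "(LINT x|?M. (norm (f x - poly P (complex_of_real ((T - x)\<^sup>2))))\<^sup>2) < e / 4"
      using even_polynomials_dense_L2[OF f, of "e / 4"] e by auto
    define p where "p t = poly P (complex_of_real ((T - t)\<^sup>2))" for t
    have pc: "continuous_on A p" for A unfolding p_def by (intro continuous_intros)
    have pL: "p \<in> L2 ?M" by (rule L2_continuous[OF pc])
    \<comment> \<open>\<open>P2\<close> is \<open>p\<close> as a polynomial in
      \<open>s = m * t - 1\<close>, because \<open>T - t = T - 1 / m - s / m\<close>. The reflected
      polynomial at \<open>1 / s\<close>, multiplied by \<open>s\<close> to the degree, reproduces
      it; this is the shape required by \<open>flat\<close>.\<close>
    define P2 where "P2 m = pcompose P (([:complex_of_real T - 1 / m, - 1 / m:])\<^sup>2)" for m :: complex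
    define g where "g n t = flat (degree (P2 (of_nat (Suc n)))) (reflect_poly (P2 (of_nat (Suc n)))) (real (Suc n) * t - 1)" for n t
    have ge: "g n t = (if real (Suc n) * t - 1 > 0 then complex_of_real (exp (- (1 / (real (Suc n) * t - 1)))) * p t else 0)" for n t
    proof (cases "real (Suc n) * t - 1 > 0")
      case True
      define s where "s = real (Suc n) * t - 1"
      have s: "s > 0" using True by (simp add: s_def)
      have "t = (s + 1) / real (Suc n)" by (simp add: s_def)
      then have t: "complex_of_real T - 1 / of_nat (Suc n) - complex_of_real s / of_nat (Suc n) = complex_of_real (T - t)"
        by (simp add: add_divide_distrib)
      have "poly (P2 (of_nat (Suc n))) (complex_of_real s) = p t"
        unfolding P2_def p_def poly_pcompose using t by (simp add: algebra_simps)
      moreover have "poly (reflect_poly (P2 (of_nat (Suc n)))) (complex_of_real (1 / s)) = complex_of_real (1 / s) ^ degree (P2 (of_nat (Suc n))) * poly (P2 (of_nat (Suc n))) (inverse (complex_of_real (1 / s)))"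
        using s by (intro poly_reflect_poly_nz) simp
      ultimately have "flat (degree (P2 (of_nat (Suc n)))) (reflect_poly (P2 (of_nat (Suc n)))) s = complex_of_real (exp (- (1 / s))) * p t"
        using s by (simp add: flat_def power_divide inverse_eq_divide)
      then show ?thesis using s by (simp add: g_def s_def)
    qed (simp add: g_def flat_def)
    have gs: "smooth_control T (g n)" for n
      unfolding g_def using smooth_control_flat[of "real (Suc n)"] by simp
    have gL: "g n \<in> L2 ?M" for n by (rule L2_continuous[OF smooth_control_continuous[OF gs]])
    have "(\<lambda>n. LINT x|?M. (cmod (p x - g n x))\<^sup>2) \<longlonglongrightarrow> (LINT x|?M. 0)"
    proof (rule integral_dominated_convergence[where w = "\<lambda>x. (2 * cmod (p x))\<^sup>2"])
      show "integrable ?M (\<lambda>x. (2 * cmod (p x))\<^sup>2)"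
        using L2_integrable[OF pL] by (simp add: power_mult_distrib)
      show "(\<lambda>x. (cmod (p x - g n x))\<^sup>2) \<in> borel_measurable ?M" for n
        using borel_measurable_integrable[OF L2_integrable[OF L2_diff(1)[OF pL gL]]] .
      show "AE x in ?M. norm ((cmod (p x - g n x))\<^sup>2) \<le> (2 * cmod (p x))\<^sup>2" for n
      proof (rule AE_I2)
        fix x
        have "cmod (g n x) \<le> cmod (p x)" by (simp add: ge norm_mult mult_left_le_one_le)
        then have "cmod (p x - g n x) \<le> 2 * cmod (p x)" using norm_triangle_ineq4[of "p x" "g n x"] by linarith
        from power_mono[OF this norm_ge_zero, of 2] show "norm ((cmod (p x - g n x))\<^sup>2) \<le> (2 * cmod (p x))\<^sup>2" by simp
      qed
      show "AE x in ?M. (\<lambda>n. (cmod (p x - g n x))\<^sup>2) \<longlonglongrightarrow> 0"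
      proof (rule AE_I2)
        fix x assume "x \<in> space ?M"
        then have x: "x > 0" by simp
        have lim: "LIM n sequentially. real (Suc n) * x - 1 :> at_top"
        proof -
          have "LIM n sequentially. -1 + x * real (Suc n) :> at_top"
            by (intro filterlim_tendsto_add_at_top[OF tendsto_const] filterlim_tendsto_pos_mult_at_top[OF tendsto_const x]
              filterlim_compose[OF filterlim_real_sequentially filterlim_Suc])
          then show ?thesis by (simp add: algebra_simps)
        qed
        have "(\<lambda>n. complex_of_real (exp (- (1 / (real (Suc n) * x - 1)))) * p x) \<longlonglongrightarrow> complex_of_real (exp (- 0)) * p x"
          by (intro tendsto_intros tendsto_divide_0[OF tendsto_const filterlim_at_top_imp_at_infinity[OF lim]])
        moreover have "\<forall>\<^sub>F n in sequentially. complex_of_real (exp (- (1 / (real (Suc n) * x - 1)))) * p x = g n x"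
          using filterlim_at_top_dense[THEN iffD1, OF lim, rule_format, of 0] by eventually_elim (simp add: ge)
        ultimately have "(\<lambda>n. g n x) \<longlonglongrightarrow> p x" by (simp add: tendsto_cong)
        from tendsto_power[OF tendsto_norm[OF tendsto_diff[OF tendsto_const[of "p x"] this]], of 2]
        show "(\<lambda>n. (cmod (p x - g n x))\<^sup>2) \<longlonglongrightarrow> 0" by simp
      qed
    qed simp
    then have "\<forall>\<^sub>F n in sequentially. (LINT x|?M. (cmod (p x - g n x))\<^sup>2) < e / 4"
      by (rule order_tendstoD(2)) (use e in simp)
    then obtain n where n: "(LINT x|?M. (cmod (p x - g n x))\<^sup>2) < e / 4" by (auto simp: eventually_sequentially)
    have "(LINT x|?M. (cmod ((f x - p x) + (p x - g n x)))\<^sup>2) \<le> 2 * (LINT x|?M. (cmod (f x - p x))\<^sup>2) + 2 * (LINT x|?M. (cmod (p x - g n x))\<^sup>2)"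
      by (rule L2_add(2)[OF L2_diff(1)[OF f pL] L2_diff(1)[OF pL gL]])
    also have "\<dots> < e" using n P by (simp add: p_def)
    finally have "(LINT x|?M. (norm (g n x - f x))\<^sup>2) < e" by (simp add: norm_minus_commute)
    then show ?thesis using gs by blast
  qed
  then have "\<forall>n. \<exists>g. smooth_control T g \<and> (LINT x|?M. (norm (g x - f x))\<^sup>2) < 1 / Suc n" by simp
  from choice[OF this] obtain F where F: "\<And>n. smooth_control T (F n)" "\<And>n. (LINT x|?M. (norm (F n x - f x))\<^sup>2) < 1 / Suc n" by blast
  have "(\<lambda>n. LINT x|?M. (norm (F n x - f x))\<^sup>2) \<longlonglongrightarrow> 0"
  proof (rule tendsto_sandwich[OF _ _ tendsto_const LIMSEQ_Suc[OF lim_1_over_n]])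
    show "\<forall>\<^sub>F n in sequentially. 0 \<le> (LINT x|?M. (norm (F n x - f x))\<^sup>2)" by (intro always_eventually allI integral_nonneg_AE) auto
    show "\<forall>\<^sub>F n in sequentially. (LINT x|?M. (norm (F n x - f x))\<^sup>2) \<le> 1 / real (Suc n)"
      using F(2) by (intro always_eventually allI less_imp_le)
  qed
  then have "L2_tendsto ?M F f"
    unfolding L2_tendsto_iff using f L2_continuous[OF smooth_control_continuous[OF F(1)]] by blast
  with F(1) show ?thesis by (rule that)
qed

section \<open>The transform\<close>

lemma L2_component: "f \<in> L2 M \<Longrightarrow> (\<lambda>x. f x $ k) \<in> L2 M" for f :: "real \<Rightarrow> complex^2"
  by (rule L2_bounded_linear(1)[OF _ bounded_linear_vec_nth])

lemma vector_2_eq: "(vector [a, b] :: complex^2) = axis 1 a + axis 2 b"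
  by (simp add: vec_eq_iff forall_2 axis_def)

lemma bounded_linear_axis: "bounded_linear (axis k :: complex \<Rightarrow> complex^2)"
  by (rule linear_conv_bounded_linear[THEN iffD1], rule linearI) (auto simp: vec_eq_iff axis_def)

lemma L2_vector:
  assumes "g \<in> L2 M" "h \<in> L2 M"
  shows "(\<lambda>x. vector [g x, h x] :: complex^2) \<in> L2 M"
  unfolding vector_2_eq
  by (intro L2_add(1) L2_bounded_linear(1)[OF assms(1) bounded_linear_axis] L2_bounded_linear(1)[OF assms(2) bounded_linear_axis])

lemma norm_vec2_sq: "(norm (v :: complex^2))\<^sup>2 = (cmod (v $ 1))\<^sup>2 + (cmod (v $ 2))\<^sup>2"
  by (simp add: norm_vec_def L2_set_def sum_2)

lemma L2_integrable_interval:
  fixes f :: "real \<Rightarrow> 'a::{banach,second_countable_topology}"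
  assumes "f \<in> L2 (lborel_on {a<..<b})"
  shows "integrable (lborel_on {a<..<b}) f"
proof -
  interpret finite_measure "lborel_on {a<..<b}" by (rule finite_measure_interval)
  have "(\<lambda>x. 1::real) \<in> L2 (lborel_on {a<..<b})" by (simp add: L2_def)
  from cauchy_schwarz_L2(1)[OF assms this L2_measurable[OF assms]] show ?thesis by simp
qed

text \<open>The exponentials are expanded and integrated term by term. The expansion shows that the
  transform is entire, and its coefficients are moments in \<open>T - s\<close>, which determine the
  control.\<close>

lemma dirac_transform_power_series:
  assumes f: "f \<in> L2 (lborel_on {0<..<T})" and T: "T > 0"
  shows "(\<lambda>n. ((\<i> ^ Suc n * (LINT s|lborel_on {0<..<T}. complex_of_real ((T - s) ^ n) * f s $ 1)
      + (- \<i>) ^ Suc n * (LINT s|lborel_on {0<..<T}. complex_of_real ((T - s) ^ n) * f s $ 2)) / fact n) * l ^ n)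
     sums dirac_transform T f l"
proof -
  let ?M = "lborel_on {0<..<T}"
  note fi = L2_integrable_interval[OF L2_component[OF f]]
  have wm: "(\<lambda>s. complex_of_real ((T - s) ^ n)) \<in> borel_measurable ?M" for n
    by (intro measurable_lborel_on borel_measurable_continuous_onI continuous_intros)
  have wi: "integrable ?M (\<lambda>s. complex_of_real ((T - s) ^ n) * f s $ k)" for n k
  proof (rule Bochner_Integration.integrable_bound[where f = "\<lambda>s. complex_of_real (T ^ n) * f s $ k"])
    show "integrable ?M (\<lambda>s. complex_of_real (T ^ n) * f s $ k)" using fi by simp
    show "AE s in ?M. norm (complex_of_real ((T - s) ^ n) * f s $ k) \<le> norm (complex_of_real (T ^ n) * f s $ k)"
      by (rule AE_I2) (auto simp: norm_mult norm_power simp del: of_real_diff intro!: mult_right_mono power_mono)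
  qed (use wm fi[of k] in simp)
  define g where "g n s = (\<i> ^ Suc n * (complex_of_real ((T - s) ^ n) * f s $ 1) + (- \<i>) ^ Suc n * (complex_of_real ((T - s) ^ n) * f s $ 2)) / fact n * l ^ n" for n s
  have gi: "integrable ?M (g n)" for n unfolding g_def using wi by simp
  have gint: "(LINT s|?M. g n s) = ((\<i> ^ Suc n * (LINT s|?M. complex_of_real ((T - s) ^ n) * f s $ 1)
      + (- \<i>) ^ Suc n * (LINT s|?M. complex_of_real ((T - s) ^ n) * f s $ 2)) / fact n) * l ^ n" for n
    unfolding g_def using wi by simp
  have gb: "norm (g n s) \<le> (T * cmod l) ^ n / fact n * (cmod (f s $ 1) + cmod (f s $ 2))" if s: "s \<in> {0<..<T}" for n s
  proof -
    have t: "\<bar>T - s\<bar> ^ n \<le> T ^ n" using s by (intro power_mono) auto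
    have "norm (\<i> ^ Suc n * (complex_of_real ((T - s) ^ n) * f s $ 1) + (- \<i>) ^ Suc n * (complex_of_real ((T - s) ^ n) * f s $ 2))
        \<le> T ^ n * cmod (f s $ 1) + T ^ n * cmod (f s $ 2)"
      by (rule order_trans[OF norm_triangle_ineq])
        (use t in \<open>auto simp: norm_mult norm_power power_abs simp del: of_real_diff power_Suc intro!: add_mono mult_right_mono\<close>)
    then have "norm (g n s) \<le> (T ^ n * cmod (f s $ 1) + T ^ n * cmod (f s $ 2)) / fact n * cmod l ^ n"
      unfolding g_def norm_mult norm_divide norm_power[of l] norm_fact by (intro mult_right_mono divide_right_mono) auto
    also have "\<dots> = (T * cmod l) ^ n / fact n * (cmod (f s $ 1) + cmod (f s $ 2))"
      by (simp add: power_mult_distrib field_simps)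
    finally show ?thesis .
  qed
  have se: "summable (\<lambda>n. (T * cmod l) ^ n / fact n)"
    using summable_exp[of "T * cmod l"] by (simp add: field_simps)
  have "(\<lambda>n. LINT s|?M. g n s) sums (LINT s|?M. (\<Sum>n. g n s))"
  proof (rule sums_integral[OF gi])
    show "AE s in ?M. summable (\<lambda>n. norm (g n s))"
      by (rule AE_I2, rule summable_comparison_test'[OF summable_mult2[OF se]]) (use gb in auto)
    show "summable (\<lambda>n. LINT s|?M. norm (g n s))"
    proof (rule summable_comparison_test'[OF summable_mult2[OF se, of "LINT s|?M. cmod (f s $ 1) + cmod (f s $ 2)"]])
      fix n
      have "(LINT s|?M. norm (g n s)) \<le> (LINT s|?M. (T * cmod l) ^ n / fact n * (cmod (f s $ 1) + cmod (f s $ 2)))"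
        by (rule integral_mono) (use gb gi fi in auto)
      then show "norm (LINT s|?M. norm (g n s)) \<le> (T * cmod l) ^ n / fact n * (LINT s|?M. cmod (f s $ 1) + cmod (f s $ 2))"
        by (simp add: integral_nonneg_AE)
    qed
  qed
  moreover have "(LINT s|?M. (\<Sum>n. g n s)) = dirac_transform T f l"
    unfolding dirac_transform_def
  proof (rule Bochner_Integration.integral_cong[OF refl])
    fix s
    have e: "(\<lambda>n. c ^ n / fact n) sums exp c" for c :: complex
      using exp_converges[of c] by (simp add: scaleR_conv_of_real field_simps)
    have "(\<lambda>n. \<i> * f s $ 1 * ((\<i> * l * complex_of_real (T - s)) ^ n / fact n) + (- \<i>) * f s $ 2 * ((- \<i> * l * complex_of_real (T - s)) ^ n / fact n))
       sums (\<i> * f s $ 1 * exp (\<i> * l * complex_of_real (T - s)) + (- \<i>) * f s $ 2 * exp (- \<i> * l * complex_of_real (T - s)))"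
      by (intro sums_add sums_mult e)
    moreover have "\<i> * f s $ 1 * ((\<i> * l * complex_of_real (T - s)) ^ n / fact n) + (- \<i>) * f s $ 2 * ((- \<i> * l * complex_of_real (T - s)) ^ n / fact n) = g n s" for n
      unfolding g_def power_mult_distrib of_real_power[symmetric] by (simp add: add_divide_distrib diff_divide_distrib algebra_simps)
    ultimately have "(\<lambda>n. g n s) sums (\<i> * f s $ 1 * exp (\<i> * l * complex_of_real (T - s)) + (- \<i>) * f s $ 2 * exp (- \<i> * l * complex_of_real (T - s)))"
      by simp
    then show "(\<Sum>n. g n s) = dirac_row T l s $ 1 * f s $ 1 + dirac_row T l s $ 2 * f s $ 2"
      by (simp add: sums_iff dirac_row_def)
  qed
  ultimately show ?thesis unfolding gint by simp
qed

lemma dirac_transform_holomorphic: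
  assumes "f \<in> L2 (lborel_on {0<..<T})" "T > 0"
  shows "dirac_transform T f holomorphic_on UNIV"
proof -
  have "dirac_transform T f holomorphic_on ball 0 R" for R
    by (rule power_series_holomorphic, unfold diff_zero, rule dirac_transform_power_series[OF assms])
  then have "dirac_transform T f field_differentiable at z" for z
    using holomorphic_on_imp_differentiable_at[OF _ open_ball, of _ 0 "cmod z + 1" z] by simp
  then show ?thesis by (simp add: holomorphic_on_def field_differentiable_at_within)
qed

text \<open>All Taylor coefficients vanish. Those of even order are even moments of the difference
  of the two components, those of odd order are odd moments of their sum. The latter become even
  moments after one factor \<open>T - s\<close>, which has no zero on the interval, is moved into
  the function.\<close>

lemma dirac_transform_eq_0:
  assumes f: "f \<in> L2 (lborel_on {0<..<T})" and T: "T > 0" and z: "dirac_transform T f = (\<lambda>_. 0)"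
  shows "AE s in lborel_on {0<..<T}. f s = 0"
proof -
  let ?M = "lborel_on {0<..<T}"
  define c where "c n = (\<i> ^ Suc n * (LINT s|?M. complex_of_real ((T - s) ^ n) * f s $ 1)
      + (- \<i>) ^ Suc n * (LINT s|?M. complex_of_real ((T - s) ^ n) * f s $ 2)) / fact n" for n
  have s: "(\<lambda>n. c n * l ^ n) sums 0" for l
    using dirac_transform_power_series[OF f T, of l] z by (simp add: c_def)
  have c0: "c n = 0" for n
  proof (rule ccontr)
    assume n: "c n \<noteq> 0"
    have "c 0 = 0" using sums_unique2[OF s[of 0] powser_sums_zero[of c]] by simp
    with n have "n > 0" by (cases n) auto
    \<comment> \<open>A nonzero coefficient of positive index would force the sum, which is the zero
      function, to be nonzero on a punctured disc.\<close>
    show False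
    proof (rule powser_0_nonzero[of 1 0 c "\<lambda>_. 0" n])
      fix r :: real assume r: "0 < r" "\<And>z. (z::complex) \<in> cball 0 r - {0} \<Longrightarrow> (0::complex) \<noteq> 0"
      have "complex_of_real r \<in> cball 0 r - {0}" using r(1) by simp
      from r(2)[OF this] show False by simp
    qed (use s n \<open>n > 0\<close> in simp_all)
  qed
  note fi = L2_integrable_interval[OF L2_component[OF f]]
  note L = L2_component[OF f]
  have wL: "(\<lambda>s. complex_of_real ((T - s) ^ n)) \<in> L2 ?M" for n by (rule L2_continuous) (intro continuous_intros)
  have wi: "integrable ?M (\<lambda>s. complex_of_real ((T - s) ^ n) * f s $ k)" for n k
    using L2_measurable[OF wL[of n]] L2_measurable[OF L[of k]]
    by (intro cauchy_schwarz_L2(1)[OF wL[of n] L[of k]]) (auto simp: norm_mult)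
  have wcL: "(\<lambda>s. complex_of_real (T - s) * g s) \<in> L2 ?M" if g: "g \<in> L2 ?M" for g
  proof (rule L2_dominated(1)[OF g, where K = T])
    show "(\<lambda>s. complex_of_real (T - s) * g s) \<in> borel_measurable ?M"
      using L2_measurable[OF wL[of 1]] L2_measurable[OF g] by simp
    show "norm (complex_of_real (T - x) * g x) \<le> T * norm (g x)" if "x \<in> space ?M" for x
      using that by (auto simp: norm_mult simp del: of_real_diff intro!: mult_right_mono)
  qed
  have "AE s in ?M. f s $ 1 - f s $ 2 = 0"
  proof (rule even_moments_zero[OF L2_diff(1)[OF L L]])
    fix n
    have i: "\<i> ^ Suc (2 * n) = \<i> * (-1) ^ n" "(- \<i>) ^ Suc (2 * n) = - \<i> * (-1) ^ n" by (simp_all add: power_mult)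
    have "(LINT s|?M. complex_of_real ((T - s) ^ (2 * n)) * f s $ 1) - (LINT s|?M. complex_of_real ((T - s) ^ (2 * n)) * f s $ 2) = 0"
      using c0[of "2 * n"] unfolding c_def i by (simp add: algebra_simps)
    then show "(LINT s|?M. complex_of_real ((T - s) ^ (2 * n)) * (f s $ 1 - f s $ 2)) = 0"
      using wi by (simp add: right_diff_distrib)
  qed
  moreover have "AE s in ?M. complex_of_real (T - s) * (f s $ 1 + f s $ 2) = 0"
  proof (rule even_moments_zero[OF wcL[OF L2_add(1)[OF L L]]])
    fix n
    have i: "\<i> ^ Suc (Suc (2 * n)) = - ((-1) ^ n)" "(- \<i>) ^ Suc (Suc (2 * n)) = - ((-1) ^ n)" by (simp_all add: power_mult)
    have "(LINT s|?M. complex_of_real ((T - s) ^ (Suc (2 * n))) * f s $ 1) + (LINT s|?M. complex_of_real ((T - s) ^ (Suc (2 * n))) * f s $ 2) = 0"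
    proof -
      have alg: "x + y = 0" if "(- a * x + - a * y) / d = 0" "a \<noteq> 0" "d \<noteq> 0" for a x y d :: complex
      proof -
        have "- a * (x + y) / d = 0" using that(1) by (simp only: distrib_left)
        then show ?thesis using that(2,3) by simp
      qed
      show ?thesis by (rule alg[OF c0[of "Suc (2 * n)", unfolded c_def i]]) (simp, rule fact_nonzero)
    qed
    moreover have "complex_of_real ((T - s) ^ (2 * n)) * (complex_of_real (T - s) * (f s $ 1 + f s $ 2))
        = complex_of_real ((T - s) ^ (Suc (2 * n))) * f s $ 1 + complex_of_real ((T - s) ^ (Suc (2 * n))) * f s $ 2" for s
      unfolding power_Suc of_real_mult by (simp add: distrib_left mult_ac del: of_real_diff of_real_power)
    ultimately show "(LINT s|?M. complex_of_real ((T - s) ^ (2 * n)) * (complex_of_real (T - s) * (f s $ 1 + f s $ 2))) = 0"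
      using wi by (simp del: of_real_diff power_Suc of_real_power of_real_mult)
  qed
  moreover have "AE s in ?M. s \<in> {0<..<T}" by (rule AE_I2) simp
  ultimately show ?thesis
  proof eventually_elim
    case (elim s)
    then have "complex_of_real (T - s) \<noteq> 0" by simp
    then have "f s $ 1 = f s $ 2" "f s $ 1 + f s $ 2 = 0" using elim by auto
    then show ?case by (simp add: vec_eq_iff forall_2)
  qed
qed

section \<open>Classical solutions of the Dirac system\<close>

lemma has_derivative_of_partials:
  fixes F :: "real \<Rightarrow> real \<Rightarrow> 'b::real_normed_vector"
  assumes F1: "((\<lambda>x. F x y) has_vector_derivative F1) (at x within X)"
    and F2: "\<And>x y. x \<in> X \<Longrightarrow> y \<in> Y \<Longrightarrow> ((\<lambda>y. F x y) has_vector_derivative F2 x y) (at y within Y)"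
    and F2c: "continuous_on (X \<times> Y) (\<lambda>(x, y). F2 x y)"
    and xy: "x \<in> X" "y \<in> Y" "convex Y"
  shows "((\<lambda>(x, y). F x y) has_derivative (\<lambda>(s, t). s *\<^sub>R F1 + t *\<^sub>R F2 x y)) (at (x, y) within X \<times> Y)"
proof -
  have "((\<lambda>(x, y). F x y) has_derivative (\<lambda>(tx, ty). tx *\<^sub>R F1 + blinfun_apply (blinfun_scaleR_left (F2 x y)) ty)) (at (x, y) within X \<times> Y)"
  proof (rule has_derivative_partialsI[where fy = "\<lambda>x y. blinfun_scaleR_left (F2 x y)"])
    show "((\<lambda>x. F x y) has_derivative (\<lambda>tx. tx *\<^sub>R F1)) (at x within X)"
      using F1 by (simp add: has_vector_derivative_def)
    show "(F x has_derivative blinfun_apply (blinfun_scaleR_left (F2 x y))) (at y within Y)" if "x \<in> X" "y \<in> Y" for x y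
      using F2[OF that] by (simp add: has_vector_derivative_def)
    have "continuous_on (X \<times> Y) (\<lambda>z. blinfun_scaleR_left (case z of (x, y) \<Rightarrow> F2 x y))"
      by (intro continuous_intros F2c)
    then show "continuous (at (x, y) within X \<times> Y) (\<lambda>(x, y). blinfun_scaleR_left (F2 x y))"
      using xy by (auto simp: continuous_on_eq_continuous_within case_prod_beta')
  qed (use xy in auto)
  then show ?thesis by simp
qed

lemma continuous_on_of_partials:
  fixes F :: "real \<Rightarrow> real \<Rightarrow> 'b::real_normed_vector"
  assumes F1: "\<And>x y. x \<in> X \<Longrightarrow> y \<in> Y \<Longrightarrow> ((\<lambda>x. F x y) has_vector_derivative F1 x y) (at x within X)"
    and F2: "\<And>x y. x \<in> X \<Longrightarrow> y \<in> Y \<Longrightarrow> ((\<lambda>y. F x y) has_vector_derivative F2 x y) (at y within Y)"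
    and F2c: "continuous_on (X \<times> Y) (\<lambda>(x, y). F2 x y)" and Y: "convex Y"
  shows "continuous_on (X \<times> Y) (\<lambda>(x, y). F x y)"
  unfolding continuous_on_eq_continuous_within
proof (clarify)
  fix x y assume "x \<in> X" "y \<in> Y"
  from has_derivative_of_partials[OF F1[OF this] F2 F2c this Y]
  show "continuous (at (x, y) within X \<times> Y) (\<lambda>(x, y). F x y)"
    by (rule has_derivative_continuous) auto
qed

lemma vector_derivative_along_line:
  fixes F :: "real \<Rightarrow> real \<Rightarrow> 'b::real_normed_vector"
  assumes F1: "\<And>x y. ((\<lambda>x. F x y) has_vector_derivative F1 x y) (at x)"
    and F2: "\<And>x y. ((\<lambda>y. F x y) has_vector_derivative F2 x y) (at y)"
    and F2c: "continuous_on UNIV (\<lambda>(x, y). F2 x y)"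
  shows "((\<lambda>s. F s (c + k * s)) has_vector_derivative (F1 s (c + k * s) + k *\<^sub>R F2 s (c + k * s))) (at s)"
proof -
  have D: "((\<lambda>(x, y). F x y) has_derivative (\<lambda>(u, v). u *\<^sub>R F1 s (c + k * s) + v *\<^sub>R F2 s (c + k * s))) (at (s, c + k * s))"
    using has_derivative_of_partials[of F "c + k * s" "F1 s (c + k * s)" s UNIV UNIV F2] F1 F2 F2c by simp
  have "((\<lambda>s. (s, c + k * s)) has_derivative (\<lambda>h. (h, k * h))) (at s)"
    by (auto intro!: derivative_eq_intros)
  from diff_chain_at[OF this D]
  have "((\<lambda>s. F s (c + k * s)) has_derivative (\<lambda>h. h *\<^sub>R F1 s (c + k * s) + (k * h) *\<^sub>R F2 s (c + k * s))) (at s)"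
    by (simp add: o_def)
  then show ?thesis
    unfolding has_vector_derivative_def by (simp add: scaleR_add_right mult.commute)
qed

lemma inner_vec2: "(u :: complex^2) \<bullet> v = Re (cnj (u $ 1) * v $ 1) + Re (cnj (u $ 2) * v $ 2)"
  by (simp add: inner_vec_def sum_2 inner_complex_def)

lemma dirac_J_mult: "dirac_J *v u = vector [u $ 2, - u $ 1]"
  by (simp add: dirac_J_def vec_eq_iff forall_2 matrix_vector_mult_def sum_2)

lemma dirac_V_mult:
  "dirac_V p q x *v u = vector [complex_of_real (p x) * u $ 1 + complex_of_real (q x) * u $ 2,
     complex_of_real (q x) * u $ 1 - complex_of_real (p x) * u $ 2]"
  by (simp add: dirac_V_def vec_eq_iff forall_2 matrix_vector_mult_def sum_2)

lemma positive_part_square_derivative: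
  "((\<lambda>y::real. (max 0 y)\<^sup>2) has_real_derivative 2 * max 0 y) (at y within S)"
proof -
  have "((\<lambda>y::real. (max 0 y)\<^sup>2) has_real_derivative 2 * max 0 y) (at y)"
  proof -
    consider "y < 0" | "y = 0" | "y > 0" by linarith
    then show ?thesis
    proof cases
      case 1
      have "((\<lambda>y::real. 0) has_real_derivative 0) (at y)" by simp
      then have "((\<lambda>y::real. (max 0 y)\<^sup>2) has_real_derivative 0) (at y)"
        by (rule has_field_derivative_transform_within_open[where S = "{..<0}"]) (use 1 in auto)
      then show ?thesis using 1 by simp
    next
      case 2
      have "((\<lambda>y::real. (max 0 y)\<^sup>2) has_derivative (\<lambda>h. 0)) (at 0)"
        unfolding has_derivative_at_alt
      proof (intro conjI allI impI)
        fix e :: real assume e: "e > 0"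
        have "norm ((max 0 h)\<^sup>2) \<le> e * norm h" if "norm h < e" for h :: real
        proof (cases "h \<ge> 0")
          case True
          then show ?thesis using that by (simp add: power2_eq_square mult_right_mono)
        next
          case False
          have "0 \<le> e * norm h" using e by (intro mult_nonneg_nonneg) auto
          then show ?thesis using False by (simp add: max_def)
        qed
        then show "\<exists>d>0. \<forall>y::real. norm (y - 0) < d \<longrightarrow> norm ((max 0 y)\<^sup>2 - (max 0 0)\<^sup>2 - 0) \<le> e * norm (y - 0)"
          using e by (intro exI[of _ e]) simp
      qed simp
      moreover have "(*) 0 = (\<lambda>h::real. 0)" by auto
      ultimately show ?thesis using 2 by (simp add: has_field_derivative_def)
    next
      case 3
      have "((\<lambda>y::real. y\<^sup>2) has_real_derivative 2 * y) (at y)" by (auto intro!: derivative_eq_intros)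
      then have "((\<lambda>y::real. (max 0 y)\<^sup>2) has_real_derivative 2 * y) (at y)"
        by (rule has_field_derivative_transform_within_open[where S = "{0<..}"]) (use 3 in auto)
      then show ?thesis using 3 by simp
    qed
  qed
  then show ?thesis by (rule has_field_derivative_at_within)
qed

text \<open>Energy estimate with the weight \<open>(X - t - x)\<^sub>+\<^sup>2\<close>, which decreases in \<open>t\<close> fast enough to absorb the
  flux; the flux through \<open>x = 0\<close> vanishes because \<open>u\<^sub>1 = 0\<close> there.\<close>

lemma classical_solution_zero_control:
  assumes u: "classical_solution 1 p q T (\<lambda>_. 0) u" and T: "T > 0" and x: "x \<ge> 0" and t: "t \<in> {0..T}"
  shows "u x t = 0"
proof -
  obtain ux ut where uxc: "continuous_on ({0..} \<times> {0..T}) (\<lambda>(x, t). ux x t)"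
    and utc: "continuous_on ({0..} \<times> {0..T}) (\<lambda>(x, t). ut x t)"
    and D: "\<And>x t. x \<ge> 0 \<Longrightarrow> t \<in> {0..T} \<Longrightarrow> ((\<lambda>y. u y t) has_vector_derivative ux x t) (at x within {0..})"
      "\<And>x t. x \<ge> 0 \<Longrightarrow> t \<in> {0..T} \<Longrightarrow> ((\<lambda>r. u x r) has_vector_derivative ut x t) (at t within {0..T})"
    and pde: "\<And>x t. x > 0 \<Longrightarrow> t \<in> {0<..<T} \<Longrightarrow> \<i> *s ut x t + 1 *s (dirac_J *v ux x t + dirac_V p q x *v u x t) = 0"
    and ic: "\<And>x. x \<ge> 0 \<Longrightarrow> u x 0 = 0" and bc: "\<And>t. t \<in> {0..T} \<Longrightarrow> u 0 t $ 1 = 0"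
    using u unfolding classical_solution_def by blast
  have uc: "continuous_on ({0..} \<times> {0..T}) (\<lambda>(x, t). u x t)"
    by (rule continuous_on_of_partials[OF _ _ utc]) (use D in auto)
  \<comment> \<open>The weight is then 1 at the point in question and 0 beyond \<open>X\<close>, so
    the interval \<open>{0..X}\<close> carries the whole weighted energy.\<close>
  define X where "X = x + t + 1"
  have X: "X > 0" using x t by (simp add: X_def)
  \<comment> \<open>\<open>S\<close> is \<open>\<i>\<close> times \<open>dirac_J\<close>, a
    symmetric isometry for the real inner product; the flux \<open>u \<bullet> S u\<close> is
    therefore at most the energy density.\<close>
  define S where "S v = (vector [\<i> * v $ 2, - \<i> * v $ 1] :: complex^2)" for v :: "complex^2"
  have S_lin: "bounded_linear S"
    by (rule linear_conv_bounded_linear[THEN iffD1], rule linearI) (auto simp: S_def vec_eq_iff forall_2 algebra_simps)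
  have S_norm: "norm (S v) = norm v" for v
  proof -
    have "(norm (S v))\<^sup>2 = (norm v)\<^sup>2" by (simp add: norm_vec2_sq S_def norm_mult)
    then show ?thesis by simp
  qed
  have S_sym: "v \<bullet> S w = S v \<bullet> w" for v w by (simp add: inner_vec2 S_def algebra_simps)
  \<comment> \<open>The potential drops out: it is real symmetric, so \<open>\<i>\<close> times it
    is skew for the real inner product.\<close>
  have energy: "u x t \<bullet> ut x t = u x t \<bullet> S (ux x t)" if "x > 0" "t \<in> {0<..<T}" for x t
  proof -
    have "(\<i> *s ut x t + 1 *s (dirac_J *v ux x t + dirac_V p q x *v u x t)) $ k = 0" for k
      using pde[OF that] by simp
    from this[of 1] this[of 2]
    have "\<i> * ut x t $ 1 = - (ux x t $ 2 + p x * u x t $ 1 + q x * u x t $ 2)"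
      "\<i> * ut x t $ 2 = - (- ux x t $ 1 + q x * u x t $ 1 - p x * u x t $ 2)"
      by (simp_all add: dirac_J_mult dirac_V_mult algebra_simps eq_neg_iff_add_eq_0)
    then have 12: "ut x t $ 1 = \<i> * (ux x t $ 2 + p x * u x t $ 1 + q x * u x t $ 2)"
      "ut x t $ 2 = \<i> * (- ux x t $ 1 + q x * u x t $ 1 - p x * u x t $ 2)"
      by (auto simp: complex_eq_iff)
    show ?thesis unfolding inner_vec2 S_def 12 vector_2 by (simp add: algebra_simps)
  qed
  define w where "w x t = (max 0 (X - t - x))\<^sup>2" for x t
  define w' where "w' x t = - 2 * max 0 (X - t - x)" for x t
  have Dw1: "((\<lambda>x. w x t) has_real_derivative w' x t) (at x within A)" for x t A
  proof -
    have "((\<lambda>x. X - t - x) has_real_derivative -1) (at x within A)" by (auto intro!: derivative_eq_intros)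
    from DERIV_chain2[OF positive_part_square_derivative[of "X - t - x" UNIV] this] show ?thesis
      by (simp add: w_def w'_def)
  qed
  have Dw2: "((\<lambda>t. w x t) has_real_derivative w' x t) (at t within A)" for x t A
  proof -
    have "((\<lambda>t. X - t - x) has_real_derivative -1) (at t within A)" by (auto intro!: derivative_eq_intros)
    from DERIV_chain2[OF positive_part_square_derivative[of "X - t - x" UNIV] this] show ?thesis
      by (simp add: w_def w'_def)
  qed
  have comp: "continuous_on A (\<lambda>z. F (f z) (g z))"
    if "continuous_on ({0..} \<times> {0..T}) (\<lambda>(x, t). F x t)" "continuous_on A f" "continuous_on A g" "\<And>z. z \<in> A \<Longrightarrow> f z \<ge> 0 \<and> g z \<in> {0..T}"
    for A :: "'z::topological_space set" and F :: "real \<Rightarrow> real \<Rightarrow> complex^2" and f g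
  proof -
    have "(\<lambda>z. (f z, g z)) ` A \<subseteq> {0..} \<times> {0..T}" using that(4) by auto
    from continuous_on_compose2[OF that(1) continuous_on_Pair[OF that(2,3)] this] show ?thesis by simp
  qed
  define e where "e t = integral {0..X} (\<lambda>x. w x t * (u x t \<bullet> u x t))" for t
  define de where "de t = integral {0..X} (\<lambda>x. w' x t * (u x t \<bullet> u x t) + w x t * (2 * (u x t \<bullet> ut x t)))" for t
  have sec: "continuous_on {0..X} (\<lambda>x. F x t)" if "continuous_on ({0..} \<times> {0..T}) (\<lambda>(x, t). F x t)" "t \<in> {0..T}"
    for F :: "real \<Rightarrow> real \<Rightarrow> complex^2" and t
    by (rule comp[OF that(1) continuous_on_id continuous_on_const]) (use that(2) in simp)
  have wc: "continuous_on A (\<lambda>x. w x t)" "continuous_on A (\<lambda>x. w' x t)" for A t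
    unfolding w_def w'_def by (intro continuous_intros)+
  have De: "(e has_real_derivative de t) (at t within {0..T})" if t: "t \<in> {0..T}" for t
  proof -
    have "((\<lambda>t. integral (cbox 0 X) (\<lambda>x. w x t * (u x t \<bullet> u x t))) has_real_derivative
        integral (cbox 0 X) (\<lambda>x. w' x t * (u x t \<bullet> u x t) + w x t * (2 * (u x t \<bullet> ut x t)))) (at t within {0..T})"
  proof (rule leibniz_rule_field_derivative[OF _ _ _ t])
    fix t x assume tx: "t \<in> {0..T}" "x \<in> cbox 0 X"
    then have x0: "x \<ge> 0" by simp
    have "((\<lambda>t. u x t \<bullet> u x t) has_derivative (\<lambda>h. u x t \<bullet> (h *\<^sub>R ut x t) + (h *\<^sub>R ut x t) \<bullet> u x t)) (at t within {0..T})"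
      using D(2)[OF x0 tx(1)] unfolding has_vector_derivative_def by (intro has_derivative_inner)
    then have "((\<lambda>t. u x t \<bullet> u x t) has_real_derivative 2 * (u x t \<bullet> ut x t)) (at t within {0..T})"
      by (simp add: has_field_derivative_def inner_commute[of "ut x t"] algebra_simps mult_commute_abs)
    from DERIV_mult[OF Dw2 this]
    show "((\<lambda>t. w x t * (u x t \<bullet> u x t)) has_real_derivative w' x t * (u x t \<bullet> u x t) + w x t * (2 * (u x t \<bullet> ut x t))) (at t within {0..T})"
      by (simp add: algebra_simps)
  next
    show "(\<lambda>x. w x t * (u x t \<bullet> u x t)) integrable_on cbox 0 X" if "t \<in> {0..T}" for t
      unfolding cbox_interval
      by (intro integrable_continuous_interval continuous_intros wc sec[OF uc that])
    show "continuous_on ({0..T} \<times> cbox 0 X) (\<lambda>(t, x). w' x t * (u x t \<bullet> u x t) + w x t * (2 * (u x t \<bullet> ut x t)))"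
      unfolding split_beta w_def w'_def
      by (intro continuous_intros comp[OF uc] comp[OF utc]) auto
  qed simp
    then show ?thesis by (simp add: e_def[abs_def] de_def)
  qed
  have de_le: "de t \<le> 0" if t: "t \<in> {0<..<T}" for t
  proof -
    have t': "t \<in> {0..T}" using t by simp
    define j where "j x = u x t \<bullet> S (u x t)" for x
    have Dj: "(j has_real_derivative 2 * (u x t \<bullet> S (ux x t))) (at x within {0..X})" if "x \<in> {0..X}" for x
    proof -
      have d: "((\<lambda>y. u y t) has_derivative (\<lambda>h. h *\<^sub>R ux x t)) (at x within {0..X})"
        using D(1)[OF _ t', of x] that unfolding has_vector_derivative_def[symmetric]
        by (auto intro: has_vector_derivative_within_subset)
      have "(j has_derivative (\<lambda>h. u x t \<bullet> S (h *\<^sub>R ux x t) + (h *\<^sub>R ux x t) \<bullet> S (u x t))) (at x within {0..X})"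
        unfolding j_def by (intro has_derivative_inner d bounded_linear.has_derivative[OF S_lin])
      moreover have "ux x t \<bullet> S (u x t) = u x t \<bullet> S (ux x t)" using S_sym[of "ux x t" "u x t"] by (simp add: inner_commute)
      ultimately show ?thesis
        by (simp add: has_field_derivative_def linear_scale[OF bounded_linear.linear[OF S_lin]] algebra_simps mult_commute_abs)
    qed
    have D2: "((\<lambda>x. w x t * j x) has_vector_derivative (w' x t * j x + w x t * (2 * (u x t \<bullet> S (ux x t))))) (at x within {0..X})" if "x \<in> {0..X}" for x
      using DERIV_mult[OF Dw1 Dj[OF that]] by (simp add: has_real_derivative_iff_has_vector_derivative algebra_simps)
    have "((\<lambda>x. w' x t * j x + w x t * (2 * (u x t \<bullet> S (ux x t)))) has_integral (w X t * j X - w 0 t * j 0)) {0..X}"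
      using X by (intro fundamental_theorem_of_calculus D2) auto
    moreover have "w X t = 0" using t by (simp add: w_def)
    moreover have "j 0 = 0" using bc[OF t'] by (simp add: j_def inner_vec2 S_def)
    ultimately have i0: "((\<lambda>x. w' x t * j x + w x t * (2 * (u x t \<bullet> S (ux x t)))) has_integral 0) {0..X}" by simp
    have "((\<lambda>x. w' x t * (u x t \<bullet> u x t) + w x t * (2 * (u x t \<bullet> ut x t))) has_integral de t) {0..X}"
      unfolding de_def
      by (intro integrable_integral integrable_continuous_interval continuous_intros wc sec[OF uc t'] sec[OF utc t'])
    from has_integral_diff[OF this i0]
    have i1: "((\<lambda>x. (w' x t * (u x t \<bullet> u x t) + w x t * (2 * (u x t \<bullet> ut x t))) - (w' x t * j x + w x t * (2 * (u x t \<bullet> S (ux x t))))) has_integral de t) {0..X}"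
      by simp
    have "((\<lambda>x. w' x t * (u x t \<bullet> u x t - j x)) has_integral de t) {0..X}"
      \<comment> \<open>The equation, and with it the energy identity, is available for
        \<open>x > 0\<close>; the point 0 is discarded.\<close>
      by (rule has_integral_spike_finite[OF _ _ i1, of "{0}"]) (use energy t in \<open>auto simp: algebra_simps\<close>)
    from this has_integral_0 show ?thesis
    proof (rule has_integral_le)
      fix x
      have "j x \<le> norm (u x t) * norm (S (u x t))" unfolding j_def by (rule norm_cauchy_schwarz)
      also have "\<dots> = u x t \<bullet> u x t" by (simp add: S_norm power2_norm_eq_inner[symmetric] power2_eq_square)
      finally have "0 \<le> u x t \<bullet> u x t - j x" by simp
      then show "w' x t * (u x t \<bullet> u x t - j x) \<le> 0" by (simp add: w'_def mult_nonpos_nonneg)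
    qed
  qed
  have e_le: "e t \<le> 0" if t: "t \<in> {0..T}" for t
  proof (cases "t = 0")
    case True
    have "e 0 = integral {0..X} (\<lambda>x. 0)" unfolding e_def by (intro integral_cong) (simp add: ic)
    then show ?thesis using True by simp
  next
    case False
    then have t0: "0 < t" using t by simp
    have "e t \<le> e 0"
    proof (rule DERIV_nonpos_imp_decreasing_open[OF less_imp_le[OF t0]])
      show "\<exists>y. (e has_real_derivative y) (at s) \<and> y \<le> 0" if "0 < s" "s < t" for s
      proof -
        have s: "s \<in> {0<..<T}" using that t by simp
        have "(e has_real_derivative de s) (at s within {0<..<T})"
          by (rule DERIV_subset[OF De]) (use s in auto)
        then have "(e has_real_derivative de s) (at s)" using s by (simp add: at_within_open[of s "{0<..<T}"])
        then show ?thesis using de_le[OF s] by blast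
      qed
      have "continuous_on {0..T} e" using De by (meson DERIV_continuous_on)
      then show "continuous_on {0..t} e" by (rule continuous_on_subset) (use t in auto)
    qed
    moreover have "e 0 = integral {0..X} (\<lambda>x. 0)" unfolding e_def by (intro integral_cong) (simp add: ic)
    ultimately show ?thesis by simp
  qed
  have gc: "continuous_on {0..X} (\<lambda>x. w x t * (u x t \<bullet> u x t))" by (intro continuous_intros wc sec[OF uc t])
  have gn: "0 \<le> w x t * (u x t \<bullet> u x t)" for x by (simp add: w_def)
  have "e t \<ge> 0" unfolding e_def by (intro integral_nonneg integrable_continuous_interval gc) (use gn in auto)
  then have "e t = 0" using e_le[OF t] by simp
  then have "\<forall>x\<in>{0..X}. w x t * (u x t \<bullet> u x t) = 0"
    using integral_eq_0_iff[OF gc X] gn by (simp add: e_def)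
  then have "w x t * (u x t \<bullet> u x t) = 0" using x t by (simp add: X_def)
  then show ?thesis by (simp add: w_def X_def)
qed

lemma classical_solutionI:
  fixes u ux ut :: "real \<Rightarrow> real \<Rightarrow> complex^2" and f :: "real \<Rightarrow> complex"
  assumes "continuous_on ({0..} \<times> {0..T}) (\<lambda>(x, t). ux x t)" "continuous_on ({0..} \<times> {0..T}) (\<lambda>(x, t). ut x t)"
    and "\<And>x t. x \<ge> 0 \<Longrightarrow> t \<in> {0..T} \<Longrightarrow> ((\<lambda>y. u y t) has_vector_derivative ux x t) (at x within {0..})"
    and "\<And>x t. x \<ge> 0 \<Longrightarrow> t \<in> {0..T} \<Longrightarrow> ((\<lambda>r. u x r) has_vector_derivative ut x t) (at t within {0..T})"
    and "\<And>x t. x > 0 \<Longrightarrow> t \<in> {0<..<T} \<Longrightarrow> \<i> *s ut x t + \<sigma> *s (dirac_J *v ux x t + dirac_V p q x *v u x t) = 0"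
    and "\<And>x. x \<ge> 0 \<Longrightarrow> u x 0 = 0" "\<And>t. t \<in> {0..T} \<Longrightarrow> u 0 t $ 1 = f t"
  shows "classical_solution \<sigma> p q T f u"
  unfolding classical_solution_def using assms by blast

lemma classical_solution_diff:
  assumes u: "classical_solution \<sigma> p q T f u" and v: "classical_solution \<sigma> p q T g v"
  shows "classical_solution \<sigma> p q T (\<lambda>t. f t - g t) (\<lambda>x t. u x t - v x t)"
proof -
  obtain ux ut where u1: "continuous_on ({0..} \<times> {0..T}) (\<lambda>(x, t). ux x t)" "continuous_on ({0..} \<times> {0..T}) (\<lambda>(x, t). ut x t)"
    and u2: "\<forall>x\<ge>0. \<forall>t\<in>{0..T}. ((\<lambda>y. u y t) has_vector_derivative ux x t) (at x within {0..}) \<and>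
           ((\<lambda>r. u x r) has_vector_derivative ut x t) (at t within {0..T})"
    and u3: "\<forall>x>0. \<forall>t\<in>{0<..<T}. \<i> *s ut x t + \<sigma> *s (dirac_J *v ux x t + dirac_V p q x *v u x t) = 0"
    and u4: "\<forall>x\<ge>0. u x 0 = 0" "\<forall>t\<in>{0..T}. u 0 t $ 1 = f t"
    using u unfolding classical_solution_def by blast
  obtain vx vt where v1: "continuous_on ({0..} \<times> {0..T}) (\<lambda>(x, t). vx x t)" "continuous_on ({0..} \<times> {0..T}) (\<lambda>(x, t). vt x t)"
    and v2: "\<forall>x\<ge>0. \<forall>t\<in>{0..T}. ((\<lambda>y. v y t) has_vector_derivative vx x t) (at x within {0..}) \<and>
           ((\<lambda>r. v x r) has_vector_derivative vt x t) (at t within {0..T})"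
    and v3: "\<forall>x>0. \<forall>t\<in>{0<..<T}. \<i> *s vt x t + \<sigma> *s (dirac_J *v vx x t + dirac_V p q x *v v x t) = 0"
    and v4: "\<forall>x\<ge>0. v x 0 = 0" "\<forall>t\<in>{0..T}. v 0 t $ 1 = g t"
    using v unfolding classical_solution_def by blast
  show ?thesis
  proof (rule classical_solutionI[where ux = "\<lambda>x t. ux x t - vx x t" and ut = "\<lambda>x t. ut x t - vt x t"])
    show "continuous_on ({0..} \<times> {0..T}) (\<lambda>(x, t). ux x t - vx x t)" "continuous_on ({0..} \<times> {0..T}) (\<lambda>(x, t). ut x t - vt x t)"
      using continuous_on_diff[OF u1(1) v1(1)] continuous_on_diff[OF u1(2) v1(2)] by (simp_all add: split_beta)
    fix x t :: real assume "0 \<le> x" "t \<in> {0..T}"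
    then show "((\<lambda>y. u y t - v y t) has_vector_derivative ux x t - vx x t) (at x within {0..})"
      "((\<lambda>r. u x r - v x r) has_vector_derivative ut x t - vt x t) (at t within {0..T})"
      using u2 v2 by (auto intro: has_vector_derivative_diff)
  next
    fix x t :: real assume "0 < x" "t \<in> {0<..<T}"
    then have "\<i> *s ut x t + \<sigma> *s (dirac_J *v ux x t + dirac_V p q x *v u x t) - (\<i> *s vt x t + \<sigma> *s (dirac_J *v vx x t + dirac_V p q x *v v x t)) = 0"
      using u3 v3 by simp
    then show "\<i> *s (ut x t - vt x t) + \<sigma> *s (dirac_J *v (ux x t - vx x t) + dirac_V p q x *v (u x t - v x t)) = 0"
      by (simp add: matrix_vector_mult_diff_distrib vector_ssub_ldistrib vector_add_ldistrib algebra_simps)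
  qed (use u4 v4 in auto)
qed

lemma classical_solution_unique:
  assumes u: "classical_solution 1 p q T f u" and v: "classical_solution 1 p q T f v"
    and "T > 0" "x \<ge> 0" "t \<in> {0..T}"
  shows "u x t = v x t"
  using classical_solution_zero_control[OF _ assms(3-5), of p q "\<lambda>x t. u x t - v x t"] classical_solution_diff[OF u v] by simp

text \<open>Since \<open>p\<close> and \<open>q\<close> are real, conjugation only flips the sign of
  \<open>\<i>\<close> and thereby exchanges the two systems. What is proved for sign 1 transfers to
  sign -1.\<close>

lemma classical_solution_cnj:
  assumes "classical_solution \<sigma> p q T f u"
  shows "classical_solution (- cnj \<sigma>) p q T (\<lambda>t. cnj (f t)) (\<lambda>x t. \<chi> k. cnj (u x t $ k))"
proof -
  obtain ux ut where u1: "continuous_on ({0..} \<times> {0..T}) (\<lambda>(x, t). ux x t)" "continuous_on ({0..} \<times> {0..T}) (\<lambda>(x, t). ut x t)"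
    and u2: "\<forall>x\<ge>0. \<forall>t\<in>{0..T}. ((\<lambda>y. u y t) has_vector_derivative ux x t) (at x within {0..}) \<and>
           ((\<lambda>r. u x r) has_vector_derivative ut x t) (at t within {0..T})"
    and u3: "\<forall>x>0. \<forall>t\<in>{0<..<T}. \<i> *s ut x t + \<sigma> *s (dirac_J *v ux x t + dirac_V p q x *v u x t) = 0"
    and u4: "\<forall>x\<ge>0. u x 0 = 0" "\<forall>t\<in>{0..T}. u 0 t $ 1 = f t"
    using assms unfolding classical_solution_def by blast
  define C where "C v = (\<chi> k. cnj (v $ k))" for v :: "complex^2"
  have C: "bounded_linear C"
    by (rule linear_conv_bounded_linear[THEN iffD1], rule linearI) (auto simp: C_def vec_eq_iff)
  have "classical_solution (- cnj \<sigma>) p q T (\<lambda>t. cnj (f t)) (\<lambda>x t. C (u x t))"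
  proof (rule classical_solutionI[where ux = "\<lambda>x t. C (ux x t)" and ut = "\<lambda>x t. C (ut x t)"])
    show "continuous_on ({0..} \<times> {0..T}) (\<lambda>(x, t). C (ux x t))" "continuous_on ({0..} \<times> {0..T}) (\<lambda>(x, t). C (ut x t))"
      using bounded_linear.continuous_on[OF C u1(1)] bounded_linear.continuous_on[OF C u1(2)] by (simp_all add: split_beta)
    fix x t :: real assume "0 \<le> x" "t \<in> {0..T}"
    then show "((\<lambda>y. C (u y t)) has_vector_derivative C (ux x t)) (at x within {0..})"
      "((\<lambda>r. C (u x r)) has_vector_derivative C (ut x t)) (at t within {0..T})"
      using u2 by (auto intro: bounded_linear.has_vector_derivative[OF C])
  next
    fix x t :: real assume "0 < x" "t \<in> {0<..<T}"
    then have "C (\<i> *s ut x t + \<sigma> *s (dirac_J *v ux x t + dirac_V p q x *v u x t)) = C 0"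
      using u3 by simp
    then show "\<i> *s C (ut x t) + - cnj \<sigma> *s (dirac_J *v C (ux x t) + dirac_V p q x *v C (u x t)) = 0"
      by (simp add: C_def vec_eq_iff forall_2 dirac_J_mult dirac_V_mult) (auto simp: algebra_simps eq_neg_iff_add_eq_0)
  qed (use u4 in \<open>auto simp: C_def vec_eq_iff\<close>)
  then show ?thesis by (simp add: C_def)
qed

text \<open>The kernel formula for solutions evaluates and differentiates the control at negative
  times too, so the control is continued to the line with a continuous derivative.\<close>

lemma smooth_control_extension:
  assumes f: "smooth_control T f" and T: "T > 0"
  obtains g g' where "\<And>t. (g has_vector_derivative g' t) (at t)" "continuous_on UNIV g'"
    "\<And>t. t \<le> 0 \<Longrightarrow> g t = 0" "\<And>t. t \<in> {0..T} \<Longrightarrow> g t = f t"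
proof -
  obtain D e where D: "\<And>t. t \<in> {0..T} \<Longrightarrow> D 0 t = f t"
    "\<And>k t. t \<in> {0..T} \<Longrightarrow> (D k has_vector_derivative D (Suc k) t) (at t within {0..T})"
    and e: "e > 0" "\<And>t. t \<in> {0..T} \<Longrightarrow> t \<le> e \<Longrightarrow> f t = 0"
    using f unfolding smooth_control_def by blast
  have Dc: "continuous_on {0..T} (D k)" for k
    unfolding continuous_on_eq_continuous_within using D(2) has_vector_derivative_continuous by blast
  \<comment> \<open>Freezing the derivative outside \<open>{0..T}\<close> gives 0 at negative times,
    because the control vanishes near 0.\<close>
  define g' where "g' t = D 1 (max 0 (min t T))" for t
  define g where "g t = (t - 0) *\<^sub>R integral {0..1} (\<lambda>\<tau>. g' (0 + \<tau> * (t - 0)))" for t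
  have g'c: "continuous_on UNIV g'"
    unfolding g'_def by (rule continuous_on_compose2[OF Dc[of 1]]) (use T in \<open>auto intro!: continuous_intros\<close>)
  have Dg: "(g has_vector_derivative g' t) (at t)" for t
    unfolding g_def by (rule unit_integral_vector_derivative[OF g'c])
  have D10: "D 1 0 = 0"
  proof (rule vector_derivative_unique_within_closed_interval)
    let ?c = "min e T"
    show "0 < ?c" "0 \<in> cbox 0 ?c" using e T by auto
    show "(D 0 has_vector_derivative D 1 0) (at 0 within cbox 0 ?c)"
      using has_vector_derivative_within_subset[OF D(2)[of 0 0], of "{0..?c}"] T by simp
    have "((\<lambda>_. 0) has_vector_derivative (0::complex)) (at 0 within {0..?c})" by simp
    then show "(D 0 has_vector_derivative 0) (at 0 within cbox 0 ?c)"
      unfolding cbox_interval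
      by (rule has_vector_derivative_transform[rotated 2]) (use D(1) e T in auto)
  qed
  show ?thesis
  proof (rule that[OF Dg g'c])
    fix t :: real
    show "g t = 0" if "t \<le> 0"
    proof -
      have "integral {0..1} (\<lambda>\<tau>. g' (0 + \<tau> * (t - 0))) = integral {0..1} (\<lambda>\<tau>::real. 0)"
      proof (rule integral_cong)
        fix \<tau> :: real assume "\<tau> \<in> {0..1}"
        then have "0 + \<tau> * (t - 0) \<le> 0" using that by (simp add: mult_nonneg_nonpos)
        then have "max 0 (min (0 + \<tau> * (t - 0)) T) = 0" using T by linarith
        then show "g' (0 + \<tau> * (t - 0)) = 0" unfolding g'_def using D10 by (simp only:)
      qed
      then show ?thesis by (simp add: g_def)
    qed
    show "g t = f t" if t: "t \<in> {0..T}"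
    proof -
      have "g t = D 0 t - D 0 0"
        unfolding g_def
      proof (rule unit_integral_eq_increment)
        show "closed_segment 0 t \<subseteq> {0..T}" using t by (auto simp: closed_segment_eq_real_ivl)
        show "(D 0 has_vector_derivative g' x) (at x within {0..T})" if "x \<in> closed_segment 0 t" for x
        proof -
          have x: "x \<in> {0..T}" using that t by (auto simp: closed_segment_eq_real_ivl)
          then have "g' x = D 1 x" by (simp add: g'_def)
          then show ?thesis using D(2)[OF x, of 0] by simp
        qed
      qed
      then show ?thesis using D(1)[OF t] D(1)[of 0] e(2)[of 0] e T by simp
    qed
  qed
qed

section \<open>Solutions built from the Goursat kernels\<close>

lemma has_vector_derivative_shift:
  assumes "(f has_vector_derivative f') (at (c + k * x))"
  shows "((\<lambda>x. f (c + k * x)) has_vector_derivative k *\<^sub>R f') (at x)"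
proof -
  have "((\<lambda>x. c + k * x) has_vector_derivative k) (at x)"
    unfolding has_real_derivative_iff_has_vector_derivative[symmetric] by (auto intro!: derivative_eq_intros)
  from vector_diff_chain_at[OF this assms] show ?thesis by (simp add: o_def)
qed

text \<open>Recovers \<open>u\<close> from the Riemann variables \<open>\<alpha> = u\<^sub>1 - i u\<^sub>2\<close>, \<open>\<beta> = u\<^sub>1 + i u\<^sub>2\<close>.\<close>

definition from_riemann :: "complex \<Rightarrow> complex \<Rightarrow> complex^2" where
  "from_riemann \<alpha> \<beta> = vector [(\<alpha> + \<beta>) / 2, \<i> * (\<alpha> - \<beta>) / 2]"

lemma from_riemann_eq: "from_riemann \<alpha> \<beta> = axis 1 ((\<alpha> + \<beta>) / 2) + axis 2 (\<i> * (\<alpha> - \<beta>) / 2)"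
  by (simp add: from_riemann_def vector_2_eq)

lemma from_riemann_vector_derivative:
  assumes "(f has_vector_derivative f') F" "(g has_vector_derivative g') F"
  shows "((\<lambda>x. from_riemann (f x) (g x)) has_vector_derivative from_riemann f' g') F"
  unfolding from_riemann_eq divide_inverse
  by (intro has_vector_derivative_add bounded_linear.has_vector_derivative[OF bounded_linear_axis]
      has_vector_derivative_mult_left has_vector_derivative_mult_right has_vector_derivative_diff assms)

lemma continuous_on_from_riemann:
  assumes "continuous_on A f" "continuous_on A g"
  shows "continuous_on A (\<lambda>x. from_riemann (f x) (g x))"
  unfolding from_riemann_eq
  by (intro continuous_on_add bounded_linear.continuous_on[OF bounded_linear_axis] continuous_intros assms) simp_all

text \<open>The values of \<open>r\<close> on the negative axis belong to a continuous continuation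
  of \<open>q + i p\<close>: the kernels live on the whole plane, the Dirac system on the
  half-line.\<close>

locale dirac_kernels =
  fixes p q :: "real \<Rightarrow> real" and T :: real and r :: "real \<Rightarrow> complex"
    and a b :: "real \<Rightarrow> real \<Rightarrow> complex" and \<phi> :: "real \<Rightarrow> complex \<Rightarrow> complex"
  assumes T: "T > 0" and r_cont: "continuous_on UNIV r" and r_eq: "\<And>x. x \<ge> 0 \<Longrightarrow> r x = Complex (q x) (p x)"
    and a_cont: "continuous_on UNIV (\<lambda>z. a (fst z) (snd z))" and b_cont: "continuous_on UNIV (\<lambda>z. b (fst z) (snd z))"
    and a_deriv: "\<And>\<xi> \<eta>. (a \<xi> has_vector_derivative r (\<eta> - \<xi>) * b \<xi> \<eta>) (at \<eta>)"
    and b_deriv: "\<And>\<xi> \<eta>. ((\<lambda>\<xi>. b \<xi> \<eta>) has_vector_derivative - cnj (r (\<eta> - \<xi>)) * a \<xi> \<eta>) (at \<xi>)"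
    and ab_diag: "\<And>\<xi>. a \<xi> \<xi> = - b \<xi> \<xi>" and b_zero: "\<And>\<eta>. b 0 \<eta> = - cnj (r \<eta>)"
    and \<phi>_cont: "continuous_on UNIV (\<lambda>z. \<phi> (fst z) (snd z))"
    and \<phi>_deriv: "\<And>x l. ((\<lambda>x. \<phi> x l) has_vector_derivative (- \<i> * l * \<phi> x l + r x * cnj (\<phi> x (cnj l)))) (at x)"
    and \<phi>_zero: "\<And>l. \<phi> 0 l = - \<i>" and \<phi>_hol: "\<And>x. \<phi> x holomorphic_on UNIV"
begin

text \<open>The response at \<open>x\<close> to an impulse emitted \<open>x + \<rho>\<close> earlier
  has the characteristic coordinates \<open>\<rho> / 2\<close> and \<open>x + \<rho> / 2\<close>.
  The upper limit can be \<open>T\<close> for all arguments because the controls vanish at negative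
  times, so no endpoint depends on \<open>x\<close> or \<open>\<tau>\<close>.\<close>

definition delayed :: "(real \<Rightarrow> real \<Rightarrow> complex) \<Rightarrow> (real \<Rightarrow> complex) \<Rightarrow> real \<Rightarrow> real \<Rightarrow> complex" where
  "delayed k f x \<tau> = integral {0..T} (\<lambda>\<rho>. k (\<rho> / 2) (x + \<rho> / 2) * f (\<tau> - \<rho>))"

lemma continuous_on_kernel:
  assumes "continuous_on UNIV (\<lambda>z. k (fst z) (snd z))" "continuous_on A f" "continuous_on A g"
  shows "continuous_on A (\<lambda>x. k (f x) (g x) :: complex)"
  using continuous_on_comp_UNIV[OF assms(1) continuous_on_Pair[OF assms(2,3)]] by simp

lemma delayed_cont:
  fixes k :: "real \<Rightarrow> real \<Rightarrow> complex" and f :: "real \<Rightarrow> complex"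
  assumes k: "continuous_on UNIV (\<lambda>z. k (fst z) (snd z))" and f: "continuous_on UNIV f"
    and c: "continuous_on A g" "continuous_on A h"
  shows "continuous_on A (\<lambda>w. delayed k f (g w) (h w))"
proof -
  have "continuous_on UNIV (\<lambda>z. integral (cbox 0 T) (\<lambda>\<rho>. k (\<rho> / 2) (fst z + \<rho> / 2) * f (snd z - \<rho>)))"
    by (rule integral_continuous_on_param)
      (auto simp: split_beta intro!: continuous_intros continuous_on_kernel[where k = k, OF k] continuous_on_comp_UNIV[OF f])
  from continuous_on_comp_UNIV[OF this continuous_on_Pair[OF c]] show ?thesis
    by (simp add: delayed_def)
qed

lemma delayed_integrand_cont:
  fixes k :: "real \<Rightarrow> real \<Rightarrow> complex" and f :: "real \<Rightarrow> complex"
  assumes k: "continuous_on UNIV (\<lambda>z. k (fst z) (snd z))" and f: "continuous_on UNIV f"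
  shows "continuous_on A (\<lambda>\<rho>. k (\<rho> / 2) (x + \<rho> / 2) * f (\<tau> - \<rho>))"
  by (intro continuous_intros continuous_on_kernel[where k = k, OF k] continuous_on_comp_UNIV[OF f]) auto

lemma delayed_derivative_time:
  fixes k :: "real \<Rightarrow> real \<Rightarrow> complex" and f :: "real \<Rightarrow> complex"
  assumes k: "continuous_on UNIV (\<lambda>z. k (fst z) (snd z))"
    and f: "\<And>t. (f has_vector_derivative f' t) (at t)" and f': "continuous_on UNIV f'"
  shows "(delayed k f x has_vector_derivative delayed k f' x \<tau>) (at \<tau>)"
proof -
  have fc: "continuous_on UNIV f"
    by (intro continuous_at_imp_continuous_on ballI has_vector_derivative_continuous[OF f])
  have "((\<lambda>\<tau>. integral (cbox 0 T) (\<lambda>\<rho>. k (\<rho> / 2) (x + \<rho> / 2) * f (\<tau> - \<rho>))) has_vector_derivative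
     integral (cbox 0 T) (\<lambda>\<rho>. k (\<rho> / 2) (x + \<rho> / 2) * f' (\<tau> - \<rho>))) (at \<tau> within UNIV)"
  proof (rule leibniz_rule_vector_derivative)
    show "((\<lambda>\<tau>. k (\<rho> / 2) (x + \<rho> / 2) * f (\<tau> - \<rho>)) has_vector_derivative k (\<rho> / 2) (x + \<rho> / 2) * f' (\<tau> - \<rho>)) (at \<tau> within UNIV)" for \<tau> \<rho>
      using has_vector_derivative_shift[of f _ "- \<rho>" 1 \<tau>, OF f] by (intro has_vector_derivative_mult_right) simp
    show "(\<lambda>\<rho>. k (\<rho> / 2) (x + \<rho> / 2) * f (\<tau> - \<rho>)) integrable_on cbox 0 T" for \<tau>
      by (intro integrable_continuous delayed_integrand_cont k fc)
    show "continuous_on (UNIV \<times> cbox 0 T) (\<lambda>(\<tau>, \<rho>). k (\<rho> / 2) (x + \<rho> / 2) * f' (\<tau> - \<rho>))"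
      unfolding split_beta by (intro continuous_intros continuous_on_kernel[where k = k, OF k] continuous_on_comp_UNIV[OF f']) auto
  qed auto
  then show ?thesis by (simp add: delayed_def[abs_def])
qed

text \<open>Moving \<open>x\<close> changes only the second characteristic coordinate, and the
  difference of the two coordinates is \<open>x\<close> throughout, so \<open>r x\<close> leaves the
  integral.\<close>

lemma delayed_derivative_space:
  assumes f: "continuous_on UNIV f"
  shows "((\<lambda>x. delayed a f x \<tau>) has_vector_derivative r x * delayed b f x \<tau>) (at x)"
proof -
  have "((\<lambda>x. integral (cbox 0 T) (\<lambda>\<rho>. a (\<rho> / 2) (x + \<rho> / 2) * f (\<tau> - \<rho>))) has_vector_derivative
     integral (cbox 0 T) (\<lambda>\<rho>. r x * b (\<rho> / 2) (x + \<rho> / 2) * f (\<tau> - \<rho>))) (at x within UNIV)"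
  proof (rule leibniz_rule_vector_derivative)
    show "((\<lambda>x. a (\<rho> / 2) (x + \<rho> / 2) * f (\<tau> - \<rho>)) has_vector_derivative r x * b (\<rho> / 2) (x + \<rho> / 2) * f (\<tau> - \<rho>)) (at x within UNIV)" for x \<rho>
      using has_vector_derivative_shift[of "a (\<rho> / 2)" _ "\<rho> / 2" 1 x, OF a_deriv]
      by (intro has_vector_derivative_mult_left) (simp add: add.commute)
    show "(\<lambda>\<rho>. a (\<rho> / 2) (x + \<rho> / 2) * f (\<tau> - \<rho>)) integrable_on cbox 0 T" for x
      by (intro integrable_continuous delayed_integrand_cont a_cont f)
    show "continuous_on (UNIV \<times> cbox 0 T) (\<lambda>(x, \<rho>). r x * b (\<rho> / 2) (x + \<rho> / 2) * f (\<tau> - \<rho>))"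
      unfolding split_beta
      by (intro continuous_intros continuous_on_comp_UNIV[OF r_cont] continuous_on_kernel[where k = b, OF b_cont] continuous_on_comp_UNIV[OF f]) auto
  qed auto
  then show ?thesis by (simp add: delayed_def[abs_def] mult.assoc)
qed

text \<open>Along the other family of characteristics \<open>x + t = y\<close> the integral is rewritten over
  \<open>\<eta> = x + \<rho> / 2\<close>, where the argument of \<open>f\<close> does not depend on \<open>x\<close>.\<close>

lemma delayed_derivative_characteristic:
  assumes f: "continuous_on UNIV f"
  shows "((\<lambda>x. delayed b f x (y - 2 * x)) has_vector_derivative
     cnj (r x) * (delayed a f x (y - 2 * x) + 2 * f (y - 2 * x)) + 2 * b (T / 2) (T / 2 + x) * f (y - 2 * x - T)) (at x)"
proof -
  define g where "g k x \<eta> = k (\<eta> - x) \<eta> * f (y - 2 * \<eta>)" for k :: "real \<Rightarrow> real \<Rightarrow> complex" and x \<eta> :: real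
  \<comment> \<open>Primitive of \<open>g\<close> in \<open>\<eta>\<close> from 0; the delayed
    integral is twice its increment from \<open>x\<close> to \<open>T / 2 + x\<close>.\<close>
  define P where "P k x z = (z - 0) *\<^sub>R integral {0..1} (\<lambda>\<tau>. g k x (0 + \<tau> * (z - 0)))" for k x z
  have gc: "continuous_on A (\<lambda>w. g k (u w) (v w))"
    if "continuous_on UNIV (\<lambda>z. k (fst z) (snd z))" "continuous_on A u" "continuous_on A v" for k u v and A :: "real set"
    unfolding g_def by (intro continuous_intros continuous_on_kernel[where k = k, OF that(1)] continuous_on_comp_UNIV[OF f] that(2,3))
  have gc2: "continuous_on A (\<lambda>w. g k (u w) (v w))"
    if "continuous_on UNIV (\<lambda>z. k (fst z) (snd z))" "continuous_on A u" "continuous_on A v" for k u v and A :: "(real \<times> real) set"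
    unfolding g_def by (intro continuous_intros continuous_on_kernel[where k = k, OF that(1)] continuous_on_comp_UNIV[OF f] that(2,3))
  have Pz: "(P k x has_vector_derivative g k x z) (at z)" if "continuous_on UNIV (\<lambda>z. k (fst z) (snd z))" for k x z
    unfolding P_def by (rule unit_integral_vector_derivative) (intro gc that continuous_intros)
  have id: "delayed k f x (y - 2 * x) = 2 * (P k x (T / 2 + x) - P k x x)" if k: "continuous_on UNIV (\<lambda>z. k (fst z) (snd z))" for k x
  proof -
    have "((\<lambda>\<rho>. k (\<rho> / 2) (x + \<rho> / 2) * f (y - 2 * x - \<rho>)) has_integral (2 * P k x (x + (1/2) * T) - 2 * P k x (x + (1/2) * 0))) {0..T}"
    proof (rule fundamental_theorem_of_calculus)
      fix \<rho> assume "\<rho> \<in> {0..T}"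
      have "((\<lambda>\<rho>. 2 * P k x (x + (1/2) * \<rho>)) has_vector_derivative 2 * ((1/2) *\<^sub>R g k x (x + (1/2) * \<rho>))) (at \<rho>)"
        by (intro has_vector_derivative_mult_right has_vector_derivative_shift Pz k)
      then have "((\<lambda>\<rho>. 2 * P k x (x + (1/2) * \<rho>)) has_vector_derivative k (\<rho> / 2) (x + \<rho> / 2) * f (y - 2 * x - \<rho>)) (at \<rho>)"
        by (simp add: g_def scaleR_conv_of_real algebra_simps)
      then show "((\<lambda>\<rho>. 2 * P k x (x + (1/2) * \<rho>)) has_vector_derivative k (\<rho> / 2) (x + \<rho> / 2) * f (y - 2 * x - \<rho>)) (at \<rho> within {0..T})"
        by (rule has_vector_derivative_at_within)
    qed (use T in simp)
    from integral_unique[OF this] show ?thesis by (simp add: delayed_def algebra_simps)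
  qed
  have Px: "((\<lambda>x. P b x z) has_vector_derivative cnj (r x) * P a x z) (at x)" for x z
  proof -
    have "((\<lambda>x. integral (cbox 0 1) (\<lambda>\<tau>. g b x (\<tau> * z))) has_vector_derivative
       integral (cbox 0 1) (\<lambda>\<tau>. cnj (r x) * g a x (\<tau> * z))) (at x within UNIV)"
    proof (rule leibniz_rule_vector_derivative)
      show "((\<lambda>x. g b x (\<tau> * z)) has_vector_derivative cnj (r x) * g a x (\<tau> * z)) (at x within UNIV)" for x \<tau>
      proof -
        let ?\<eta> = "\<tau> * z"
        have "((\<lambda>x. b (?\<eta> + (-1) * x) ?\<eta>) has_vector_derivative (-1) *\<^sub>R (- cnj (r (?\<eta> - (?\<eta> + (-1) * x))) * a (?\<eta> + (-1) * x) ?\<eta>)) (at x)"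
          by (rule has_vector_derivative_shift[where f = "\<lambda>\<xi>. b \<xi> ?\<eta>"], rule b_deriv)
        then have "((\<lambda>x. b (?\<eta> - x) ?\<eta>) has_vector_derivative cnj (r x) * a (?\<eta> - x) ?\<eta>) (at x)" by simp
        from has_vector_derivative_mult_left[OF this, of "f (y - 2 * ?\<eta>)"] show ?thesis by (simp add: g_def mult.assoc)
      qed
      show "(\<lambda>\<tau>. g b x (\<tau> * z)) integrable_on cbox 0 1" for x
        by (intro integrable_continuous gc b_cont continuous_intros)
      show "continuous_on (UNIV \<times> cbox 0 1) (\<lambda>(x, \<tau>). cnj (r x) * g a x (\<tau> * z))"
        unfolding split_beta
        by (intro continuous_intros continuous_on_comp_UNIV[OF r_cont] gc2 a_cont)
    qed auto
    from bounded_linear.has_vector_derivative[OF bounded_linear_scaleR_right this, of z]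
    show ?thesis by (simp add: P_def scaleR_conv_of_real mult_ac)
  qed
  have line: "((\<lambda>s. P b s (c + 1 * s)) has_vector_derivative (cnj (r x) * P a x (c + 1 * x) + 1 *\<^sub>R g b x (c + 1 * x))) (at x)" for c x
    by (rule vector_derivative_along_line[OF Px Pz[OF b_cont]])
      (unfold split_beta, intro gc2 b_cont continuous_intros)
  have "((\<lambda>x. 2 * (P b x (T / 2 + 1 * x) - P b x (0 + 1 * x))) has_vector_derivative
     2 * ((cnj (r x) * P a x (T / 2 + 1 * x) + 1 *\<^sub>R g b x (T / 2 + 1 * x)) - (cnj (r x) * P a x (0 + 1 * x) + 1 *\<^sub>R g b x (0 + 1 * x)))) (at x)"
    by (intro has_vector_derivative_mult_right has_vector_derivative_diff line)
  \<comment> \<open>The lower endpoint enters with \<open>b 0 x = - cnj (r x)\<close> and produces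
    the term \<open>2 * f (y - 2 * x)\<close>; the upper endpoint leaves the last term.\<close>
  moreover have "2 * ((cnj (r x) * P a x (T / 2 + 1 * x) + 1 *\<^sub>R g b x (T / 2 + 1 * x)) - (cnj (r x) * P a x (0 + 1 * x) + 1 *\<^sub>R g b x (0 + 1 * x)))
     = cnj (r x) * (delayed a f x (y - 2 * x) + 2 * f (y - 2 * x)) + 2 * b (T / 2) (T / 2 + x) * f (y - 2 * x - T)"
    unfolding id[OF a_cont] by (simp add: g_def b_zero algebra_simps)
  ultimately show ?thesis unfolding id[OF b_cont] by simp
qed

text \<open>The leading part \<open>g (t - x)\<close> times the vector (1, i) has Riemann variables
  \<open>2 * g (t - x)\<close> and 0; the kernels add the regular responses in both
  variables.\<close>

lemma classical_solution_exists:
  assumes g: "\<And>t. (g has_vector_derivative g' t) (at t)" and g': "continuous_on UNIV g'"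
    and g0: "\<And>t. t \<le> 0 \<Longrightarrow> g t = 0"
  shows "classical_solution 1 p q T g (\<lambda>x t. from_riemann (2 * g (t - x) + delayed a g x (t - x)) (delayed b g x (t - x)))"
proof -
  have gc: "continuous_on UNIV g"
    by (intro continuous_at_imp_continuous_on ballI has_vector_derivative_continuous[OF g])
  define \<alpha> where "\<alpha> x t = 2 * g (t - x) + delayed a g x (t - x)" for x t
  define \<beta> where "\<beta> x t = delayed b g x (t - x)" for x t
  define \<alpha>t where "\<alpha>t x t = 2 * g' (t - x) + delayed a g' x (t - x)" for x t
  define \<beta>t where "\<beta>t x t = delayed b g' x (t - x)" for x t
  define \<alpha>x where "\<alpha>x x t = r x * \<beta> x t - \<alpha>t x t" for x t
  define \<beta>x where "\<beta>x x t = cnj (r x) * \<alpha> x t + 2 * b (T / 2) (T / 2 + x) * g (t - x - T) + \<beta>t x t" for x t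
  have gs: "((\<lambda>t. g (t - x)) has_vector_derivative g' (t - x)) (at t)" for x t
    using has_vector_derivative_shift[of g _ "- x" 1 t, OF g] by simp
  have ds: "((\<lambda>t. delayed k g x (t - x)) has_vector_derivative delayed k g' x (t - x)) (at t)"
    if "continuous_on UNIV (\<lambda>z. k (fst z) (snd z))" for k x t
    using has_vector_derivative_shift[of "delayed k g x" _ "- x" 1 t, OF delayed_derivative_time[OF that g g']] by simp
  have D\<alpha>t: "(\<alpha> x has_vector_derivative \<alpha>t x t) (at t)" for x t
    unfolding \<alpha>_def \<alpha>t_def by (intro has_vector_derivative_add has_vector_derivative_mult_right gs ds a_cont)
  have D\<beta>t: "(\<beta> x has_vector_derivative \<beta>t x t) (at t)" for x t
    unfolding \<beta>_def \<beta>t_def by (intro ds b_cont)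
  have D\<alpha>x: "((\<lambda>x. \<alpha> x t) has_vector_derivative \<alpha>x x t) (at x)" for x t
  proof -
    have "((\<lambda>s. (2 * g (t + (-1) * s) + delayed a g s (t + (-1) * s))) has_vector_derivative
       ((0 + r x * delayed b g x (t + (-1) * x)) + (-1) *\<^sub>R (2 * g' (t + (-1) * x) + delayed a g' x (t + (-1) * x)))) (at x)"
    proof (rule vector_derivative_along_line[where F = "\<lambda>x \<tau>. 2 * g \<tau> + delayed a g x \<tau>"])
      show "((\<lambda>x. 2 * g y + delayed a g x y) has_vector_derivative 0 + r x * delayed b g x y) (at x)" for x y
        by (intro has_vector_derivative_add has_vector_derivative_const delayed_derivative_space gc)
      show "((\<lambda>y. 2 * g y + delayed a g x y) has_vector_derivative 2 * g' y + delayed a g' x y) (at y)" for x y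
        by (intro has_vector_derivative_add has_vector_derivative_mult_right g delayed_derivative_time g' a_cont)
      show "continuous_on UNIV (\<lambda>(x, y). 2 * g' y + delayed a g' x y)"
        unfolding split_beta by (intro continuous_intros continuous_on_comp_UNIV[OF g'] delayed_cont a_cont g')
    qed
    then show ?thesis by (simp add: \<alpha>_def \<alpha>x_def \<beta>_def \<alpha>t_def algebra_simps)
  qed
  have D\<beta>x: "((\<lambda>x. \<beta> x t) has_vector_derivative \<beta>x x t) (at x)" for x t
  proof -
    have "((\<lambda>s. delayed b g s ((t + 1 * s) - 2 * s)) has_vector_derivative
       ((cnj (r x) * (delayed a g x ((t + 1 * x) - 2 * x) + 2 * g ((t + 1 * x) - 2 * x)) + 2 * b (T / 2) (T / 2 + x) * g ((t + 1 * x) - 2 * x - T))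
        + 1 *\<^sub>R delayed b g' x ((t + 1 * x) - 2 * x))) (at x)"
    \<comment> \<open>With \<open>y = x + t\<close> held fixed the characteristic derivative
      applies; moving \<open>y\<close> along with \<open>x\<close> adds the time derivative.\<close>
    proof (rule vector_derivative_along_line[where F = "\<lambda>x y. delayed b g x (y - 2 * x)"])
      show "((\<lambda>y. delayed b g x (y - 2 * x)) has_vector_derivative delayed b g' x (y - 2 * x)) (at y)" for x y
        using has_vector_derivative_shift[of "delayed b g x" _ "- (2 * x)" 1 y, OF delayed_derivative_time[OF b_cont g g']] by simp
      show "continuous_on UNIV (\<lambda>(x, y). delayed b g' x (y - 2 * x))"
        unfolding split_beta by (intro delayed_cont b_cont g' continuous_intros)
    qed (rule delayed_derivative_characteristic[OF gc])
    moreover have "(t + 1 * s) - 2 * s = t - s" for s by simp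
    ultimately show ?thesis by (simp add: \<beta>_def \<beta>x_def \<alpha>_def \<beta>t_def algebra_simps)
  qed
  have "classical_solution 1 p q T g (\<lambda>x t. from_riemann (\<alpha> x t) (\<beta> x t))"
  proof (rule classical_solutionI[where ux = "\<lambda>x t. from_riemann (\<alpha>x x t) (\<beta>x x t)" and ut = "\<lambda>x t. from_riemann (\<alpha>t x t) (\<beta>t x t)"])
    have ct: "continuous_on A (\<lambda>z. \<alpha>t (fst z) (snd z))" "continuous_on A (\<lambda>z. \<beta>t (fst z) (snd z))" for A
      unfolding \<alpha>t_def \<beta>t_def by (intro continuous_intros continuous_on_comp_UNIV[OF g'] delayed_cont a_cont b_cont g')+
    have c0: "continuous_on A (\<lambda>z. \<alpha> (fst z) (snd z))" "continuous_on A (\<lambda>z. \<beta> (fst z) (snd z))" for A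
      unfolding \<alpha>_def \<beta>_def by (intro continuous_intros continuous_on_comp_UNIV[OF gc] delayed_cont a_cont b_cont gc)+
    show "continuous_on ({0..} \<times> {0..T}) (\<lambda>(x, t). from_riemann (\<alpha>t x t) (\<beta>t x t))"
      unfolding split_beta by (intro continuous_on_from_riemann ct)
    show "continuous_on ({0..} \<times> {0..T}) (\<lambda>(x, t). from_riemann (\<alpha>x x t) (\<beta>x x t))"
      unfolding split_beta \<alpha>x_def \<beta>x_def
      by (intro continuous_on_from_riemann continuous_intros ct c0 continuous_on_comp_UNIV[OF r_cont] continuous_on_kernel[where k = b, OF b_cont] continuous_on_comp_UNIV[OF gc])
  next
    fix x t :: real
    show "((\<lambda>y. from_riemann (\<alpha> y t) (\<beta> y t)) has_vector_derivative from_riemann (\<alpha>x x t) (\<beta>x x t)) (at x within {0..})"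
      by (intro from_riemann_vector_derivative has_vector_derivative_at_within[OF D\<alpha>x] has_vector_derivative_at_within[OF D\<beta>x])
    show "((\<lambda>s. from_riemann (\<alpha> x s) (\<beta> x s)) has_vector_derivative from_riemann (\<alpha>t x t) (\<beta>t x t)) (at t within {0..T})"
      by (intro from_riemann_vector_derivative has_vector_derivative_at_within[OF D\<alpha>t] has_vector_derivative_at_within[OF D\<beta>t])
  next
    fix x t :: real assume x: "x > 0" and t: "t \<in> {0<..<T}"
    \<comment> \<open>The endpoint term of the characteristic derivative is the control at the
      negative time \<open>t - x - T\<close>.\<close>
    have z: "g (t - x - T) = 0" using x t by (intro g0) simp
    have rx: "r x = complex_of_real (q x) + \<i> * complex_of_real (p x)" using r_eq[of x] x by (simp add: Complex_eq)
    have "\<alpha>t x t = r x * \<beta> x t - \<alpha>x x t" "\<beta>t x t = \<beta>x x t - cnj (r x) * \<alpha> x t"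
      by (simp_all add: \<alpha>x_def \<beta>x_def z)
    then show "\<i> *s from_riemann (\<alpha>t x t) (\<beta>t x t) + 1 *s (dirac_J *v from_riemann (\<alpha>x x t) (\<beta>x x t) + dirac_V p q x *v from_riemann (\<alpha> x t) (\<beta> x t)) = 0"
      by (simp add: vec_eq_iff forall_2 dirac_J_mult dirac_V_mult from_riemann_def rx) (simp add: field_simps)
  next
    fix x :: real assume x: "x \<ge> 0"
    have "delayed k g x (0 - x) = 0" for k
    proof -
      have "integral {0..T} (\<lambda>\<rho>. k (\<rho> / 2) (x + \<rho> / 2) * g (0 - x - \<rho>)) = integral {0..T} (\<lambda>\<rho>. 0)"
        by (rule integral_cong) (use x g0 in auto)
      then show ?thesis by (simp add: delayed_def)
    qed
    then show "from_riemann (\<alpha> x 0) (\<beta> x 0) = 0"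
      using g0[of "- x"] x by (simp add: \<alpha>_def \<beta>_def from_riemann_def vec_eq_iff forall_2)
  next
    fix t :: real assume t: "t \<in> {0..T}"
    \<comment> \<open>At \<open>x = 0\<close> the kernels are evaluated on the diagonal, where
      \<open>a = - b\<close>; the regular parts cancel in the first component.\<close>
    have "delayed a g 0 t = integral {0..T} (\<lambda>\<rho>. - (b (\<rho> / 2) (0 + \<rho> / 2) * g (t - \<rho>)))"
      by (simp add: delayed_def ab_diag)
    also have "\<dots> = - delayed b g 0 t" by (simp only: delayed_def integral_neg)
    finally show "from_riemann (\<alpha> 0 t) (\<beta> 0 t) $ 1 = g t"
      by (simp add: \<alpha>_def \<beta>_def from_riemann_def)
  qed
  then show ?thesis by (simp add: \<alpha>_def \<beta>_def)
qed

end

section \<open>Generalized solutions\<close>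

lemma lebesgue_integral_open_interval:
  fixes h :: "real \<Rightarrow> complex"
  assumes "continuous_on {0..c} h"
  shows "(LINT s|lborel_on {0<..<c}. h s) = integral {0..c} h"
proof -
  have "set_integrable lborel {0..c} h" by (rule borel_integrable_atLeastAtMost'[OF assms])
  then have si: "set_integrable lborel {0<..<c} h" by (rule set_integrable_subset) auto
  have "(LINT s|lborel_on {0<..<c}. h s) = (LINT s|lborel. indicator {0<..<c} s *\<^sub>R h s)"
    by (subst integral_restrict_space) auto
  also have "\<dots> = integral {0<..<c} h"
    using set_borel_integral_eq_integral(2)[OF si] by (simp add: set_lebesgue_integral_def)
  also have "\<dots> = integral {0..c} h" using integral_open_interval_real[of 0 c h] by simp
  finally show ?thesis .
qed

lemma L2_cong:
  assumes "\<And>x. x \<in> space M \<Longrightarrow> f x = g x"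
  shows "f \<in> L2 M \<longleftrightarrow> g \<in> L2 M"
proof -
  have "f \<in> borel_measurable M \<longleftrightarrow> g \<in> borel_measurable M" using assms by (intro measurable_cong) auto
  moreover have "integrable M (\<lambda>x. (norm (f x))\<^sup>2) \<longleftrightarrow> integrable M (\<lambda>x. (norm (g x))\<^sup>2)"
    using assms by (intro Bochner_Integration.integrable_cong) auto
  ultimately show ?thesis by (simp add: L2_def)
qed

lemma L2_tendsto_cong:
  assumes "\<And>n x. x \<in> space M \<Longrightarrow> f n x = f' n x" "\<And>x. x \<in> space M \<Longrightarrow> g x = g' x"
  shows "L2_tendsto M f g \<longleftrightarrow> L2_tendsto M f' g'"
proof -
  have "f n \<in> L2 M \<longleftrightarrow> f' n \<in> L2 M" for n using assms by (intro L2_cong) auto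
  moreover have "g \<in> L2 M \<longleftrightarrow> g' \<in> L2 M" using assms by (intro L2_cong) auto
  moreover have "(LINT x|M. (norm (f n x - g x))\<^sup>2) = (LINT x|M. (norm (f' n x - g' x))\<^sup>2)" for n
    using assms by (intro Bochner_Integration.integral_cong) auto
  ultimately show ?thesis by (simp add: L2_tendsto_iff)
qed

lemma L2_tendsto_bounded_linear:
  fixes A :: "'a::{banach,second_countable_topology} \<Rightarrow> 'b::{banach,second_countable_topology}"
  assumes A: "bounded_linear A" and f: "L2_tendsto M f g"
  shows "L2_tendsto M (\<lambda>n x. A (f n x)) (\<lambda>x. A (g x))"
proof -
  have L: "\<And>n. f n \<in> L2 M" "g \<in> L2 M" and l: "(\<lambda>n. (LINT x|M. (norm (f n x - g x))\<^sup>2)) \<longlonglongrightarrow> 0"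
    using f by (auto simp: L2_tendsto_iff)
  have e: "A (f n x) - A (g x) = A (f n x - g x)" for n x by (simp add: linear_diff[OF bounded_linear.linear[OF A]])
  have "(\<lambda>n. (LINT x|M. (norm (A (f n x) - A (g x)))\<^sup>2)) \<longlonglongrightarrow> 0"
  proof (rule tendsto_sandwich[OF _ _ tendsto_const])
    show "\<forall>\<^sub>F n in sequentially. 0 \<le> (LINT x|M. (norm (A (f n x) - A (g x)))\<^sup>2)" by simp
    show "\<forall>\<^sub>F n in sequentially. (LINT x|M. (norm (A (f n x) - A (g x)))\<^sup>2) \<le> (onorm A)\<^sup>2 * (LINT x|M. (norm (f n x - g x))\<^sup>2)"
      unfolding e by (intro always_eventually allI L2_bounded_linear(2)[OF L2_diff(1)[OF L] A])
    show "(\<lambda>n. (onorm A)\<^sup>2 * (LINT x|M. (norm (f n x - g x))\<^sup>2)) \<longlonglongrightarrow> 0" using tendsto_mult_left[OF l] by simp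
  qed
  then show ?thesis unfolding L2_tendsto_iff using L2_bounded_linear(1)[OF L(1) A] L2_bounded_linear(1)[OF L(2) A] by blast
qed

definition cnj_vec :: "complex^2 \<Rightarrow> complex^2" where "cnj_vec v = (\<chi> k. cnj (v $ k))"

lemma bounded_linear_cnj_vec: "bounded_linear cnj_vec"
  by (rule linear_conv_bounded_linear[THEN iffD1], rule linearI) (auto simp: cnj_vec_def vec_eq_iff)

lemma cnj_vec_cnj_vec [simp]: "cnj_vec (cnj_vec v) = v"
  by (simp add: cnj_vec_def vec_eq_iff)

lemma smooth_control_cnj: "smooth_control T f \<Longrightarrow> smooth_control T (\<lambda>t. cnj (f t))"
proof -
  assume "smooth_control T f"
  then obtain D e where D: "\<forall>t\<in>{0..T}. D 0 t = f t"
    "\<forall>k. \<forall>t\<in>{0..T}. (D k has_vector_derivative D (Suc k) t) (at t within {0..T})"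
    and e: "e > 0" "\<forall>t\<in>{0..T}. t \<le> e \<longrightarrow> f t = 0"
    unfolding smooth_control_def by blast
  then show ?thesis unfolding smooth_control_def
    by (intro conjI exI[of _ "\<lambda>k t. cnj (D k t)"] exI[of _ e]) (auto intro: has_vector_derivative_cnj)
qed

lemma generalized_solution_cnj:
  assumes "generalized_solution \<sigma> p q T f u"
  shows "generalized_solution (- cnj \<sigma>) p q T (\<lambda>t. cnj (f t)) (\<lambda>x t. cnj_vec (u x t))"
proof -
  obtain fn un where 1: "\<And>n. smooth_control T (fn n)" "\<And>n. classical_solution \<sigma> p q T (fn n) (un n)"
    "L2_tendsto (lborel_on {0<..<T}) fn f" "\<And>t. t \<in> {0..T} \<Longrightarrow> L2_tendsto (lborel_on {0<..}) (\<lambda>n x. un n x t) (\<lambda>x. u x t)"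
    using assms unfolding generalized_solution_def by blast
  show ?thesis
    unfolding generalized_solution_def
  proof (intro exI[of _ "\<lambda>n t. cnj (fn n t)"] exI[of _ "\<lambda>n x t. cnj_vec (un n x t)"] conjI allI ballI)
    show "smooth_control T (\<lambda>t. cnj (fn n t))" for n by (rule smooth_control_cnj[OF 1(1)])
    show "classical_solution (- cnj \<sigma>) p q T (\<lambda>t. cnj (fn n t)) (\<lambda>x t. cnj_vec (un n x t))" for n
      unfolding cnj_vec_def by (rule classical_solution_cnj[OF 1(2)])
    show "L2_tendsto (lborel_on {0<..<T}) (\<lambda>n t. cnj (fn n t)) (\<lambda>t. cnj (f t))"
      by (rule L2_tendsto_bounded_linear[OF bounded_linear_cnj 1(3)])
    show "L2_tendsto (lborel_on {0<..}) (\<lambda>n x. cnj_vec (un n x t)) (\<lambda>x. cnj_vec (u x t))" if "t \<in> {0..T}" for t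
      by (rule L2_tendsto_bounded_linear[OF bounded_linear_cnj_vec 1(4)[OF that]])
  qed
qed

lemma norm_from_riemann_sq: "(norm (from_riemann \<alpha> \<beta>))\<^sup>2 = ((cmod \<alpha>)\<^sup>2 + (cmod \<beta>)\<^sup>2) / 2"
proof -
  have "(cmod (\<alpha> + \<beta>))\<^sup>2 + (cmod (\<alpha> - \<beta>))\<^sup>2 = 2 * (cmod \<alpha>)\<^sup>2 + 2 * (cmod \<beta>)\<^sup>2"
    unfolding cmod_power2 by (simp add: power2_eq_square algebra_simps)
  then show ?thesis
    unfolding norm_vec2_sq from_riemann_def by (simp add: norm_divide norm_mult power_divide)
qed

lemma from_riemann_diff: "from_riemann \<alpha> \<beta> - from_riemann \<gamma> \<delta> = from_riemann (\<alpha> - \<gamma>) (\<beta> - \<delta>)"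
  by (simp add: from_riemann_def vec_eq_iff forall_2 field_simps)

lemma borel_measurable_from_riemann:
  assumes "f \<in> borel_measurable M" "g \<in> borel_measurable M"
  shows "(\<lambda>x. from_riemann (f x) (g x)) \<in> borel_measurable M"
proof -
  have am: "(axis k :: complex \<Rightarrow> complex^2) \<in> borel_measurable borel" for k
    by (intro borel_measurable_continuous_onI linear_continuous_on[OF bounded_linear_axis[of k]])
  show ?thesis unfolding from_riemann_eq
    by (intro borel_measurable_add measurable_compose[OF _ am]) (use assms in simp_all)
qed

section \<open>Waves generated by square-integrable controls\<close>

context dirac_kernels
begin

definition zero_extension :: "(real \<Rightarrow> complex) \<Rightarrow> real \<Rightarrow> complex" where
  "zero_extension f s = (if 0 < s \<and> s < T then f s else 0)"

definition wave_integral :: "(real \<Rightarrow> real \<Rightarrow> complex) \<Rightarrow> (real \<Rightarrow> complex) \<Rightarrow> real \<Rightarrow> real \<Rightarrow> complex" where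
  "wave_integral k f x t = (LINT \<rho>|lborel_on {0<..<T}. k (\<rho> / 2) (x + \<rho> / 2) * zero_extension f (t - x - \<rho>))"

text \<open>The formula of \<open>classical_solution_exists\<close> with the control cut off to the
  open interval, which makes it meaningful for every square-integrable control.\<close>

definition wave :: "(real \<Rightarrow> complex) \<Rightarrow> real \<Rightarrow> real \<Rightarrow> complex^2" where
  "wave f x t = from_riemann (2 * zero_extension f (t - x) + wave_integral a f x t) (wave_integral b f x t)"

lemma zero_extension_L2:
  assumes f: "f \<in> L2 (lborel_on {0<..<T})"
  shows "zero_extension f \<in> L2 lborel" "(LINT s|lborel. (cmod (zero_extension f s))\<^sup>2) = (LINT s|lborel_on {0<..<T}. (cmod (f s))\<^sup>2)"
    "integrable lborel (zero_extension f)" "(LINT s|lborel. cmod (zero_extension f s))\<^sup>2 \<le> T * (LINT s|lborel_on {0<..<T}. (cmod (f s))\<^sup>2)"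
proof -
  have e: "zero_extension f = (\<lambda>s. indicator {0<..<T} s *\<^sub>R f s)" by (auto simp: zero_extension_def)
  have e2: "(\<lambda>s. (cmod (zero_extension f s))\<^sup>2) = (\<lambda>s. indicator {0<..<T} s *\<^sub>R (cmod (f s))\<^sup>2)" by (auto simp: zero_extension_def)
  have e3: "(\<lambda>s. cmod (zero_extension f s)) = (\<lambda>s. indicator {0<..<T} s *\<^sub>R cmod (f s))" by (auto simp: zero_extension_def)
  have m: "zero_extension f \<in> borel_measurable lborel"
    unfolding e using L2_measurable[OF f] by (subst borel_measurable_restrict_space_iff[symmetric]) auto
  have i: "integrable lborel (\<lambda>s. (cmod (zero_extension f s))\<^sup>2)"
    unfolding e2 using L2_integrable[OF f] by (subst integrable_restrict_space[symmetric]) auto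
  show "zero_extension f \<in> L2 lborel" by (rule L2_I[OF m i])
  show "(LINT s|lborel. (cmod (zero_extension f s))\<^sup>2) = (LINT s|lborel_on {0<..<T}. (cmod (f s))\<^sup>2)"
    unfolding e2 by (subst integral_restrict_space[symmetric]) auto
  show "integrable lborel (zero_extension f)"
    unfolding e using L2_integrable_interval[OF f] by (subst integrable_restrict_space[symmetric]) auto
  have "(\<lambda>x. 1::real) \<in> L2 (lborel_on {0<..<T})"
    by (rule L2_continuous) (intro continuous_intros)
  from cauchy_schwarz_L2(2)[OF f this L2_measurable[OF f]]
  have "(LINT x|lborel_on {0<..<T}. cmod (f x))\<^sup>2 \<le> (LINT x|lborel_on {0<..<T}. (cmod (f x))\<^sup>2) * measure (lborel_on {0<..<T}) {0<..<T}" by simp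
  moreover have "measure (lborel_on {0<..<T}) {0<..<T} = T"
    using T by (simp add: measure_restrict_space)
  ultimately show "(LINT s|lborel. cmod (zero_extension f s))\<^sup>2 \<le> T * (LINT s|lborel_on {0<..<T}. (cmod (f s))\<^sup>2)"
    unfolding e3 by (subst integral_restrict_space[symmetric]) (auto simp: mult.commute)
qed

lemma kernel_bound:
  assumes "continuous_on UNIV (\<lambda>z. k (fst z) (snd z) :: complex)"
  obtains B where "B \<ge> 0" "\<And>\<xi> \<eta>. \<xi> \<in> {0..2 * T} \<Longrightarrow> \<eta> \<in> {0..2 * T} \<Longrightarrow> cmod (k \<xi> \<eta>) \<le> B"
proof -
  obtain B where B: "B \<ge> 0" "\<And>z. z \<in> {0..2 * T} \<times> {0..2 * T} \<Longrightarrow> cmod (k (fst z) (snd z)) \<le> B"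
    by (rule compact_bound[OF assms, of "{0..2 * T} \<times> {0..2 * T}"]) (auto intro: compact_Times)
  show ?thesis by (rule that[OF B(1)]) (use B(2)[of "(\<xi>, \<eta>)" for \<xi> \<eta>] in auto)
qed

lemma reflected_integrable:
  assumes f: "f \<in> L2 (lborel_on {0<..<T})"
  shows "integrable lborel (\<lambda>\<rho>. zero_extension f (c - \<rho>))" "(LINT \<rho>|lborel. cmod (zero_extension f (c - \<rho>))) = (LINT s|lborel. cmod (zero_extension f s))"
    "integrable lborel (\<lambda>\<rho>. (cmod (zero_extension f (c - \<rho>)))\<^sup>2)" "(LINT \<rho>|lborel. (cmod (zero_extension f (c - \<rho>)))\<^sup>2) = (LINT s|lborel. (cmod (zero_extension f s))\<^sup>2)"
  using lborel_integrable_real_affine[OF zero_extension_L2(3)[OF f], of "-1" c]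
    lborel_integral_real_affine[of "-1" "\<lambda>s. cmod (zero_extension f s)" c]
    lborel_integrable_real_affine[OF L2_integrable[OF zero_extension_L2(1)[OF f]], of "-1" c]
    lborel_integral_real_affine[of "-1" "\<lambda>s. (cmod (zero_extension f s))\<^sup>2" c] by simp_all

lemma wave_integral_integrable:
  assumes k: "continuous_on UNIV (\<lambda>z. k (fst z) (snd z) :: complex)" and f: "f \<in> L2 (lborel_on {0<..<T})"
    and x: "x \<in> {0..T}"
  shows "integrable (lborel_on {0<..<T}) (\<lambda>\<rho>. k (\<rho> / 2) (x + \<rho> / 2) * zero_extension f (t - x - \<rho>))"
proof -
  obtain B where B: "B \<ge> 0" "\<And>\<xi> \<eta>. \<xi> \<in> {0..2 * T} \<Longrightarrow> \<eta> \<in> {0..2 * T} \<Longrightarrow> cmod (k \<xi> \<eta>) \<le> B" using kernel_bound[OF k] by blast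
  have i: "integrable (lborel_on {0<..<T}) (\<lambda>\<rho>. zero_extension f (t - x - \<rho>))"
    by (subst integrable_restrict_space) (auto intro: integrable_mult_indicator reflected_integrable[OF f])
  have km: "(\<lambda>\<rho>. k (\<rho> / 2) (x + \<rho> / 2)) \<in> borel_measurable (lborel_on {0<..<T})"
    by (intro measurable_lborel_on borel_measurable_continuous_onI continuous_on_kernel[where k = k, OF k] continuous_intros) auto
  show ?thesis
  proof (rule Bochner_Integration.integrable_bound[where f = "\<lambda>\<rho>. B * cmod (zero_extension f (t - x - \<rho>))"])
    show "AE \<rho> in lborel_on {0<..<T}. norm (k (\<rho> / 2) (x + \<rho> / 2) * zero_extension f (t - x - \<rho>)) \<le> norm (B * cmod (zero_extension f (t - x - \<rho>)))"
      using B x by (intro AE_I2) (auto simp: norm_mult intro!: mult_right_mono)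
  qed (use i km in auto)
qed

text \<open>The kernel is bounded on the relevant square, and a square-integrable control on an
  interval of length \<open>T\<close> is integrable. The indicator expresses finite speed: up to
  time \<open>T\<close> nothing has passed \<open>x = T\<close>.\<close>

lemma wave_integral_bound:
  assumes k: "continuous_on UNIV (\<lambda>z. k (fst z) (snd z) :: complex)"
    and B: "B \<ge> 0" "\<And>\<xi> \<eta>. \<xi> \<in> {0..2 * T} \<Longrightarrow> \<eta> \<in> {0..2 * T} \<Longrightarrow> cmod (k \<xi> \<eta>) \<le> B"
    and f: "f \<in> L2 (lborel_on {0<..<T})" and x: "x > 0" and t: "t \<le> T"
  shows "(cmod (wave_integral k f x t))\<^sup>2 \<le> B\<^sup>2 * T * (LINT s|lborel_on {0<..<T}. (cmod (f s))\<^sup>2) * indicator {0<..<T} x"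
proof (cases "x < T")
  case True
  have i: "integrable (lborel_on {0<..<T}) (\<lambda>\<rho>. zero_extension f (t - x - \<rho>))"
    by (subst integrable_restrict_space) (auto intro: integrable_mult_indicator reflected_integrable[OF f])
  have "cmod (wave_integral k f x t) \<le> (LINT \<rho>|lborel_on {0<..<T}. cmod (k (\<rho> / 2) (x + \<rho> / 2) * zero_extension f (t - x - \<rho>)))"
    unfolding wave_integral_def by (rule integral_norm_bound)
  also have "\<dots> \<le> (LINT \<rho>|lborel_on {0<..<T}. B * cmod (zero_extension f (t - x - \<rho>)))"
  proof (rule integral_mono)
    show "integrable (lborel_on {0<..<T}) (\<lambda>\<rho>. cmod (k (\<rho> / 2) (x + \<rho> / 2) * zero_extension f (t - x - \<rho>)))"
      by (rule integrable_norm[OF wave_integral_integrable[OF k f]]) (use True x in simp)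
    show "integrable (lborel_on {0<..<T}) (\<lambda>\<rho>. B * cmod (zero_extension f (t - x - \<rho>)))" using i by simp
  qed (use True x B in \<open>auto simp: norm_mult intro!: mult_right_mono\<close>)
  also have "\<dots> = B * (LINT \<rho>|lborel. indicator {0<..<T} \<rho> *\<^sub>R cmod (zero_extension f (t - x - \<rho>)))"
    by (subst integral_restrict_space[symmetric]) auto
  also have "\<dots> \<le> B * (LINT \<rho>|lborel. cmod (zero_extension f (t - x - \<rho>)))"
    using B reflected_integrable(1)[OF f, of "t - x"]
    by (intro mult_left_mono integral_mono integrable_mult_indicator) (auto simp: indicator_def)
  also have "\<dots> = B * (LINT s|lborel. cmod (zero_extension f s))" by (simp only: reflected_integrable(2)[OF f])
  finally have "(cmod (wave_integral k f x t))\<^sup>2 \<le> (B * (LINT s|lborel. cmod (zero_extension f s)))\<^sup>2" by (rule power_mono) simp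
  also have "\<dots> \<le> B\<^sup>2 * (T * (LINT s|lborel_on {0<..<T}. (cmod (f s))\<^sup>2))"
    unfolding power_mult_distrib by (intro mult_left_mono zero_extension_L2(4)[OF f]) simp
  finally show ?thesis using True x by simp
next
  case False
  have "wave_integral k f x t = (LINT \<rho>|lborel_on {0<..<T}. 0)"
    unfolding wave_integral_def by (rule Bochner_Integration.integral_cong) (use False t in \<open>auto simp: zero_extension_def\<close>)
  then show ?thesis using False by simp
qed

lemma wave_integral_measurable:
  assumes k: "continuous_on UNIV (\<lambda>z. k (fst z) (snd z) :: complex)" and f: "f \<in> L2 (lborel_on {0<..<T})"
  shows "(\<lambda>x. wave_integral k f x t) \<in> borel_measurable borel"
proof -
  interpret finite_measure "lborel_on {0<..<T}" by (rule finite_measure_interval)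
  have zm[measurable]: "zero_extension f \<in> borel_measurable borel" using L2_measurable[OF zero_extension_L2(1)[OF f]] by simp
  have s[measurable]: "snd \<in> borel_measurable (borel \<Otimes>\<^sub>M lborel_on {0<..<T})"
    by (rule measurable_compose[OF measurable_snd]) (rule measurable_lborel_on, simp)
  have fs[measurable]: "fst \<in> borel_measurable (borel \<Otimes>\<^sub>M lborel_on {0<..<T})" by simp
  have km: "(\<lambda>z. k (fst z) (snd z)) \<in> borel_measurable borel" by (rule borel_measurable_continuous_onI[OF k])
  have "(\<lambda>z. (snd z / 2, fst z + snd z / 2)) \<in> borel_measurable (borel \<Otimes>\<^sub>M lborel_on {0<..<T})"
    by (intro borel_measurable_Pair) simp_all
  from measurable_compose[OF this km]
  have "(\<lambda>z. k (snd z / 2) (fst z + snd z / 2) * zero_extension f (t - fst z - snd z)) \<in> borel_measurable (borel \<Otimes>\<^sub>M lborel_on {0<..<T})"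
    by (intro borel_measurable_times measurable_compose[OF _ zm]) simp_all
  then show ?thesis unfolding wave_integral_def by (intro borel_measurable_lebesgue_integral) (simp add: split_beta)
qed

lemma wave_L2:
  obtains C where "C \<ge> 0" "\<And>f t. f \<in> L2 (lborel_on {0<..<T}) \<Longrightarrow> t \<le> T \<Longrightarrow> (\<lambda>x. wave f x t) \<in> L2 (lborel_on {0<..})"
    "\<And>f t. f \<in> L2 (lborel_on {0<..<T}) \<Longrightarrow> t \<le> T \<Longrightarrow> (LINT x|lborel_on {0<..}. (norm (wave f x t))\<^sup>2) \<le> C * (LINT s|lborel_on {0<..<T}. (cmod (f s))\<^sup>2)"
proof -
  obtain A where A: "A \<ge> 0" "\<And>\<xi> \<eta>. \<xi> \<in> {0..2 * T} \<Longrightarrow> \<eta> \<in> {0..2 * T} \<Longrightarrow> cmod (a \<xi> \<eta>) \<le> A" using kernel_bound[OF a_cont] by blast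
  obtain B where B: "B \<ge> 0" "\<And>\<xi> \<eta>. \<xi> \<in> {0..2 * T} \<Longrightarrow> \<eta> \<in> {0..2 * T} \<Longrightarrow> cmod (b \<xi> \<eta>) \<le> B" using kernel_bound[OF b_cont] by blast
  \<comment> \<open>The 4 comes from \<open>2 * zero_extension f\<close>: its square contributes 4,
    doubled by splitting the sum and halved by \<open>norm_from_riemann_sq\<close>. Each kernel
    contributes its squared bound times \<open>T\<close> for the Cauchy-Schwarz step and
    \<open>T\<close> for the range of \<open>x\<close>.\<close>
  define C where "C = 4 + (A\<^sup>2 + B\<^sup>2) * T * T"
  have main: "(\<lambda>x. wave f x t) \<in> L2 (lborel_on {0<..}) \<and> (LINT x|lborel_on {0<..}. (norm (wave f x t))\<^sup>2) \<le> C * (LINT s|lborel_on {0<..<T}. (cmod (f s))\<^sup>2)"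
    if f: "f \<in> L2 (lborel_on {0<..<T})" and t: "t \<le> T" for f t
  proof -
    define N where "N = (LINT s|lborel_on {0<..<T}. (cmod (f s))\<^sup>2)"
    have N0: "N \<ge> 0" by (simp add: N_def)
    define G where "G x = 4 * (cmod (zero_extension f (t - x)))\<^sup>2 + (A\<^sup>2 + B\<^sup>2) * T * N * indicator {0<..<T} x" for x
    have zm: "zero_extension f \<in> borel_measurable borel" using L2_measurable[OF zero_extension_L2(1)[OF f]] by simp
    have um: "(\<lambda>x. wave f x t) \<in> borel_measurable borel"
      unfolding wave_def
      by (intro borel_measurable_from_riemann borel_measurable_add borel_measurable_times measurable_compose[OF _ zm] wave_integral_measurable a_cont b_cont f) simp_all
    have ind: "integrable lborel (indicator {0<..<T} :: real \<Rightarrow> real)" using T by simp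
    have Gi: "integrable lborel G" unfolding G_def using reflected_integrable(3)[OF f, of t] ind by simp
    have Gint: "(LINT x|lborel. G x) = C * N"
      unfolding G_def using reflected_integrable(3,4)[OF f, of t] ind T zero_extension_L2(2)[OF f]
      by (simp add: C_def N_def algebra_simps)
    have G0: "G x \<ge> 0" for x using N0 T by (simp add: G_def)
    have le: "(norm (wave f x t))\<^sup>2 \<le> G x" if x: "x > 0" for x
    proof -
      have "(norm (wave f x t))\<^sup>2 = ((cmod (2 * zero_extension f (t - x) + wave_integral a f x t))\<^sup>2 + (cmod (wave_integral b f x t))\<^sup>2) / 2"
        by (simp add: wave_def norm_from_riemann_sq)
      also have "\<dots> \<le> ((2 * (cmod (2 * zero_extension f (t - x)))\<^sup>2 + 2 * (cmod (wave_integral a f x t))\<^sup>2) + 2 * (cmod (wave_integral b f x t))\<^sup>2) / 2"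
        by (intro divide_right_mono add_mono norm_add_sq_le) auto
      also have "\<dots> = 4 * (cmod (zero_extension f (t - x)))\<^sup>2 + (cmod (wave_integral a f x t))\<^sup>2 + (cmod (wave_integral b f x t))\<^sup>2"
        by (simp add: norm_mult power_mult_distrib)
      also have "\<dots> \<le> 4 * (cmod (zero_extension f (t - x)))\<^sup>2 + A\<^sup>2 * T * N * indicator {0<..<T} x + B\<^sup>2 * T * N * indicator {0<..<T} x"
        unfolding N_def by (intro add_mono order_refl wave_integral_bound a_cont b_cont A B f x t)
      also have "\<dots> = G x" by (simp add: G_def algebra_simps)
      finally show ?thesis .
    qed
    have Gi': "integrable (lborel_on {0<..}) G"
      using integrable_mult_indicator[of "{0<..}" lborel G] Gi by (simp add: integrable_restrict_space)
    have um': "(\<lambda>x. wave f x t) \<in> borel_measurable (lborel_on {0<..})" by (rule measurable_lborel_on[OF um])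
    have i: "integrable (lborel_on {0<..}) (\<lambda>x. (norm (wave f x t))\<^sup>2)"
      by (rule Bochner_Integration.integrable_bound[OF Gi']) (use um' le G0 in auto)
    have "(LINT x|lborel_on {0<..}. (norm (wave f x t))\<^sup>2) \<le> (LINT x|lborel_on {0<..}. G x)"
      using i Gi' le by (intro integral_mono) auto
    also have "\<dots> = (LINT x|lborel. indicator {0<..} x *\<^sub>R G x)" by (subst integral_restrict_space) auto
    also have "\<dots> \<le> (LINT x|lborel. G x)"
      using Gi G0 by (intro integral_mono integrable_mult_indicator) (auto simp: indicator_def)
    finally show ?thesis using L2_I[OF um' i] Gint by (simp add: N_def)
  qed
  show ?thesis
  proof (rule that[of C])
    show "C \<ge> 0" using T by (simp add: C_def)
  qed (rule main[THEN conjunct1] main[THEN conjunct2], assumption+)+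
qed

lemma wave_diff:
  assumes f: "f \<in> L2 (lborel_on {0<..<T})" and g: "g \<in> L2 (lborel_on {0<..<T})" and x: "x > 0" and t: "t \<le> T"
  shows "wave (\<lambda>s. f s - g s) x t = wave f x t - wave g x t"
proof -
  have z: "zero_extension (\<lambda>s. f s - g s) y = zero_extension f y - zero_extension g y" for y by (simp add: zero_extension_def)
  have "wave_integral k (\<lambda>s. f s - g s) x t = wave_integral k f x t - wave_integral k g x t"
    if k: "continuous_on UNIV (\<lambda>z. k (fst z) (snd z) :: complex)" for k
  proof (cases "x < T")
    case True
    then show ?thesis
      unfolding wave_integral_def z right_diff_distrib using x by (intro Bochner_Integration.integral_diff wave_integral_integrable k f g) auto
  next
    case False
    then have "zero_extension h (t - x - \<rho>) = 0" if "\<rho> \<in> {0<..<T}" for h \<rho> using t that by (simp add: zero_extension_def)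
    then have "wave_integral k h x t = (LINT \<rho>|lborel_on {0<..<T}. 0)" for h
      unfolding wave_integral_def by (intro Bochner_Integration.integral_cong) auto
    then show ?thesis by simp
  qed
  note c = this[OF a_cont] this[OF b_cont]
  show ?thesis unfolding wave_def from_riemann_diff z c by (simp add: algebra_simps)
qed

lemma wave_tendsto:
  assumes "L2_tendsto (lborel_on {0<..<T}) fn f" "t \<le> T"
  shows "L2_tendsto (lborel_on {0<..}) (\<lambda>n x. wave (fn n) x t) (\<lambda>x. wave f x t)"
proof -
  obtain C where C: "C \<ge> 0" "\<And>f t. f \<in> L2 (lborel_on {0<..<T}) \<Longrightarrow> t \<le> T \<Longrightarrow> (\<lambda>x. wave f x t) \<in> L2 (lborel_on {0<..})"
    "\<And>f t. f \<in> L2 (lborel_on {0<..<T}) \<Longrightarrow> t \<le> T \<Longrightarrow> (LINT x|lborel_on {0<..}. (norm (wave f x t))\<^sup>2) \<le> C * (LINT s|lborel_on {0<..<T}. (cmod (f s))\<^sup>2)"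
    by (rule wave_L2) (rule that)
  have L: "\<And>n. fn n \<in> L2 (lborel_on {0<..<T})" "f \<in> L2 (lborel_on {0<..<T})"
    and l: "(\<lambda>n. (LINT x|lborel_on {0<..<T}. (norm (fn n x - f x))\<^sup>2)) \<longlonglongrightarrow> 0"
    using assms by (auto simp: L2_tendsto_iff)
  have "(\<lambda>n. (LINT x|lborel_on {0<..}. (norm (wave (fn n) x t - wave f x t))\<^sup>2)) \<longlonglongrightarrow> 0"
  proof (rule tendsto_sandwich[OF _ _ tendsto_const])
    show "\<forall>\<^sub>F n in sequentially. 0 \<le> (LINT x|lborel_on {0<..}. (norm (wave (fn n) x t - wave f x t))\<^sup>2)" by simp
    have "(LINT x|lborel_on {0<..}. (norm (wave (fn n) x t - wave f x t))\<^sup>2) = (LINT x|lborel_on {0<..}. (norm (wave (\<lambda>s. fn n s - f s) x t))\<^sup>2)" for n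
      by (rule Bochner_Integration.integral_cong) (auto simp: wave_diff[OF L _ assms(2)])
    then show "\<forall>\<^sub>F n in sequentially. (LINT x|lborel_on {0<..}. (norm (wave (fn n) x t - wave f x t))\<^sup>2) \<le> C * (LINT x|lborel_on {0<..<T}. (norm (fn n x - f x))\<^sup>2)"
      using C(3)[OF L2_diff(1)[OF L] assms(2)] by simp
    show "(\<lambda>n. C * (LINT x|lborel_on {0<..<T}. (norm (fn n x - f x))\<^sup>2)) \<longlonglongrightarrow> 0" using tendsto_mult_left[OF l] by simp
  qed
  then show ?thesis unfolding L2_tendsto_iff using C(2) L assms(2) by blast
qed

text \<open>For \<open>x > 0\<close> and \<open>t \<le> T\<close> the formula sees the control only
  at times below \<open>T\<close>, so the extended control and the cut-off control give the same
  values.\<close>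

lemma classical_solution_smooth:
  assumes f: "smooth_control T f"
  obtains u where "classical_solution 1 p q T f u" "\<And>x t. x > 0 \<Longrightarrow> t \<in> {0..T} \<Longrightarrow> u x t = wave f x t"
proof -
  obtain g g' where g: "\<And>t. (g has_vector_derivative g' t) (at t)" "continuous_on UNIV g'"
    "\<And>t. t \<le> 0 \<Longrightarrow> g t = 0" "\<And>t. t \<in> {0..T} \<Longrightarrow> g t = f t"
    using smooth_control_extension[OF f T] by blast
  have gc: "continuous_on UNIV g"
    by (intro continuous_at_imp_continuous_on ballI has_vector_derivative_continuous[OF g(1)])
  let ?u = "\<lambda>x t. from_riemann (2 * g (t - x) + delayed a g x (t - x)) (delayed b g x (t - x))"
  have "classical_solution 1 p q T g ?u" by (rule classical_solution_exists[OF g(1-3)])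
  then have "classical_solution 1 p q T f ?u" unfolding classical_solution_def using g(4) by auto
  moreover have "?u x t = wave f x t" if x: "x > 0" and t: "t \<in> {0..T}" for x t
  proof -
    have z: "g (t - x - \<rho>) = zero_extension f (t - x - \<rho>)" if "\<rho> \<ge> 0" for \<rho>
      using g(3)[of "t - x - \<rho>"] g(4)[of "t - x - \<rho>"] x t that by (auto simp: zero_extension_def)
    have "delayed k g x (t - x) = wave_integral k f x t" if k: "continuous_on UNIV (\<lambda>z. k (fst z) (snd z) :: complex)" for k
    proof -
      let ?h = "\<lambda>\<rho>. k (\<rho> / 2) (x + \<rho> / 2) * g (t - x - \<rho>)"
      have "delayed k g x (t - x) = (LINT \<rho>|lborel_on {0<..<T}. ?h \<rho>)"
        unfolding delayed_def by (rule lebesgue_integral_open_interval[symmetric]) (rule delayed_integrand_cont[OF k gc])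
      also have "\<dots> = wave_integral k f x t" unfolding wave_integral_def by (rule Bochner_Integration.integral_cong) (auto simp: z)
      finally show ?thesis .
    qed
    note this[OF a_cont] this[OF b_cont]
    then show ?thesis using z[of 0] by (simp add: wave_def)
  qed
  ultimately show ?thesis by (rule that)
qed

text \<open>Smooth controls approximate \<open>f\<close>, their classical solutions are waves, and
  waves depend continuously on the control at each time.\<close>

lemma generalized_solution_wave:
  assumes f: "f \<in> L2 (lborel_on {0<..<T})"
  shows "generalized_solution 1 p q T f (wave f)"
proof -
  obtain F where F: "\<And>n. smooth_control T (F n)" "L2_tendsto (lborel_on {0<..<T}) F f"
    using smooth_controls_dense[OF f] by blast
  have "\<forall>n. \<exists>u. classical_solution 1 p q T (F n) u \<and> (\<forall>x>0. \<forall>t\<in>{0..T}. u x t = wave (F n) x t)"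
  proof
    fix n
    show "\<exists>u. classical_solution 1 p q T (F n) u \<and> (\<forall>x>0. \<forall>t\<in>{0..T}. u x t = wave (F n) x t)"
      by (rule classical_solution_smooth[OF F(1), of n]) blast
  qed
  from choice[OF this] obtain u where uu: "\<forall>n. classical_solution 1 p q T (F n) (u n) \<and> (\<forall>x>0. \<forall>t\<in>{0..T}. u n x t = wave (F n) x t)" ..
  then have u: "classical_solution 1 p q T (F n) (u n)" "x > 0 \<Longrightarrow> t \<in> {0..T} \<Longrightarrow> u n x t = wave (F n) x t" for n x t
    by simp_all
  have "L2_tendsto (lborel_on {0<..}) (\<lambda>n x. u n x t) (\<lambda>x. wave f x t)" if "t \<in> {0..T}" for t
    using wave_tendsto[OF F(2), of t] that u(2)
    by (subst L2_tendsto_cong[where f' = "\<lambda>n x. wave (F n) x t" and g' = "\<lambda>x. wave f x t"]) auto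
  then show ?thesis unfolding generalized_solution_def
    by (intro exI[of _ F] exI[of _ u] conjI allI ballI F u(1))
qed

text \<open>Whatever approximating controls occur, uniqueness of classical solutions identifies the
  approximants with waves, and the limits agree by continuity. The value picked by
  \<open>dirac_solution\<close> is thereby fixed up to null sets.\<close>

lemma generalized_solution_unique:
  assumes u: "generalized_solution 1 p q T f u" and t: "t \<in> {0..T}"
  shows "AE x in lborel_on {0<..}. u x t = wave f x t"
proof -
  obtain fn un where 1: "\<And>n. smooth_control T (fn n)" "\<And>n. classical_solution 1 p q T (fn n) (un n)"
    "L2_tendsto (lborel_on {0<..<T}) fn f" "\<And>t. t \<in> {0..T} \<Longrightarrow> L2_tendsto (lborel_on {0<..}) (\<lambda>n x. un n x t) (\<lambda>x. u x t)"
    using u unfolding generalized_solution_def by blast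
  have "un n x t = wave (fn n) x t" if "x > 0" for n x
  proof -
    obtain v where v: "classical_solution 1 p q T (fn n) v" "\<And>x t. x > 0 \<Longrightarrow> t \<in> {0..T} \<Longrightarrow> v x t = wave (fn n) x t"
      by (rule classical_solution_smooth[OF 1(1), of n]) (rule that)
    show ?thesis using classical_solution_unique[OF 1(2) v(1) T _ t, of x] v(2)[OF that t] that by simp
  qed
  then have "L2_tendsto (lborel_on {0<..}) (\<lambda>n x. un n x t) (\<lambda>x. wave f x t)"
    using wave_tendsto[OF 1(3), of t] t
    by (subst L2_tendsto_cong[where f' = "\<lambda>n x. wave (fn n) x t" and g' = "\<lambda>x. wave f x t"]) auto
  from L2_tendsto_unique[OF 1(4)[OF t] this] show ?thesis .
qed

text \<open>Explicit representative of the control operator; the second term is the conjugate of the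
  wave for the conjugated control. Being given by formulas, it obeys linearity and the Volterra form
  at every point of the interval and not just almost everywhere.\<close>

definition control_map :: "(real \<Rightarrow> complex^2) \<Rightarrow> real \<Rightarrow> complex^2" where
  "control_map f x = wave (\<lambda>s. f s $ 1) x T + cnj_vec (wave (\<lambda>s. cnj (f s $ 2)) x T)"

lemma AE_restrict_interval:
  "(AE x in lborel_on {0<..}. P x) \<Longrightarrow> (AE x in lborel_on {0<..<T}. P x)"
  by (simp add: AE_restrict_space_iff) (auto elim: eventually_mono)

lemma generalized_solution_dirac_solution:
  assumes f: "f \<in> L2 (lborel_on {0<..<T})"
  shows "generalized_solution 1 p q T f (dirac_solution 1 p q T f)"
    and "generalized_solution (-1) p q T f (dirac_solution (-1) p q T f)"
proof -
  have c: "(\<lambda>s. cnj (f s)) \<in> L2 (lborel_on {0<..<T})" by (rule L2_bounded_linear(1)[OF f bounded_linear_cnj])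
  show "generalized_solution 1 p q T f (dirac_solution 1 p q T f)"
    unfolding dirac_solution_def
    by (rule someI[where P = "generalized_solution 1 p q T f", OF generalized_solution_wave[OF f]])
  have "generalized_solution (-1) p q T f (\<lambda>x t. cnj_vec (wave (\<lambda>s. cnj (f s)) x t))"
    using generalized_solution_cnj[OF generalized_solution_wave[OF c]] by simp
  then show "generalized_solution (-1) p q T f (dirac_solution (-1) p q T f)"
    unfolding dirac_solution_def by (rule someI[where P = "generalized_solution (-1) p q T f"])
qed

lemma control_operator_eq:
  assumes f: "f \<in> L2 (lborel_on {0<..<T})"
  shows "AE x in lborel_on {0<..<T}. control_operator p q T f x = control_map f x"
proof -
  have T0: "T \<in> {0..T}" using T by simp
  note G = generalized_solution_dirac_solution[OF L2_component[OF f]]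
  note A = generalized_solution_unique[OF G(1) T0, of 1]
  have "generalized_solution 1 p q T (\<lambda>s. cnj (f s $ 2)) (\<lambda>x t. cnj_vec (dirac_solution (-1) p q T (\<lambda>s. f s $ 2) x t))"
    using generalized_solution_cnj[OF G(2)] by simp
  note B = generalized_solution_unique[OF this T0]
  show ?thesis
    using AE_restrict_interval[OF A] AE_restrict_interval[OF B]
  proof eventually_elim
    case (elim x)
    from elim(2) have "cnj_vec (cnj_vec (dirac_solution (-1) p q T (\<lambda>s. f s $ 2) x T)) = cnj_vec (wave (\<lambda>s. cnj (f s $ 2)) x T)" by simp
    with elim(1) show ?case by (simp add: control_operator_def control_map_def)
  qed
qed

end

section \<open>Inversion of the control operator\<close>

definition volterra :: "(real \<Rightarrow> real \<Rightarrow> complex) \<Rightarrow> (real \<Rightarrow> complex) \<Rightarrow> real \<Rightarrow> complex" where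
  "volterra k f t = (LINT s|lborel. indicator {0<..<t} s *\<^sub>R (k t s * f s))"

text \<open>Lebesgue integrals serve for square-integrable data, unit-interval integrals for the
  Picard scheme; on continuous functions the two agree.\<close>

lemma volterra_eq_integral:
  fixes f :: "real \<Rightarrow> complex"
  assumes k: "continuous_on UNIV (\<lambda>z. k (fst z) (snd z) :: complex)" and f: "continuous_on UNIV f" and t: "t \<ge> 0"
  shows "volterra k f t = (t - 0) *\<^sub>R integral {0..1} (\<lambda>\<tau>. k t (0 + \<tau> * (t - 0)) * f (0 + \<tau> * (t - 0)))"
proof -
  let ?h = "\<lambda>s. k t s * f s"
  have kc: "continuous_on UNIV (k t)"
    using continuous_on_comp_UNIV[OF k, of UNIV "\<lambda>s. (t, s)"] by (simp add: continuous_on_Pair)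
  have hc: "continuous_on UNIV ?h" by (intro continuous_intros kc f)
  have "volterra k f t = (LINT s|lborel_on {0<..<t}. ?h s)"
    unfolding volterra_def by (subst integral_restrict_space) auto
  also have "\<dots> = integral {0..t} ?h"
    by (rule lebesgue_integral_open_interval) (rule continuous_on_subset[OF hc], simp)
  finally have 1: "volterra k f t = integral {0..t} ?h" .
  obtain G where G: "\<And>x. x \<in> {0..t} \<Longrightarrow> (G has_vector_derivative ?h x) (at x within {0..t})"
    by (rule antiderivative_continuous[OF continuous_on_subset[OF hc subset_UNIV, of "{0..t}"]]) (rule that)
  have "integral {0..t} ?h = G t - G 0"
    by (rule integral_unique[OF fundamental_theorem_of_calculus[OF t]]) (rule G)
  moreover have "(t - 0) *\<^sub>R integral {0..1} (\<lambda>\<tau>. ?h (0 + \<tau> * (t - 0))) = G t - G 0"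
    by (rule unit_integral_eq_increment[where S = "{0..t}"]) (use t in \<open>auto simp: closed_segment_eq_real_ivl intro: G\<close>)
  ultimately show ?thesis using 1 by simp
qed

lemma volterra_integrable:
  fixes f :: "real \<Rightarrow> complex"
  assumes k: "continuous_on UNIV (\<lambda>z. k (fst z) (snd z) :: complex)" and f: "integrable lborel f"
  shows "integrable lborel (\<lambda>s. indicator {0<..<t} s *\<^sub>R (k t s * f s))"
proof -
  have kc: "continuous_on UNIV (k t)"
    using continuous_on_comp_UNIV[OF k, of UNIV "\<lambda>s. (t, s)"] by (simp add: continuous_on_Pair)
  obtain B where B: "B \<ge> 0" "\<And>s. s \<in> {0..t} \<Longrightarrow> cmod (k t s) \<le> B" by (rule compact_bound[OF kc compact_Icc]) (rule that)
  show ?thesis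
  proof (rule Bochner_Integration.integrable_bound[where f = "\<lambda>s. B * cmod (f s)"])
    show "integrable lborel (\<lambda>s. B * cmod (f s))" using f by simp
    show "(\<lambda>s. indicator {0<..<t} s *\<^sub>R (k t s * f s)) \<in> borel_measurable lborel"
      using borel_measurable_integrable[OF f] borel_measurable_continuous_onI[OF kc] by simp
    show "AE s in lborel. norm (indicator {0<..<t} s *\<^sub>R (k t s * f s)) \<le> norm (B * cmod (f s))"
      using B by (intro AE_I2) (auto simp: norm_mult indicator_def intro!: mult_right_mono)
  qed
qed

lemma volterra_add:
  fixes f g :: "real \<Rightarrow> complex"
  assumes "continuous_on UNIV (\<lambda>z. k (fst z) (snd z) :: complex)"
    and "integrable lborel (\<lambda>s. indicator {0<..<t} s *\<^sub>R (k t s * f s))" "integrable lborel (\<lambda>s. indicator {0<..<t} s *\<^sub>R (k t s * g s))"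
  shows "volterra k (\<lambda>s. f s + g s) t = volterra k f t + volterra k g t"
  unfolding volterra_def distrib_left scaleR_add_right by (rule Bochner_Integration.integral_add[OF assms(2,3)])

text \<open>Dominated convergence: when the upper limit tends to \<open>c\<close>, the integrands
  converge except possibly at \<open>s = c\<close>. The gain from integrable to continuous functions
  is what reduces the inversion to continuous data.\<close>

lemma volterra_continuous:
  fixes f :: "real \<Rightarrow> complex"
  assumes k: "continuous_on UNIV (\<lambda>z. k (fst z) (snd z) :: complex)" and f: "integrable lborel f"
  shows "continuous_on {0..T} (volterra k f)"
  unfolding continuous_on_sequentially
proof (intro allI ballI impI)
  fix t :: "nat \<Rightarrow> real" and c assume c: "c \<in> {0..T}" and t: "(\<forall>n. t n \<in> {0..T}) \<and> t \<longlonglongrightarrow> c"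
  obtain B where B: "B \<ge> 0" "\<And>z. z \<in> {0..T} \<times> {0..T} \<Longrightarrow> cmod (k (fst z) (snd z)) \<le> B"
    by (rule compact_bound[OF k compact_Times[OF compact_Icc compact_Icc]]) (rule that)
  have "(\<lambda>n. LINT s|lborel. indicator {0<..<t n} s *\<^sub>R (k (t n) s * f s)) \<longlonglongrightarrow> (LINT s|lborel. indicator {0<..<c} s *\<^sub>R (k c s * f s))"
  proof (rule integral_dominated_convergence[where w = "\<lambda>s. B * cmod (f s)"])
    show "(\<lambda>s. indicator {0<..<c} s *\<^sub>R (k c s * f s)) \<in> borel_measurable lborel"
      "\<And>n. (\<lambda>s. indicator {0<..<t n} s *\<^sub>R (k (t n) s * f s)) \<in> borel_measurable lborel"
      using borel_measurable_integrable[OF volterra_integrable[OF k f]] by blast+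
    show "integrable lborel (\<lambda>s. B * cmod (f s))" using f by simp
    show "AE s in lborel. norm (indicator {0<..<t n} s *\<^sub>R (k (t n) s * f s)) \<le> B * cmod (f s)" for n
    proof (intro AE_I2)
      fix s
      show "norm (indicator {0<..<t n} s *\<^sub>R (k (t n) s * f s)) \<le> B * cmod (f s)"
      proof (cases "s \<in> {0<..<t n}")
        case True
        then have "s \<in> {0..T}" using t[THEN conjunct1, rule_format, of n] by simp
        then have "cmod (k (t n) s) \<le> B" using B(2)[of "(t n, s)"] t by simp
        then have "cmod (k (t n) s) * cmod (f s) \<le> B * cmod (f s)" by (rule mult_right_mono) simp
        then show ?thesis using True by (simp add: norm_mult)
      qed (use B in simp)
    qed
    have ne: "AE s in lborel. s \<noteq> c" by (rule AE_lborel_singleton)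
    show "AE s in lborel. (\<lambda>n. indicator {0<..<t n} s *\<^sub>R (k (t n) s * f s)) \<longlonglongrightarrow> indicator {0<..<c} s *\<^sub>R (k c s * f s)"
      using ne
    proof eventually_elim
      case (elim s)
      have kc: "continuous_on UNIV (\<lambda>t. k t s)"
        using continuous_on_comp_UNIV[OF k, of UNIV "\<lambda>t. (t, s)"] by (simp add: continuous_on_Pair)
      have "(\<lambda>n. k (t n) s) \<longlonglongrightarrow> k c s"
        using continuous_on_tendsto_compose[OF kc, of t c sequentially] t by simp
      moreover have "(\<lambda>n. indicator {0<..<t n} s :: real) \<longlonglongrightarrow> indicator {0<..<c} s"
      proof (rule tendsto_eventually)
        consider "s < c" | "s > c" using elim by linarith
        then show "\<forall>\<^sub>F n in sequentially. (indicator {0<..<t n} s :: real) = indicator {0<..<c} s"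
        proof cases
          case 1
          have "\<forall>\<^sub>F n in sequentially. s < t n" using t 1 by (intro order_tendstoD(1)[of t c]) auto
          then show ?thesis by eventually_elim (use 1 in \<open>auto simp: indicator_def\<close>)
        next
          case 2
          have "\<forall>\<^sub>F n in sequentially. t n < s" using t 2 by (intro order_tendstoD(2)[of t c]) auto
          then show ?thesis by eventually_elim (use 2 in \<open>auto simp: indicator_def\<close>)
        qed
      qed
      ultimately show ?case by (intro tendsto_intros)
    qed
  qed
  then show "(volterra k f \<circ> t) \<longlonglongrightarrow> volterra k f c" by (simp add: o_def volterra_def)
qed

lemma volterra_system_continuous:
  fixes e1 e2 :: "real \<Rightarrow> complex" and k :: "bool \<Rightarrow> bool \<Rightarrow> real \<Rightarrow> real \<Rightarrow> complex"
  assumes k: "\<And>i j. continuous_on UNIV (\<lambda>z. k i j (fst z) (snd z))"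
    and e: "continuous_on {0..T} e1" "continuous_on {0..T} e2"
  obtains g1 g2 where "continuous_on UNIV g1" "continuous_on UNIV g2"
    "\<And>t. t \<in> {0..T} \<Longrightarrow> g1 t + (volterra (k True True) g1 t + volterra (k True False) g2 t) = e1 t"
    "\<And>t. t \<in> {0..T} \<Longrightarrow> g2 t + (volterra (k False True) g1 t + volterra (k False False) g2 t) = e2 t"
proof (cases "T \<ge> 0")
  case False
  then show ?thesis using that[of "\<lambda>_. 0" "\<lambda>_. 0"] by simp
next
  case T: True
  \<comment> \<open>The right-hand sides are known to be continuous on \<open>{0..T}\<close> only;
    composing them with \<open>clamp\<close> makes them continuous on the line, as
    \<open>picard_series\<close> requires.\<close>
  define clamp where "clamp t = max 0 (min t T)" for t
  define I where "I i G t \<tau> = k i True t (0 + \<tau> * (t - 0)) * fst (G (0 + \<tau> * (t - 0)) :: complex \<times> complex)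
    + k i False t (0 + \<tau> * (t - 0)) * snd (G (0 + \<tau> * (t - 0)))" for i G and t \<tau> :: real
  define \<Phi> where "\<Phi> G t = (- ((t - 0) *\<^sub>R integral {0..1} (I True G t)), - ((t - 0) *\<^sub>R integral {0..1} (I False G t)))" for G t
  define g0 where "g0 t = (e1 (clamp t), e2 (clamp t))" for t
  define K where "K R = {- real R..real R}" for R
  have kk: "continuous_on A (\<lambda>x. k i j (u x) (v x))" if "continuous_on A u" "continuous_on A v" for i j and A :: "(real \<times> real) set" and u v
    using continuous_on_comp_UNIV[OF k continuous_on_Pair[OF that]] by simp
  have Ic: "continuous_on UNIV (\<lambda>(t, \<tau>). I i G t \<tau>)" if "continuous_on UNIV G" for i G
    unfolding I_def split_beta by (intro continuous_intros kk continuous_on_comp_UNIV[OF that])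
  have Ic1: "continuous_on A (I i G t)" if "continuous_on UNIV G" for i G t A
    using continuous_on_comp_UNIV[OF Ic[OF that], of A "\<lambda>\<tau>. (t, \<tau>)" i] by (simp add: continuous_on_Pair)
  have c\<Phi>: "continuous_on UNIV (\<Phi> G)" if "continuous_on UNIV G" for G
    unfolding \<Phi>_def by (intro continuous_intros continuous_on_unit_integral[OF Ic[OF that]])
  have add\<Phi>: "\<Phi> (\<lambda>z. G z + H z) = (\<lambda>z. \<Phi> G z + \<Phi> H z)" if G: "continuous_on UNIV G" and H: "continuous_on UNIV H" for G H
  proof
    fix t
    have "integral {0..1} (I i (\<lambda>z. G z + H z) t) = integral {0..1} (I i G t) + integral {0..1} (I i H t)" for i
    proof -
      have "I i (\<lambda>z. G z + H z) t = (\<lambda>\<tau>. I i G t \<tau> + I i H t \<tau>)" by (simp add: I_def fun_eq_iff algebra_simps)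
      then show ?thesis
        by (simp only: integral_add[OF integrable_continuous_interval[OF Ic1[OF G]] integrable_continuous_interval[OF Ic1[OF H]]])
    qed
    then show "\<Phi> (\<lambda>z. G z + H z) t = \<Phi> G t + \<Phi> H t" by (simp add: \<Phi>_def algebra_simps)
  qed
  have est: "\<exists>c\<ge>0. \<forall>G D n. 0 \<le> D \<longrightarrow> continuous_on UNIV G \<longrightarrow> (\<forall>z\<in>K R. norm (G z) \<le> D * \<bar>z\<bar> ^ n / fact n)
        \<longrightarrow> (\<forall>z\<in>K R. norm (\<Phi> G z) \<le> D * c * \<bar>z\<bar> ^ Suc n / fact (Suc n))" for R
  proof -
    have "\<exists>B\<ge>0. \<forall>z\<in>K R \<times> K R. cmod (k i j (fst z) (snd z)) \<le> B" for i j
      by (rule compact_bound[OF k compact_Times[OF compact_Icc compact_Icc]]) (unfold K_def, blast)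
    then obtain B where B: "\<And>i j. B i j \<ge> 0" "\<And>i j z. z \<in> K R \<times> K R \<Longrightarrow> cmod (k i j (fst z) (snd z)) \<le> B i j" by metis
    define S where "S i = B i True + B i False" for i
    have S0: "S i \<ge> 0" for i using B(1) by (simp add: S_def)
    have "norm (\<Phi> G t) \<le> D * (S True + S False) * \<bar>t\<bar> ^ Suc n / fact (Suc n)"
      if D: "0 \<le> D" and G: "continuous_on UNIV G" and b: "\<forall>z\<in>K R. norm (G z) \<le> D * \<bar>z\<bar> ^ n / fact n" and t: "t \<in> K R" for G D n t
    proof -
      define L where "L = D * \<bar>t\<bar> ^ n / fact n"
      have L0: "L \<ge> 0" using D by (simp add: L_def)
      have one: "norm ((t - 0) *\<^sub>R integral {0..1} (I i G t)) \<le> \<bar>t\<bar> * (S i * L / real (n + 1))" for i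
      proof -
        have "norm (integral {0..1} (I i G t)) \<le> S i * L / real (n + 1)"
        proof (rule unit_integral_bound)
          show "continuous_on {0..1} (I i G t)" by (rule Ic1[OF G])
          fix \<tau> :: real assume \<tau>: "0 \<le> \<tau>" "\<tau> \<le> 1"
          have "\<bar>\<tau> * t\<bar> \<le> 1 * \<bar>t\<bar>" unfolding abs_mult using \<tau> by (intro mult_right_mono) auto
          then have in1: "\<tau> * t \<in> K R" using t unfolding K_def by (auto simp: abs_le_iff)
          have "norm (G (\<tau> * t)) \<le> L * \<tau> ^ n"
            using b[rule_format, OF in1] \<tau> by (simp add: L_def abs_mult power_mult_distrib mult_ac)
          then have n1: "cmod (fst (G (\<tau> * t))) \<le> L * \<tau> ^ n" and n2: "cmod (snd (G (\<tau> * t))) \<le> L * \<tau> ^ n"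
            using norm_fst_le[of "fst (G (\<tau> * t))" "snd (G (\<tau> * t))"] norm_snd_le[of "snd (G (\<tau> * t))" "fst (G (\<tau> * t))"] by simp_all
          have bb: "cmod (k i j t (\<tau> * t)) \<le> B i j" for j using B(2)[of "(t, \<tau> * t)"] t in1 by simp
          have "norm (I i G t \<tau>) \<le> cmod (k i True t (\<tau> * t)) * cmod (fst (G (\<tau> * t))) + cmod (k i False t (\<tau> * t)) * cmod (snd (G (\<tau> * t)))"
            unfolding I_def by (rule order_trans[OF norm_triangle_ineq]) (simp add: norm_mult)
          also have "\<dots> \<le> B i True * (L * \<tau> ^ n) + B i False * (L * \<tau> ^ n)"
            by (intro add_mono mult_mono bb n1 n2 B(1)) auto
          finally show "norm (I i G t \<tau>) \<le> S i * L * \<tau> ^ n" by (simp add: S_def algebra_simps)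
        qed
        from mult_left_mono[OF this abs_ge_zero[of t]] show ?thesis by simp
      qed
      have "norm (\<Phi> G t) \<le> norm ((t - 0) *\<^sub>R integral {0..1} (I True G t)) + norm ((t - 0) *\<^sub>R integral {0..1} (I False G t))"
        unfolding \<Phi>_def by (rule order_trans[OF norm_Pair_le]) simp
      also have "\<dots> \<le> \<bar>t\<bar> * (S True * L / real (n + 1)) + \<bar>t\<bar> * (S False * L / real (n + 1))" by (intro add_mono one)
      also have "\<dots> = D * (S True + S False) * \<bar>t\<bar> ^ Suc n / fact (Suc n)" by (simp add: L_def add_divide_distrib[symmetric] algebra_simps)
      finally show ?thesis .
    qed
    then show ?thesis using S0 by (intro exI[of _ "S True + S False"]) (simp only: add_nonneg_nonneg simp_thms | blast)+
  qed
  have exh: "\<exists>R. z \<in> interior (K R)" for z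
  proof -
    obtain R where R: "\<bar>z\<bar> < real R" using reals_Archimedean2 by blast
    then have "z \<in> interior (K R)" unfolding K_def by (simp add: interior_atLeastAtMost_real abs_less_iff)
    then show ?thesis by blast
  qed
  have cc: "continuous_on UNIV clamp" unfolding clamp_def by (intro continuous_intros)
  have ci: "clamp t \<in> {0..T}" for t using T by (simp add: clamp_def)
  have g0c: "continuous_on UNIV g0"
    unfolding g0_def using ci by (intro continuous_intros continuous_on_compose2[OF e(1) cc] continuous_on_compose2[OF e(2) cc]) auto
  have g0b: "\<exists>D. \<forall>z\<in>K R. norm (g0 z) \<le> D" for R
    by (rule compact_bound[OF g0c compact_Icc]) (unfold K_def, blast)
  have rho: "\<exists>P. \<forall>z\<in>K R. \<bar>z\<bar> \<le> P" for R by (intro exI[of _ "real R"]) (auto simp: K_def)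
  obtain g where gc: "continuous_on UNIV g" and geq: "\<And>z. g z = g0 z + \<Phi> g z"
    by (rule picard_series[of K \<Phi> "\<lambda>z. \<bar>z\<bar>" g0, OF exh c\<Phi> add\<Phi> est abs_ge_zero rho g0c g0b]) (assumption+, rule that)
  have gc1: "continuous_on UNIV (\<lambda>t. fst (g t))" and gc2: "continuous_on UNIV (\<lambda>t. snd (g t))"
    by (intro continuous_intros gc)+
  have kc: "continuous_on A (\<lambda>\<tau>. k i j t (0 + \<tau> * (t - 0)) * G (0 + \<tau> * (t - 0)))" if "continuous_on UNIV G" for i j t A G
  proof -
    have "continuous_on A (\<lambda>\<tau>. (t, 0 + \<tau> * (t - 0)))" by (intro continuous_intros)
    from continuous_on_comp_UNIV[OF k this] have "continuous_on A (\<lambda>\<tau>. k i j t (0 + \<tau> * (t - 0)))" by simp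
    then show ?thesis by (intro continuous_on_mult continuous_on_comp_UNIV[OF that] continuous_intros)
  qed
  have "volterra (k i True) (\<lambda>t. fst (g t)) t + volterra (k i False) (\<lambda>t. snd (g t)) t = (t - 0) *\<^sub>R integral {0..1} (I i g t)"
    if "t \<in> {0..T}" for i t
  proof -
    have t: "t \<ge> 0" using that by simp
    show ?thesis unfolding volterra_eq_integral[OF k gc1 t] volterra_eq_integral[OF k gc2 t] scaleR_add_right[symmetric] I_def
      by (simp only: integral_add[OF integrable_continuous_interval[OF kc[OF gc1]] integrable_continuous_interval[OF kc[OF gc2]]])
  qed
  note v = this
  show ?thesis
  proof (rule that[OF gc1 gc2])
    fix t assume t: "t \<in> {0..T}"
    have ct: "clamp t = t" using t by (simp add: clamp_def)
    show "fst (g t) + (volterra (k True True) (\<lambda>t. fst (g t)) t + volterra (k True False) (\<lambda>t. snd (g t)) t) = e1 t"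
      "snd (g t) + (volterra (k False True) (\<lambda>t. fst (g t)) t + volterra (k False False) (\<lambda>t. snd (g t)) t) = e2 t"
      unfolding v[OF t] by (subst geq, simp add: g0_def \<Phi>_def ct)+
  qed
qed

context dirac_kernels
begin

text \<open>In the Riemann variables at time \<open>T\<close>, and with \<open>t = T - x\<close> as variable, the control operator is
  twice the identity plus a \<open>2 \<times> 2\<close> system of Volterra operators; \<open>True\<close> indexes the first component.\<close>

definition riemann_kernel :: "bool \<Rightarrow> bool \<Rightarrow> real \<Rightarrow> real \<Rightarrow> complex" where
  "riemann_kernel i j \<xi> \<eta> = (if i then if j then a \<xi> \<eta> else cnj (b \<xi> \<eta>) else if j then b \<xi> \<eta> else cnj (a \<xi> \<eta>))"

text \<open>Putting \<open>x = T - t\<close> and \<open>\<rho> = t - s\<close> in the wave integral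
  turns \<open>\<rho> / 2\<close> and \<open>x + \<rho> / 2\<close> into these arguments. The final
  division by 2 normalizes the leading part of the system to the identity.\<close>

definition control_kernel :: "bool \<Rightarrow> bool \<Rightarrow> real \<Rightarrow> real \<Rightarrow> complex" where
  "control_kernel i j t s = riemann_kernel i j ((t - s) / 2) (T - (t + s) / 2) / 2"

lemma control_kernel_cont: "continuous_on UNIV (\<lambda>z. control_kernel i j (fst z) (snd z))"
  unfolding control_kernel_def riemann_kernel_def
  by (cases i; cases j) (auto intro!: continuous_intros continuous_on_kernel[OF a_cont] continuous_on_kernel[OF b_cont])

lemma wave_integral_eq_volterra:
  assumes t: "t \<in> {0<..<T}"
  shows "wave_integral (riemann_kernel i j) f (T - t) T = 2 * volterra (control_kernel i j) f t"
proof -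
  let ?k = "riemann_kernel i j"
  let ?g = "\<lambda>\<rho>. indicator {0<..<T} \<rho> *\<^sub>R (?k (\<rho> / 2) (T - t + \<rho> / 2) * zero_extension f (t - \<rho>))"
  have "wave_integral ?k f (T - t) T = (LINT \<rho>|lborel. ?g \<rho>)"
    unfolding wave_integral_def by (subst integral_restrict_space) auto
  also have "\<dots> = (LINT s|lborel. ?g (t - s))"
    using lborel_integral_real_affine[of "-1" ?g t] by simp
  also have "\<dots> = (LINT s|lborel. 2 * (indicator {0<..<t} s *\<^sub>R (control_kernel i j t s * f s)))"
  proof (rule Bochner_Integration.integral_cong[OF refl])
    fix s
    have "T - t + (t - s) / 2 = T - (t + s) / 2" by (simp add: field_simps)
    then have 1: "?g (t - s) = indicator {0<..<T} (t - s) *\<^sub>R (?k ((t - s) / 2) (T - (t + s) / 2) * zero_extension f s)"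
      by (simp only: diff_diff_eq2 add_diff_cancel_left')
    show "?g (t - s) = 2 * (indicator {0<..<t} s *\<^sub>R (control_kernel i j t s * f s))"
      unfolding 1 control_kernel_def using t by (auto simp: zero_extension_def indicator_def)
  qed
  also have "\<dots> = 2 * volterra (control_kernel i j) f t" unfolding volterra_def by (rule integral_mult_right_zero)
  finally show ?thesis .
qed

lemma wave_integral_cnj: "cnj (wave_integral k f x t) = wave_integral (\<lambda>\<xi> \<eta>. cnj (k \<xi> \<eta>)) (\<lambda>s. cnj (f s)) x t"
  unfolding wave_integral_def Bochner_Integration.integral_cnj[symmetric] by (rule Bochner_Integration.integral_cong) (auto simp: zero_extension_def)

lemma control_map_eq:
  assumes t: "t \<in> {0<..<T}"
  shows "control_map f (T - t) = vector [
     (f t $ 1 + (volterra (control_kernel True True) (\<lambda>s. f s $ 1) t + volterra (control_kernel True False) (\<lambda>s. f s $ 2) t)) +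
     (f t $ 2 + (volterra (control_kernel False True) (\<lambda>s. f s $ 1) t + volterra (control_kernel False False) (\<lambda>s. f s $ 2) t)),
     \<i> * ((f t $ 1 + (volterra (control_kernel True True) (\<lambda>s. f s $ 1) t + volterra (control_kernel True False) (\<lambda>s. f s $ 2) t)) -
     (f t $ 2 + (volterra (control_kernel False True) (\<lambda>s. f s $ 1) t + volterra (control_kernel False False) (\<lambda>s. f s $ 2) t)))]"
proof -
  have z: "zero_extension g (T - (T - t)) = g t" for g using t by (simp add: zero_extension_def)
  have 1: "wave_integral a (\<lambda>s. f s $ 1) (T - t) T = 2 * volterra (control_kernel True True) (\<lambda>s. f s $ 1) t"
    "wave_integral b (\<lambda>s. f s $ 1) (T - t) T = 2 * volterra (control_kernel False True) (\<lambda>s. f s $ 1) t"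
    using wave_integral_eq_volterra[OF t, of True True] wave_integral_eq_volterra[OF t, of False True] by (simp_all add: riemann_kernel_def[abs_def])
  have 2: "cnj (wave_integral a (\<lambda>s. cnj (f s $ 2)) (T - t) T) = 2 * volterra (control_kernel False False) (\<lambda>s. f s $ 2) t"
    "cnj (wave_integral b (\<lambda>s. cnj (f s $ 2)) (T - t) T) = 2 * volterra (control_kernel True False) (\<lambda>s. f s $ 2) t"
    unfolding wave_integral_cnj
    using wave_integral_eq_volterra[OF t, of False False] wave_integral_eq_volterra[OF t, of True False] by (simp_all add: riemann_kernel_def[abs_def])
  have c: "cnj_vec (from_riemann \<alpha> \<beta>) = vector [(cnj \<alpha> + cnj \<beta>) / 2, - \<i> * (cnj \<alpha> - cnj \<beta>) / 2]" for \<alpha> \<beta>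
    by (simp add: cnj_vec_def from_riemann_def vec_eq_iff forall_2)
  show ?thesis unfolding control_map_def wave_def z c
    unfolding from_riemann_def complex_cnj_add complex_cnj_mult complex_cnj_cnj 1 2
    by (simp add: vec_eq_iff forall_2 field_simps)
qed

lemma L2_reflect:
  fixes f :: "real \<Rightarrow> complex"
  assumes f: "f \<in> L2 (lborel_on {0<..<T})"
  shows "(\<lambda>t. f (T - t)) \<in> L2 (lborel_on {0<..<T})"
proof -
  have m: "zero_extension f \<in> borel_measurable borel" using L2_measurable[OF zero_extension_L2(1)[OF f]] by simp
  have "(\<lambda>t. zero_extension f (T - t)) \<in> borel_measurable (lborel_on {0<..<T})"
    by (intro measurable_lborel_on measurable_compose[OF _ m]) simp
  moreover have "integrable (lborel_on {0<..<T}) (\<lambda>t. (cmod (zero_extension f (T - t)))\<^sup>2)"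
    using integrable_mult_indicator[of "{0<..<T}" lborel, OF _ reflected_integrable(3)[OF f, of T]]
    by (simp add: integrable_restrict_space)
  ultimately have "(\<lambda>t. zero_extension f (T - t)) \<in> L2 (lborel_on {0<..<T})" by (rule L2_I)
  then show ?thesis by (rule L2_cong[THEN iffD1, rotated]) (simp add: zero_extension_def)
qed

text \<open>The control is \<open>z + g\<close>, where \<open>z\<close> is the datum in Riemann
  variables and \<open>g\<close> solves the Volterra system whose right-hand side is minus the
  Volterra image of \<open>z\<close>. That right-hand side is continuous although \<open>z\<close>
  is only square integrable.\<close>

theorem control_map_surj:
  assumes y: "y \<in> L2 (lborel_on {0<..<T})"
  obtains f where "f \<in> L2 (lborel_on {0<..<T})" "\<And>x. x \<in> {0<..<T} \<Longrightarrow> control_map f x = y x"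
proof -
  \<comment> \<open>The Riemann variables of \<open>y\<close>, halved to compensate the factor 2 in
    front of the Volterra system.\<close>
  define Z where "Z i x = (if i then y x $ 1 - \<i> * y x $ 2 else y x $ 1 + \<i> * y x $ 2) / 2" for i x
  have ZL: "Z i \<in> L2 (lborel_on {0<..<T})" for i
  proof -
    note c = L2_component[OF y, of 1] L2_component[OF y, of 2]
    have m: "(\<lambda>x. c * h x) \<in> L2 (lborel_on {0<..<T})" if "h \<in> L2 (lborel_on {0<..<T})" for c and h :: "real \<Rightarrow> complex"
      by (rule L2_bounded_linear(1)[OF that bounded_linear_mult_right])
    have "Z i = (\<lambda>x. (1 / 2) * (y x $ 1 + (if i then - \<i> else \<i>) * y x $ 2))"
      by (auto simp: Z_def fun_eq_iff field_simps)
    then show ?thesis by (simp only:) (intro m L2_add(1) c)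
  qed
  define z where "z i = zero_extension (\<lambda>t. Z i (T - t))" for i
  have zi: "integrable lborel (z i)" for i unfolding z_def by (rule zero_extension_L2(3)[OF L2_reflect[OF ZL]])
  have zL: "z i \<in> L2 (lborel_on {0<..<T})" for i
    unfolding z_def by (rule L2_cong[THEN iffD1, OF _ L2_reflect[OF ZL]]) (simp add: zero_extension_def)
  let ?V = "\<lambda>i j. volterra (control_kernel i j)"
  define e where "e i t = - (?V i True (z True) t + ?V i False (z False) t)" for i t
  have ec: "continuous_on {0..T} (e i)" for i
    unfolding e_def by (intro continuous_intros volterra_continuous control_kernel_cont zi)
  obtain g1 g2 where gc: "continuous_on UNIV g1" "continuous_on UNIV g2"
    and g: "\<And>t. t \<in> {0..T} \<Longrightarrow> g1 t + (?V True True g1 t + ?V True False g2 t) = e True t"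
    "\<And>t. t \<in> {0..T} \<Longrightarrow> g2 t + (?V False True g1 t + ?V False False g2 t) = e False t"
    by (rule volterra_system_continuous[OF control_kernel_cont ec ec]) (rule that)
  define f :: "real \<Rightarrow> complex^2" where "f t = vector [z True t + g1 t, z False t + g2 t]" for t
  have fL: "f \<in> L2 (lborel_on {0<..<T})"
    unfolding f_def by (intro L2_vector L2_add(1) zL L2_continuous continuous_on_subset[OF gc(1)] continuous_on_subset[OF gc(2)]) simp_all
  have gi: "integrable lborel (\<lambda>s. indicator {0<..<t} s *\<^sub>R (control_kernel i j t s * G s))" if G: "continuous_on UNIV G" for i j t G
  proof -
    have "continuous_on UNIV (control_kernel i j t)"
      using continuous_on_comp_UNIV[OF control_kernel_cont, of UNIV "\<lambda>s. (t, s)" i j] by (simp add: continuous_on_Pair)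
    then have c: "continuous_on UNIV (\<lambda>s. control_kernel i j t s * G s)" by (rule continuous_on_mult[OF _ G])
    then have "set_integrable lborel {0..t} (\<lambda>s. control_kernel i j t s * G s)"
      by (intro borel_integrable_atLeastAtMost' continuous_on_subset[OF c]) simp
    then have "set_integrable lborel {0<..<t} (\<lambda>s. control_kernel i j t s * G s)" by (rule set_integrable_subset) auto
    then show ?thesis by (simp add: set_integrable_def)
  qed
  have Vadd: "?V i j (\<lambda>s. z k s + G s) t = ?V i j (z k) t + ?V i j G t" if "continuous_on UNIV G" for i j k t G
    by (rule volterra_add[OF control_kernel_cont volterra_integrable[OF control_kernel_cont zi] gi[OF that]])
  have key: "f t $ 1 + (?V True True (\<lambda>s. f s $ 1) t + ?V True False (\<lambda>s. f s $ 2) t) = z True t"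
    "f t $ 2 + (?V False True (\<lambda>s. f s $ 1) t + ?V False False (\<lambda>s. f s $ 2) t) = z False t" if t: "t \<in> {0<..<T}" for t
  proof -
    have t': "t \<in> {0..T}" using t by simp
    show "f t $ 1 + (?V True True (\<lambda>s. f s $ 1) t + ?V True False (\<lambda>s. f s $ 2) t) = z True t"
      unfolding f_def vector_2 Vadd[OF gc(1)] Vadd[OF gc(2)] g(1)[OF t', folded eq_diff_eq] e_def by simp
    show "f t $ 2 + (?V False True (\<lambda>s. f s $ 1) t + ?V False False (\<lambda>s. f s $ 2) t) = z False t"
      unfolding f_def vector_2 Vadd[OF gc(1)] Vadd[OF gc(2)] g(2)[OF t', folded eq_diff_eq] e_def by simp
  qed
  show ?thesis
  proof (rule that[OF fL])
    fix x assume x: "x \<in> {0<..<T}"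
    then have t: "T - x \<in> {0<..<T}" by simp
    have "z i (T - x) = Z i x" for i using x by (simp add: z_def zero_extension_def)
    then have "control_map f x = vector [Z True x + Z False x, \<i> * (Z True x - Z False x)]"
      using control_map_eq[OF t, of f] unfolding key[OF t] by simp
    also have "\<dots> = y x" by (simp add: Z_def vec_eq_iff forall_2 field_simps)
    finally show "control_map f x = y x" .
  qed
qed

end

section \<open>Pairing with the spectral solution\<close>

text \<open>Bilinear, without conjugation, so that pairing with \<open>\<theta> x l\<close> stays
  holomorphic in \<open>l\<close>.\<close>

definition cdot :: "complex^2 \<Rightarrow> complex^2 \<Rightarrow> complex" where
  "cdot u v = u $ 1 * v $ 1 + u $ 2 * v $ 2"

lemma cdot_linear [simp]:
  "cdot (u + v) w = cdot u w + cdot v w" "cdot w (u + v) = cdot w u + cdot w v"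
  "cdot (u - v) w = cdot u w - cdot v w" "cdot w (u - v) = cdot w u - cdot w v"
  "cdot (c *s u) w = c * cdot u w" "cdot w (c *s u) = c * cdot w u"
  by (simp_all add: cdot_def algebra_simps)

lemma cdot_commute: "cdot u v = cdot v u"
  by (simp add: cdot_def)

lemma cnj_cdot: "cnj (cdot u v) = cdot (cnj_vec u) (cnj_vec v)"
  by (simp add: cdot_def cnj_vec_def)

lemma norm_cnj_vec [simp]: "norm (cnj_vec v) = norm v"
  by (simp add: norm_vec_def cnj_vec_def)

lemma cdot_norm_le: "cmod (cdot u v) \<le> norm u * norm v"
proof -
  have "norm u = L2_set (\<lambda>i. cmod (u $ i)) UNIV" "norm v = L2_set (\<lambda>i. cmod (v $ i)) UNIV" by (simp_all add: norm_vec_def)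
  moreover have "(\<Sum>i\<in>UNIV. \<bar>cmod (u $ i)\<bar> * \<bar>cmod (v $ i)\<bar>) \<le> L2_set (\<lambda>i. cmod (u $ i)) UNIV * L2_set (\<lambda>i. cmod (v $ i)) UNIV"
    by (rule L2_set_mult_ineq)
  moreover have "cmod (cdot u v) \<le> (\<Sum>i\<in>UNIV. \<bar>cmod (u $ i)\<bar> * \<bar>cmod (v $ i)\<bar>)"
    unfolding cdot_def sum_2 by (rule order_trans[OF norm_triangle_ineq]) (simp add: norm_mult)
  ultimately show ?thesis by simp
qed

lemma cdot_cnj_vec_self: "cdot (cnj_vec u) u = of_real ((norm u)\<^sup>2)"
  unfolding norm_vec2_sq of_real_add complex_norm_square by (simp add: cdot_def cnj_vec_def)

lemma L2_inner_eq: "L2_inner M f g = (LINT x|M. cdot (cnj_vec (f x)) (g x))"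
  by (simp add: L2_inner_def sum_2 cdot_def cnj_vec_def)

lemma L2_cnj_vec: "f \<in> L2 M \<Longrightarrow> (\<lambda>x. cnj_vec (f x)) \<in> L2 M"
  by (rule L2_bounded_linear(1)[OF _ bounded_linear_cnj_vec])

lemma cdot_integrable:
  assumes f: "f \<in> L2 M" and g: "g \<in> L2 M"
  shows "integrable M (\<lambda>x. cdot (f x) (g x))"
    and "(cmod (LINT x|M. cdot (f x) (g x)))\<^sup>2 \<le> (LINT x|M. (norm (f x))\<^sup>2) * (LINT x|M. (norm (g x))\<^sup>2)"
proof -
  have m: "(\<lambda>x. cdot (f x) (g x)) \<in> borel_measurable M"
    unfolding cdot_def using f g by (intro borel_measurable_add borel_measurable_times L2_measurable[OF L2_component])
  show "integrable M (\<lambda>x. cdot (f x) (g x))"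
    "(cmod (LINT x|M. cdot (f x) (g x)))\<^sup>2 \<le> (LINT x|M. (norm (f x))\<^sup>2) * (LINT x|M. (norm (g x))\<^sup>2)"
    by (rule cauchy_schwarz_L2(1)[OF f g m] cauchy_schwarz_L2(3)[OF f g m], rule cdot_norm_le)+
qed

lemma L2_tendsto_cdot:
  assumes f: "L2_tendsto M f g" and h: "h \<in> L2 M"
  shows "(\<lambda>n. LINT x|M. cdot (f n x) (h x)) \<longlonglongrightarrow> (LINT x|M. cdot (g x) (h x))"
proof -
  have L: "\<And>n. f n \<in> L2 M" "g \<in> L2 M" and l: "(\<lambda>n. sqrt (LINT x|M. (norm (f n x - g x))\<^sup>2)) \<longlonglongrightarrow> 0"
    using f by (auto simp: L2_tendsto_def)
  let ?H = "sqrt (LINT x|M. (norm (h x))\<^sup>2)"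
  have "(\<lambda>n. (LINT x|M. cdot (f n x) (h x)) - (LINT x|M. cdot (g x) (h x))) \<longlonglongrightarrow> 0"
  proof (rule tendsto_norm_zero_cancel, rule tendsto_sandwich[OF _ _ tendsto_const])
    show "\<forall>\<^sub>F n in sequentially. 0 \<le> norm ((LINT x|M. cdot (f n x) (h x)) - (LINT x|M. cdot (g x) (h x)))" by simp
    have "norm ((LINT x|M. cdot (f n x) (h x)) - (LINT x|M. cdot (g x) (h x))) \<le> sqrt (LINT x|M. (norm (f n x - g x))\<^sup>2) * ?H" for n
    proof -
      have "(LINT x|M. cdot (f n x) (h x)) - (LINT x|M. cdot (g x) (h x)) = (LINT x|M. cdot (f n x - g x) (h x))"
        unfolding cdot_linear by (rule Bochner_Integration.integral_diff[symmetric]) (intro cdot_integrable(1) L h)+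
      then show ?thesis
        using cdot_integrable(2)[OF L2_diff(1)[OF L(1)[of n] L(2)] h]
        unfolding real_sqrt_mult[symmetric] by (simp add: real_le_rsqrt)
    qed
    then show "\<forall>\<^sub>F n in sequentially. norm ((LINT x|M. cdot (f n x) (h x)) - (LINT x|M. cdot (g x) (h x))) \<le> sqrt (LINT x|M. (norm (f n x - g x))\<^sup>2) * ?H"
      by simp
    show "(\<lambda>n. sqrt (LINT x|M. (norm (f n x - g x))\<^sup>2) * ?H) \<longlonglongrightarrow> 0" using tendsto_mult_right[OF l, of ?H] by simp
  qed
  then show ?thesis by (simp add: LIM_zero_iff)
qed

lemma L2_restrict:
  fixes f :: "real \<Rightarrow> 'a::{banach,second_countable_topology}"
  assumes f: "f \<in> L2 (lborel_on {0<..})"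
  shows "f \<in> L2 (lborel_on {0<..<T})" "(LINT x|lborel_on {0<..<T}. (norm (f x))\<^sup>2) \<le> (LINT x|lborel_on {0<..}. (norm (f x))\<^sup>2)"
proof -
  have e: "lborel_on {0<..<T} = restrict_space (lborel_on {0<..}) {0<..<T}"
  proof -
    have "{0<..} \<inter> {0<..<T} = {0<..<T}" by auto
    then show ?thesis by (subst restrict_restrict_space) simp_all
  qed
  have s: "{0<..<T} \<inter> space (lborel_on {0<..}) \<in> sets (lborel_on {0<..})"
    by (auto simp: sets_restrict_space image_iff intro!: bexI[of _ "{0<..<T}"])
  have m: "f \<in> borel_measurable (lborel_on {0<..<T})" unfolding e by (rule measurable_restrict_space1[OF L2_measurable[OF f]])
  have i: "integrable (lborel_on {0<..}) (\<lambda>x. indicator {0<..<T} x *\<^sub>R (norm (f x))\<^sup>2)"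
  proof (rule Bochner_Integration.integrable_bound[OF L2_integrable[OF f]])
    have "{0<..<T} \<in> sets (lborel_on {0<..})" using s by (simp add: Int_absorb2 subset_iff)
    then show "(\<lambda>x. indicator {0<..<T} x *\<^sub>R (norm (f x))\<^sup>2) \<in> borel_measurable (lborel_on {0<..})"
      by (intro borel_measurable_scaleR borel_measurable_indicator borel_measurable_power)
        (use L2_measurable[OF f] in simp_all)
  qed (auto simp: indicator_def)
  then have "integrable (lborel_on {0<..<T}) (\<lambda>x. (norm (f x))\<^sup>2)"
    unfolding e by (subst integrable_restrict_space[OF s])
  with m show "f \<in> L2 (lborel_on {0<..<T})" by (rule L2_I)
  have "(LINT x|lborel_on {0<..<T}. (norm (f x))\<^sup>2) = (LINT x|lborel_on {0<..}. indicator {0<..<T} x *\<^sub>R (norm (f x))\<^sup>2)"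
    unfolding e by (subst integral_restrict_space[OF s]) simp
  also have "\<dots> \<le> (LINT x|lborel_on {0<..}. (norm (f x))\<^sup>2)"
    by (intro integral_mono i L2_integrable[OF f]) (auto simp: indicator_def)
  finally show "(LINT x|lborel_on {0<..<T}. (norm (f x))\<^sup>2) \<le> (LINT x|lborel_on {0<..}. (norm (f x))\<^sup>2)" .
qed

context dirac_kernels
begin

definition \<theta> :: "real \<Rightarrow> complex \<Rightarrow> complex^2" where
  "\<theta> x l = from_riemann (\<phi> x l) (cnj (\<phi> x (cnj l)))"

lemma \<theta>_zero: "\<theta> 0 l $ 1 = 0" "\<theta> 0 l $ 2 = 1"
  by (simp_all add: \<theta>_def from_riemann_def \<phi>_zero)

lemma cnj_vec_\<theta>: "cnj_vec (\<theta> x l) = \<theta> x (cnj l)"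
  by (simp add: \<theta>_def from_riemann_def cnj_vec_def vec_eq_iff forall_2 algebra_simps)

lemma \<theta>_cont: "continuous_on A (\<lambda>x. \<theta> x l)"
proof -
  have "continuous_on A (\<lambda>x. \<phi> x l)" for l
    using continuous_on_comp_UNIV[OF \<phi>_cont, of A "\<lambda>x. (x, l)"] by (simp add: continuous_on_Pair)
  then show ?thesis unfolding \<theta>_def by (intro continuous_on_from_riemann continuous_on_cnj)
qed

lemma \<theta>_L2: "(\<lambda>x. \<theta> x l) \<in> L2 (lborel_on {c<..<d})"
  by (rule L2_continuous[OF \<theta>_cont])

lemma \<theta>_deriv:
  assumes x: "x \<ge> 0"
  shows "((\<lambda>x. \<theta> x l $ 1) has_vector_derivative (of_real (q x) * \<theta> x l $ 1 - (l + of_real (p x)) * \<theta> x l $ 2)) (at x)"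
    and "((\<lambda>x. \<theta> x l $ 2) has_vector_derivative ((l - of_real (p x)) * \<theta> x l $ 1 - of_real (q x) * \<theta> x l $ 2)) (at x)"
proof -
  have r: "r x = of_real (q x) + \<i> * of_real (p x)" using r_eq[OF x] by (simp add: complex_eq_iff)
  have d: "((\<lambda>x. \<phi> x l) has_vector_derivative (- \<i> * l * \<phi> x l + r x * cnj (\<phi> x (cnj l)))) (at x)" by (rule \<phi>_deriv)
  have "((\<lambda>x. cnj (\<phi> x (cnj l))) has_vector_derivative cnj (- \<i> * cnj l * \<phi> x (cnj l) + r x * cnj (\<phi> x (cnj (cnj l))))) (at x)"
    by (rule has_vector_derivative_cnj[OF \<phi>_deriv])
  from from_riemann_vector_derivative[OF d this]
  have D: "((\<lambda>x. \<theta> x l) has_vector_derivative from_riemann (- \<i> * l * \<phi> x l + r x * cnj (\<phi> x (cnj l)))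
      (cnj (- \<i> * cnj l * \<phi> x (cnj l) + r x * cnj (\<phi> x (cnj (cnj l)))))) (at x)" (is "(_ has_vector_derivative ?D) _")
    unfolding \<theta>_def .
  have c: "((\<lambda>x. \<theta> x l $ k) has_vector_derivative ?D $ k) (at x)" for k
    by (rule bounded_linear.has_vector_derivative[OF bounded_linear_vec_nth D])
  have "?D $ 1 = of_real (q x) * \<theta> x l $ 1 - (l + of_real (p x)) * \<theta> x l $ 2"
    "?D $ 2 = (l - of_real (p x)) * \<theta> x l $ 1 - of_real (q x) * \<theta> x l $ 2"
    unfolding \<theta>_def from_riemann_def r by (simp_all add: field_simps)
  with c[of 1] c[of 2] show
    "((\<lambda>x. \<theta> x l $ 1) has_vector_derivative (of_real (q x) * \<theta> x l $ 1 - (l + of_real (p x)) * \<theta> x l $ 2)) (at x)"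
    "((\<lambda>x. \<theta> x l $ 2) has_vector_derivative ((l - of_real (p x)) * \<theta> x l $ 1 - of_real (q x) * \<theta> x l $ 2)) (at x)" by simp_all
qed

lemma wave_eq_0:
  assumes "x > 0" "t \<le> x"
  shows "wave f x t = 0"
proof -
  have "wave_integral k f x t = (LINT \<rho>|lborel_on {0<..<T}. 0)" for k
    unfolding wave_integral_def by (rule Bochner_Integration.integral_cong) (use assms in \<open>auto simp: zero_extension_def\<close>)
  then show ?thesis using assms by (simp add: wave_def zero_extension_def from_riemann_def vec_eq_iff forall_2)
qed

text \<open>By the Lagrange identity \<open>A t = \<integral> u(x,t) \<cdot> \<theta>(x,l) dx\<close> satisfies \<open>A' = i l A + i f\<close>.\<close>

lemma classical_pairing:
  assumes u: "classical_solution 1 p q T f u" and u0: "\<And>t. t \<in> {0..T} \<Longrightarrow> u T t = 0"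
  shows "integral {0..T} (\<lambda>x. cdot (u x T) (\<theta> x l)) = integral {0..T} (\<lambda>s. \<i> * exp (\<i> * l * of_real (T - s)) * f s)"
proof -
  obtain ux ut where uxc: "continuous_on ({0..} \<times> {0..T}) (\<lambda>(x, t). ux x t)" and utc: "continuous_on ({0..} \<times> {0..T}) (\<lambda>(x, t). ut x t)"
    and D: "\<And>x t. x \<ge> 0 \<Longrightarrow> t \<in> {0..T} \<Longrightarrow> ((\<lambda>y. u y t) has_vector_derivative ux x t) (at x within {0..})"
      "\<And>x t. x \<ge> 0 \<Longrightarrow> t \<in> {0..T} \<Longrightarrow> ((\<lambda>r. u x r) has_vector_derivative ut x t) (at t within {0..T})"
    and pde: "\<And>x t. x > 0 \<Longrightarrow> t \<in> {0<..<T} \<Longrightarrow> \<i> *s ut x t + 1 *s (dirac_J *v ux x t + dirac_V p q x *v u x t) = 0"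
    and ini: "\<And>x. x \<ge> 0 \<Longrightarrow> u x 0 = 0" and bd: "\<And>t. t \<in> {0..T} \<Longrightarrow> u 0 t $ 1 = f t"
    using u unfolding classical_solution_def by blast
  have bb: "bounded_bilinear cdot"
    by (rule bounded_bilinear.intro) (auto simp: cdot_def algebra_simps intro!: exI[of _ 1] cdot_norm_le[unfolded cdot_def])
  have ct: "continuous_on {0..T} (\<lambda>t. u x t)" if "x \<ge> 0" for x
    unfolding continuous_on_eq_continuous_within using D(2)[OF that] has_vector_derivative_continuous by blast
  have cx: "continuous_on {0..T} (\<lambda>x. u x t)" if "t \<in> {0..T}" for t
    unfolding continuous_on_eq_continuous_within
  proof
    fix x assume "x \<in> {0..T}"
    then have "continuous (at x within {0..}) (\<lambda>y. u y t)" by (intro has_vector_derivative_continuous[OF D(1)] that) simp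
    then show "continuous (at x within {0..T}) (\<lambda>y. u y t)" by (rule continuous_within_subset) simp
  qed
  define A where "A t = integral {0..T} (\<lambda>x. cdot (u x t) (\<theta> x l))" for t
  have dA: "(A has_vector_derivative integral {0..T} (\<lambda>x. cdot (ut x t) (\<theta> x l))) (at t within {0..T})" if t: "t \<in> {0..T}" for t
  proof -
    have "((\<lambda>t. integral (cbox 0 T) (\<lambda>x. cdot (u x t) (\<theta> x l))) has_vector_derivative integral (cbox 0 T) (\<lambda>x. cdot (ut x t) (\<theta> x l))) (at t within {0..T})"
    proof (rule leibniz_rule_vector_derivative)
      show "((\<lambda>t. cdot (u x t) (\<theta> x l)) has_vector_derivative cdot (ut x t) (\<theta> x l)) (at t within {0..T})" if "t \<in> {0..T}" "x \<in> cbox 0 T" for t x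
        by (rule bounded_linear.has_vector_derivative[OF bounded_bilinear.bounded_linear_left[OF bb] D(2)]) (use that in auto)
      show "(\<lambda>x. cdot (u x t) (\<theta> x l)) integrable_on cbox 0 T" if "t \<in> {0..T}" for t
        unfolding cbox_interval by (intro integrable_continuous_interval bounded_bilinear.continuous_on[OF bb] cx that \<theta>_cont)
      have "continuous_on ({0..T} \<times> cbox 0 T) (\<lambda>z. ut (snd z) (fst z))"
      proof -
        have "continuous_on ({0..T} \<times> cbox 0 T) (\<lambda>z. (\<lambda>(x, t). ut x t) (snd z, fst z))"
          by (rule continuous_on_compose2[OF utc]) (auto intro!: continuous_intros)
        then show ?thesis by simp
      qed
      then show "continuous_on ({0..T} \<times> cbox 0 T) (\<lambda>(t, x). cdot (ut x t) (\<theta> x l))"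
        unfolding split_beta
        by (intro bounded_bilinear.continuous_on[OF bb] continuous_on_compose2[OF \<theta>_cont[of UNIV]] continuous_intros) auto
    qed (use t in auto)
    then show ?thesis unfolding A_def cbox_interval .
  qed
  have eq: "integral {0..T} (\<lambda>x. cdot (ut x t) (\<theta> x l)) = \<i> * f t + \<i> * l * A t" if t: "t \<in> {0<..<T}" for t
  proof -
    have t': "t \<in> {0..T}" using t by simp
    \<comment> \<open>Boundary form of the Lagrange identity. It vanishes at \<open>T\<close>
      because the solution does, and at 0 only the boundary value \<open>f t\<close> survives since
      \<open>\<theta>\<close> starts at (0, 1).\<close>
    define Q where "Q x = u x t $ 2 * \<theta> x l $ 1 - u x t $ 1 * \<theta> x l $ 2" for x
    have Qc: "continuous_on {0..T} Q"
      unfolding Q_def by (intro continuous_intros continuous_on_component cx[OF t'] \<theta>_cont)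
    have "(Q has_vector_derivative - \<i> * cdot (ut x t) (\<theta> x l) - l * cdot (u x t) (\<theta> x l)) (at x)" if x: "x \<in> {0<..<T}" for x
    proof -
      have "((\<lambda>y. u y t) has_vector_derivative ux x t) (at x within {0<..})"
        by (rule has_vector_derivative_within_subset[OF D(1)]) (use x t in auto)
      then have du: "((\<lambda>y. u y t) has_vector_derivative ux x t) (at x)" using x by (simp add: at_within_open[of x "{0<..}"])
      have x0: "x \<ge> 0" "x > 0" using x by auto
      have c: "((\<lambda>y. u y t $ k) has_vector_derivative ux x t $ k) (at x)" for k
        by (rule bounded_linear.has_vector_derivative[OF bounded_linear_vec_nth du])
      have "(Q has_vector_derivative ((u x t $ 2 * (of_real (q x) * \<theta> x l $ 1 - (l + of_real (p x)) * \<theta> x l $ 2) + ux x t $ 2 * \<theta> x l $ 1)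
          - (u x t $ 1 * ((l - of_real (p x)) * \<theta> x l $ 1 - of_real (q x) * \<theta> x l $ 2) + ux x t $ 1 * \<theta> x l $ 2))) (at x)"
        unfolding Q_def
        by (rule has_vector_derivative_diff[OF has_vector_derivative_mult[OF c[of 2] \<theta>_deriv(1)[OF x0(1)]]
              has_vector_derivative_mult[OF c[of 1] \<theta>_deriv(2)[OF x0(1)]]])
      moreover have "\<i> * ut x t $ 1 + (ux x t $ 2 + (of_real (p x) * u x t $ 1 + of_real (q x) * u x t $ 2)) = 0"
        "\<i> * ut x t $ 2 + (- ux x t $ 1 + (of_real (q x) * u x t $ 1 - of_real (p x) * u x t $ 2)) = 0"
        using pde[OF x0(2) t] by (simp_all add: vec_eq_iff forall_2 dirac_J_mult dirac_V_mult)
      then have "ux x t $ 2 = - \<i> * ut x t $ 1 - (of_real (p x) * u x t $ 1 + of_real (q x) * u x t $ 2)"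
        "ux x t $ 1 = \<i> * ut x t $ 2 + (of_real (q x) * u x t $ 1 - of_real (p x) * u x t $ 2)"
        by algebra+
      ultimately show ?thesis by (simp add: cdot_def algebra_simps)
    qed
    then have Qi: "((\<lambda>x. - \<i> * cdot (ut x t) (\<theta> x l) - l * cdot (u x t) (\<theta> x l)) has_integral Q T - Q 0) {0..T}"
      using T by (intro fundamental_theorem_of_calculus_interior Qc) auto
    have Qf: "Q T - Q 0 = f t" unfolding Q_def using u0[OF t'] bd[OF t'] by (simp add: \<theta>_zero)
    have "continuous_on {0..T} (\<lambda>x. (x, t))" by (intro continuous_intros)
    moreover have "(\<lambda>x. (x, t)) ` {0..T} \<subseteq> {0..} \<times> {0..T}" using t' by auto
    ultimately have "continuous_on {0..T} (\<lambda>x. (\<lambda>(x, t). ut x t) (x, t))" by (rule continuous_on_compose2[OF utc])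
    then have "continuous_on {0..T} (\<lambda>x. ut x t)" by simp
    then have ui: "(\<lambda>x. cdot (ut x t) (\<theta> x l)) integrable_on {0..T}"
      by (intro integrable_continuous_interval bounded_bilinear.continuous_on[OF bb] \<theta>_cont)
    have vi: "(\<lambda>x. cdot (u x t) (\<theta> x l)) integrable_on {0..T}"
      by (intro integrable_continuous_interval bounded_bilinear.continuous_on[OF bb] \<theta>_cont cx t')
    have "((\<lambda>x. - \<i> * cdot (ut x t) (\<theta> x l) - l * cdot (u x t) (\<theta> x l)) has_integral
        - \<i> * integral {0..T} (\<lambda>x. cdot (ut x t) (\<theta> x l)) - l * A t) {0..T}"
      unfolding A_def by (intro has_integral_diff has_integral_mult_right integrable_integral ui vi)
    from has_integral_unique[OF this Qi[unfolded Qf]]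
    have "- \<i> * integral {0..T} (\<lambda>x. cdot (ut x t) (\<theta> x l)) - l * A t = f t" .
    then have "\<i> * (- \<i> * integral {0..T} (\<lambda>x. cdot (ut x t) (\<theta> x l)) - l * A t) = \<i> * f t" by simp
    then show ?thesis by (simp add: algebra_simps)
  qed
  \<comment> \<open>Integrating factor for the equation
    \<open>A' = \<i> l A + \<i> f\<close>.\<close>
  define H where "H t = exp (\<i> * l * of_real (T - t)) * A t" for t
  have de: "((\<lambda>t. exp (\<i> * l * of_real (T - t))) has_vector_derivative - (\<i> * l) * exp (\<i> * l * of_real (T - t))) (at t within S)" for t S
  proof -
    have "((\<lambda>z. exp (\<i> * l * (of_real T - z))) has_field_derivative - (\<i> * l) * exp (\<i> * l * (of_real T - of_real t))) (at (of_real t))"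
      by (auto intro!: derivative_eq_intros)
    from has_vector_derivative_real_field[OF this] show ?thesis by simp
  qed
  have Ac: "continuous_on {0..T} A"
    unfolding continuous_on_eq_continuous_within by (rule ballI, rule has_vector_derivative_continuous[OF dA])
  have Hc: "continuous_on {0..T} H"
    unfolding H_def by (intro continuous_intros Ac)
  have "(H has_vector_derivative \<i> * exp (\<i> * l * of_real (T - t)) * f t) (at t)" if t: "t \<in> {0<..<T}" for t
  proof -
    have "(A has_vector_derivative \<i> * f t + \<i> * l * A t) (at t within {0<..<T})"
      using t by (intro has_vector_derivative_within_subset[OF dA[of t, unfolded eq[OF t]]]) auto
    then have "(A has_vector_derivative \<i> * f t + \<i> * l * A t) (at t)" using t by (simp add: at_within_open[of t "{0<..<T}"])
    from has_vector_derivative_mult[OF de this] show ?thesis unfolding H_def by (simp add: algebra_simps)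
  qed
  then have "((\<lambda>t. \<i> * exp (\<i> * l * of_real (T - t)) * f t) has_integral H T - H 0) {0..T}"
    using T by (intro fundamental_theorem_of_calculus_interior Hc) auto
  moreover have "A 0 = 0"
  proof -
    have "A 0 = integral {0..T} (\<lambda>x. 0)" unfolding A_def by (rule integral_cong) (simp add: ini cdot_def)
    then show ?thesis by simp
  qed
  ultimately show ?thesis unfolding H_def A_def by (simp add: integral_unique)
qed

text \<open>Both sides are continuous in the control for the \<open>L2\<close> norm, so the identity
  extends from smooth controls by density.\<close>

lemma wave_pairing:
  assumes f: "f \<in> L2 (lborel_on {0<..<T})"
  shows "(LINT x|lborel_on {0<..<T}. cdot (wave f x T) (\<theta> x l)) = (LINT s|lborel_on {0<..<T}. \<i> * exp (\<i> * l * of_real (T - s)) * f s)"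
proof -
  let ?M = "lborel_on {0<..<T}"
  have smooth: "(LINT x|?M. cdot (wave f x T) (\<theta> x l)) = (LINT s|?M. \<i> * exp (\<i> * l * of_real (T - s)) * f s)"
    if f: "smooth_control T f" for f
  proof -
    obtain u where u: "classical_solution 1 p q T f u" "\<And>x t. x > 0 \<Longrightarrow> t \<in> {0..T} \<Longrightarrow> u x t = wave f x t"
      by (rule classical_solution_smooth[OF f]) (rule that)
    have "u T t = 0" if "t \<in> {0..T}" for t using u(2)[OF T that] wave_eq_0[OF T, of t f] that by simp
    note P = classical_pairing[OF u(1) this, of l]
    have c: "continuous_on {0..T} (\<lambda>x. u x T)"
    proof -
      have "\<exists>ux. \<forall>x\<ge>0. ((\<lambda>y. u y T) has_vector_derivative ux x) (at x within {0..})"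
        using u(1) T unfolding classical_solution_def by fastforce
      then have "continuous (at x within {0..}) (\<lambda>y. u y T)" if "x \<ge> 0" for x
        using has_vector_derivative_continuous that by blast
      then show ?thesis
        unfolding continuous_on_eq_continuous_within
        by (meson atLeastAtMost_iff atLeastatMost_subset_iff continuous_within_subset Icc_subset_Ici_iff order_refl)
    qed
    have "(LINT x|?M. cdot (wave f x T) (\<theta> x l)) = (LINT x|?M. cdot (u x T) (\<theta> x l))"
      using T by (intro Bochner_Integration.integral_cong) (auto simp: u(2))
    also have "\<dots> = integral {0..T} (\<lambda>x. cdot (u x T) (\<theta> x l))"
      by (rule lebesgue_integral_open_interval) (unfold cdot_def, intro continuous_intros continuous_on_component c \<theta>_cont)
    also note P
    also have "integral {0..T} (\<lambda>s. \<i> * exp (\<i> * l * of_real (T - s)) * f s) = (LINT s|?M. \<i> * exp (\<i> * l * of_real (T - s)) * f s)"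
      by (rule lebesgue_integral_open_interval[symmetric]) (intro continuous_intros smooth_control_continuous[OF f])
    finally show ?thesis .
  qed
  obtain F where F: "\<And>n. smooth_control T (F n)" "L2_tendsto ?M F f" by (rule smooth_controls_dense[OF f]) (rule that)
  have t: "L2_tendsto ?M (\<lambda>n x. wave (F n) x T) (\<lambda>x. wave f x T)"
  proof -
    have L: "L2_tendsto (lborel_on {0<..}) (\<lambda>n x. wave (F n) x T) (\<lambda>x. wave f x T)" by (rule wave_tendsto[OF F(2)]) simp
    then have m: "\<And>n. (\<lambda>x. wave (F n) x T) \<in> L2 (lborel_on {0<..})" "(\<lambda>x. wave f x T) \<in> L2 (lborel_on {0<..})"
      and l: "(\<lambda>n. (LINT x|lborel_on {0<..}. (norm (wave (F n) x T - wave f x T))\<^sup>2)) \<longlonglongrightarrow> 0"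
      by (auto simp: L2_tendsto_iff)
    have "(\<lambda>n. (LINT x|?M. (norm (wave (F n) x T - wave f x T))\<^sup>2)) \<longlonglongrightarrow> 0"
    proof (rule tendsto_sandwich[OF _ _ tendsto_const l])
      show "\<forall>\<^sub>F n in sequentially. (LINT x|?M. (norm (wave (F n) x T - wave f x T))\<^sup>2) \<le> (LINT x|lborel_on {0<..}. (norm (wave (F n) x T - wave f x T))\<^sup>2)"
        by (intro always_eventually allI L2_restrict(2)[OF L2_diff(1)[OF m]])
    qed simp
    then show ?thesis unfolding L2_tendsto_iff using L2_restrict(1)[OF m(1)] L2_restrict(1)[OF m(2)] by blast
  qed
  have 1: "(\<lambda>n. LINT x|?M. cdot (wave (F n) x T) (\<theta> x l)) \<longlonglongrightarrow> (LINT x|?M. cdot (wave f x T) (\<theta> x l))"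
    by (rule L2_tendsto_cdot[OF t \<theta>_L2])
  have e: "(\<lambda>s. vector [\<i> * exp (\<i> * l * of_real (T - s)), 0] :: complex^2) \<in> L2 ?M"
    by (intro L2_vector L2_continuous continuous_intros)
  have "L2_tendsto ?M (\<lambda>n s. axis 1 (F n s) :: complex^2) (\<lambda>s. axis 1 (f s))"
    by (rule L2_tendsto_bounded_linear[OF bounded_linear_axis F(2)])
  from L2_tendsto_cdot[OF this e]
  have 2: "(\<lambda>n. LINT s|?M. \<i> * exp (\<i> * l * of_real (T - s)) * F n s) \<longlonglongrightarrow> (LINT s|?M. \<i> * exp (\<i> * l * of_real (T - s)) * f s)"
    by (simp add: cdot_def axis_def mult_ac)
  show ?thesis by (rule LIMSEQ_unique[OF 1[unfolded smooth[OF F(1)]] 2])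
qed

lemma control_map_L2:
  obtains C where "C \<ge> 0" "\<And>f. f \<in> L2 (lborel_on {0<..<T}) \<Longrightarrow> control_map f \<in> L2 (lborel_on {0<..<T})"
    "\<And>f. f \<in> L2 (lborel_on {0<..<T}) \<Longrightarrow> (LINT x|lborel_on {0<..<T}. (norm (control_map f x))\<^sup>2) \<le> C * (LINT x|lborel_on {0<..<T}. (norm (f x))\<^sup>2)"
proof -
  let ?M = "lborel_on {0<..<T}"
  obtain C where C: "C \<ge> 0" "\<And>f t. f \<in> L2 ?M \<Longrightarrow> t \<le> T \<Longrightarrow> (\<lambda>x. wave f x t) \<in> L2 (lborel_on {0<..})"
    "\<And>f t. f \<in> L2 ?M \<Longrightarrow> t \<le> T \<Longrightarrow> (LINT x|lborel_on {0<..}. (norm (wave f x t))\<^sup>2) \<le> C * (LINT s|?M. (cmod (f s))\<^sup>2)"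
    by (rule wave_L2) (rule that)
  have main: "control_map f \<in> L2 ?M \<and> (LINT x|?M. (norm (control_map f x))\<^sup>2) \<le> 2 * C * (LINT x|?M. (norm (f x))\<^sup>2)" if f: "f \<in> L2 ?M" for f
  proof -
    have 1: "(\<lambda>s. f s $ 1) \<in> L2 ?M" and 2: "(\<lambda>s. f s $ 2) \<in> L2 ?M" by (rule L2_component[OF f])+
    have 3: "(\<lambda>s. cnj (f s $ 2)) \<in> L2 ?M" by (rule L2_bounded_linear(1)[OF 2 bounded_linear_cnj])
    note u1 = L2_restrict[OF C(2)[OF 1 order_refl], of T] and u2 = L2_restrict[OF C(2)[OF 3 order_refl], of T]
    have L: "control_map f \<in> L2 ?M" unfolding control_map_def by (rule L2_add(1)[OF u1(1) L2_cnj_vec[OF u2(1)]])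
    have "(LINT x|?M. (norm (control_map f x))\<^sup>2) \<le> 2 * (LINT x|?M. (norm (wave (\<lambda>s. f s $ 1) x T))\<^sup>2) + 2 * (LINT x|?M. (norm (cnj_vec (wave (\<lambda>s. cnj (f s $ 2)) x T)))\<^sup>2)"
      unfolding control_map_def by (rule L2_add(2)[OF u1(1) L2_cnj_vec[OF u2(1)]])
    moreover have "(LINT x|?M. (norm (wave (\<lambda>s. f s $ 1) x T))\<^sup>2) \<le> C * (LINT x|?M. (cmod (f x $ 1))\<^sup>2)"
      by (rule order_trans[OF u1(2) C(3)[OF 1 order_refl]])
    moreover have "(LINT x|?M. (norm (wave (\<lambda>s. cnj (f s $ 2)) x T))\<^sup>2) \<le> C * (LINT x|?M. (cmod (f x $ 2))\<^sup>2)"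
      using order_trans[OF u2(2) C(3)[OF 3 order_refl]] by simp
    moreover have "(LINT x|?M. (norm (f x))\<^sup>2) = (LINT x|?M. (cmod (f x $ 1))\<^sup>2) + (LINT x|?M. (cmod (f x $ 2))\<^sup>2)"
      unfolding norm_vec2_sq by (rule Bochner_Integration.integral_add[OF L2_integrable[OF 1] L2_integrable[OF 2]])
    ultimately show ?thesis using L by (simp add: algebra_simps)
  qed
  show ?thesis
  proof (rule that[of "2 * C"])
    show "2 * C \<ge> 0" using C by simp
  qed (rule main[THEN conjunct1] main[THEN conjunct2], assumption)+
qed

lemma control_map_in_L2: "f \<in> L2 (lborel_on {0<..<T}) \<Longrightarrow> control_map f \<in> L2 (lborel_on {0<..<T})"
  by (rule control_map_L2) blast

text \<open>The second control contributes the conjugate of a wave pairing at \<open>cnj l\<close>;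
  conjugating the exponential there produces the second entry of \<open>dirac_row\<close>.\<close>

theorem dirac_transform_eq_pairing:
  assumes f: "f \<in> L2 (lborel_on {0<..<T})"
  shows "dirac_transform T f l = (LINT x|lborel_on {0<..<T}. cdot (control_map f x) (\<theta> x l))"
proof -
  let ?M = "lborel_on {0<..<T}"
  obtain C where C: "\<And>f t. f \<in> L2 ?M \<Longrightarrow> t \<le> T \<Longrightarrow> (\<lambda>x. wave f x t) \<in> L2 (lborel_on {0<..})" by (rule wave_L2) blast
  have 1: "(\<lambda>s. f s $ 1) \<in> L2 ?M" and 2: "(\<lambda>s. f s $ 2) \<in> L2 ?M" by (rule L2_component[OF f])+
  have 3: "(\<lambda>s. cnj (f s $ 2)) \<in> L2 ?M" by (rule L2_bounded_linear(1)[OF 2 bounded_linear_cnj])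
  have u: "(\<lambda>x. wave (\<lambda>s. f s $ 1) x T) \<in> L2 ?M" "(\<lambda>x. wave (\<lambda>s. cnj (f s $ 2)) x T) \<in> L2 ?M"
    by (intro L2_restrict(1) C 1 3 order_refl)+
  have ei: "integrable ?M (\<lambda>s. c * exp (d * of_real (T - s)) * g s)" if g: "g \<in> L2 ?M" for c d :: complex and g
  proof -
    have e: "(\<lambda>s. c * exp (d * of_real (T - s))) \<in> L2 ?M" by (intro L2_continuous continuous_intros)
    show ?thesis
      by (rule cauchy_schwarz_L2(1)[OF e g]) (use L2_measurable[OF e] L2_measurable[OF g] in \<open>auto simp: norm_mult\<close>)
  qed
  have "(LINT x|?M. cdot (control_map f x) (\<theta> x l)) = (LINT x|?M. cdot (wave (\<lambda>s. f s $ 1) x T) (\<theta> x l))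
      + (LINT x|?M. cdot (cnj_vec (wave (\<lambda>s. cnj (f s $ 2)) x T)) (\<theta> x l))"
    unfolding control_map_def cdot_linear
    by (rule Bochner_Integration.integral_add) (intro cdot_integrable(1) u L2_cnj_vec \<theta>_L2)+
  also have "(LINT x|?M. cdot (cnj_vec (wave (\<lambda>s. cnj (f s $ 2)) x T)) (\<theta> x l)) = cnj (LINT x|?M. cdot (wave (\<lambda>s. cnj (f s $ 2)) x T) (\<theta> x (cnj l)))"
    unfolding Bochner_Integration.integral_cnj[symmetric] cnj_cdot cnj_vec_\<theta> by simp
  also have "\<dots> = (LINT s|?M. - \<i> * exp (- \<i> * l * of_real (T - s)) * f s $ 2)"
    unfolding wave_pairing[OF 3] Bochner_Integration.integral_cnj[symmetric] by (simp add: exp_cnj)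
  also have "(LINT x|?M. cdot (wave (\<lambda>s. f s $ 1) x T) (\<theta> x l)) = (LINT s|?M. \<i> * exp (\<i> * l * of_real (T - s)) * f s $ 1)"
    by (rule wave_pairing[OF 1])
  also have "(LINT s|?M. \<i> * exp (\<i> * l * of_real (T - s)) * f s $ 1) + (LINT s|?M. - \<i> * exp (- \<i> * l * of_real (T - s)) * f s $ 2)
      = dirac_transform T f l"
    unfolding dirac_transform_def dirac_row_def vector_2
    by (rule Bochner_Integration.integral_add[symmetric]) (rule ei[OF 1] ei[OF 2])+
  finally show ?thesis ..
qed

lemma control_map_linear:
  assumes f: "f \<in> L2 (lborel_on {0<..<T})" and g: "g \<in> L2 (lborel_on {0<..<T})" and x: "x \<in> {0<..<T}"
  shows "control_map (\<lambda>s. c *s f s + g s) x = c *s control_map f x + control_map g x"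
proof -
  let ?V = "\<lambda>i j. volterra (control_kernel i j)"
  have t: "T - x \<in> {0<..<T}" using x by simp
  have vz: "?V i j h (T - x) = ?V i j (zero_extension h) (T - x)" for i j h
    unfolding volterra_def by (rule Bochner_Integration.integral_cong) (use t in \<open>auto simp: indicator_def zero_extension_def\<close>)
  have vi: "integrable lborel (\<lambda>s. indicator {0<..<T - x} s *\<^sub>R (control_kernel i j (T - x) s * h s))"
    if h: "h \<in> L2 (lborel_on {0<..<T})" for i j h
  proof -
    have "(\<lambda>s. indicator {0<..<T - x} s *\<^sub>R (control_kernel i j (T - x) s * h s)) = (\<lambda>s. indicator {0<..<T - x} s *\<^sub>R (control_kernel i j (T - x) s * zero_extension h s))"
      using t by (auto simp: indicator_def zero_extension_def)
    then show ?thesis using volterra_integrable[OF control_kernel_cont zero_extension_L2(3)[OF h]] by simp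
  qed
  have V: "?V i j (\<lambda>s. c * f s $ k + g s $ k) (T - x) = c * ?V i j (\<lambda>s. f s $ k) (T - x) + ?V i j (\<lambda>s. g s $ k) (T - x)" for i j k
  proof -
    have "?V i j (\<lambda>s. c * f s $ k + g s $ k) (T - x) = ?V i j (\<lambda>s. c * f s $ k) (T - x) + ?V i j (\<lambda>s. g s $ k) (T - x)"
      by (rule volterra_add[OF control_kernel_cont vi vi]) (intro L2_component g L2_bounded_linear(1)[OF L2_component[OF f] bounded_linear_mult_right])+
    also have "?V i j (\<lambda>s. c * f s $ k) (T - x) = (LINT s|lborel. c * (indicator {0<..<T - x} s *\<^sub>R (control_kernel i j (T - x) s * f s $ k)))"
      unfolding volterra_def by (simp add: mult.left_commute)
    also have "\<dots> = c * ?V i j (\<lambda>s. f s $ k) (T - x)" unfolding volterra_def by (rule integral_mult_right_zero)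
    finally show ?thesis .
  qed
  have W: "control_map h x = control_map h (T - (T - x))" for h by simp
  show ?thesis unfolding W control_map_eq[OF t] vector_add_component vector_smult_component V
    by (simp add: vec_eq_iff forall_2 algebra_simps)
qed

end

section \<open>The Hilbert space structure\<close>

lemma bounded_linear_smult: "bounded_linear (\<lambda>v :: complex^2. c *s v)"
  by (rule linear_conv_bounded_linear[THEN iffD1], rule linearI) (auto simp: vec_eq_iff algebra_simps)

lemma L2_lincomb:
  fixes f g :: "real \<Rightarrow> complex^2"
  assumes "f \<in> L2 M" "g \<in> L2 M"
  shows "(\<lambda>s. c *s f s + g s) \<in> L2 M"
  by (rule L2_add(1)[OF L2_bounded_linear(1)[OF assms(1) bounded_linear_smult] assms(2)])

lemma L2_inner_lincomb:
  assumes "f \<in> L2 M" "g \<in> L2 M" "h \<in> L2 M"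
  shows "L2_inner M h (\<lambda>s. c *s f s + g s) = c * L2_inner M h f + L2_inner M h g"
proof -
  have "(LINT x|M. c * cdot (cnj_vec (h x)) (f x) + cdot (cnj_vec (h x)) (g x))
     = (LINT x|M. c * cdot (cnj_vec (h x)) (f x)) + (LINT x|M. cdot (cnj_vec (h x)) (g x))"
    by (intro Bochner_Integration.integral_add integrable_mult_right cdot_integrable(1) L2_cnj_vec assms)
  then show ?thesis unfolding L2_inner_eq cdot_linear by (simp only: integral_mult_right_zero)
qed

lemma L2_inner_cnj: "L2_inner M g f = cnj (L2_inner M f g)"
  unfolding L2_inner_eq Bochner_Integration.integral_cnj[symmetric] cnj_cdot by (simp add: cdot_commute)

lemma L2_inner_self: "L2_inner M f f = of_real (LINT x|M. (norm (f x))\<^sup>2)"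
  unfolding L2_inner_eq cdot_cnj_vec_self by (rule integral_complex_of_real)

lemma L2_inner_cauchy_schwarz:
  assumes "f \<in> L2 M" "g \<in> L2 M"
  shows "cmod (L2_inner M f g) \<le> sqrt (LINT x|M. (norm (f x))\<^sup>2) * sqrt (LINT x|M. (norm (g x))\<^sup>2)"
  using cdot_integrable(2)[OF L2_cnj_vec[OF assms(1)] assms(2)]
  unfolding L2_inner_eq real_sqrt_mult[symmetric] by (simp add: real_le_rsqrt)

lemma L2_inner_cong:
  assumes "\<And>x. x \<in> space M \<Longrightarrow> f x = f' x" "\<And>x. x \<in> space M \<Longrightarrow> g x = g' x"
  shows "L2_inner M f g = L2_inner M f' g'"
  unfolding L2_inner_eq by (rule Bochner_Integration.integral_cong) (simp_all add: assms)

lemma L2_inner_cong_AE: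
  assumes "f \<in> L2 M" "g \<in> L2 M" "f' \<in> L2 M" "g' \<in> L2 M" "AE x in M. f x = f' x" "AE x in M. g x = g' x"
  shows "L2_inner M f g = L2_inner M f' g'"
  unfolding L2_inner_eq
proof (rule integral_cong_AE)
  show "(\<lambda>x. cdot (cnj_vec (f x)) (g x)) \<in> borel_measurable M" "(\<lambda>x. cdot (cnj_vec (f' x)) (g' x)) \<in> borel_measurable M"
    by (intro borel_measurable_integrable cdot_integrable(1) L2_cnj_vec assms)+
  show "AE x in M. cdot (cnj_vec (f x)) (g x) = cdot (cnj_vec (f' x)) (g' x)"
    using assms(5,6) by eventually_elim simp
qed

lemma dirac_row_L2: "dirac_row T l \<in> L2 (lborel_on {0<..<T})"
proof -
  have "(\<lambda>s. dirac_row T l s) \<in> L2 (lborel_on {0<..<T})"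
    unfolding dirac_row_def by (intro L2_vector L2_continuous continuous_intros)
  then show ?thesis .
qed

lemma dirac_transform_eq_cdot: "dirac_transform T f l = (LINT s|lborel_on {0<..<T}. cdot (dirac_row T l s) (f s))"
  by (simp add: dirac_transform_def cdot_def)

lemma dirac_transform_lincomb:
  assumes "f \<in> L2 (lborel_on {0<..<T})" "g \<in> L2 (lborel_on {0<..<T})"
  shows "dirac_transform T (\<lambda>s. c *s f s + g s) = (\<lambda>l. c * dirac_transform T f l + dirac_transform T g l)"
proof
  fix l
  let ?M = "lborel_on {0<..<T}"
  have "(LINT x|?M. c * cdot (dirac_row T l x) (f x) + cdot (dirac_row T l x) (g x))
     = (LINT x|?M. c * cdot (dirac_row T l x) (f x)) + (LINT x|?M. cdot (dirac_row T l x) (g x))"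
    by (intro Bochner_Integration.integral_add integrable_mult_right cdot_integrable(1) dirac_row_L2 assms)
  then show "dirac_transform T (\<lambda>s. c *s f s + g s) l = c * dirac_transform T f l + dirac_transform T g l"
    unfolding dirac_transform_eq_cdot cdot_linear by (simp only: integral_mult_right_zero)
qed

lemma dirac_transform_zero: "dirac_transform T (\<lambda>_. 0) = (\<lambda>_. 0)"
  by (simp add: dirac_transform_def fun_eq_iff)

lemma dirac_transform_inj:
  assumes f: "f \<in> L2 (lborel_on {0<..<T})" and g: "g \<in> L2 (lborel_on {0<..<T})" and T: "T > 0"
    and eq: "dirac_transform T f = dirac_transform T g"
  shows "AE s in lborel_on {0<..<T}. f s = g s"
proof -
  have "dirac_transform T (\<lambda>s. (-1) *s g s + f s) = (\<lambda>_. 0)" unfolding dirac_transform_lincomb[OF g f] eq by simp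
  from dirac_transform_eq_0[OF L2_lincomb[OF g f] T this] show ?thesis
    by eventually_elim (simp add: vec_eq_iff)
qed

lemma dirac_space_iff: "T > 0 \<Longrightarrow> F \<in> dirac_space T \<longleftrightarrow> (\<exists>f\<in>L2 (lborel_on {0<..<T}). F = dirac_transform T f)"
  unfolding dirac_space_def using dirac_transform_holomorphic by blast

text \<open>Stated for a general operator \<open>A\<close> because it is used twice: with the
  control map for the theorem, and with the identity in \<open>L2_riesz\<close>, to view
  \<open>L2\<close> itself as a space of functions. Completeness is that of \<open>L2\<close>,
  transported back by surjectivity of \<open>A\<close>.\<close>

lemma dirac_space_hilbert:
  fixes A :: "(real \<Rightarrow> complex^2) \<Rightarrow> real \<Rightarrow> complex^2"
  defines "M \<equiv> \<lambda>T. lborel_on {0<..<T::real}"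
  assumes T: "T > 0"
    and AL: "\<And>f. f \<in> L2 (M T) \<Longrightarrow> A f \<in> L2 (M T)"
    and lin: "\<And>f g c x. f \<in> L2 (M T) \<Longrightarrow> g \<in> L2 (M T) \<Longrightarrow> x \<in> {0<..<T} \<Longrightarrow> A (\<lambda>s. c *s f s + g s) x = c *s A f x + A g x"
    and inj: "\<And>f. f \<in> L2 (M T) \<Longrightarrow> (AE x in M T. A f x = 0) \<Longrightarrow> dirac_transform T f = (\<lambda>_. 0)"
    and surj: "\<And>y. y \<in> L2 (M T) \<Longrightarrow> \<exists>f\<in>L2 (M T). \<forall>x\<in>{0<..<T}. A f x = y x"
    and ip: "\<And>f g. f \<in> L2 (M T) \<Longrightarrow> g \<in> L2 (M T) \<Longrightarrow> ip (dirac_transform T f) (dirac_transform T g) = L2_inner (M T) (A f) (A g)"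
  shows "hilbert_function_space (dirac_space T) ip"
proof -
  let ?S = "dirac_space T"
  have S: "F \<in> ?S \<longleftrightarrow> (\<exists>f\<in>L2 (M T). F = dirac_transform T f)" for F unfolding M_def by (rule dirac_space_iff[OF T])
  have lc: "(\<lambda>w. c * F w + G w) \<in> ?S" if "F \<in> ?S" "G \<in> ?S" for F G c
  proof -
    obtain f g where f: "f \<in> L2 (M T)" "F = dirac_transform T f" and g: "g \<in> L2 (M T)" "G = dirac_transform T g"
      using \<open>F \<in> ?S\<close> \<open>G \<in> ?S\<close> unfolding S by blast
    show ?thesis unfolding S f(2) g(2)
      by (rule bexI[OF _ L2_lincomb[OF f(1) g(1), of c]]) (rule dirac_transform_lincomb[OF f(1)[unfolded M_def] g(1)[unfolded M_def], symmetric])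
  qed
  have iplc: "ip H (\<lambda>w. c * F w + G w) = c * ip H F + ip H G" if "F \<in> ?S" "G \<in> ?S" "H \<in> ?S" for F G H c
  proof -
    obtain f g h where f: "f \<in> L2 (M T)" "F = dirac_transform T f" and g: "g \<in> L2 (M T)" "G = dirac_transform T g"
      and h: "h \<in> L2 (M T)" "H = dirac_transform T h"
      using \<open>F \<in> ?S\<close> \<open>G \<in> ?S\<close> \<open>H \<in> ?S\<close> unfolding S by blast
    have "ip H (\<lambda>w. c * F w + G w) = L2_inner (M T) (A h) (A (\<lambda>s. c *s f s + g s))"
      unfolding f(2) g(2) h(2) dirac_transform_lincomb[OF f(1)[unfolded M_def] g(1)[unfolded M_def], symmetric]
      by (rule ip[OF h(1) L2_lincomb[OF f(1) g(1)]])
    also have "\<dots> = L2_inner (M T) (A h) (\<lambda>s. c *s A f s + A g s)"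
      by (rule L2_inner_cong) (auto simp: lin[OF f(1) g(1)] M_def)
    also have "\<dots> = c * ip H F + ip H G"
      unfolding L2_inner_lincomb[OF AL[OF f(1)] AL[OF g(1)] AL[OF h(1)]] f(2) g(2) h(2)
      by (simp only: ip[OF h(1) f(1)] ip[OF h(1) g(1)])
    finally show ?thesis .
  qed
  have zero: "(\<lambda>_. 0) \<in> ?S" unfolding S by (rule bexI[of _ "\<lambda>_. 0"]) (simp_all add: dirac_transform_zero L2_zero)
  have ip0: "ip H (\<lambda>_. 0) = 0" if "H \<in> ?S" for H using iplc[OF zero zero that, of 1] by simp
  have self: "ip (dirac_transform T f) (dirac_transform T f) = of_real (LINT x|M T. (norm (A f x))\<^sup>2)" if "f \<in> L2 (M T)" for f
    unfolding ip[OF that that] by (rule L2_inner_self)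
  have norm_diff: "ip_norm ip (\<lambda>w. dirac_transform T f w - dirac_transform T g w) = sqrt (LINT x|M T. (norm (A f x - A g x))\<^sup>2)"
    if f: "f \<in> L2 (M T)" and g: "g \<in> L2 (M T)" for f g
  proof -
    have e1: "(\<lambda>w. dirac_transform T f w - dirac_transform T g w) = dirac_transform T (\<lambda>s. (-1) *s g s + f s)"
      unfolding dirac_transform_lincomb[OF g[unfolded M_def] f[unfolded M_def]] by simp
    have e2: "(LINT x|M T. (norm (A (\<lambda>s. (-1) *s g s + f s) x))\<^sup>2) = (LINT x|M T. (norm (A f x - A g x))\<^sup>2)"
    proof (rule Bochner_Integration.integral_cong[OF refl])
      fix x assume "x \<in> space (M T)"
      then have x: "x \<in> {0<..<T}" by (simp add: M_def)
      have "(-1) *s A g x + A f x = A f x - A g x" by (simp add: vec_eq_iff)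
      then show "(norm (A (\<lambda>s. (-1) *s g s + f s) x))\<^sup>2 = (norm (A f x - A g x))\<^sup>2" by (simp only: lin[OF g f x])
    qed
    show ?thesis unfolding ip_norm_def e1 self[OF L2_lincomb[OF g f]] e2 by simp
  qed
  have complete: "\<exists>F\<in>?S. (\<lambda>n. ip_norm ip (\<lambda>w. X n w - F w)) \<longlonglongrightarrow> 0"
    if X: "\<And>n. X n \<in> ?S" and cau: "\<And>e. e > 0 \<Longrightarrow> \<exists>N. \<forall>m\<ge>N. \<forall>n\<ge>N. ip_norm ip (\<lambda>w. X m w - X n w) < e" for X
  proof -
    have "\<forall>n. \<exists>f. f \<in> L2 (M T) \<and> X n = dirac_transform T f" using X unfolding S by blast
    from choice[OF this] obtain f where f: "\<And>n. f n \<in> L2 (M T)" "\<And>n. X n = dirac_transform T (f n)" by blast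
    obtain y where y: "y \<in> L2 (M T)" "(\<lambda>n. (LINT x|M T. (norm (A (f n) x - y x))\<^sup>2)) \<longlonglongrightarrow> 0"
    proof (rule L2_complete[of "M T" "\<lambda>n. A (f n)"])
      show "finite_measure (M T)" unfolding M_def by (rule finite_measure_interval)
      fix e :: real assume "e > 0"
      then have "\<exists>N. \<forall>m\<ge>N. \<forall>n\<ge>N. ip_norm ip (\<lambda>w. X m w - X n w) < sqrt e" by (intro cau) simp
      then show "\<exists>N. \<forall>m\<ge>N. \<forall>n\<ge>N. (LINT x|M T. (norm (A (f m) x - A (f n) x))\<^sup>2) < e"
        unfolding f(2) norm_diff[OF f(1) f(1)] real_sqrt_less_iff .
    qed (rule AL[OF f(1)], rule that)
    obtain g where g: "g \<in> L2 (M T)" "\<forall>x\<in>{0<..<T}. A g x = y x" using surj[OF y(1)] by blast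
    have "(LINT x|M T. (norm (A (f n) x - A g x))\<^sup>2) = (LINT x|M T. (norm (A (f n) x - y x))\<^sup>2)" for n
      by (rule Bochner_Integration.integral_cong) (use g(2) in \<open>auto simp: M_def\<close>)
    then have "(\<lambda>n. ip_norm ip (\<lambda>w. X n w - dirac_transform T g w)) \<longlonglongrightarrow> 0"
      unfolding f(2) norm_diff[OF f(1) g(1)] using tendsto_real_sqrt[OF y(2)] by simp
    moreover have "dirac_transform T g \<in> ?S" unfolding S using g(1) by blast
    ultimately show ?thesis by blast
  qed
  have sym: "ip G F = cnj (ip F G)" if "F \<in> ?S" "G \<in> ?S" for F G
  proof -
    obtain f g where "f \<in> L2 (M T)" "F = dirac_transform T f" "g \<in> L2 (M T)" "G = dirac_transform T g"
      using \<open>F \<in> ?S\<close> \<open>G \<in> ?S\<close> unfolding S by blast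
    then show ?thesis by (simp add: ip L2_inner_cnj[of _ "A g"])
  qed
  have pos: "0 < Re (ip F F)" if "F \<in> ?S" "F \<noteq> (\<lambda>_. 0)" for F
  proof -
    obtain f where f: "f \<in> L2 (M T)" "F = dirac_transform T f" using \<open>F \<in> ?S\<close> unfolding S by blast
    have "(LINT x|M T. (norm (A f x))\<^sup>2) \<noteq> 0"
      using L2_AE_eq_iff[OF AL[OF f(1)] L2_zero] inj[OF f(1)] that(2) f(2) by auto
    moreover have "(LINT x|M T. (norm (A f x))\<^sup>2) \<ge> 0" by simp
    ultimately have "(LINT x|M T. (norm (A f x))\<^sup>2) > 0" by (simp only: less_le not_sym simp_thms)
    then show ?thesis by (simp add: f(2) self[OF f(1)])
  qed
  show ?thesis unfolding hilbert_function_space_def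
  proof (intro conjI allI ballI impI)
    show "(\<lambda>w. F w + G w) \<in> ?S" if "F \<in> ?S" "G \<in> ?S" for F G using lc[OF that, of 1] by simp
    show "(\<lambda>w. c * F w) \<in> ?S" if "F \<in> ?S" for F c using lc[OF that zero, of c] by simp
    show "ip F (\<lambda>w. G w + H w) = ip F G + ip F H" if "F \<in> ?S" "G \<in> ?S" "H \<in> ?S" for F G H
      using iplc[OF that(2,3,1), of 1] by simp
    show "ip F (\<lambda>w. c * G w) = c * ip F G" if "F \<in> ?S" "G \<in> ?S" for F G c
      using iplc[OF that(2) zero that(1), of c] ip0[OF that(1)] by simp
    show "\<exists>F\<in>?S. (\<lambda>n. ip_norm ip (\<lambda>w. X n w - F w)) \<longlonglongrightarrow> 0"
      if "(\<forall>n. X n \<in> ?S) \<and> (\<forall>e>0. \<exists>N. \<forall>m\<ge>N. \<forall>n\<ge>N. ip_norm ip (\<lambda>w. X m w - X n w) < e)" for X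
      using that by (intro complete) auto
  qed (rule zero sym pos; assumption)+
qed

text \<open>The transform identifies \<open>L\<^sub>2\<close> modulo equality almost everywhere with a Hilbert space of
  functions, to which the representation theorem for the latter applies.\<close>

lemma L2_riesz:
  fixes \<Phi> :: "(real \<Rightarrow> complex^2) \<Rightarrow> complex"
  assumes T: "T > 0"
    and lin: "\<And>f g c. f \<in> L2 (lborel_on {0<..<T}) \<Longrightarrow> g \<in> L2 (lborel_on {0<..<T}) \<Longrightarrow> \<Phi> (\<lambda>s. c *s f s + g s) = c * \<Phi> f + \<Phi> g"
    and bound: "\<And>f. f \<in> L2 (lborel_on {0<..<T}) \<Longrightarrow> cmod (\<Phi> f) \<le> C * sqrt (LINT s|lborel_on {0<..<T}. (norm (f s))\<^sup>2)"
  obtains h where "h \<in> L2 (lborel_on {0<..<T})" "\<And>g. g \<in> L2 (lborel_on {0<..<T}) \<Longrightarrow> L2_inner (lborel_on {0<..<T}) h g = \<Phi> g"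
proof -
  let ?M = "lborel_on {0<..<T}" and ?S = "dirac_space T" and ?t = "dirac_transform T"
  \<comment> \<open>Representatives agree almost everywhere by injectivity of the transform, so the
    chosen one may be replaced by any other under \<open>L2_inner\<close> and
    \<open>\<Phi>\<close>.\<close>
  define rep where "rep F = (SOME f. f \<in> L2 ?M \<and> ?t f = F)" for F
  have rep: "rep (?t f) \<in> L2 ?M" "?t (rep (?t f)) = ?t f" if "f \<in> L2 ?M" for f
    using someI[of "\<lambda>g. g \<in> L2 ?M \<and> ?t g = ?t f" f] that unfolding rep_def by blast+
  have repAE: "AE s in ?M. rep (?t f) s = f s" if "f \<in> L2 ?M" for f
    by (rule dirac_transform_inj[OF rep(1)[OF that] that T rep(2)[OF that]])
  have \<Phi>0: "\<Phi> f = \<Phi> g" if f: "f \<in> L2 ?M" and g: "g \<in> L2 ?M" and "AE s in ?M. f s = g s" for f g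
  proof -
    have "(LINT s|?M. (norm ((-1) *s g s + f s))\<^sup>2) = 0"
      by (rule integral_eq_zero_AE, use that(3) in eventually_elim) (simp add: vec_eq_iff)
    then have "\<Phi> (\<lambda>s. (-1) *s g s + f s) = 0" using bound[OF L2_lincomb[OF g f, of "-1"]] by simp
    then show ?thesis using lin[OF g f, of "-1"] by simp
  qed
  define ip where "ip F G = L2_inner ?M (rep F) (rep G)" for F G
  have ip: "ip (?t f) (?t g) = L2_inner ?M f g" if "f \<in> L2 ?M" "g \<in> L2 ?M" for f g
    unfolding ip_def by (intro L2_inner_cong_AE rep repAE that)
  have H: "hilbert_function_space ?S ip"
  proof (rule dirac_space_hilbert[where A = "\<lambda>f. f", OF T])
    fix f :: "real \<Rightarrow> complex^2" assume f: "f \<in> L2 ?M" and z: "AE x in ?M. f x = 0"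
    show "?t f = (\<lambda>_. 0)"
    proof
      fix l
      have "(LINT s|?M. cdot (dirac_row T l s) (f s)) = 0"
        by (rule integral_eq_zero_AE, use z in eventually_elim) (simp add: cdot_def)
      then show "?t f l = 0" by (simp add: dirac_transform_eq_cdot)
    qed
  qed (use ip in auto)
  interpret function_hilbert_space ?S ip by (rule function_hilbert_space.intro[OF H])
  have S: "F \<in> ?S \<longleftrightarrow> (\<exists>f\<in>L2 ?M. F = ?t f)" for F by (rule dirac_space_iff[OF T])
  define \<phi> where "\<phi> F = \<Phi> (rep F)" for F
  have \<phi>: "\<phi> (?t f) = \<Phi> f" if "f \<in> L2 ?M" for f unfolding \<phi>_def by (intro \<Phi>0 rep repAE that)
  have \<phi>lin: "\<phi> (\<lambda>w. c * F w + G w) = c * \<phi> F + \<phi> G" if "F \<in> ?S" "G \<in> ?S" for c F G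
  proof -
    obtain f g where f: "f \<in> L2 ?M" "F = ?t f" and g: "g \<in> L2 ?M" "G = ?t g" using \<open>F \<in> ?S\<close> \<open>G \<in> ?S\<close> unfolding S by blast
    show ?thesis unfolding f(2) g(2) dirac_transform_lincomb[OF f(1) g(1), symmetric]
      by (simp only: \<phi>[OF f(1)] \<phi>[OF g(1)] \<phi>[OF L2_lincomb[OF f(1) g(1)]] lin[OF f(1) g(1)])
  qed
  have \<phi>z: "\<phi> (\<lambda>_. 0) = 0" using \<phi>lin[OF zero_mem zero_mem, of 1] by simp
  obtain F0 where F0: "F0 \<in> ?S" "\<And>F. F \<in> ?S \<Longrightarrow> ip F0 F = \<phi> F"
  proof (rule riesz_on_subspace[of ?S \<phi> C])
    show "cmod (\<phi> F) \<le> C * ip_norm ip F" if "F \<in> ?S" for F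
    proof -
      obtain f where f: "f \<in> L2 ?M" "F = ?t f" using \<open>F \<in> ?S\<close> unfolding S by blast
      show ?thesis unfolding f(2) \<phi>[OF f(1)] ip_norm_def ip[OF f(1) f(1)] L2_inner_self using bound[OF f(1)] by simp
    qed
    show "\<phi> (\<lambda>w. F w + G w) = \<phi> F + \<phi> G" if "F \<in> ?S" "G \<in> ?S" for F G using \<phi>lin[OF that, of 1] by simp
    show "\<phi> (\<lambda>w. c * F w) = c * \<phi> F" if "F \<in> ?S" for F c using \<phi>lin[OF that zero_mem, of c] \<phi>z by simp
  qed (assumption | rule subset_refl zero_mem add_mem scale_mem that)+
  obtain h where h: "h \<in> L2 ?M" "F0 = ?t h" using F0(1) unfolding S by blast
  show ?thesis
  proof (rule that[OF h(1)])
    fix g :: "real \<Rightarrow> complex^2" assume g: "g \<in> L2 ?M"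
    have "?t g \<in> ?S" unfolding S using g by blast
    from F0(2)[OF this] show "L2_inner ?M h g = \<Phi> g" unfolding h(2) ip[OF h(1) g] \<phi>[OF g] .
  qed
qed

lemma (in function_hilbert_space) kernel_unique:
  assumes K: "K \<in> S" "\<And>F. F \<in> S \<Longrightarrow> ip K F = F z" and L: "L \<in> S" "\<And>F. F \<in> S \<Longrightarrow> ip L F = F z"
  shows "K = L"
proof -
  note D = diff_mem[OF K(1) L(1)]
  have "ip (\<lambda>w. K w - L w) (\<lambda>w. K w - L w) = 0"
    by (simp add: ip_diff_left[OF D K(1) L(1)] K(2)[OF D] L(2)[OF D])
  then have "(\<lambda>w. K w - L w) = (\<lambda>_. 0)" using ip_pos[OF D] by auto
  then show ?thesis by (simp add: fun_eq_iff)
qed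

section \<open>Connecting operator, reproducing kernel and Hermite-Biehler function\<close>

context dirac_kernels
begin

abbreviation M :: "real measure" where "M \<equiv> lborel_on {0<..<T}"

text \<open>A consequence of linearity and boundedness; needed because \<open>dirac_inner\<close>
  ranges over all representatives of its arguments.\<close>

lemma control_map_cong_AE:
  assumes f: "f \<in> L2 M" and g: "g \<in> L2 M" and eq: "AE s in M. f s = g s"
  shows "AE x in M. control_map f x = control_map g x"
proof -
  obtain C where C: "\<And>f. f \<in> L2 M \<Longrightarrow> (LINT x|M. (norm (control_map f x))\<^sup>2) \<le> C * (LINT x|M. (norm (f x))\<^sup>2)"
    by (rule control_map_L2) (rule that)
  have d: "(-1) *s v + u = u - v" for u v :: "complex^2" by (simp add: vec_eq_iff)
  have "(LINT x|M. (norm (control_map f x - control_map g x))\<^sup>2) = (LINT x|M. (norm (control_map (\<lambda>s. (-1) *s g s + f s) x))\<^sup>2)"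
  proof (rule Bochner_Integration.integral_cong[OF refl])
    fix x assume "x \<in> space M"
    then have x: "x \<in> {0<..<T}" by simp
    show "(norm (control_map f x - control_map g x))\<^sup>2 = (norm (control_map (\<lambda>s. (-1) *s g s + f s) x))\<^sup>2" unfolding control_map_linear[OF g f x] unfolding d ..
  qed
  also have "\<dots> \<le> C * (LINT x|M. (norm ((-1) *s g x + f x))\<^sup>2)" by (rule C[OF L2_lincomb[OF g f]])
  also have "(LINT x|M. (norm ((-1) *s g x + f x))\<^sup>2) = 0" using L2_AE_eq_iff[OF f g] eq by (simp only: d)
  finally have "(LINT x|M. (norm (control_map f x - control_map g x))\<^sup>2) \<le> 0" by simp
  moreover have "(LINT x|M. (norm (control_map f x - control_map g x))\<^sup>2) \<ge> 0" by simp
  ultimately have "(LINT x|M. (norm (control_map f x - control_map g x))\<^sup>2) = 0" by (rule order_antisym)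
  then show ?thesis using L2_AE_eq_iff[OF control_map_in_L2[OF f] control_map_in_L2[OF g]] by blast
qed

lemma control_map_lincomb: "f \<in> L2 M \<Longrightarrow> g \<in> L2 M \<Longrightarrow> h \<in> L2 M \<Longrightarrow>
    L2_inner M h (control_map (\<lambda>s. c *s f s + g s)) = c * L2_inner M h (control_map f) + L2_inner M h (control_map g)"
  using L2_inner_cong[of M h h "control_map (\<lambda>s. c *s f s + g s)" "\<lambda>x. c *s control_map f x + control_map g x"] control_map_linear[of f g]
    L2_inner_lincomb[OF control_map_in_L2[of f] control_map_in_L2[of g], of h c] by simp

lemma generalized_solution_L2:
  "generalized_solution \<sigma> p q T f u \<Longrightarrow> t \<in> {0..T} \<Longrightarrow> (\<lambda>x. u x t) \<in> L2 (lborel_on {0<..})"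
  unfolding generalized_solution_def L2_tendsto_def by blast

lemma control_operator_L2:
  assumes f: "f \<in> L2 M"
  shows "control_operator p q T f \<in> L2 M"
proof -
  have T0: "T \<in> {0..T}" using T by simp
  note G = generalized_solution_dirac_solution[OF L2_component[OF f]]
  show ?thesis unfolding control_operator_def
    by (rule L2_add(1)[OF L2_restrict(1)[OF generalized_solution_L2[OF G(1) T0]] L2_restrict(1)[OF generalized_solution_L2[OF G(2) T0]]])
qed

text \<open>Riesz representation supplies a candidate for the adjoint, so the choice in
  \<open>L2_adjoint\<close> is not vacuous. It is applied to \<open>control_map\<close>, since
  \<open>control_operator\<close> is known to be linear only up to null sets; the two have the same
  scalar products.\<close>

lemma connecting_operator:
  assumes f: "f \<in> L2 M"
  shows "connecting_operator p q T f \<in> L2 M"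
    and "g \<in> L2 M \<Longrightarrow> L2_inner M (connecting_operator p q T f) g = L2_inner M (control_map f) (control_map g)"
proof -
  obtain C where C: "C \<ge> 0" "\<And>f. f \<in> L2 M \<Longrightarrow> (LINT x|M. (norm (control_map f x))\<^sup>2) \<le> C * (LINT x|M. (norm (f x))\<^sup>2)"
    by (rule control_map_L2) (rule that)
  note Wf = control_map_in_L2[OF f]
  let ?N = "sqrt (LINT x|M. (norm (control_map f x))\<^sup>2)"
  obtain h where h: "h \<in> L2 M" "\<And>g. g \<in> L2 M \<Longrightarrow> L2_inner M h g = L2_inner M (control_map f) (control_map g)"
  proof (rule L2_riesz[OF T, of "\<lambda>g. L2_inner M (control_map f) (control_map g)" "?N * sqrt C"])
    show "L2_inner M (control_map f) (control_map (\<lambda>s. c *s g s + h s)) = c * L2_inner M (control_map f) (control_map g) + L2_inner M (control_map f) (control_map h)"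
      if "g \<in> L2 M" "h \<in> L2 M" for g h c by (rule control_map_lincomb[OF that Wf])
    show "cmod (L2_inner M (control_map f) (control_map g)) \<le> ?N * sqrt C * sqrt (LINT s|M. (norm (g s))\<^sup>2)" if g: "g \<in> L2 M" for g
    proof -
      have "cmod (L2_inner M (control_map f) (control_map g)) \<le> ?N * sqrt (LINT x|M. (norm (control_map g x))\<^sup>2)"
        by (rule L2_inner_cauchy_schwarz[OF Wf control_map_in_L2[OF g]])
      also have "\<dots> \<le> ?N * (sqrt C * sqrt (LINT s|M. (norm (g s))\<^sup>2))"
        unfolding real_sqrt_mult[of C, symmetric] by (intro mult_left_mono real_sqrt_le_mono C(2)[OF g]) simp
      finally show ?thesis by (simp only: mult.assoc)
    qed
  qed (rule that)
  have c: "L2_inner M (control_operator p q T f) (control_operator p q T g) = L2_inner M (control_map f) (control_map g)" if "g \<in> L2 M" for g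
    by (intro L2_inner_cong_AE control_operator_L2 control_map_in_L2 control_operator_eq f that)
  let ?P = "\<lambda>h. h \<in> L2 M \<and> (\<forall>g\<in>L2 M. L2_inner M h g = L2_inner M (control_operator p q T f) (control_operator p q T g))"
  have "?P h" using h c by simp
  then have "?P (connecting_operator p q T f)"
    unfolding connecting_operator_def L2_adjoint_def by (rule someI[where P = ?P])
  then show "connecting_operator p q T f \<in> L2 M"
    and "g \<in> L2 M \<Longrightarrow> L2_inner M (connecting_operator p q T f) g = L2_inner M (control_map f) (control_map g)" using c by simp_all
qed

text \<open>The definite description is justified because representatives of the same function agree
  almost everywhere, by injectivity of the transform, and the control map respects this.\<close>

lemma dirac_inner_eq:
  assumes f: "f \<in> L2 M" and g: "g \<in> L2 M"
  shows "dirac_inner p q T (dirac_transform T f) (dirac_transform T g) = L2_inner M (control_map f) (control_map g)"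
  unfolding dirac_inner_def
proof (rule the_equality)
  show "\<exists>f'\<in>L2 M. \<exists>g'\<in>L2 M. dirac_transform T f' = dirac_transform T f \<and> dirac_transform T g' = dirac_transform T g \<and>
      L2_inner M (control_map f) (control_map g) = L2_inner M (connecting_operator p q T f') g'"
    by (rule bexI[OF _ f], rule bexI[OF _ g]) (simp add: connecting_operator(2)[OF f g])
  fix c assume "\<exists>f'\<in>L2 M. \<exists>g'\<in>L2 M. dirac_transform T f' = dirac_transform T f \<and> dirac_transform T g' = dirac_transform T g \<and>
      c = L2_inner M (connecting_operator p q T f') g'"
  then obtain f' g' where f': "f' \<in> L2 M" "dirac_transform T f' = dirac_transform T f"
    and g': "g' \<in> L2 M" "dirac_transform T g' = dirac_transform T g" and c: "c = L2_inner M (connecting_operator p q T f') g'"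
    by blast
  show "c = L2_inner M (control_map f) (control_map g)"
    unfolding c connecting_operator(2)[OF f'(1) g'(1)]
    by (intro L2_inner_cong_AE control_map_in_L2 control_map_cong_AE dirac_transform_inj[OF f'(1) f T f'(2)] dirac_transform_inj[OF g'(1) g T g'(2)] f g f'(1) g'(1))
qed

text \<open>Definiteness rests on the pairing formula: a control with vanishing image has vanishing
  transform. Completeness rests on surjectivity of the control map.\<close>

lemma dirac_space_hilbert_inner: "hilbert_function_space (dirac_space T) (dirac_inner p q T)"
proof (rule dirac_space_hilbert[where A = control_map, OF T])
  fix f assume f: "f \<in> L2 M" and z: "AE x in M. control_map f x = 0"
  show "dirac_transform T f = (\<lambda>_. 0)"
  proof
    fix l
    show "dirac_transform T f l = 0"
      unfolding dirac_transform_eq_pairing[OF f]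
      by (rule integral_eq_zero_AE, use z in eventually_elim) (simp add: cdot_def)
  qed
next
  fix y :: "real \<Rightarrow> complex^2" assume "y \<in> L2 M"
  then show "\<exists>f\<in>L2 M. \<forall>x\<in>{0<..<T}. control_map f x = y x" by (rule control_map_surj) blast
qed (rule control_map_in_L2 control_map_linear dirac_inner_eq; assumption)+

definition kernel_control :: "complex \<Rightarrow> real \<Rightarrow> complex^2" where
  "kernel_control z = (SOME f. f \<in> L2 M \<and> (\<forall>x\<in>{0<..<T}. control_map f x = \<theta> x (cnj z)))"

lemma kernel_control: "kernel_control z \<in> L2 M" "x \<in> {0<..<T} \<Longrightarrow> control_map (kernel_control z) x = \<theta> x (cnj z)"
proof -
  have "\<exists>f. f \<in> L2 M \<and> (\<forall>x\<in>{0<..<T}. control_map f x = \<theta> x (cnj z))" by (rule control_map_surj[OF \<theta>_L2[of "cnj z"]]) blast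
  from someI_ex[OF this] show "kernel_control z \<in> L2 M" "x \<in> {0<..<T} \<Longrightarrow> control_map (kernel_control z) x = \<theta> x (cnj z)" by (simp_all add: kernel_control_def)
qed

lemma L2_inner_kernel_control:
  assumes f: "f \<in> L2 M"
  shows "L2_inner M (control_map (kernel_control z)) (control_map f) = dirac_transform T f z"
proof -
  have "L2_inner M (control_map (kernel_control z)) (control_map f) = L2_inner M (\<lambda>x. \<theta> x (cnj z)) (control_map f)" by (rule L2_inner_cong) (simp_all add: kernel_control(2))
  then show ?thesis
    unfolding dirac_transform_eq_pairing[OF f] L2_inner_eq cnj_vec_\<theta> by (simp add: cdot_commute)
qed

definition repr_kernel :: "complex \<Rightarrow> complex \<Rightarrow> complex" where "repr_kernel z = dirac_transform T (kernel_control z)"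

lemma repr_kernel_mem: "repr_kernel z \<in> dirac_space T"
  unfolding dirac_space_iff[OF T] repr_kernel_def using kernel_control(1) by blast

lemma repr_kernel_reproducing: "F \<in> dirac_space T \<Longrightarrow> dirac_inner p q T (repr_kernel z) F = F z"
  unfolding dirac_space_iff[OF T] repr_kernel_def using dirac_inner_eq[OF kernel_control(1)] L2_inner_kernel_control by auto

lemma repr_kernel_eq_integral: "repr_kernel z l = integral {0..T} (\<lambda>x. cdot (\<theta> x (cnj z)) (\<theta> x l))"
proof -
  let ?h = "\<lambda>x. cdot (\<theta> x (cnj z)) (\<theta> x l)"
  have "repr_kernel z l = (LINT x|M. ?h x)"
    unfolding repr_kernel_def dirac_transform_eq_pairing[OF kernel_control(1)] by (rule Bochner_Integration.integral_cong) (simp_all add: kernel_control(2))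
  also have "\<dots> = integral {0..T} ?h"
    by (rule lebesgue_integral_open_interval) (unfold cdot_def, intro continuous_intros continuous_on_component \<theta>_cont)
  finally show ?thesis .
qed

lemma repr_kernel_eq: "(l - cnj z) * repr_kernel z l = \<i> / 2 * (\<phi> T l * cnj (\<phi> T z) - sharp (\<phi> T) l * \<phi> T (cnj z))"
proof -
  let ?w = "cnj z"
  \<comment> \<open>The boundary form of the Lagrange identity, now for two spectral solutions. At 0
    it vanishes because the initial value does not depend on the spectral parameter.\<close>
  define Q where "Q x = \<theta> x l $ 2 * \<theta> x ?w $ 1 - \<theta> x l $ 1 * \<theta> x ?w $ 2" for x
  have "(Q has_vector_derivative (l - ?w) * cdot (\<theta> x ?w) (\<theta> x l)) (at x within {0..T})" if x: "x \<in> {0..T}" for x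
  proof -
    have x0: "x \<ge> 0" using x by simp
    have "(Q has_vector_derivative
        ((\<theta> x l $ 2 * (of_real (q x) * \<theta> x ?w $ 1 - (?w + of_real (p x)) * \<theta> x ?w $ 2)
          + ((l - of_real (p x)) * \<theta> x l $ 1 - of_real (q x) * \<theta> x l $ 2) * \<theta> x ?w $ 1)
        - (\<theta> x l $ 1 * ((?w - of_real (p x)) * \<theta> x ?w $ 1 - of_real (q x) * \<theta> x ?w $ 2)
          + (of_real (q x) * \<theta> x l $ 1 - (l + of_real (p x)) * \<theta> x l $ 2) * \<theta> x ?w $ 2))) (at x)"
      unfolding Q_def
      by (rule has_vector_derivative_diff[OF has_vector_derivative_mult[OF \<theta>_deriv(2)[OF x0] \<theta>_deriv(1)[OF x0]]
            has_vector_derivative_mult[OF \<theta>_deriv(1)[OF x0] \<theta>_deriv(2)[OF x0]]])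
    also have "(\<theta> x l $ 2 * (of_real (q x) * \<theta> x ?w $ 1 - (?w + of_real (p x)) * \<theta> x ?w $ 2)
          + ((l - of_real (p x)) * \<theta> x l $ 1 - of_real (q x) * \<theta> x l $ 2) * \<theta> x ?w $ 1)
        - (\<theta> x l $ 1 * ((?w - of_real (p x)) * \<theta> x ?w $ 1 - of_real (q x) * \<theta> x ?w $ 2)
          + (of_real (q x) * \<theta> x l $ 1 - (l + of_real (p x)) * \<theta> x l $ 2) * \<theta> x ?w $ 2)
        = (l - ?w) * cdot (\<theta> x ?w) (\<theta> x l)" unfolding cdot_def by (simp add: algebra_simps)
    finally show ?thesis by (rule has_vector_derivative_at_within)
  qed
  then have "((\<lambda>x. (l - ?w) * cdot (\<theta> x ?w) (\<theta> x l)) has_integral Q T - Q 0) {0..T}"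
    using T by (intro fundamental_theorem_of_calculus) auto
  then have "(l - ?w) * repr_kernel z l = Q T - Q 0" 
    unfolding repr_kernel_eq_integral integral_mult_right[symmetric] by (rule integral_unique)
  also have "\<dots> = \<i> / 2 * (\<phi> T l * cnj (\<phi> T z) - sharp (\<phi> T) l * \<phi> T ?w)"
  proof -
    \<comment> \<open>\<open>A\<close> and \<open>B\<close> stand for \<open>\<phi> T\<close> and
      its reflection at \<open>l\<close>, \<open>C\<close> and \<open>D\<close> for the same at
      \<open>cnj z\<close>.\<close>
    have "\<i> * (A - B) / 2 * ((C + D) / 2) - (A + B) / 2 * (\<i> * (C - D) / 2) = \<i> / 2 * (A * D - B * C)" for A B C D :: complex
      by (simp add: field_simps)
    moreover have "Q 0 = 0" unfolding Q_def \<theta>_zero by simp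
    ultimately show ?thesis unfolding Q_def \<theta>_def from_riemann_def sharp_def vector_2 complex_cnj_cnj by simp
  qed
  finally show ?thesis .
qed

text \<open>On the diagonal the kernel is the squared norm of \<open>\<theta>\<close>, which is
  nonzero because the continuous function \<open>\<theta>\<close> starts at (0, 1).\<close>

lemma repr_kernel_pos: obtains N where "N > 0" "repr_kernel z z = complex_of_real N"
proof -
  let ?f = "\<lambda>x. (norm (\<theta> x z))\<^sup>2"
  have c: "continuous_on {0..T} ?f" by (intro continuous_intros \<theta>_cont)
  have K: "repr_kernel z z = complex_of_real (integral {0..T} ?f)"
  proof -
    have "repr_kernel z z = integral {0..T} (\<lambda>x. complex_of_real (?f x))"
      unfolding repr_kernel_eq_integral cnj_vec_\<theta>[symmetric] cdot_cnj_vec_self ..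
    also have "\<dots> = complex_of_real (integral {0..T} ?f)"
      by (rule integral_unique, rule has_integral_of_real, rule integrable_integral, rule integrable_continuous_interval[OF c])
    finally show ?thesis .
  qed
  have "integral {0..T} ?f \<noteq> 0"
  proof
    assume "integral {0..T} ?f = 0"
    then have i: "(?f has_integral 0) (cbox 0 T)"
      using integrable_integral[OF integrable_continuous_interval[OF c]] by simp
    have "?f 0 = 0"
      by (rule has_integral_0_cbox_imp_0[OF _ _ i]) (use c T in \<open>auto simp: box_real\<close>)
    then show False using \<theta>_zero(2)[of z] by simp
  qed
  moreover have "integral {0..T} ?f \<ge> 0" by (rule integral_nonneg[OF integrable_continuous_interval[OF c]]) simp
  ultimately show ?thesis using K by (intro that[of "integral {0..T} ?f"]) simp_all
qed

text \<open>At a real zero of \<open>\<phi> T\<close> the kernel would vanish off the diagonal, hence on it by continuity.\<close>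

lemma hermite_biehler_phi: "hermite_biehler_function (\<phi> T)"
proof
  \<comment> \<open>The kernel identity at \<open>l = z\<close> equates \<open>2 * Im z\<close>
    times the positive diagonal value with half the difference of the squared moduli.\<close>
  have gt: "cmod (\<phi> T (cnj z)) < cmod (\<phi> T z)" if z: "Im z > 0" for z
  proof -
    obtain N where N: "N > 0" "repr_kernel z z = complex_of_real N" by (rule repr_kernel_pos)
    have "(z - cnj z) * of_real N = \<i> / 2 * (\<phi> T z * cnj (\<phi> T z) - \<phi> T (cnj z) * cnj (\<phi> T (cnj z)))"
      using repr_kernel_eq[of z z] unfolding N(2) sharp_def by (simp add: mult.commute)
    also have "\<dots> = \<i> / 2 * complex_of_real ((cmod (\<phi> T z))\<^sup>2 - (cmod (\<phi> T (cnj z)))\<^sup>2)"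
      unfolding complex_norm_square[symmetric] of_real_diff ..
    finally have "Im ((z - cnj z) * of_real N) = Im (\<i> / 2 * complex_of_real ((cmod (\<phi> T z))\<^sup>2 - (cmod (\<phi> T (cnj z)))\<^sup>2))"
      by (rule arg_cong)
    then have "2 * Im z * N = ((cmod (\<phi> T z))\<^sup>2 - (cmod (\<phi> T (cnj z)))\<^sup>2) / 2" by simp
    moreover have "2 * Im z * N > 0" using z N(1) by simp
    ultimately have "((cmod (\<phi> T z))\<^sup>2 - (cmod (\<phi> T (cnj z)))\<^sup>2) / 2 > 0" by (simp only:)
    then have "(cmod (\<phi> T (cnj z)))\<^sup>2 < (cmod (\<phi> T z))\<^sup>2" by simp
    then show ?thesis by (rule power_less_imp_less_base) simp
  qed
  show "hermite_biehler (\<phi> T)" unfolding hermite_biehler_def using gt \<phi>_hol by blast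
  fix z assume z: "Im z \<ge> 0"
  show "\<phi> T z \<noteq> 0"
  proof
    assume E: "\<phi> T z = 0"
    then have "\<not> Im z > 0" using gt[of z] by auto
    then have cz: "cnj z = z" using z by (simp add: complex_eq_iff)
    have 0: "repr_kernel z l = 0" if "l \<noteq> z" for l using repr_kernel_eq[of l z] that by (simp add: cz E)
    have "repr_kernel z holomorphic_on UNIV" unfolding repr_kernel_def by (rule dirac_transform_holomorphic[OF kernel_control(1) T])
    then have "continuous_on UNIV (repr_kernel z)" by (rule holomorphic_on_imp_continuous_on)
    then have "isCont (repr_kernel z) z" by (simp add: continuous_on_eq_continuous_at)
    then have "repr_kernel z \<midarrow>z\<rightarrow> repr_kernel z z" by (simp add: isCont_def)
    moreover have "repr_kernel z \<midarrow>z\<rightarrow> 0"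
      by (rule tendsto_eventually) (simp add: eventually_at_filter 0)
    ultimately have "repr_kernel z z = 0" by (rule LIM_unique)
    moreover obtain N where "N > 0" "repr_kernel z z = complex_of_real N" by (rule repr_kernel_pos)
    ultimately show False by simp
  qed
qed

text \<open>The equation says that pairing with the image of \<open>j\<close> under the connecting
  operator is evaluation of the transform at \<open>z\<close>. By the adjoint relation this is the
  reproducing property of the transform of \<open>j\<close>.\<close>

lemma solves_kernel_equation_iff:
  "solves_kernel_equation p q T z j \<longleftrightarrow> j \<in> L2 M \<and> dirac_transform T j = repr_kernel z"
proof -
  interpret function_hilbert_space "dirac_space T" "dirac_inner p q T"
    by (rule function_hilbert_space.intro[OF dirac_space_hilbert_inner])
  have row: "(\<lambda>s. cnj_vec (dirac_row T z s)) \<in> L2 M" by (rule L2_cnj_vec[OF dirac_row_L2])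
  have rt: "L2_inner M (\<lambda>s. cnj_vec (dirac_row T z s)) g = dirac_transform T g z" for g
    by (simp add: L2_inner_eq dirac_transform_eq_cdot)
  have s: "solves_kernel_equation p q T z j \<longleftrightarrow> j \<in> L2 M \<and> (AE s in M. connecting_operator p q T j s = cnj_vec (dirac_row T z s))"
    unfolding solves_kernel_equation_def by (simp add: vec_eq_iff cnj_vec_def)
  show ?thesis unfolding s
  proof (intro conj_cong refl iffI)
    assume j: "j \<in> L2 M"
    note Cj = connecting_operator(1)[OF j]
    show "dirac_transform T j = repr_kernel z" if eq: "AE s in M. connecting_operator p q T j s = cnj_vec (dirac_row T z s)"
    proof -
      have F: "dirac_transform T j \<in> dirac_space T" unfolding dirac_space_iff[OF T] using j by blast
      have "dirac_inner p q T (dirac_transform T j) G = G z" if "G \<in> dirac_space T" for G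
      proof -
        obtain g where g: "g \<in> L2 M" "G = dirac_transform T g" using \<open>G \<in> dirac_space T\<close> unfolding dirac_space_iff[OF T] by blast
        have "L2_inner M (connecting_operator p q T j) g = L2_inner M (\<lambda>s. cnj_vec (dirac_row T z s)) g"
          by (rule L2_inner_cong_AE[OF Cj g(1) row g(1) eq]) simp
        then show ?thesis unfolding g(2) dirac_inner_eq[OF j g(1)] connecting_operator(2)[OF j g(1)] rt .
      qed
      then show ?thesis by (rule kernel_unique[OF F _ repr_kernel_mem repr_kernel_reproducing])
    qed
    assume eq: "dirac_transform T j = repr_kernel z"
    \<comment> \<open>Conversely, the defect of the equation is tested against itself: both scalar
      products equal the value at \<open>z\<close> of the transform of the defect, so its norm is
      0.\<close>
    let ?d = "\<lambda>s. connecting_operator p q T j s - cnj_vec (dirac_row T z s)"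
    have d: "?d \<in> L2 M" by (rule L2_diff(1)[OF Cj row])
    have "AE s in M. j s = kernel_control z s" by (rule dirac_transform_inj[OF j kernel_control(1) T eq[unfolded repr_kernel_def]])
    then have W: "AE s in M. control_map j s = control_map (kernel_control z) s" by (rule control_map_cong_AE[OF j kernel_control(1)])
    have "L2_inner M ?d ?d = L2_inner M (connecting_operator p q T j) ?d - L2_inner M (\<lambda>s. cnj_vec (dirac_row T z s)) ?d"
    proof -
      have "cdot (cnj_vec (?d s)) (?d s) = cdot (cnj_vec (connecting_operator p q T j s)) (?d s) - cdot (cnj_vec (cnj_vec (dirac_row T z s))) (?d s)" for s
        unfolding linear_diff[OF bounded_linear.linear[OF bounded_linear_cnj_vec]] cdot_linear(3) ..
      then show ?thesis unfolding L2_inner_eq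
        by (simp only:) (intro Bochner_Integration.integral_diff cdot_integrable(1) L2_cnj_vec d Cj dirac_row_L2)
    qed
    also have "L2_inner M (connecting_operator p q T j) ?d = L2_inner M (control_map (kernel_control z)) (control_map ?d)"
      unfolding connecting_operator(2)[OF j d]
      by (rule L2_inner_cong_AE[OF control_map_in_L2[OF j] control_map_in_L2[OF d] control_map_in_L2[OF kernel_control(1)] control_map_in_L2[OF d] W]) simp
    also have "\<dots> = L2_inner M (\<lambda>s. cnj_vec (dirac_row T z s)) ?d" unfolding rt by (rule L2_inner_kernel_control[OF d])
    finally have "(LINT s|M. (norm (?d s))\<^sup>2) = 0" unfolding L2_inner_self by simp
    then show "AE s in M. connecting_operator p q T j s = cnj_vec (dirac_row T z s)" using L2_AE_eq_iff[OF Cj row] by blast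
  qed
qed

end

theorem mainTheorem2:
  fixes p q :: "real \<Rightarrow> real" and T :: real
  assumes "C1_half_line p" and "C1_half_line q" and "T > 0"
  shows "hilbert_function_space (dirac_space T) (dirac_inner p q T) \<and>
    (\<exists>E. hermite_biehler E \<and> dirac_space T = de_Branges_space E \<and>
       (\<forall>F\<in>dirac_space T. ip_norm (dirac_inner p q T) F = ip_norm (de_Branges_inner E) F)) \<and>
    (\<forall>z. \<exists>j. solves_kernel_equation p q T z j \<and>
       (\<forall>j'. solves_kernel_equation p q T z j' \<longrightarrow> (AE s in lborel_on {0<..<T}. j' s = j s)) \<and>
       (\<forall>K. is_reproducing_kernel (dirac_space T) (dirac_inner p q T) z K \<longleftrightarrow>
          K = dirac_transform T j))"
proof -
  \<comment> \<open>Even reflection continues the potential continuously to the whole line, as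
    kernels on the whole plane require.\<close>
  have cont: "continuous_on UNIV (\<lambda>x. g \<bar>x\<bar>)" if g: "C1_half_line g" for g
  proof -
    have "continuous (at x within {0..}) g" if "x \<ge> 0" for x
      using g that unfolding C1_half_line_def by (metis DERIV_continuous)
    then have "continuous_on {0..} g" by (simp add: continuous_on_eq_continuous_within)
    then show ?thesis by (rule continuous_on_compose2) (auto intro!: continuous_intros)
  qed
  define r where "r x = complex_of_real (q \<bar>x\<bar>) + \<i> * complex_of_real (p \<bar>x\<bar>)" for x
  have r_cont: "continuous_on UNIV r" unfolding r_def by (intro continuous_intros cont assms(1,2))
  have r_eq: "r x = Complex (q x) (p x)" if "x \<ge> 0" for x using that by (simp add: r_def complex_eq_iff)
  obtain a b :: "real \<Rightarrow> real \<Rightarrow> complex" where ab: "continuous_on UNIV (\<lambda>z. a (fst z) (snd z))" "continuous_on UNIV (\<lambda>z. b (fst z) (snd z))"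
    "\<And>\<xi> \<eta>. (a \<xi> has_vector_derivative r (\<eta> - \<xi>) * b \<xi> \<eta>) (at \<eta>)"
    "\<And>\<xi> \<eta>. ((\<lambda>\<xi>. b \<xi> \<eta>) has_vector_derivative - cnj (r (\<eta> - \<xi>)) * a \<xi> \<eta>) (at \<xi>)"
    "\<And>\<xi>. a \<xi> \<xi> = - b \<xi> \<xi>" "\<And>\<eta>. b 0 \<eta> = - cnj (r \<eta>)"
    by (rule goursat_kernel[OF r_cont]) (rule that)
  obtain \<phi> :: "real \<Rightarrow> complex \<Rightarrow> complex" where \<phi>: "continuous_on UNIV (\<lambda>z. \<phi> (fst z) (snd z))"
    "\<And>x l. ((\<lambda>x. \<phi> x l) has_vector_derivative (- \<i> * l * \<phi> x l + r x * cnj (\<phi> x (cnj l)))) (at x)"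
    "\<And>l. \<phi> 0 l = - \<i>" "\<And>x. \<phi> x holomorphic_on UNIV"
    by (rule spectral_solution[OF r_cont]) (rule that)
  interpret dirac_kernels p q T r a b \<phi>
    by (rule dirac_kernels.intro[OF \<open>T > 0\<close> r_cont r_eq ab \<phi>])
  note H = dirac_space_hilbert_inner
  interpret function_hilbert_space "dirac_space T" "dirac_inner p q T" by (rule function_hilbert_space.intro[OF H])
  have hol: "F holomorphic_on UNIV" if "F \<in> dirac_space T" for F using that by (simp add: dirac_space_def)
  note dB = de_Branges_space_of_kernel[OF function_hilbert_space.intro[OF H] hermite_biehler_phi hol repr_kernel_mem repr_kernel_reproducing repr_kernel_eq]
  show ?thesis
  proof (intro conjI allI)
    show "\<exists>E. hermite_biehler E \<and> dirac_space T = de_Branges_space E \<and>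
       (\<forall>F\<in>dirac_space T. ip_norm (dirac_inner p q T) F = ip_norm (de_Branges_inner E) F)"
      by (intro exI[of _ "\<phi> T"] conjI ballI hermite_biehler_function.hb[OF hermite_biehler_phi] dB)
    fix z
    have "is_reproducing_kernel (dirac_space T) (dirac_inner p q T) z K \<longleftrightarrow> K = repr_kernel z" for K
      unfolding is_reproducing_kernel_def using kernel_unique[OF _ _ repr_kernel_mem repr_kernel_reproducing] repr_kernel_mem repr_kernel_reproducing by blast
    moreover have "AE s in lborel_on {0<..<T}. j' s = kernel_control z s" if "solves_kernel_equation p q T z j'" for j'
      using that unfolding solves_kernel_equation_iff repr_kernel_def by (intro dirac_transform_inj[OF _ kernel_control(1) T]) simp_all
    moreover have "solves_kernel_equation p q T z (kernel_control z)" unfolding solves_kernel_equation_iff repr_kernel_def using kernel_control(1) by simp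
    ultimately show "\<exists>j. solves_kernel_equation p q T z j \<and>
       (\<forall>j'. solves_kernel_equation p q T z j' \<longrightarrow> (AE s in lborel_on {0<..<T}. j' s = j s)) \<and>
       (\<forall>K. is_reproducing_kernel (dirac_space T) (dirac_inner p q T) z K \<longleftrightarrow> K = dirac_transform T j)"
      unfolding repr_kernel_def by blast
  qed (rule H)
qed

end
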